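(* Let $\alpha$ be a weak composition and $\varphi$ a flag. Then $$\sum_{T\in\mathrm{SSKT}(\alpha,\varphi)}x^{\mathsf{wt}(T)}=\sum_{u^\bullet\in\mathscr W(\alpha,\varphi)}x^{\mathsf{wt}(u^\bullet)}.$$
   Context: Tableaux: fillings by positive integers of finite sets of boxes (row $r$, column $c\in\mathbb{Z}_{>0}$), rows left-justified, French notation (rows indexed increasing upward); $T_{rc}$ is an entry; shape = weak composition of row lengths. Weight of a word $u$: $\mathsf{wt}(u)=(\beta_1,\beta_2,\dots)$, $\beta_j$ the multiplicity of $j$; $\mathsf{wt}(T)$ = weight of its multiset of entries. A flag is a weakly increasing $\varphi:\mathbb{Z}_{>0}\to\mathbb{Z}_{>0}$ with $\varphi(m)\ge m$. A key tableau: (a) rows weakly decreasing left to right; (b) columns with distinct entries; (c) if boxes $(i,j),(k,j)$ with $i<k$ have $T_{ij}>T_{kj}$ then $(i,j+1)$ is a box with $T_{i,j+1}>T_{kj}$. $\varphi$-flagged: $T_{ij}\le\varphi(i)$. $\mathrm{SSKT}(\alpha,\varphi)$: $\varphi$-flagged key tableaux of shape $\alpha$. A semistandard Young tableau (SSYT) has partition shape, rows weakly increasing left to right, columns strictly increasing bottom to top; it is standard if its entries are $1,\dots,m$ without repetition. The standardization $\mathsf{std}(T)$ of an SSYT of weight $\beta$ replaces its $1$'s from left to right by $1,\dots,\beta_1$, its $2$'s from left to right by $\beta_1+1,\dots,\beta_1+\beta_2$, etc. $\mathsf{key}(\alpha)$ is the unique SSYT of weight $\alpha$ such that for every $c$ the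 set of entries of column $c+1$ is contained in the set of entries of column $c$. Column insertion of $x$ into an SSYT: set $x_1=x$; at column $c=1,2,\dots$: if $x_c>z$ for all $z$ in column $c$, place $x_c$ at the top of column $c$ and stop; if column $c$ contains $x_c$, set $x_{c+1}=x_c$ and go to column $c+1$; otherwise let $x_{c+1}$ be the smallest entry of column $c$ greater than $x_c$, replace it by $x_c$, and go to column $c+1$. For a word $v=v_1\cdots v_m$, let $P_j$ be the result of column inserting $v_m,v_{m-1},\dots,v_{m+1-j}$ successively into the empty tableau; $(v\to\varnothing)=(P,Q)$ where $P=P_m$ and $Q$ is the standard tableau whose entries $\le j$ form the shape of $P_j$ for each $j$. A maximal factorization $u^\bullet=\cdots u^2u^1$ of a word $u$ factors $u$ into weakly increasing (possibly empty) consecutive sequences $u^i$ such that the nonempty components have maximal length; it is $\varphi$-flagged if no letter of $u^i$ exceeds $\varphi(i)$; $\mathsf{wt}(u^\bullet)=\mathsf{wt}(u)$. $\mathscr W(\alpha,\varphi)$ is the set of $\varphi$-flagged maximal factorizations $u^\bullet=u^n\cdots u^2u^1$ with $\ell(u^i)=\alpha_i$ for all $i$ and $(u\to\varnothing)=(P,\mathsf{std}(\mathsf{key}(\alpha)))$ for some $P$. *)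

theory Defs
  imports Main "HOL-Library.Poly_Mapping"
begin

(* Letters, entries, row and column indices are positive integers, represented by nat with
   explicit positivity conditions; list positions are shifted by one.
   A weak composition (alpha_1, ..., alpha_n) is a nat list, and alpha_i = 0 for i > n. *)

definition part :: "nat list \<Rightarrow> nat \<Rightarrow> nat" where
  "part \<alpha> i = (if 1 \<le> i \<and> i \<le> length \<alpha> then \<alpha> ! (i - 1) else 0)"

definition is_flag :: "(nat \<Rightarrow> nat) \<Rightarrow> bool" where
  "is_flag \<phi> \<longleftrightarrow> (\<forall>m\<ge>1. m \<le> \<phi> m) \<and> (\<forall>m n. 1 \<le> m \<and> m \<le> n \<longrightarrow> \<phi> m \<le> \<phi> n)"

definition wt :: "nat list \<Rightarrow> nat \<Rightarrow>\<^sub>0 nat" where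
  "wt u = Abs_poly_mapping (count_list u)"

lemma lookup_wt [simp]: "Poly_Mapping.lookup (wt u) = count_list u"
proof -
  have "{k. count_list u k \<noteq> 0} \<subseteq> set u"
    by (auto simp: count_list_0_iff)
  then have "finite {k. count_list u k \<noteq> 0}"
    by (rule finite_subset) simp
  then show ?thesis
    unfolding wt_def by (simp add: Abs_poly_mapping_inverse)
qed

(* Polynomials with integer coefficients in x_1, x_2, ...: the exponent vectors have type
   nat =>0 nat. *)

definition xpow :: "(nat \<Rightarrow>\<^sub>0 nat) \<Rightarrow> (nat \<Rightarrow>\<^sub>0 nat) \<Rightarrow>\<^sub>0 int" where
  "xpow \<beta> = Poly_Mapping.single \<beta> 1"


section \<open>Key tableaux\<close>

(* A tableau of weak composition shape is the list of its rows (possibly empty) from bottom to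
   top; each row is listed from left to right. *)

definition boxes :: "nat list list \<Rightarrow> (nat \<times> nat) set" where
  "boxes T = {(r, c). 1 \<le> r \<and> r \<le> length T \<and> 1 \<le> c \<and> c \<le> length (T ! (r - 1))}"

definition entry :: "nat list list \<Rightarrow> nat \<Rightarrow> nat \<Rightarrow> nat" where
  "entry T r c = T ! (r - 1) ! (c - 1)"

definition shape :: "nat list list \<Rightarrow> nat list" where
  "shape T = map length T"

definition key_tableau :: "nat list list \<Rightarrow> bool" where
  "key_tableau T \<longleftrightarrow>
     (\<forall>(r, c) \<in> boxes T. 1 \<le> entry T r c) \<and>
     (\<forall>r c. (r, c) \<in> boxes T \<and> (r, c + 1) \<in> boxes T \<longrightarrow> entry T r (c + 1) \<le> entry T r c) \<and>
     (\<forall>i k j. (i, j) \<in> boxes T \<and> (k, j) \<in> boxes T \<and> i \<noteq> k \<longrightarrow> entry T i j \<noteq> entry T k j) \<and>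
     (\<forall>i k j. (i, j) \<in> boxes T \<and> (k, j) \<in> boxes T \<and> i < k \<and> entry T i j > entry T k j
        \<longrightarrow> (i, j + 1) \<in> boxes T \<and> entry T i (j + 1) > entry T k j)"

definition flagged_tableau :: "(nat \<Rightarrow> nat) \<Rightarrow> nat list list \<Rightarrow> bool" where
  "flagged_tableau \<phi> T \<longleftrightarrow> (\<forall>(i, j) \<in> boxes T. entry T i j \<le> \<phi> i)"

definition SSKT :: "nat list \<Rightarrow> (nat \<Rightarrow> nat) \<Rightarrow> nat list list set" where
  "SSKT \<alpha> \<phi> = {T. shape T = \<alpha> \<and> key_tableau T \<and> flagged_tableau \<phi> T}"


section \<open>Semistandard Young tableaux and column insertion\<close>

(* Young tableaux, in contrast, are lists of nonempty columns from left to right; each column is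
   listed from bottom to top. Boxes are still written (row, column). *)

definition yboxes :: "nat list list \<Rightarrow> (nat \<times> nat) set" where
  "yboxes T = {(r, c). 1 \<le> c \<and> c \<le> length T \<and> 1 \<le> r \<and> r \<le> length (T ! (c - 1))}"

definition yentry :: "nat list list \<Rightarrow> nat \<Rightarrow> nat \<Rightarrow> nat" where
  "yentry T r c = T ! (c - 1) ! (r - 1)"

definition SSYT :: "nat list list set" where
  "SSYT = {T.
     [] \<notin> set T \<and> sorted_wrt (\<ge>) (map length T) \<and>
     (\<forall>(r, c) \<in> yboxes T. 1 \<le> yentry T r c) \<and>
     (\<forall>r c. (r, c) \<in> yboxes T \<and> (r, c + 1) \<in> yboxes T \<longrightarrow> yentry T r c \<le> yentry T r (c + 1)) \<and>
     (\<forall>r c. (r, c) \<in> yboxes T \<and> (r + 1, c) \<in> yboxes T \<longrightarrow> yentry T r c < yentry T (r + 1) c)}"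

definition standard :: "nat list list \<Rightarrow> bool" where
  "standard T \<longleftrightarrow> T \<in> SSYT \<and> distinct (concat T) \<and> set (concat T) = {1..length (concat T)}"

(* An entry is replaced by the number of entries that are smaller, or equal and weakly to its
   left (equal entries of an SSYT lie in distinct columns). *)

definition std :: "nat list list \<Rightarrow> nat list list" where
  "std T = map (\<lambda>c. map (\<lambda>r.
       card {(r', c') \<in> yboxes T. yentry T r' c' < yentry T r c \<or>
                                  (yentry T r' c' = yentry T r c \<and> c' \<le> c)})
     [1..<Suc (length (T ! (c - 1)))]) [1..<Suc (length T)]"

definition key :: "nat list \<Rightarrow> nat list list" where
  "key \<alpha> = (THE T. T \<in> SSYT \<and> Poly_Mapping.lookup (wt (concat T)) = part \<alpha> \<and>
                   (\<forall>c. c + 1 < length T \<longrightarrow> set (T ! (c + 1)) \<subseteq> set (T ! c)))"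

fun col_insert :: "nat \<Rightarrow> nat list list \<Rightarrow> nat list list" where
  "col_insert x [] = [[x]]"
| "col_insert x (C # Cs) =
     (if \<forall>z\<in>set C. z < x then (C @ [x]) # Cs
      else if x \<in> set C then C # col_insert x Cs
      else let y = Min {z \<in> set C. x < z}
           in map (\<lambda>z. if z = y then x else z) C # col_insert y Cs)"

(* P_j: the last j letters of v are inserted, starting from the last one *)

definition insertion_step :: "nat list \<Rightarrow> nat \<Rightarrow> nat list list" where
  "insertion_step v j = foldr col_insert (drop (length v - j) v) []"

definition insertion :: "nat list \<Rightarrow> nat list list \<times> nat list list" where
  "insertion v =
     (insertion_step v (length v),
      THE Q. standard Q \<and> yboxes Q = yboxes (insertion_step v (length v)) \<and>
        (\<forall>j\<le>length v. {(r, c) \<in> yboxes Q. yentry Q r c \<le> j} = yboxes (insertion_step v j)))"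


section \<open>Maximal factorizations\<close>

(* The factorization u^n ... u^2 u^1 is the list [u^1, u^2, ..., u^n]. *)

definition word_of :: "nat list list \<Rightarrow> nat list" where
  "word_of us = concat (rev us)"

(* Maximality: no nonempty component, say u^(i+1), is properly contained in a longer weakly
   increasing sequence s u^(i+1) t of consecutive letters of the word. *)

definition maximal_factorization :: "nat list list \<Rightarrow> bool" where
  "maximal_factorization us \<longleftrightarrow>
     (\<forall>w \<in> set us. sorted w) \<and>
     (\<forall>i < length us. us ! i \<noteq> [] \<longrightarrow>
        (\<forall>p s t q. word_of (drop (Suc i) us) = p @ s \<and> word_of (take i us) = t @ q \<and>
                   sorted (s @ us ! i @ t) \<longrightarrow> s = [] \<and> t = []))"

definition flagged_factorization :: "(nat \<Rightarrow> nat) \<Rightarrow> nat list list \<Rightarrow> bool" where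
  "flagged_factorization \<phi> us \<longleftrightarrow> (\<forall>i < length us. \<forall>a \<in> set (us ! i). a \<le> \<phi> (Suc i))"

definition WFact :: "nat list \<Rightarrow> (nat \<Rightarrow> nat) \<Rightarrow> nat list list set" where
  "WFact \<alpha> \<phi> = {us.
     (\<forall>a \<in> set (word_of us). 1 \<le> a) \<and>
     maximal_factorization us \<and> flagged_factorization \<phi> us \<and>
     map length us = \<alpha> \<and> (\<exists>P. insertion (word_of us) = (P, std (key \<alpha>)))}"


section \<open>Finiteness of the index sets\<close>

lemma finite_bounded_lists:
  fixes b :: "nat \<Rightarrow> nat" and \<alpha> :: "nat list"
  shows "finite {us. map length us = \<alpha> \<and> (\<forall>i < length us. \<forall>a \<in> set (us ! i). a \<le> b (Suc i))}"
    (is "finite ?S")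
proof -
  let ?M = "Max (b ` {..Suc (length \<alpha>)})"
  let ?A = "{w. set w \<subseteq> {..?M} \<and> length w \<le> Max (set (0 # \<alpha>))}"
  have "?S \<subseteq> {us. set us \<subseteq> ?A \<and> length us = length \<alpha>}"
  proof
    fix us assume "us \<in> ?S"
    then have len: "map length us = \<alpha>"
      and bd: "\<And>i a. i < length us \<Longrightarrow> a \<in> set (us ! i) \<Longrightarrow> a \<le> b (Suc i)" by auto
    have l: "length us = length \<alpha>" using len by auto
    have "w \<in> ?A" if w: "w \<in> set us" for w
    proof -
      obtain i where i: "i < length us" "w = us ! i" using w by (auto simp: in_set_conv_nth)
      have "b (Suc i) \<le> ?M" using i l by (intro Max_ge) auto
      then have "set w \<subseteq> {..?M}" using bd i by fastforce
      moreover have "length w \<in> set (0 # \<alpha>)" using w len by auto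
      then have "length w \<le> Max (set (0 # \<alpha>))" by (intro Max_ge) auto
      ultimately show ?thesis by simp
    qed
    then show "us \<in> {us. set us \<subseteq> ?A \<and> length us = length \<alpha>}" using l by blast
  qed
  moreover have "finite {us. set us \<subseteq> ?A \<and> length us = length \<alpha>}"
    by (intro finite_lists_length_eq finite_lists_length_le) simp
  ultimately show ?thesis by (rule finite_subset)
qed

lemma finite_SSKT: "finite (SSKT \<alpha> \<phi>)"
proof (rule finite_subset[OF _ finite_bounded_lists[of \<alpha> \<phi>]], rule subsetI)
  fix T assume T: "T \<in> SSKT \<alpha> \<phi>"
  have "a \<le> \<phi> (Suc i)" if i: "i < length T" and a: "a \<in> set (T ! i)" for i a
  proof -
    obtain j where "j < length (T ! i)" "a = T ! i ! j" using a by (metis in_set_conv_nth)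
    then have "(Suc i, Suc j) \<in> boxes T" "a = entry T (Suc i) (Suc j)"
      using i by (auto simp: boxes_def entry_def)
    then show ?thesis using T by (auto simp: SSKT_def flagged_tableau_def)
  qed
  then show "T \<in> {us. map length us = \<alpha> \<and> (\<forall>i<length us. \<forall>a\<in>set (us ! i). a \<le> \<phi> (Suc i))}"
    using T by (auto simp: SSKT_def shape_def)
qed

lemma finite_WFact: "finite (WFact \<alpha> \<phi>)"
  by (rule finite_subset[OF _ finite_bounded_lists[of \<alpha> \<phi>]])
    (auto simp: WFact_def flagged_factorization_def)

end

theory Submission
  imports Defs "HOL-Library.Multiset"
begin

text \<open>
  Both sides are counted weight by weight, and the counts are shown to satisfy the same recursion
  with the same initial values; no bijection between tableaux and words is constructed.

  \<^item> If \<open>\<phi>(i) > i\<close>, with \<open>i\<close> minimal, let \<open>a = \<phi>(i) - 1\<close>. The bracket rule for the letters \<open>a\<close>, \<open>a + 1\<close> decomposes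
    both index sets into strings, and lowering \<open>\<phi>(i)\<close> to \<open>a\<close> keeps of each string either everything or
    only the end at which no \<open>a + 1\<close> can be lowered any more. So the counts for the lowered flag
    determine those for \<open>\<phi>\<close>; this is a Demazure operator.
  \<^item> If \<open>\<phi>(i) = i\<close> for all rows and \<open>\<alpha>\<^sub>i < \<alpha>\<^sub>i\<^sub>+\<^sub>1\<close>, then \<open>\<phi>(i)\<close> may be raised to \<open>i + 1\<close> without changing either
    set, and once rows \<open>i\<close> and \<open>i + 1\<close> carry the same flag they can be exchanged. For words the
    exchange goes through Knuth equivalence; for tableaux, the columns determine a key tableau, whose rows
    are filled greedily, and two consecutive greedy rows of exchanged lengths
    use up the same entries.
  \<^item> If \<open>\<phi>(i) = i\<close> and \<open>\<alpha>\<close> is weakly decreasing, both sets consist of the one element with rows \<open>i \<dots> i\<close>.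

  The condition on the recording tableau says that the \<open>k\<close>-th factor adds one box to each of the first
  \<open>\<alpha>\<^sub>k\<close> columns of the insertion tableau, so only the column heights of the latter matter.
\<close>

section \<open>Bracket words and strings\<close>

text \<open>What makes the flag recursion work is that a lowered flag leaves the string lengths
  visible in the counts. Let the charge of an element be its number of unmatched closing brackets
  minus that of unmatched opening ones. A string kept whole and longer than \<open>d\<close> meets
  the charges \<open>d\<close> and \<open>-d-2\<close> equally often, and a string of which only the
  end survives meets just the charge equal to its length. Subtracting the two counts therefore
  isolates the strings of length \<open>d\<close>, and equal counts for the lowered flag force
  equally many strings of every length.

  The obstacle is to show that the steps along strings respect the two conditions that are not
  local. For words this is the recording condition: a step must preserve the column heights of the
  insertion tableau for every suffix made of whole factors. For tableaux it is the greedy filling: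
  changing one letter in one column can alter the choices of many rows, and once some rows have been
  removed the two lists of columns may differ in several places. The invariant is thus a relation
  between lists of columns that is wider than a single change.\<close>

datatype bracket = Opn | Cls | Neu

text \<open>An opening bracket is matched with a closing one to its right, so cancelling matched
  pairs leaves closing brackets followed by opening ones; \<open>cls\<close> and \<open>opn\<close>
  are the sizes of these two blocks. The truncated subtraction performs the cancellation.\<close>

fun unmatched_cls :: "bracket list \<Rightarrow> nat" where
  "unmatched_cls [] = 0"
| "unmatched_cls (Opn # ts) = unmatched_cls ts - 1"
| "unmatched_cls (Cls # ts) = Suc (unmatched_cls ts)"
| "unmatched_cls (Neu # ts) = unmatched_cls ts"

fun unmatched_opn :: "bracket list \<Rightarrow> nat" where
  "unmatched_opn [] = 0"
| "unmatched_opn (Opn # ts) = unmatched_opn ts + (1 - unmatched_cls ts)"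
| "unmatched_opn (Cls # ts) = unmatched_opn ts"
| "unmatched_opn (Neu # ts) = unmatched_opn ts"

abbreviation "cls \<equiv> unmatched_cls"
abbreviation "opn \<equiv> unmatched_opn"

lemma unmatched_append:
  "cls (u @ v) = cls u + (cls v - opn u) \<and> opn (u @ v) = opn v + (opn u - cls v)"
proof (induction u)
  case (Cons t u)
  then show ?case by (cases t) auto
qed simp

lemma cls_append: "cls (u @ v) = cls u + (cls v - opn u)"
  and opn_append: "opn (u @ v) = opn v + (opn u - cls v)"
  using unmatched_append by blast+

text \<open>Cancelling a pair removes one bracket of each kind. This turns the position on a string
  into a difference of multiplicities, or of row lengths.\<close>

lemma unmatched_balance:
  "int (cls ts) - int (opn ts) = int (count_list ts Cls) - int (count_list ts Opn)"
proof (induction ts)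
  case (Cons t ts)
  then show ?case by (cases t) auto
qed simp

text \<open>The step turns the leftmost unmatched opening bracket into a closing one.\<close>

definition flip_at :: "bracket list \<Rightarrow> bracket list \<Rightarrow> bool" where
  "flip_at p q \<longleftrightarrow> opn p = 0 \<and> cls q = 0"

lemma flip_at_counts:
  assumes "flip_at p q"
  shows "opn (p @ Opn # q) = Suc (opn (p @ Cls # q))" "cls (p @ Cls # q) = Suc (cls (p @ Opn # q))"
  using assms by (auto simp: flip_at_def cls_append opn_append)

text \<open>A leading opening bracket without partner is the place to flip. In every other case the
  flip of the tail serves: the unmatched closing brackets of the tail all lie in \<open>p\<close>,
  so a leading opening bracket finds its partner there.\<close>

lemma exists_flip_opn: "opn ts > 0 \<Longrightarrow> \<exists>p q. ts = p @ Opn # q \<and> flip_at p q"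
proof (induction ts)
  case (Cons t ts)
  show ?case
  proof (cases "opn ts > 0 \<and> (t = Opn \<longrightarrow> cls ts > 0)")
    case True
    then obtain p q where pq: "ts = p @ Opn # q" "flip_at p q" using Cons.IH by auto
    have "cls ts = cls p" using pq by (auto simp: flip_at_def cls_append)
    then have "flip_at (t # p) q" using pq True by (cases t) (auto simp: flip_at_def)
    then show ?thesis using pq(1) by (metis append_Cons)
  next
    case False
    then have "t = Opn \<and> cls ts = 0" using Cons.prems by (cases t) auto
    then have "t # ts = [] @ Opn # ts \<and> flip_at [] ts" by (auto simp: flip_at_def)
    then show ?thesis by blast
  qed
qed simp

lemma exists_flip_cls: "cls ts > 0 \<Longrightarrow> \<exists>p q. ts = p @ Cls # q \<and> flip_at p q"
proof (induction ts)
  case (Cons t ts)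
  show ?case
  proof (cases "cls ts > (if t = Opn then 1 else 0)")
    case True
    then obtain p q where pq: "ts = p @ Cls # q" "flip_at p q" using Cons.IH by auto
    have "cls ts = Suc (cls p)" using pq by (auto simp: flip_at_def cls_append)
    then have "flip_at (t # p) q" using pq True by (cases t) (auto simp: flip_at_def split: if_splits)
    then show ?thesis using pq(1) by (metis append_Cons)
  next
    case False
    then have "t = Cls \<and> cls ts = 0" using Cons.prems by (cases t) (auto split: if_splits)
    then have "t # ts = [] @ Cls # ts \<and> flip_at [] ts" by (auto simp: flip_at_def)
    then show ?thesis by blast
  qed
qed simp

text \<open>Let \<open>us\<close> be the stretch between two different positions. By the condition
  on the right of the earlier position, \<open>us\<close> has no unmatched closing bracket; so the
  earlier opening bracket is still unmatched when the later position is reached, against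
  \<open>opn = 0\<close> there.\<close>

lemma flip_unique_opn:
  assumes "p @ Opn # q = p' @ Opn # q'" "flip_at p q" "flip_at p' q'"
  shows "p = p'"
proof -
  have "\<not> (\<exists>us. p2 = p1 @ Opn # us)" if "flip_at p1 (us @ Opn # q2)" "flip_at p2 q2"
    "p2 = p1 @ Opn # us" for p1 p2 us q2
    using that by (auto simp: flip_at_def cls_append opn_append)
  then have *: "\<not> (p2 = p1 @ Opn # us \<and> q1 = us @ Opn # q2)" if "flip_at p1 q1" "flip_at p2 q2" for p1 q1 p2 q2 us
    using that by blast
  show ?thesis
    using assms(1) *[OF assms(2,3)] *[OF assms(3,2)]
    by (auto simp: append_eq_append_conv2 Cons_eq_append_conv append_eq_Cons_conv)
qed

text \<open>The mirror argument: the later closing bracket must find an opening partner in the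
  stretch between the positions, and that partner would be unmatched to the left of the later
  position.\<close>

lemma flip_unique_cls:
  assumes "p @ Cls # q = p' @ Cls # q'" "flip_at p q" "flip_at p' q'"
  shows "p = p'"
proof -
  have *: "\<not> (p2 = p1 @ Cls # us \<and> q1 = us @ Cls # q2)" if "flip_at p1 q1" "flip_at p2 q2" for p1 q1 p2 q2 us
    using that by (auto simp: flip_at_def cls_append opn_append)
  show ?thesis
    using assms(1) *[OF assms(2,3)] *[OF assms(3,2)]
    by (auto simp: append_eq_append_conv2 Cons_eq_append_conv append_eq_Cons_conv)
qed

text \<open>A set decomposed into strings by an injective partial map, given by its graph \<open>E\<close>;
  \<open>l\<close> is constant along strings.\<close>

locale strings =
  fixes X :: "'x set" and E :: "'x \<Rightarrow> 'x \<Rightarrow> bool" and oo cc :: "'x \<Rightarrow> nat" and l :: "'x \<Rightarrow> 'l"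
  assumes finite_X: "finite X"
    and step: "E x y \<Longrightarrow> x \<in> X \<and> y \<in> X \<and> oo x = Suc (oo y) \<and> cc y = Suc (cc x) \<and> l x = l y"
    and functional: "E x y \<Longrightarrow> E x y' \<Longrightarrow> y = y'"
    and injective: "E x y \<Longrightarrow> E x' y \<Longrightarrow> x = x'"
    and down: "x \<in> X \<Longrightarrow> oo x > 0 \<Longrightarrow> \<exists>y. E x y"
    and up: "y \<in> X \<Longrightarrow> cc y > 0 \<Longrightarrow> \<exists>x. E x y"
begin

definition level :: "'x set \<Rightarrow> 'l \<Rightarrow> nat \<Rightarrow> nat \<Rightarrow> 'x set" where
  "level Y k i j = {x \<in> Y. l x = k \<and> oo x = i \<and> cc x = j}"

text \<open>The step along the strings is itself the bijection; the second assumption says that at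
  this height it neither enters nor leaves \<open>Y\<close>.\<close>

lemma card_level_shift:
  assumes "Y \<subseteq> X"
    and "\<And>x y. E x y \<Longrightarrow> oo x = Suc i \<Longrightarrow> x \<in> Y \<longleftrightarrow> y \<in> Y"
  shows "card (level Y k (Suc i) j) = card (level Y k i (Suc j))"
proof -
  let ?A = "level Y k (Suc i) j" and ?B = "level Y k i (Suc j)"
  obtain e where e: "\<And>x. x \<in> ?A \<Longrightarrow> E x (e x)"
    using down assms(1) unfolding level_def
    by (metis (mono_tags, lifting) mem_Collect_eq subsetD zero_less_Suc)
  have "bij_betw e ?A ?B"
  proof (rule bij_betw_imageI)
    show "inj_on e ?A" using e injective by (intro inj_onI) metis
    show "e ` ?A = ?B"
    proof (intro equalityI subsetI)
      fix y assume "y \<in> e ` ?A"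
      then obtain x where x: "x \<in> ?A" "y = e x" by blast
      then have xy: "E x y" using e by simp
      show "y \<in> ?B" using x(1) step[OF xy] assms(2)[OF xy] by (simp add: level_def)
    next
      fix y assume y: "y \<in> ?B"
      then obtain x where x: "E x y" using up assms(1) by (fastforce simp: level_def)
      have xA: "x \<in> ?A" using y step[OF x] assms(2)[OF x] by (simp add: level_def)
      have "e x = y" using e[OF xA] x functional by blast
      then show "y \<in> e ` ?A" using xA by blast
    qed
  qed
  then show ?thesis by (rule bij_betw_same_card)
qed

text \<open>A string of length \<open>i + j\<close> meets the level in exactly one element, and so
  does it meet its end \<open>oo = 0\<close>.\<close>

lemma card_level: "card (level X k i j) = card (level X k 0 (i + j))"
proof (induction i arbitrary: j)
  case (Suc i)
  then show ?case using card_level_shift[of X i k j] step by auto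
qed simp

lemma card_level_sub:
  assumes "Y \<subseteq> X" and "\<And>x y. E x y \<Longrightarrow> oo y > 0 \<Longrightarrow> x \<in> Y \<longleftrightarrow> y \<in> Y"
  shows "card (level Y k (Suc i) j) = card (level Y k 1 (i + j))"
proof (induction i arbitrary: j)
  case (Suc i)
  have "card (level Y k (Suc (Suc i)) j) = card (level Y k (Suc i) (Suc j))"
    by (rule card_level_shift) (use assms step in fastforce)+
  then show ?case using Suc by simp
qed simp

text \<open>Label and charge are what a weight, or a pair of row lengths, records of an element; the
  length of its string is not visible in them.\<close>

definition slice :: "'x set \<Rightarrow> 'l \<Rightarrow> int \<Rightarrow> 'x set" where
  "slice Y k d = {x \<in> Y. l x = k \<and> int (cc x) - int (oo x) = d}"

lemma card_slice:
  assumes "Y \<subseteq> X" and "\<And>x. x \<in> X \<Longrightarrow> oo x < N"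
  shows "card (slice Y k d) = (\<Sum>i<N. if 0 \<le> d + int i then card (level Y k i (nat (d + int i))) else 0)"
proof -
  have fin: "finite Y" using assms(1) finite_X finite_subset by blast
  have "slice Y k d = (\<Union>i\<in>{..<N}. {x \<in> slice Y k d. oo x = i})"
    using assms by (auto simp: slice_def)
  also have "card \<dots> = (\<Sum>i<N. card {x \<in> slice Y k d. oo x = i})"
    by (rule card_UN_disjoint) (use fin in \<open>auto simp: slice_def\<close>)
  also have "\<dots> = (\<Sum>i<N. if 0 \<le> d + int i then card (level Y k i (nat (d + int i))) else 0)"
  proof (rule sum.cong[OF refl])
    fix i
    have "{x \<in> slice Y k d. oo x = i} =
        (if 0 \<le> d + int i then level Y k i (nat (d + int i)) else {})"
      by (auto simp: slice_def level_def)
    then show "card {x \<in> slice Y k d. oo x = i} =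
        (if 0 \<le> d + int i then card (level Y k i (nat (d + int i))) else 0)" by simp
  qed
  finally show ?thesis .
qed

lemma bound_exists: "\<exists>N. \<forall>x\<in>X. oo x < N \<and> cc x < N"
proof -
  have "oo x < Suc (Max (oo ` X) + Max (cc ` X)) \<and> cc x < Suc (Max (oo ` X) + Max (cc ` X))" if "x \<in> X" for x
  proof -
    have "oo x \<le> Max (oo ` X)" "cc x \<le> Max (cc ` X)" using finite_X that by simp_all
    then show ?thesis by linarith
  qed
  then show ?thesis by blast
qed

text \<open>Reflection of every string in its midpoint. Numerically, the levels
  \<open>(i + d, i)\<close> and \<open>(i, i + d)\<close> belong to strings of the same length
  \<open>2 * i + d\<close>.\<close>

lemma card_slice_opposite: "card (slice X k d) = card (slice X k (- d))"
proof -
  have main: "card (slice X k (int d)) = card (slice X k (- int d))" for d :: nat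
  proof -
    obtain N where N: "\<And>x. x \<in> X \<Longrightarrow> oo x < N" "\<And>x. x \<in> X \<Longrightarrow> cc x < N" using bound_exists by blast
    have "card (slice X k (- int d)) =
        (\<Sum>i<d + N. if 0 \<le> - int d + int i then card (level X k i (nat (- int d + int i))) else 0)"
      by (rule card_slice) (use N in force)+
    also have "\<dots> = (\<Sum>i\<in>{d..<d + N}. card (level X k i (i - d)))"
      by (rule sum.mono_neutral_cong_right) (auto simp: nat_diff_distrib' simp flip: of_nat_diff)
    also have "\<dots> = (\<Sum>i<N. card (level X k (i + d) i))"
      using sum.shift_bounds_nat_ivl[of "\<lambda>i. card (level X k i (i - d))" 0 d N]
      by (simp add: lessThan_atLeast0 add.commute)
    also have "\<dots> = (\<Sum>i<N. card (level X k i (i + d)))"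
      by (subst card_level, subst (2) card_level) (simp add: add.commute add.left_commute)
    also have "\<dots> = (\<Sum>i<N. if 0 \<le> int d + int i then card (level X k i (nat (int d + int i))) else 0)"
      by (rule sum.cong) (auto simp: nat_add_distrib add.commute)
    also have "\<dots> = card (slice X k (int d))"
      by (rule card_slice[symmetric]) (use N in auto)
    finally show ?thesis by simp
  qed
  show ?thesis
  proof (cases "d \<ge> 0")
    case True
    then show ?thesis using main[of "nat d"] by simp
  next
    case False
    then show ?thesis using main[of "nat (- d)"] by simp
  qed
qed

end

section \<open>Strings cut down by a smaller set, and the number of strings of each length\<close>

locale filtered_strings = strings +
  fixes Y
  assumes subset: "Y \<subseteq> X"
    and tops: "x \<in> X \<Longrightarrow> oo x = 0 \<Longrightarrow> x \<in> Y"
    and down_closed: "E x y \<Longrightarrow> x \<in> Y \<Longrightarrow> y \<in> Y"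
    and up_closed: "E x y \<Longrightarrow> y \<in> Y \<Longrightarrow> oo y > 0 \<Longrightarrow> x \<in> Y"
begin

text \<open>The number \<open>-d-2\<close> is the image of \<open>d\<close> under the shifted
  reflection of the Demazure and Weyl character formulas. Whole strings longer than \<open>d\<close>
  cancel in the difference, a string reduced to its end counts only if its length is
  \<open>d\<close>, and shorter strings meet neither charge.\<close>

lemma card_tops:
  "int (card (level X k 0 d)) = int (card (slice Y k (int d))) - int (card (slice Y k (- int d - 2)))"
proof -
  obtain N where N: "\<And>x. x \<in> X \<Longrightarrow> oo x < N" using bound_exists by blast
  have sub: "card (level Y k (Suc i) j) = card (level Y k 1 (i + j))" for i j
    by (rule card_level_sub) (use subset down_closed up_closed in blast)+
  have "card (slice Y k (- int d - 2)) =
      (\<Sum>i<d + 2 + N. if 0 \<le> - int d - 2 + int i then card (level Y k i (nat (- int d - 2 + int i))) else 0)"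
    by (rule card_slice) (use N subset in force)+
  also have "\<dots> = (\<Sum>i\<in>{d + 2..<d + 2 + N}. card (level Y k i (i - (d + 2))))"
    by (rule sum.mono_neutral_cong_right) (auto simp: nat_diff_distrib' algebra_simps intro!: arg_cong[where f = card] arg_cong[where f = "level Y k _"])
  also have "\<dots> = (\<Sum>i<N. card (level Y k (i + (d + 2)) i))"
    using sum.shift_bounds_nat_ivl[of "\<lambda>i. card (level Y k i (i - (d + 2)))" 0 "d + 2" N]
    by (simp add: lessThan_atLeast0 add.commute)
  \<comment> \<open>The levels \<open>(i + d + 2, i)\<close> and \<open>(i + 1, i + 1 + d)\<close>
    lie on strings of the same length and both away from the end \<open>oo = 0\<close>, where
    \<open>Y\<close> is constant along a string.\<close>
  also have "\<dots> = (\<Sum>i<N. card (level Y k (Suc i) (Suc i + d)))"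
  proof (rule sum.cong[OF refl])
    fix i show "card (level Y k (i + (d + 2)) i) = card (level Y k (Suc i) (Suc i + d))"
      using sub[of "i + d + 1" i] sub[of i "Suc i + d"] by (simp add: algebra_simps)
  qed
  finally have low: "card (slice Y k (- int d - 2)) = (\<Sum>i<N. card (level Y k (Suc i) (Suc i + d)))" .
  have "card (slice Y k (int d)) =
      (\<Sum>i<Suc N. if 0 \<le> int d + int i then card (level Y k i (nat (int d + int i))) else 0)"
    by (rule card_slice) (use N subset in force)+
  also have "\<dots> = (\<Sum>i<Suc N. card (level Y k i (i + d)))"
    by (rule sum.cong) (auto simp: nat_add_distrib add.commute)
  also have "\<dots> = card (level Y k 0 d) + (\<Sum>i<N. card (level Y k (Suc i) (Suc i + d)))"
    by (subst sum.lessThan_Suc_shift) simp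
  finally have "card (slice Y k (int d)) = card (level Y k 0 d) + card (slice Y k (- int d - 2))"
    using low by simp
  moreover have "level Y k 0 d = level X k 0 d" using tops subset by (auto simp: level_def)
  ultimately show ?thesis by simp
qed

end

text \<open>Equal slices of the cut sets give equal numbers of strings of each length, and these
  numbers give back every level of the full sets.\<close>

lemma filtered_strings_card_slice:
  assumes "filtered_strings X E oo cc l Y" "filtered_strings X' E' oo' cc' l' Y'"
    and eq: "\<And>d. card (strings.slice oo cc l Y k d) = card (strings.slice oo' cc' l' Y' k d)"
  shows "card (strings.slice oo cc l X k d) = card (strings.slice oo' cc' l' X' k d)"
proof -
  interpret A: filtered_strings X E oo cc l Y by fact
  interpret B: filtered_strings X' E' oo' cc' l' Y' by fact
  have tops: "card (A.level X k 0 d) = card (B.level X' k 0 d)" for d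
    using A.card_tops[of k d] B.card_tops[of k d] eq by simp
  then have levels: "card (A.level X k i j) = card (B.level X' k i j)" for i j
    using A.card_level[of k i j] B.card_level[of k i j] by simp
  obtain N where N: "\<And>x. x \<in> X \<Longrightarrow> oo x < N" using A.bound_exists by blast
  obtain N' where N': "\<And>x. x \<in> X' \<Longrightarrow> oo' x < N'" using B.bound_exists by blast
  have "card (A.slice X k d) = (\<Sum>i<N + N'. if 0 \<le> d + int i then card (A.level X k i (nat (d + int i))) else 0)"
    by (rule A.card_slice) (use N in force)+
  also have "\<dots> = (\<Sum>i<N + N'. if 0 \<le> d + int i then card (B.level X' k i (nat (d + int i))) else 0)"
    by (simp only: levels)
  also have "\<dots> = card (B.slice X' k d)"
    by (rule B.card_slice[symmetric]) (use N' in force)+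
  finally show ?thesis .
qed

section \<open>Column insertion\<close>

text \<open>Expelling the smallest entry \<open>y >= x\<close> covers two cases of the insertion
  rule at once: if \<open>x\<close> is already present, then \<open>y = x\<close>, the column stays
  as it is and \<open>x\<close> moves on. The second component is empty when the insertion stops in
  this column.\<close>

definition step :: "nat \<Rightarrow> nat list \<Rightarrow> nat list \<times> nat list" where
  "step x C = (if \<forall>z\<in>set C. z < x then (C @ [x], [])
     else let y = Min {z \<in> set C. x \<le> z} in (map (\<lambda>z. if z = y then x else z) C, [y]))"

text \<open>\<open>pass w C\<close> inserts the word \<open>w\<close>, from right to left, into the single column \<open>C\<close>;
  the second component is the word of letters that move on to the next column.\<close>

fun pass :: "nat list \<Rightarrow> nat list \<Rightarrow> nat list \<times> nat list" where
  "pass [] C = (C, [])"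
| "pass (x # w) C = (fst (step x (fst (pass w C))), snd (step x (fst (pass w C))) @ snd (pass w C))"

fun ins_word :: "nat list \<Rightarrow> nat list list \<Rightarrow> nat list list" where
  "ins_word [] P = P"
| "ins_word (x # w) P = col_insert x (ins_word w P)"

lemma insertion_step_eq: "insertion_step v j = ins_word (drop (length v - j) v) []"
proof -
  have "List.foldr col_insert w P = ins_word w P" for w P by (induction w) auto
  then show ?thesis by (simp add: insertion_step_def)
qed

lemma ins_word_append: "ins_word (u @ v) P = ins_word u (ins_word v P)"
  by (induction u) auto

lemma pass_append:
  "pass (u @ v) C = (fst (pass u (fst (pass v C))), snd (pass u (fst (pass v C))) @ snd (pass v C))"
  by (induction u) auto

lemma step_cases:
  obtains (append) "\<forall>z\<in>set C. z < x" "step x C = (C @ [x], [])"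
  | (bump) y where "y \<in> set C" "x \<le> y" "\<forall>z\<in>set C. x \<le> z \<longrightarrow> y \<le> z"
      "step x C = (map (\<lambda>z. if z = y then x else z) C, [y])"
proof (cases "\<forall>z\<in>set C. z < x")
  case True
  then show ?thesis using append by (simp add: step_def)
next
  case False
  let ?A = "{z \<in> set C. x \<le> z}"
  have "Min ?A \<in> ?A" using False by (intro Min_in) (auto simp: not_less)
  moreover have "\<forall>z\<in>set C. x \<le> z \<longrightarrow> Min ?A \<le> z" by auto
  ultimately show ?thesis using False bump[of "Min ?A"] by (auto simp: step_def Let_def)
qed

lemma col_insert_step: "col_insert x (C # Cs) = fst (step x C) # ins_word (snd (step x C)) Cs"
proof (cases rule: step_cases[where C = C and x = x])
  case append
  then show ?thesis by simp
next
  case (bump y)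
  show ?thesis
  proof (cases "x \<in> set C")
    case True
    then have "y = x" using bump by (meson le_antisym order_refl)
    then show ?thesis using True bump by (auto simp: map_idI)
  next
    case False
    have "Min {z \<in> set C. x < z} = y"
      using bump False by (intro Min_eqI) (auto simp: less_le)
    then show ?thesis using bump False by (auto simp: Let_def not_less)
  qed
qed

text \<open>Columns further right are reached only by letters expelled from the first one, so one
  column can process the whole word before the next is considered. The inductions over columns below
  rest on this.\<close>

lemma ins_word_Cons: "ins_word w (C # Cs) = fst (pass w C) # ins_word (snd (pass w C)) Cs"
  by (induction w) (simp_all add: col_insert_step ins_word_append del: col_insert.simps)

lemma ins_word_Nil:
  assumes "w \<noteq> []"
  shows "ins_word w [] = fst (pass w []) # ins_word (snd (pass w [])) []"
proof -
  obtain u x where w: "w = u @ [x]" using assms by (metis rev_exhaust)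
  have "step x [] = ([x], [])" by (simp add: step_def)
  then show ?thesis by (simp add: w ins_word_append pass_append ins_word_Cons)
qed

abbreviation column :: "nat list \<Rightarrow> bool" where "column C \<equiv> sorted_wrt (<) C"

lemma set_step:
  assumes "column C"
  shows "set (fst (step x C)) = insert x (set C - set (snd (step x C)))"
proof (cases rule: step_cases[where C = C and x = x])
  case append
  then show ?thesis by auto
next
  case (bump y)
  then show ?thesis by auto
qed

lemma column_step:
  assumes "column C"
  shows "column (fst (step x C))"
proof (cases rule: step_cases[where C = C and x = x])
  case append
  then show ?thesis using assms by (auto simp: sorted_wrt_append)
next
  case (bump y)
  have "sorted_wrt (\<lambda>a b. (if a = y then x else a) < (if b = y then x else b)) C"
    by (rule sorted_wrt_mono_rel[OF _ assms]) (use bump in \<open>fastforce split: if_splits\<close>)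
  then show ?thesis using bump by (simp add: sorted_wrt_map)
qed

lemma column_pass: "column C \<Longrightarrow> column (fst (pass w C))"
  by (induction w) (auto simp: column_step)

lemma mset_step:
  assumes "column C"
  shows "mset (fst (step x C)) + mset (snd (step x C)) = add_mset x (mset C)"
proof (cases rule: step_cases[where C = C and x = x])
  case append
  then show ?thesis by auto
next
  case (bump y)
  then obtain u v where C: "C = u @ y # v" by (metis split_list)
  then have "y \<notin> set u" "y \<notin> set v" using assms by (auto simp: sorted_wrt_append)
  then have "map (\<lambda>z. if z = y then x else z) u = u" "map (\<lambda>z. if z = y then x else z) v = v"
    by (auto intro!: map_idI)
  then have "fst (step x C) = u @ x # v" using bump C by simp
  then show ?thesis using bump C by simp
qed

lemma mset_pass: "column C \<Longrightarrow> mset (fst (pass w C)) + mset (snd (pass w C)) = mset w + mset C"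
proof (induction w)
  case (Cons x w)
  have "mset (fst (pass (x # w) C)) + mset (snd (pass (x # w) C)) =
      (mset (fst (step x (fst (pass w C)))) + mset (snd (step x (fst (pass w C))))) + mset (snd (pass w C))"
    by simp
  also have "\<dots> = add_mset x (mset (fst (pass w C)) + mset (snd (pass w C)))"
    using mset_step[OF column_pass[OF Cons.prems]] by simp
  finally show ?case using Cons by simp
qed simp

lemma length_pass: "column C \<Longrightarrow> length (fst (pass w C)) + length (snd (pass w C)) = length w + length C"
  using arg_cong[OF mset_pass, of C size w] by simp

lemma pass_nonempty: "w \<noteq> [] \<Longrightarrow> fst (pass w C) \<noteq> []"
  by (cases w) (auto simp: step_def Let_def)

text \<open>At least one letter stays behind in the new column; this makes the induction over
  columns well-founded when the insertion starts from the empty tableau.\<close>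

lemma length_snd_pass: "w \<noteq> [] \<Longrightarrow> length (snd (pass w [])) < length w"
  using length_pass[of "[]" w] pass_nonempty[of w "[]"] by (metis add.right_neutral add_less_cancel_right add_lessD1 length_greater_0_conv less_add_same_cancel2 list.size(3) sorted_wrt.simps(1))

lemma ins_word_columns:
  "\<forall>C\<in>set P. column C \<and> C \<noteq> [] \<Longrightarrow> \<forall>C\<in>set (ins_word w P). column C \<and> C \<noteq> []"
proof (induction P arbitrary: w)
  case Nil
  show ?case
  proof (induction w rule: length_induct)
    case (1 w)
    show ?case
    proof (cases "w = []")
      case False
      then show ?thesis
        using 1[rule_format, OF length_snd_pass[OF False]] pass_nonempty[OF False, of "[]"]
          column_pass[of "[]" w] by (simp add: ins_word_Nil)
    qed simp
  qed
next
  case (Cons C P)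
  have "fst (pass w C) \<noteq> []" using Cons.prems pass_nonempty[of w C] by (cases "w = []") auto
  moreover have "\<forall>C\<in>set (ins_word (snd (pass w C)) P). column C \<and> C \<noteq> []" using Cons by auto
  ultimately show ?case unfolding ins_word_Cons using column_pass[of C w] Cons.prems by simp
qed

lemma mset_col_insert:
  "\<forall>C\<in>set P. column C \<Longrightarrow> mset (concat (col_insert x P)) = add_mset x (mset (concat P))"
proof (induction P arbitrary: x)
  case (Cons C P)
  note IH = Cons.IH and P = Cons.prems
  from P have C: "column C" by simp
  show ?case
  proof (cases rule: step_cases[where C = C and x = x])
    case append
    then show ?thesis unfolding col_insert_step by simp
  next
    case (bump y)
    have "mset (concat (col_insert x (C # P))) = mset (fst (step x C)) + mset (concat (col_insert y P))"
      unfolding col_insert_step using bump by simp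
    also have "\<dots> = (mset (fst (step x C)) + mset (snd (step x C))) + mset (concat P)"
      using IH[of y] P bump by simp
    finally show ?thesis using mset_step[OF C] by simp
  qed
qed simp

lemma mset_ins_word: "mset (concat (ins_word w [])) = mset w"
  by (induction w) (use mset_col_insert ins_word_columns[of "[]"] in auto)


subsection \<open>Knuth equivalence\<close>

inductive knuth :: "nat list \<Rightarrow> nat list \<Rightarrow> bool" where
  knuth1: "x \<le> y \<Longrightarrow> y < z \<Longrightarrow> knuth (p @ [x, z, y] @ q) (p @ [z, x, y] @ q)"
| knuth2: "x < y \<Longrightarrow> y \<le> z \<Longrightarrow> knuth (p @ [y, x, z] @ q) (p @ [y, z, x] @ q)"
| knuth_refl: "knuth u u"
| knuth_sym: "knuth u v \<Longrightarrow> knuth v u"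
| knuth_trans: "knuth u v \<Longrightarrow> knuth v w \<Longrightarrow> knuth u w"

lemma knuth_cong: "knuth u v \<Longrightarrow> knuth (p @ u @ q) (p @ v @ q)"
proof (induction rule: knuth.induct)
  case (knuth1 x y z p' q')
  then show ?case using knuth.knuth1[of x y z "p @ p'" "q' @ q"] by simp
next
  case (knuth2 x y z p' q')
  then show ?case using knuth.knuth2[of x y z "p @ p'" "q' @ q"] by simp
qed (blast intro: knuth.intros)+

lemma knuth_length: "knuth u v \<Longrightarrow> length u = length v"
  by (induction rule: knuth.induct) auto

text \<open>A strictly increasing column is determined by its set, and on sets the positions of the
  entries disappear from the case distinctions.\<close>

definition step_set :: "nat \<Rightarrow> nat set \<Rightarrow> nat set \<Rightarrow> nat list \<Rightarrow> bool" where
  "step_set x S S' ys \<longleftrightarrow> (\<forall>z\<in>S. z < x) \<and> S' = insert x S \<and> ys = [] \<or>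
     (\<exists>y\<in>S. x \<le> y \<and> (\<forall>z\<in>S. x \<le> z \<longrightarrow> y \<le> z) \<and> S' = insert x (S - {y}) \<and> ys = [y])"

lemma step_set_step:
  assumes "column C"
  shows "step_set x (set C) (set (fst (step x C))) (snd (step x C))"
proof (cases rule: step_cases[where C = C and x = x])
  case append
  then show ?thesis by (auto simp: step_set_def)
next
  case (bump y)
  then show ?thesis using set_step[OF assms, of x] unfolding step_set_def by auto
qed

lemma step_set_bump:
  assumes "step_set x S S' ys" "t \<in> S" "x \<le> t"
  obtains y where "y \<in> S" "x \<le> y" "\<forall>z\<in>S. x \<le> z \<longrightarrow> y \<le> z" "S' = insert x (S - {y})" "ys = [y]"
  using assms unfolding step_set_def by (meson not_le)

lemma step_set_append:
  assumes "step_set x S S' ys" "\<And>t. t \<in> S \<Longrightarrow> t < x"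
  shows "ys = [] \<and> S' = insert x S"
  using assms unfolding step_set_def by (meson not_le)

text \<open>On both sides \<open>y\<close> is inserted before the others and then lies in the
  column. Hence \<open>x\<close> expels some \<open>x1 <= y\<close>, while \<open>z\<close> expels
  something \<open>>= z\<close> or is put on top, and the two do not interfere. If all three expel
  letters, these satisfy \<open>x1 <= y1 < z1\<close>, which is the first relation again.\<close>

lemma K1_step_set:
  assumes "x \<le> y" "y < z" "step_set y S S1 a"
    "step_set z S1 S2 b" "step_set x S2 S3 c" "step_set x S1 S2' c'" "step_set z S2' S3' b'"
  shows "S3 = S3'" "knuth (c @ b @ a) (b' @ c' @ a)"
proof -
  have y: "y \<in> S1" using assms(3) by (auto simp: step_set_def)
  then obtain x1 where x1: "x1 \<in> S1" "x \<le> x1" "\<forall>t\<in>S1. x \<le> t \<longrightarrow> x1 \<le> t"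
      "S2' = insert x (S1 - {x1})" "c' = [x1]"
    using step_set_bump[OF assms(6) y assms(1)] by blast
  have x1y: "x1 \<le> y" using x1 y assms(1) by blast
  consider (A) "\<forall>t\<in>S1. t < z" "S2 = insert z S1" "b = []"
    | (B) z1 where "z1 \<in> S1" "z \<le> z1" "\<forall>t\<in>S1. z \<le> t \<longrightarrow> z1 \<le> t" "S2 = insert z (S1 - {z1})" "b = [z1]"
    using assms(4) by (auto simp: step_set_def)
  then show "S3 = S3'" "knuth (c @ b @ a) (b' @ c' @ a)"
  proof (atomize (full), cases)
    case A
    have "b' = []" "S3' = insert z S2'"
      using assms(1,2,7) x1 A by (auto simp: step_set_def)
    moreover have "c = [x1]" "S3 = insert x (S2 - {x1})"
    proof -
      obtain x2 where x2: "x2 \<in> S2" "x \<le> x2" "\<forall>t\<in>S2. x \<le> t \<longrightarrow> x2 \<le> t"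
        "S3 = insert x (S2 - {x2})" "c = [x2]"
        using step_set_bump[OF assms(5), of y] assms(1) y A by auto
      have "x2 \<le> x1" using x2 x1 A by auto
      then have "x2 = x1" using x2 x1 A x1y assms(2) by (auto intro: le_antisym)
      then show "c = [x1]" "S3 = insert x (S2 - {x1})" using x2 by auto
    qed
    ultimately show "S3 = S3' \<and> knuth (c @ b @ a) (b' @ c' @ a)"
      using A x1 x1y assms(2) by (auto intro: knuth_refl)
  next
    case (B z1)
    obtain x2 where x2: "x2 \<in> S2" "x \<le> x2" "\<forall>t\<in>S2. x \<le> t \<longrightarrow> x2 \<le> t"
      "S3 = insert x (S2 - {x2})" "c = [x2]"
      using step_set_bump[OF assms(5), of y] assms(1,2) y B by auto
    have x1z: "x1 \<noteq> z1" "x1 < z" using x1y B assms(2) by auto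
    then have "x2 \<le> x1" using x2 x1 B by auto
    then have x21: "x2 = x1" using x2 x1 B x1z by (auto intro: le_antisym)
    have "z1 \<in> S2'" using x1 B x1z by auto
    then obtain z2 where z2: "z2 \<in> S2'" "z \<le> z2" "\<forall>t\<in>S2'. z \<le> t \<longrightarrow> z2 \<le> t"
      "S3' = insert z (S2' - {z2})" "b' = [z2]"
      using step_set_bump[OF assms(7) \<open>z1 \<in> S2'\<close> B(2)] by blast
    have "z2 \<le> z1" using z2 \<open>z1 \<in> S2'\<close> B by blast
    then have z21: "z2 = z1" using z2 B x1 assms(1,2) by (auto intro: le_antisym)
    have S: "S3 = S3'" using x2 z2 x21 z21 x1 B assms(1,2) x1z by auto
    have "knuth (c @ b @ a) (b' @ c' @ a)"
    proof (cases "a = []")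
      case True
      \<comment> \<open>If \<open>y\<close> had been put on top of the column, no entry
        \<open>>= z\<close> would be left for \<open>z\<close> to expel.\<close>
      then have "\<forall>t\<in>S. t < y" "S1 = insert y S" using assms(3) by (auto simp: step_set_def)
      then show ?thesis using B assms(2) by auto
    next
      case False
      then obtain y1 where y1: "y1 \<in> S" "y \<le> y1" "\<forall>t\<in>S. y \<le> t \<longrightarrow> y1 \<le> t"
        "S1 = insert y (S - {y1})" "a = [y1]"
        using assms(3) by (auto simp: step_set_def)
      have "y1 < z1" using y1 B assms(2) by (metis DiffE insertE less_le_trans nat_less_le not_less singletonI)
      then have "knuth ([] @ [x1, z1, y1] @ []) ([] @ [z1, x1, y1] @ [])"
        using x1y y1 by (intro knuth1) auto
      then show ?thesis using x2 z2 x21 z21 x1 B y1 by simp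
    qed
    then show "S3 = S3' \<and> knuth (c @ b @ a) (b' @ c' @ a)" using S by simp
  qed
qed

text \<open>If some entry lies in \<open>[x, z)\<close>, then \<open>x\<close> expels an entry below
  \<open>z\<close> on both sides, the insertions of \<open>x\<close> and \<open>z\<close> commute,
  and the output is related by the second relation or equal. If there is no such entry,
  \<open>z\<close> itself gets expelled, by \<open>x\<close> on one side and by \<open>y\<close> on
  the other; the outputs are then equal or related by the first relation. So the two relations have
  to be treated together.\<close>

lemma K2_step_set:
  assumes "x < y" "y \<le> z" "step_set z S S1 a" "step_set x S1 S2 b" "step_set y S2 S3 c"
    "step_set x S S1' b'" "step_set z S1' S2' a'" "step_set y S2' S3' c'"
  shows "S3 = S3'" "knuth (c @ b @ a) (c' @ a' @ b')"
proof -
  have "S3 = S3' \<and> knuth (c @ b @ a) (c' @ a' @ b')"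
  proof (cases "\<exists>t\<in>S. x \<le> t \<and> t < z")
    case True
    then obtain p where p: "p \<in> S" "x \<le> p" "\<forall>t\<in>S. x \<le> t \<longrightarrow> p \<le> t" "S1' = insert x (S - {p})" "b' = [p]"
      using True step_set_bump[OF assms(6)] by blast
    have pz: "p < z" using True p by force
    have S1: "S1 = insert z (S - set a)" "\<forall>t\<in>set a. z \<le> t"
      using assms(3) by (auto simp: step_set_def)
    then have "p \<in> S1" using p pz by auto
    then obtain p' where p': "p' \<in> S1" "x \<le> p'" "\<forall>t\<in>S1. x \<le> t \<longrightarrow> p' \<le> t" "S2 = insert x (S1 - {p'})" "b = [p']"
      using step_set_bump[OF assms(4), of p] p by auto
    have "p' \<le> p" using p' \<open>p \<in> S1\<close> p by blast
    then have pp: "p' = p" using p p' S1 pz by (auto intro: le_antisym)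
    have a: "a' = a \<and> S2' = S2"
    proof (cases "\<forall>t\<in>S. t < z")
      case True
      then have "a = []" "S1 = insert z S" using assms(3) by (auto simp: step_set_def)
      moreover have "a' = []" "S2' = insert z S1'" using assms(7) True p assms(1,2) by (auto simp: step_set_def)
      ultimately show ?thesis using p' pp p pz by auto
    next
      case False
      then obtain z1 where z1: "z1 \<in> S" "z \<le> z1" "\<forall>t\<in>S. z \<le> t \<longrightarrow> z1 \<le> t" "S1 = insert z (S - {z1})" "a = [z1]"
        using assms(3) by (auto simp: step_set_def)
      have "z1 \<in> S1'" using z1 p pz by auto
      then obtain z2 where z2: "z2 \<in> S1'" "z \<le> z2" "\<forall>t\<in>S1'. z \<le> t \<longrightarrow> z2 \<le> t" "S2' = insert z (S1' - {z2})" "a' = [z2]"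
        using step_set_bump[OF assms(7) _ z1(2)] by blast
      have "z2 \<le> z1" using z2 \<open>z1 \<in> S1'\<close> z1 by blast
      then have "z2 = z1" using z2 z1 p assms(1,2) by (auto intro: le_antisym)
      then show ?thesis using z2 z1 p p' pp pz assms(1,2) by auto
    qed
    have zS2: "z \<in> S2" using S1 p' pp pz by auto
    then obtain q where q: "q \<in> S2" "y \<le> q" "\<forall>t\<in>S2. y \<le> t \<longrightarrow> q \<le> t" "S3 = insert y (S2 - {q})" "c = [q]"
      using step_set_bump[OF assms(5) zS2 assms(2)] by blast
    have c': "S3' = S3 \<and> c' = [q]"
      using assms(8) q a by (auto simp: step_set_def intro: le_antisym)
    have qz: "q \<le> z" using q zS2 assms(2) by blast
    have pq: "p < q"
    proof (cases "q = z")
      case False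
      then have "q \<in> S - {p}" "x \<le> q" using q p' pp S1 assms(1) by auto
      then show ?thesis using p by (metis DiffE insertI1 le_neq_implies_less)
    qed (use pz in simp)
    have "knuth ([q] @ [p] @ a) ([q] @ a @ [p])"
    proof (cases "a = []")
      case False
      then obtain z1 where "a = [z1]" "z \<le> z1" using assms(3) by (auto simp: step_set_def)
      then show ?thesis using knuth2[of p q z1 "[]" "[]"] pq qz by simp
    qed (simp add: knuth_refl)
    then show ?thesis using c' q p' pp p a by simp
  next
    case False
    then have gap: "\<And>t. t \<in> S \<Longrightarrow> x \<le> t \<Longrightarrow> z \<le> t" by (meson not_le)
    show ?thesis
    proof (cases "\<forall>t\<in>S. t < x")
      case True
      have z: "a = [] \<and> S1 = insert z S" by (rule step_set_append[OF assms(3)]) (use True assms(1,2) in auto)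
      have "b = [z] \<and> S2 = insert x (S1 - {z})"
      proof -
        obtain z1 where z1: "z1 \<in> S1" "x \<le> z1" "S2 = insert x (S1 - {z1})" "b = [z1]"
          using step_set_bump[OF assms(4), of z] assms(1,2) z by auto
        then have "z1 = z" using z True by (metis insertE not_le)
        then show ?thesis using z1 by simp
      qed
      then have b: "b = [z]" "S2 = insert x S" using z True assms(1,2) by auto
      have c: "c = [] \<and> S3 = insert y (insert x S)" unfolding b(2)[symmetric] by (rule step_set_append[OF assms(5)]) (use True assms(1) b in auto)
      have b': "b' = [] \<and> S1' = insert x S" by (rule step_set_append[OF assms(6)]) (use True in auto)
      have "a' = [] \<and> S2' = insert z S1'" by (rule step_set_append[OF assms(7)]) (use True assms(1,2) b' in auto)
      then have a': "a' = [] \<and> S2' = insert z (insert x S)" using b' by simp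
      have "c' = [z] \<and> S3' = insert y (S2' - {z})"
      proof -
        have "z \<in> S2'" using a' by simp
        then obtain z1 where z1: "z1 \<in> S2'" "y \<le> z1" "S3' = insert y (S2' - {z1})" "c' = [z1]"
          using step_set_bump[OF assms(8) _ assms(2)] by blast
        have "z1 \<notin> S" using True z1(2) assms(1) by force
        moreover have "z1 \<noteq> x" using assms(1) z1(2) by simp
        ultimately have "z1 = z" using a' z1(1) by blast
        then show ?thesis using z1 by simp
      qed
      then have "c' = [z] \<and> S3' = insert y (insert x S)" using a' True assms(1,2) by auto
      then show ?thesis using b c a' b' z by (simp add: knuth_refl)
    next
      case False
      then obtain p where p: "p \<in> S" "x \<le> p" "\<forall>t\<in>S. x \<le> t \<longrightarrow> p \<le> t" "S1' = insert x (S - {p})" "b' = [p]"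
        using False step_set_bump[OF assms(6)] by (metis not_less)
      have zp: "z \<le> p" using gap p by blast
      have z: "S1 = insert z (S - {p}) \<and> a = [p]"
      proof -
        obtain z1 where z1: "z1 \<in> S" "z \<le> z1" "\<forall>t\<in>S. z \<le> t \<longrightarrow> z1 \<le> t" "S1 = insert z (S - {z1})" "a = [z1]"
          using step_set_bump[OF assms(3) p(1) zp] by blast
        then have "z1 = p" using p zp assms(1,2) by (metis le_antisym le_trans less_imp_le)
        then show ?thesis using z1 by simp
      qed
      have zS: "z \<notin> S - {p}" using p assms(1,2) zp by (metis DiffE le_antisym le_trans less_imp_le singletonI)
      have b: "b = [z] \<and> S2 = insert x (S - {p})"
      proof -
        obtain z1 where z1: "z1 \<in> S1" "x \<le> z1" "\<forall>t\<in>S1. x \<le> t \<longrightarrow> z1 \<le> t" "S2 = insert x (S1 - {z1})" "b = [z1]"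
          using step_set_bump[OF assms(4), of z] assms(1,2) z by auto
        have "z1 \<le> z" using z1 z assms(1,2) by auto
        moreover have "z \<le> z1" using z1 z gap by auto
        ultimately have "z1 = z" by simp
        then show ?thesis using z1 z zS by auto
      qed
      show ?thesis
      proof (cases "\<exists>t\<in>S - {p}. x \<le> t")
        case True
        then obtain t where "t \<in> S - {p}" "x \<le> t" by blast
        then have "t \<in> S2" "y \<le> t" using b gap[of t] assms(2) by auto
        then obtain q where q: "q \<in> S2" "y \<le> q" "\<forall>t\<in>S2. y \<le> t \<longrightarrow> q \<le> t" "S3 = insert y (S2 - {q})" "c = [q]"
          using step_set_bump[OF assms(5)] by blast
        then have qS: "q \<in> S" "q \<noteq> p" using b assms(1) by auto
        have pq: "p < q" using p qS q assms(1) by (metis le_neq_implies_less le_trans less_imp_le)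
        have "q \<in> S1'" using p qS by auto
        then obtain q' where q': "q' \<in> S1'" "z \<le> q'" "\<forall>t\<in>S1'. z \<le> t \<longrightarrow> q' \<le> t" "S2' = insert z (S1' - {q'})" "a' = [q']"
          using step_set_bump[OF assms(7) _ order_trans[OF zp less_imp_le[OF pq]]] by blast
        have "q' \<in> S - {p}" using q' p assms(1,2) by auto
        then have "q \<le> q'" using q b q' assms(2) by auto
        moreover have "q' \<le> q" using q' \<open>q \<in> S1'\<close> pq zp by auto
        ultimately have qq: "q' = q" by simp
        have c': "c' = [z] \<and> S3' = insert y (S2' - {z})"
        proof -
          obtain z1 where z1: "z1 \<in> S2'" "y \<le> z1" "\<forall>t\<in>S2'. y \<le> t \<longrightarrow> z1 \<le> t" "S3' = insert y (S2' - {z1})" "c' = [z1]"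
            using step_set_bump[OF assms(8) _ assms(2)] q' by blast
          have "z1 \<le> z" using z1 q' assms(2) by auto
          moreover have "z \<le> z1" using z1 q' p gap assms(1) by auto
          ultimately have "z1 = z" by simp
          then show ?thesis using z1 by auto
        qed
        have "S3' = S3" using c' q' qq q b p zS assms(1,2) pq by auto
        \<comment> \<open>Here \<open>z <= p < q\<close>: the second relation has turned into the
          first one.\<close>
        moreover have "knuth ([z, q, p]) ([q, z, p])" using knuth1[of z p q "[]" "[]"] zp pq by simp
        ultimately show ?thesis using c' q q' qq b z p by (auto intro: knuth_sym)
      next
        case False
        then have noq: "\<And>t. t \<in> S - {p} \<Longrightarrow> t < x" by (meson not_le)
        have c: "c = [] \<and> S3 = insert y S2" by (rule step_set_append[OF assms(5)]) (use b noq assms(1) in fastforce)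
        have a': "a' = [] \<and> S2' = insert z S1'" by (rule step_set_append[OF assms(7)]) (use p noq assms(1,2) in fastforce)
        have "c' = [z] \<and> S3' = insert y (S2' - {z})"
        proof -
          obtain z1 where z1: "z1 \<in> S2'" "y \<le> z1" "S3' = insert y (S2' - {z1})" "c' = [z1]"
            using step_set_bump[OF assms(8) _ assms(2)] a' by blast
          have "z1 \<in> insert z (insert x (S - {p}))" using z1(1) a' p(4) by simp
          moreover have "z1 \<notin> S - {p}" using noq[of z1] z1(2) assms(1) by (meson leD less_trans)
          moreover have "z1 \<noteq> x" using assms(1) z1(2) by simp
          ultimately have "z1 = z" by blast
          then show ?thesis using z1 by auto
        qed
        then have "c' = [z] \<and> S3' = S3" using a' c b p zS assms(1,2) by auto
        then show ?thesis using c a' b z p by (simp add: knuth_refl)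
      qed
    qed
  qed
  then show "S3 = S3'" "knuth (c @ b @ a) (c' @ a' @ b')" by auto
qed

lemma pass_triple:
  assumes "column C"
    and eq: "\<And>S1 S2 S3 S1' S2' S3' r s t r' s' t'. step_set z (set C) S1 r \<Longrightarrow> step_set y S1 S2 s \<Longrightarrow> step_set x S2 S3 t \<Longrightarrow>
      step_set z' (set C) S1' r' \<Longrightarrow> step_set y' S1' S2' s' \<Longrightarrow> step_set x' S2' S3' t' \<Longrightarrow>
      S3 = S3' \<and> knuth (t @ s @ r) (t' @ s' @ r')"
  shows "fst (pass [x, y, z] C) = fst (pass [x', y', z'] C) \<and>
    knuth (snd (pass [x, y, z] C)) (snd (pass [x', y', z'] C))"
proof -
  note c = assms(1) column_step
  have "set (fst (pass [x, y, z] C)) = set (fst (pass [x', y', z'] C)) \<and>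
     knuth (snd (pass [x, y, z] C)) (snd (pass [x', y', z'] C))"
    using eq[OF step_set_step step_set_step step_set_step step_set_step step_set_step step_set_step] c by simp
  then show ?thesis using strict_sorted_equal column_pass[OF assms(1)] by blast
qed

lemma pass_K1:
  assumes "x \<le> y" "y < z" "column C"
  shows "fst (pass [x, z, y] C) = fst (pass [z, x, y] C) \<and>
    knuth (snd (pass [x, z, y] C)) (snd (pass [z, x, y] C))"
proof (rule pass_triple[OF assms(3)])
  fix S1 S2 S3 S1' S2' S3' r s t r' s' t'
  assume h: "step_set y (set C) S1 r" "step_set z S1 S2 s" "step_set x S2 S3 t"
      "step_set y (set C) S1' r'" "step_set x S1' S2' s'" "step_set z S2' S3' t'"
  have e: "S1' = S1" "r' = r" using h(1,4) by (auto simp: step_set_def intro: le_antisym)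
  show "S3 = S3' \<and> knuth (t @ s @ r) (t' @ s' @ r')"
    using K1_step_set[OF assms(1,2) h(1,2,3) h(5)[unfolded e] h(6)] e by simp
qed

lemma pass_K2:
  assumes "x < y" "y \<le> z" "column C"
  shows "fst (pass [y, x, z] C) = fst (pass [y, z, x] C) \<and>
    knuth (snd (pass [y, x, z] C)) (snd (pass [y, z, x] C))"
proof (rule pass_triple[OF assms(3)])
  fix S1 S2 S3 S1' S2' S3' r s t r' s' t'
  assume h: "step_set z (set C) S1 r" "step_set x S1 S2 s" "step_set y S2 S3 t"
      "step_set x (set C) S1' r'" "step_set z S1' S2' s'" "step_set y S2' S3' t'"
  show "S3 = S3' \<and> knuth (t @ s @ r) (t' @ s' @ r')"
    using K2_step_set[OF assms(1,2) h] by simp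
qed

lemma pass_context:
  assumes "fst (pass u (fst (pass q C))) = fst (pass v (fst (pass q C))) \<and>
    knuth (snd (pass u (fst (pass q C)))) (snd (pass v (fst (pass q C))))"
  shows "fst (pass (p @ u @ q) C) = fst (pass (p @ v @ q) C) \<and>
    knuth (snd (pass (p @ u @ q) C)) (snd (pass (p @ v @ q) C))"
  unfolding pass_append[of p] pass_append[of u] pass_append[of v] fst_conv snd_conv append_assoc
  using assms by (metis knuth_cong)

lemma pass_knuth:
  "knuth u v \<Longrightarrow> column C \<Longrightarrow> fst (pass u C) = fst (pass v C) \<and> knuth (snd (pass u C)) (snd (pass v C))"
proof (induction arbitrary: C rule: knuth.induct)
  case (knuth1 x y z p q)
  have "column (fst (pass q C))" using knuth1 column_pass by blast
  from pass_context[OF pass_K1[OF knuth1(1,2) this]] show ?case .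
next
  case (knuth2 x y z p q)
  have "column (fst (pass q C))" using knuth2 column_pass by blast
  from pass_context[OF pass_K2[OF knuth2(1,2) this]] show ?case .
next
  case (knuth_refl u)
  then show ?case by (simp add: knuth.knuth_refl)
next
  case (knuth_sym u v)
  from knuth_sym.IH[OF knuth_sym.prems] show ?case by (auto intro: knuth.knuth_sym)
next
  case (knuth_trans u v w)
  from knuth_trans.IH(1)[OF knuth_trans.prems] knuth_trans.IH(2)[OF knuth_trans.prems]
  show ?case by (auto intro: knuth.knuth_trans)
qed

text \<open>Equivalent words produce the same first column and pass on equivalent, shorter
  words.\<close>

theorem knuth_ins_word: "knuth u v \<Longrightarrow> ins_word u [] = ins_word v []"
proof (induction u arbitrary: v rule: length_induct)
  case (1 u)
  show ?case
  proof (cases "u = []")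
    case True
    then show ?thesis using knuth_length[OF 1(2)] by simp
  next
    case False
    then have "v \<noteq> []" using knuth_length[OF 1(2)] by auto
    then show ?thesis
      using False 1(1)[rule_format, OF length_snd_pass[OF False]] pass_knuth[OF 1(2), of "[]"]
      by (simp add: ins_word_Nil)
  qed
qed

subsection \<open>Column heights\<close>

text \<open>Columns are counted from 0 here, whereas \<open>yboxes\<close> counts them from 1.
  Absent columns have height 0, so that heights can be compared for all \<open>c\<close>.\<close>

definition ht :: "nat list list \<Rightarrow> nat \<Rightarrow> nat" where
  "ht P c = (if c < length P then length (P ! c) else 0)"

lemma ht_simps [simp]:
  "ht [] c = 0" "ht (C # P) 0 = length C" "ht (C # P) (Suc c) = ht P c"
  by (auto simp: ht_def)

definition tableau :: "nat list list \<Rightarrow> bool" where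
  "tableau P \<longleftrightarrow> (\<forall>C\<in>set P. column C \<and> C \<noteq> [])"

lemma tableau_ins_word: "tableau P \<Longrightarrow> tableau (ins_word w P)"
  unfolding tableau_def by (rule ins_word_columns)

lemma tableau_simps [simp]: "tableau []" "tableau (C # P) \<longleftrightarrow> column C \<and> C \<noteq> [] \<and> tableau P"
  by (auto simp: tableau_def)

fun land :: "nat \<Rightarrow> nat list list \<Rightarrow> nat" where
  "land x [] = 0"
| "land x (C # P) = (case snd (step x C) of [] \<Rightarrow> 0 | y # _ \<Rightarrow> Suc (land y P))"

lemma ht_col_insert: "ht (col_insert x P) c = ht P c + (if c = land x P then 1 else 0)"
proof (induction P arbitrary: x c)
  case Nil
  show ?case by (cases c) auto
next
  case (Cons C P)
  show ?case
  proof (cases rule: step_cases[where C = C and x = x])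
    case append
    then show ?thesis unfolding col_insert_step by (cases c) auto
  next
    case (bump y)
    then show ?thesis unfolding col_insert_step using Cons by (cases c) auto
  qed
qed

lemma step_bumpI:
  assumes "column C" "y \<in> set C" "x \<le> y" "\<And>z. z \<in> set C \<Longrightarrow> x \<le> z \<Longrightarrow> y \<le> z"
  shows "snd (step x C) = [y] \<and> set (fst (step x C)) = insert x (set C - {y})"
proof (cases rule: step_cases[where C = C and x = x])
  case append
  then show ?thesis using assms(2,3) by (meson not_le)
next
  case (bump y')
  then have "y' = y" using assms by (meson le_antisym)
  then show ?thesis using bump(4) set_step[OF assms(1), of x] by simp
qed

lemma step_appendI:
  assumes "\<And>z. z \<in> set C \<Longrightarrow> z < x"
  shows "snd (step x C) = [] \<and> set (fst (step x C)) = insert x (set C)"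
  using assms by (auto simp: step_def)

lemma column_eqI: "column C \<Longrightarrow> column D \<Longrightarrow> set C = set D \<Longrightarrow> C = D"
  by (simp add: strict_sorted_equal)

text \<open>The bumping lemma for columns. In each column the later letter \<open>x\<close> finds
  the earlier letter \<open>y\<close>, so it expels some \<open>x1 <= y\<close>; if \<open>y\<close>
  expelled \<open>y1 >= y\<close>, the order \<open>x1 <= y1\<close> persists in the next column.
  Where \<open>y\<close> came to rest, \<open>x\<close> still has to move on.\<close>

lemma land_less:
  assumes "tableau P" "x \<le> y"
  shows "land y P < land x (col_insert y P)"
  using assms
proof (induction P arbitrary: x y)
  case Nil
  then show ?case using step_bumpI[of "[y]" y x] by simp
next
  case (Cons C P)
  have C: "column C" using Cons.prems by simp
  have y: "y \<in> set (fst (step y C))" using set_step[OF C] by simp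
  obtain x1 where x1: "x \<le> x1" "x1 \<le> y" "snd (step x (fst (step y C))) = [x1]"
    using y Cons.prems(2) by (cases rule: step_cases[where C = "fst (step y C)" and x = x]) auto
  show ?case
  proof (cases rule: step_cases[where C = C and x = y])
    case append
    then show ?thesis unfolding col_insert_step using x1 by simp
  next
    case (bump y1)
    then have "land y1 P < land x1 (col_insert y1 P)" using Cons x1 by simp
    then show ?thesis unfolding col_insert_step using x1 bump by simp
  qed
qed

text \<open>Listed in the order of the word, hence opposite to the order of insertion.\<close>

fun lands :: "nat list \<Rightarrow> nat list list \<Rightarrow> nat list" where
  "lands [] P = []"
| "lands (x # w) P = land x (ins_word w P) # lands w P"

lemma length_lands [simp]: "length (lands w P) = length w"
  by (induction w) auto

lemma lands_drop: "lands (drop k w) P = drop k (lands w P)"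
proof (induction w arbitrary: k)
  case (Cons x w)
  then show ?case by (cases k) auto
qed simp

lemma ht_ins_word: "ht (ins_word w P) c = ht P c + count_list (lands w P) c"
  by (induction w) (auto simp: ht_col_insert)

lemma sorted_lands:
  assumes "tableau P" "sorted w"
  shows "sorted_wrt (>) (lands w P)"
  using assms(2)
proof (induction w)
  case (Cons x w)
  show ?case
  proof (cases w)
    case (Cons y w')
    have "x \<le> y" "sorted w" using Cons \<open>sorted (x # w)\<close> by auto
    then have "land y (ins_word w' P) < land x (ins_word w P)"
      using land_less[OF tableau_ins_word[OF assms(1)], of x y w'] Cons by simp
    then show ?thesis using Cons.IH \<open>sorted w\<close> Cons by fastforce
  qed simp
qed simp

text \<open>The letters of a weakly increasing word, inserted from right to left, land further and
  further to the right, so no column receives two boxes.\<close>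

lemma row_strip:
  assumes "tableau P" "sorted r"
  shows "ht (ins_word r P) c = ht P c + (if c \<in> set (lands r P) then 1 else 0)"
    and "distinct (lands r P)"
proof -
  have "sorted_wrt (<) (rev (lands r P))"
    using sorted_lands[OF assms] by (simp add: sorted_wrt_rev)
  then show d: "distinct (lands r P)" by (metis distinct_rev strict_sorted_iff)
  have "distinct xs \<Longrightarrow> count_list xs c = (if c \<in> set xs then 1 else 0)" for xs :: "nat list"
    by (induction xs) auto
  then have "count_list (lands r P) c = (if c \<in> set (lands r P) then 1 else 0)" using d by blast
  then show "ht (ins_word r P) c = ht P c + (if c \<in> set (lands r P) then 1 else 0)"
    by (simp add: ht_ins_word)
qed

text \<open>The landing columns form a decreasing list, which is determined by its set. In
  particular the last letter of the word lands in column 0.\<close>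

lemma row_exact:
  assumes "tableau P" "sorted r" and "\<And>c. ht (ins_word r P) c = ht P c + (if c < length r then 1 else 0)"
  shows "lands r P = rev [0..<length r]"
proof -
  have "c \<in> set (lands r P) \<longleftrightarrow> c < length r" for c
    using row_strip(1)[OF assms(1,2), of c] assms(3)[of c] by (auto split: if_splits)
  then have "set (lands r P) = {..<length r}" by blast
  then have "set (rev (lands r P)) = set [0..<length r]" by (simp add: lessThan_atLeast0)
  moreover have "sorted_wrt (<) (rev (lands r P))" "sorted_wrt (<) [0..<length r]"
    using sorted_lands[OF assms(1,2)] by (simp_all add: sorted_wrt_rev)
  ultimately have "rev (lands r P) = [0..<length r]" by (metis strict_sorted_equal)
  then show ?thesis by (metis rev_rev_ident)
qed

text \<open>The columns are filled from left to right, so the shapes inside a factor follow from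
  those at its two ends. This reduces the condition on the recording tableau to the ends of the
  factors.\<close>

lemma row_exact_drop:
  assumes "tableau P" "sorted r" and "\<And>c. ht (ins_word r P) c = ht P c + (if c < length r then 1 else 0)"
  shows "ht (ins_word (drop k r) P) c = ht P c + (if c < length r - k then 1 else 0)"
proof -
  have "lands (drop k r) P = drop k (rev [0..<length r])"
    using row_exact[OF assms] by (simp add: lands_drop)
  also have "\<dots> = rev [0..<length r - k]" by (simp add: drop_rev)
  finally have "set (lands (drop k r) P) = {..<length r - k}" by auto
  moreover have "sorted (drop k r)" using assms(2) by (simp add: sorted_wrt_drop)
  ultimately show ?thesis using row_strip(1)[OF assms(1), of "drop k r" c] by auto
qed


subsection \<open>Column insertion preserves semistandardness\<close>

definition row_le :: "nat list \<Rightarrow> nat list \<Rightarrow> bool" where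
  "row_le C D \<longleftrightarrow> length D \<le> length C \<and> (\<forall>j<length D. C ! j \<le> D ! j)"

definition hd_col :: "nat list list \<Rightarrow> nat list" where
  "hd_col P = (case P of [] \<Rightarrow> [] | C # _ \<Rightarrow> C)"

fun semistandard :: "nat list list \<Rightarrow> bool" where
  "semistandard [] = True"
| "semistandard (C # P) = (column C \<and> row_le C (hd_col P) \<and> semistandard P)"

lemma hd_col_col_insert: "hd_col (col_insert x P) = fst (step x (hd_col P))"
proof (cases P)
  case Nil
  then show ?thesis by (simp add: hd_col_def step_def)
next
  case (Cons C P')
  then show ?thesis by (simp add: hd_col_def col_insert_step del: col_insert.simps)
qed

lemma column_hd_col: "semistandard P \<Longrightarrow> column (hd_col P)"
  by (cases P) (auto simp: hd_col_def)

lemma column_nth_less: "column C \<Longrightarrow> i < j \<Longrightarrow> j < length C \<Longrightarrow> C ! i < C ! j"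
  by (simp add: sorted_wrt_iff_nth_less)

text \<open>A letter expelled from height \<open>p\<close> of \<open>C\<close> enters
  \<open>D\<close> at height at most \<open>p\<close>, because \<open>D ! p\<close> is at least
  \<open>C ! p = y\<close> whenever that box exists. Up to height \<open>p\<close> the new entries
  of \<open>C\<close> are at most \<open>y\<close>, and everywhere they are at most the old
  ones.\<close>

lemma row_le_step:
  assumes C: "column C" and D: "column D" and le: "row_le C D" and y: "snd (step x C) = [y]"
  shows "row_le (fst (step x C)) (fst (step y D))"
proof -
  have "y \<in> set C" "x \<le> y" and C': "fst (step x C) = map (\<lambda>z. if z = y then x else z) C"
    using y by (cases rule: step_cases[where C = C and x = x]; auto)+
  then obtain p where p: "p < length C" "C ! p = y" by (auto simp: in_set_conv_nth)
  have Cj: "fst (step x C) ! j = (if j = p then x else C ! j)" if "j < length C" for j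
    using that C' p C by (auto simp: distinct_conv_nth strict_sorted_iff)
  have len: "length (fst (step x C)) = length C" using C' by simp
  have small: "fst (step x C) ! j \<le> y" if "j \<le> p" for j
    using Cj[of j] column_nth_less[OF C, of j p] that p \<open>x \<le> y\<close> by (cases "j = p") auto
  have mono: "fst (step x C) ! j \<le> C ! j" if "j < length C" for j
    using Cj[OF that] p \<open>x \<le> y\<close> by auto
  have Dle: "\<And>j. j < length D \<Longrightarrow> C ! j \<le> D ! j" "length D \<le> length C" using le by (auto simp: row_le_def)
  show ?thesis
  proof (cases rule: step_cases[where C = D and x = y])
    case append
    have pl: "length D \<le> p"
    proof (rule ccontr)
      assume "\<not> length D \<le> p"
      then have "y \<le> D ! p" "D ! p \<in> set D" using Dle p by auto
      then show False using append by auto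
    qed
    have "fst (step x C) ! j \<le> (D @ [y]) ! j" if "j < Suc (length D)" for j
    proof (cases "j < length D")
      case True
      then show ?thesis using mono[of j] Dle(1)[of j] Dle(2) by (simp add: nth_append)
    next
      case False
      then have "j = length D" using that by simp
      then show ?thesis using small[of j] pl by simp
    qed
    then show ?thesis using append pl p by (simp add: row_le_def len)
  next
    case (bump y1)
    then obtain q where q: "q < length D" "D ! q = y1" by (auto simp: in_set_conv_nth)
    have Dj: "fst (step y D) ! j = (if j = q then y else D ! j)" if "j < length D" for j
      using that bump q D by (auto simp: distinct_conv_nth strict_sorted_iff)
    have pq: "q \<le> p"
    proof (rule ccontr)
      assume "\<not> q \<le> p"
      then have "p < length D" "p < q" using q by auto
      then have "y \<le> D ! p" "D ! p \<in> set D" "D ! p < D ! q"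
        using Dle(1)[of p] p column_nth_less[OF D, of p q] q by auto
      then show False using bump q by auto
    qed
    have "fst (step x C) ! j \<le> fst (step y D) ! j" if "j < length D" for j
      using Dj[OF that] small[of j] pq mono[of j] Dle(1)[OF that] Dle(2) that by (cases "j = q") auto
    then show ?thesis using bump Dle(2) by (auto simp: row_le_def len)
  qed
qed

text \<open>Semistandardness serves to keep the column heights weakly decreasing, so that the
  recording tableau has partition shape.\<close>

lemma semistandard_col_insert: "semistandard P \<Longrightarrow> semistandard (col_insert x P)"
proof (induction P arbitrary: x)
  case Nil
  then show ?case by (simp add: row_le_def hd_col_def)
next
  case (Cons C P)
  have C: "column C" "column (fst (step x C))" using Cons.prems column_step by auto
  show ?case
  proof (cases rule: step_cases[where C = C and x = x])
    case append
    then have "row_le (C @ [x]) (hd_col P)" using Cons.prems by (auto simp: row_le_def nth_append)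
    then show ?thesis unfolding col_insert_step using append Cons.prems C by simp
  next
    case (bump y)
    then have "row_le (fst (step x C)) (fst (step y (hd_col P)))"
      using row_le_step[of C "hd_col P" x y] Cons.prems column_hd_col by auto
    then show ?thesis
      unfolding col_insert_step using bump C Cons by (simp add: hd_col_col_insert del: col_insert.simps)
  qed
qed

lemma semistandard_ins_word: "semistandard (ins_word w [])"
  by (induction w) (auto intro: semistandard_col_insert)

lemma semistandard_ht: "semistandard P \<Longrightarrow> ht P (Suc c) \<le> ht P c"
proof (induction P arbitrary: c)
  case (Cons C P)
  then show ?case
  proof (cases c)
    case 0
    have "ht P 0 = length (hd_col P)" by (cases P) (auto simp: hd_col_def)
    then show ?thesis using Cons.prems 0 by (simp add: row_le_def)
  qed simp
qed simp


subsection \<open>Column insertion and the bracket rule for two consecutive letters\<close>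

definition tok :: "nat \<Rightarrow> nat \<Rightarrow> bracket" where
  "tok a x = (if x = Suc a then Opn else if x = a then Cls else Neu)"

text \<open>The column is read from top to bottom: \<open>a + 1\<close> comes before
  \<open>a\<close>, and the two match each other.\<close>

definition ctok :: "nat \<Rightarrow> nat list \<Rightarrow> bracket list" where
  "ctok a C = (if Suc a \<in> set C then [Opn] else []) @ (if a \<in> set C then [Cls] else [])"

text \<open>The crystal raising operator of type A for the letters \<open>a\<close> and
  \<open>a + 1\<close>: the leftmost unmatched \<open>a + 1\<close> becomes
  \<open>a\<close>.\<close>

definition letter_step :: "nat \<Rightarrow> nat list \<Rightarrow> nat list \<Rightarrow> bool" where
  "letter_step a w w' \<longleftrightarrow>
     (\<exists>p q. w = p @ Suc a # q \<and> w' = p @ a # q \<and> flip_at (map (tok a) p) (map (tok a) q))"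

text \<open>The raising operator on the word formed by a column and the letters expelled from it.
  The alternatives tell whether the changed letter lies among the expelled letters or in the
  column.\<close>

definition column_letter_step :: "nat \<Rightarrow> nat list \<Rightarrow> nat list \<Rightarrow> nat list \<Rightarrow> nat list \<Rightarrow> bool" where
  "column_letter_step a C v C' v' \<longleftrightarrow>
     C' = C \<and> (\<exists>p q. v = p @ Suc a # q \<and> v' = p @ a # q \<and> flip_at (ctok a C @ map (tok a) p) (map (tok a) q)) \<or>
     v' = v \<and> Suc a \<in> set C \<and> a \<notin> set C \<and> set C' = insert a (set C - {Suc a}) \<and> cls (map (tok a) v) = 0"

lemma column_letter_stepI:
  "v = p @ Suc a # q \<Longrightarrow> v' = p @ a # q \<Longrightarrow> flip_at (ctok a C @ map (tok a) p) (map (tok a) q) \<Longrightarrow>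
    column_letter_step a C v C v'"
  by (auto simp: column_letter_step_def)

text \<open>Here \<open>A\<close> and \<open>B\<close> stand for the presence of \<open>a\<close>
  and \<open>a + 1\<close> in the column, and \<open>Z\<close> for the letters expelled earlier.
  Since \<open>y\<close> is the least entry \<open>>= x\<close>, only a few configurations of these
  two letters remain, and in each of them the brackets cancel alike before and after the
  insertion.\<close>

lemma bump_brackets:
  assumes "x \<le> y" "y = a \<Longrightarrow> A" "y = Suc a \<Longrightarrow> B" "A \<Longrightarrow> x \<le> a \<Longrightarrow> y \<le> a" "B \<Longrightarrow> x \<le> Suc a \<Longrightarrow> y \<le> Suc a"
  defines "new \<equiv> (if Suc a = x \<or> B \<and> Suc a \<noteq> y then [Opn] else []) @ (if a = x \<or> A \<and> a \<noteq> y then [Cls] else [])"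
    and "old \<equiv> (if B then [Opn] else []) @ (if A then [Cls] else [])"
  shows "cls (tok a x # old @ Z) = cls (new @ tok a y # Z) \<and> opn (tok a x # old @ Z) = opn (new @ tok a y # Z)"
  unfolding new_def old_def tok_def
  by (insert assms(1-5), cases A; cases B; cases "x = a"; cases "x = Suc a"; cases "y = a"; cases "y = Suc a"; simp)

lemma step_brackets:
  assumes "column C"
  shows "cls (tok a x # ctok a C @ Z) = cls (ctok a (fst (step x C)) @ map (tok a) (snd (step x C)) @ Z) \<and>
    opn (tok a x # ctok a C @ Z) = opn (ctok a (fst (step x C)) @ map (tok a) (snd (step x C)) @ Z)"
proof (cases rule: step_cases[where C = C and x = x])
  case append
  have h: "z \<in> set C \<Longrightarrow> z < x" for z using append by auto
  show ?thesis using append h[of a] h[of "Suc a"] by (auto simp: ctok_def tok_def)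
next
  case (bump y)
  have s: "set (fst (step x C)) = insert x (set C - {y})" using set_step[OF assms, of x] bump by simp
  have new: "ctok a (fst (step x C)) = (if Suc a = x \<or> Suc a \<in> set C \<and> Suc a \<noteq> y then [Opn] else []) @
      (if a = x \<or> a \<in> set C \<and> a \<noteq> y then [Cls] else [])"
    by (simp add: s ctok_def)
  have "snd (step x C) = [y]" using bump by simp
  then show ?thesis unfolding new ctok_def[of a C]
    using bump_brackets[of x y a "a \<in> set C" "Suc a \<in> set C" Z] bump(1-3)
    by (simp only: list.map append_Cons append_Nil) blast
qed

lemma pass_brackets:
  "cls (map (tok a) w) = cls (ctok a (fst (pass w [])) @ map (tok a) (snd (pass w []))) \<and>
   opn (map (tok a) w) = opn (ctok a (fst (pass w [])) @ map (tok a) (snd (pass w [])))"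
proof (induction w)
  case Nil
  then show ?case by (simp add: ctok_def)
next
  case (Cons x w)
  let ?C = "fst (pass w [])" and ?v = "snd (pass w [])"
  have "column ?C" by (simp add: column_pass)
  from step_brackets[OF this, of a x "map (tok a) ?v"]
  have "cls (ctok a (fst (pass (x # w) [])) @ map (tok a) (snd (pass (x # w) []))) = cls (tok a x # ctok a ?C @ map (tok a) ?v)"
    "opn (ctok a (fst (pass (x # w) [])) @ map (tok a) (snd (pass (x # w) []))) = opn (tok a x # ctok a ?C @ map (tok a) ?v)"
    by simp_all
  then show ?case using Cons by (cases "tok a x") simp_all
qed

text \<open>The changed letter is the one being inserted. A column with \<open>a\<close> but without
  \<open>a + 1\<close> is excluded by the assumption. If the column has both letters, the expelled
  letter changes from \<open>a + 1\<close> to \<open>a\<close>; otherwise the same letters are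
  expelled and the change stays in the column.\<close>

lemma column_letter_step_head:
  assumes C: "column C" and 0: "cls (ctok a C @ map (tok a) v) = 0"
  shows "column_letter_step a (fst (step (Suc a) C)) (snd (step (Suc a) C) @ v)
    (fst (step a C)) (snd (step a C) @ v)"
proof -
  have cv: "cls (map (tok a) v) \<le> opn (ctok a C)" "cls (ctok a C) = 0" using 0 by (auto simp: cls_append)
  consider (none) "a \<notin> set C" "Suc a \<notin> set C" | (one) "a \<notin> set C" "Suc a \<in> set C" | (both) "a \<in> set C" "Suc a \<in> set C"
    using cv(2) by (auto simp: ctok_def split: if_splits)
  then show ?thesis
  proof cases
    case none
    then have ge: "z \<in> set C \<Longrightarrow> a \<le> z \<Longrightarrow> Suc (Suc a) \<le> z" for z
      by (metis Suc_leI le_neq_implies_less)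
    have cv0: "cls (map (tok a) v) = 0" using cv none by (simp add: ctok_def)
    show ?thesis
    proof (cases rule: step_cases[where C = C and x = a])
      case append
      then have "snd (step (Suc a) C) = [] \<and> set (fst (step (Suc a) C)) = insert (Suc a) (set C)"
        by (intro step_appendI) auto
      moreover have "snd (step a C) = [] \<and> set (fst (step a C)) = insert a (set C)"
        using append by (intro step_appendI) auto
      ultimately show ?thesis using none cv0 by (auto simp: column_letter_step_def)
    next
      case (bump y)
      have y: "Suc (Suc a) \<le> y" using ge bump by auto
      have "snd (step (Suc a) C) = [y] \<and> set (fst (step (Suc a) C)) = insert (Suc a) (set C - {y})"
        using bump y by (intro step_bumpI C) auto
      moreover have "snd (step a C) = [y] \<and> set (fst (step a C)) = insert a (set C - {y})"
        using bump by (intro step_bumpI C) auto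
      ultimately show ?thesis using none cv0 y by (auto simp: column_letter_step_def tok_def)
    qed
  next
    case one
    have "snd (step (Suc a) C) = [Suc a] \<and> set (fst (step (Suc a) C)) = insert (Suc a) (set C - {Suc a})"
      using one by (intro step_bumpI C) auto
    moreover have "snd (step a C) = [Suc a] \<and> set (fst (step a C)) = insert a (set C - {Suc a})"
      using one by (intro step_bumpI C) (auto simp: Suc_le_eq le_less)
    ultimately show ?thesis using one cv by (auto simp: column_letter_step_def tok_def ctok_def)
  next
    case both
    have 1: "snd (step (Suc a) C) = [Suc a] \<and> set (fst (step (Suc a) C)) = insert (Suc a) (set C - {Suc a})"
      using both by (intro step_bumpI C) auto
    have 2: "snd (step a C) = [a] \<and> set (fst (step a C)) = insert a (set C - {a})"
      using both by (intro step_bumpI C) auto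
    have e: "fst (step (Suc a) C) = C" "fst (step a C) = C"
      using both 1 2 column_step[OF C] C by (auto intro!: column_eqI)
    have "flip_at (ctok a C @ map (tok a) []) (map (tok a) v)"
      using cv both by (simp add: flip_at_def ctok_def)
    then show ?thesis using column_letter_stepI[of "[Suc a] @ v" "[]" a v "[a] @ v" C] 1 2 e by simp
  qed
qed

text \<open>A letter common to both words is inserted after the changed one; the last assumption
  says that an \<open>a + 1\<close> inserted now finds a closing partner and so does not become the
  letter to be raised. The change can pass from the column to the expelled word, but not
  back.\<close>

lemma column_letter_step_tail:
  assumes C: "column C" and C1: "column C1" and st: "column_letter_step a C v C1 v1"
    and x: "x = Suc a \<Longrightarrow> cls (ctok a C @ map (tok a) v) > 0"
  shows "column_letter_step a (fst (step x C)) (snd (step x C) @ v) (fst (step x C1)) (snd (step x C1) @ v1)"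
  using st unfolding column_letter_step_def[of a C v]
proof (elim disjE conjE exE)
  fix p q assume h: "C1 = C" "v = p @ Suc a # q" "v1 = p @ a # q" "flip_at (ctok a C @ map (tok a) p) (map (tok a) q)"
  let ?L = "ctok a C @ map (tok a) p"
  have "cls (ctok a C @ map (tok a) v) = cls ?L"
    using h by (simp add: flip_at_def cls_append opn_append tok_def)
  then have "opn (tok a x # ?L) = 0"
    using x h(4) by (cases "x = Suc a") (auto simp: flip_at_def tok_def)
  then have "opn (ctok a (fst (step x C)) @ map (tok a) (snd (step x C) @ p)) = 0"
    using step_brackets[OF C, of a x "map (tok a) p"] by simp
  then show ?thesis
    using h by (auto intro!: column_letter_stepI[where p = "snd (step x C) @ p" and q = q] simp: flip_at_def)
next
  assume h: "v1 = v" "Suc a \<in> set C" "a \<notin> set C" "set C1 = insert a (set C - {Suc a})" "cls (map (tok a) v) = 0"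
  have "x \<noteq> Suc a" using x h by (auto simp: ctok_def)
  then consider (less) "x < a" | (eq) "x = a" | (gr) "Suc a < x" by linarith
  then show ?thesis
  proof cases
    case less
    obtain y where y: "y \<in> set C" "x \<le> y" "\<forall>z\<in>set C. x \<le> z \<longrightarrow> y \<le> z"
      using less h(2) by (cases rule: step_cases[where C = C and x = x]) auto
    have 1: "snd (step x C) = [y] \<and> set (fst (step x C)) = insert x (set C - {y})"
      using y by (intro step_bumpI C) auto
    show ?thesis
    proof (cases "y = Suc a")
      case False
      have ya: "y < a" using y h False less by (metis le_SucE le_neq_implies_less less_imp_le_nat less_SucI)
      have 2: "snd (step x C1) = [y] \<and> set (fst (step x C1)) = insert x (set C1 - {y})"
        using y ya h by (intro step_bumpI C1) auto
      show ?thesis unfolding column_letter_step_def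
        using 1 2 h less ya by (intro disjI2) (auto simp: tok_def)
    next
      case True
      \<comment> \<open>Here \<open>x\<close> expels the very entry in which the two columns differ,
        so the change passes into the expelled word.\<close>
      have "a \<le> z" if "z \<in> set C1" "x \<le> z" for z
        using that y h True by (metis DiffD1 insertE order_refl Suc_leD)
      then have 2: "snd (step x C1) = [a] \<and> set (fst (step x C1)) = insert x (set C1 - {a})"
        using h less by (intro step_bumpI C1) auto
      have e: "fst (step x C1) = fst (step x C)"
        using 1 2 True h less column_step[OF C] column_step[OF C1] by (intro column_eqI) auto
      have "flip_at (ctok a (fst (step x C)) @ map (tok a) []) (map (tok a) v)"
        using 1 True h less by (auto simp: flip_at_def ctok_def)
      then show ?thesis
        using column_letter_stepI[of "[Suc a] @ v" "[]" a v "[a] @ v" "fst (step x C)"] 1 2 e True h by simp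
    qed
  next
    case eq
    have 1: "snd (step x C) = [Suc a] \<and> set (fst (step x C)) = insert x (set C - {Suc a})"
      using h eq by (intro step_bumpI C) (auto simp: Suc_le_eq le_less)
    have 2: "snd (step x C1) = [a] \<and> set (fst (step x C1)) = insert x (set C1 - {a})"
      using h eq by (intro step_bumpI C1) auto
    have e: "fst (step x C1) = fst (step x C)"
      using 1 2 eq h column_step[OF C] column_step[OF C1] by (intro column_eqI) auto
    have "flip_at (ctok a (fst (step x C)) @ map (tok a) []) (map (tok a) v)"
      using 1 eq h by (auto simp: flip_at_def ctok_def)
    then show ?thesis
      using column_letter_stepI[of "[Suc a] @ v" "[]" a v "[a] @ v" "fst (step x C)"] 1 2 e h by simp
  next
    case gr
    show ?thesis
    proof (cases rule: step_cases[where C = C and x = x])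
      case append
      have 1: "snd (step x C) = [] \<and> set (fst (step x C)) = insert x (set C)"
        using append by (intro step_appendI) auto
      have 2: "snd (step x C1) = [] \<and> set (fst (step x C1)) = insert x (set C1)"
        using append h gr by (intro step_appendI) auto
      show ?thesis unfolding column_letter_step_def
        using 1 2 h gr by (intro disjI2) auto
    next
      case (bump y)
      have 1: "snd (step x C) = [y] \<and> set (fst (step x C)) = insert x (set C - {y})"
        using bump by (intro step_bumpI C) auto
      have 2: "snd (step x C1) = [y] \<and> set (fst (step x C1)) = insert x (set C1 - {y})"
        using bump h gr by (intro step_bumpI C1) auto
      show ?thesis unfolding column_letter_step_def
        using 1 2 h gr bump by (intro disjI2) (auto simp: tok_def)
    qed
  qed
qed

lemma pass_letter_step:
  "letter_step a w w' \<Longrightarrow>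
    column_letter_step a (fst (pass w [])) (snd (pass w [])) (fst (pass w' [])) (snd (pass w' []))"
proof (induction w arbitrary: w')
  case Nil
  then show ?case by (simp add: letter_step_def)
next
  case (Cons x w)
  from Cons.prems obtain p q where pq: "x # w = p @ Suc a # q" "w' = p @ a # q"
      "flip_at (map (tok a) p) (map (tok a) q)" by (auto simp: letter_step_def)
  have col: "column (fst (pass u []))" for u by (simp add: column_pass)
  show ?case
  proof (cases p)
    case Nil
    then have "cls (map (tok a) w) = 0" using pq by (simp add: flip_at_def)
    then show ?thesis
      using column_letter_step_head[OF col, of a w "snd (pass w [])"] pass_brackets[of a w] pq Nil by simp
  next
    case (Cons x' p')
    then have w: "x' = x" "w = p' @ Suc a # q" "w' = x # p' @ a # q" using pq by auto
    have f: "flip_at (map (tok a) p') (map (tok a) q)"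
      using pq(3) Cons by (cases "tok a x'") (auto simp: flip_at_def)
    then have "letter_step a w (p' @ a # q)" using w by (auto simp: letter_step_def)
    then have IH: "column_letter_step a (fst (pass w [])) (snd (pass w []))
       (fst (pass (p' @ a # q) [])) (snd (pass (p' @ a # q) []))" using Cons.IH by blast
    \<comment> \<open>The letter \<open>x\<close> lies to the left of the raised one and so must
      have a partner in \<open>p'\<close>; by \<open>pass_brackets\<close> the column together with
      the expelled word still offers that partner.\<close>
    have "cls (ctok a (fst (pass w [])) @ map (tok a) (snd (pass w []))) > 0" if "x = Suc a"
    proof -
      have "cls (map (tok a) w) = cls (map (tok a) p')"
        using w f by (simp add: flip_at_def cls_append tok_def)
      moreover have "cls (map (tok a) p') > 0"
        using pq(3) Cons that w by (auto simp: flip_at_def tok_def)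
      ultimately show ?thesis using pass_brackets[of a w] by simp
    qed
    from column_letter_step_tail[OF col col IH this] show ?thesis using w by simp
  qed
qed

text \<open>Column by column: either the change stays in the column, which keeps its height and
  expels the same word, or the column is the same and the expelled words differ by a raising step
  again.\<close>

theorem letter_step_ht: "letter_step a w w' \<Longrightarrow> ht (ins_word w' []) c = ht (ins_word w []) c"
proof (induction w arbitrary: w' c rule: length_induct)
  case (1 w)
  have ne: "w \<noteq> []" "w' \<noteq> []" using 1(2) by (auto simp: letter_step_def)
  let ?C = "fst (pass w [])" and ?v = "snd (pass w [])" and ?C' = "fst (pass w' [])" and ?v' = "snd (pass w' [])"
  have col: "column ?C" "column ?C'" by (simp_all add: column_pass)
  have st: "column_letter_step a ?C ?v ?C' ?v'" by (rule pass_letter_step[OF 1(2)])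
  have "length ?C' = length ?C \<and> (ht (ins_word ?v' []) d = ht (ins_word ?v []) d)" for d
    using st unfolding column_letter_step_def
  proof (elim disjE conjE exE)
    fix p q assume h: "?C' = ?C" "?v = p @ Suc a # q" "?v' = p @ a # q" "flip_at (ctok a ?C @ map (tok a) p) (map (tok a) q)"
    \<comment> \<open>A suffix of a word without unmatched opening brackets has none either.\<close>
    then have "flip_at (map (tok a) p) (map (tok a) q)" by (simp add: flip_at_def opn_append)
    then have "letter_step a ?v ?v'" unfolding letter_step_def using h by blast
    then show ?thesis using 1(1) length_snd_pass[OF ne(1)] h(1) by auto
  next
    assume h: "?v' = ?v" "Suc a \<in> set ?C" "a \<notin> set ?C" "set ?C' = insert a (set ?C - {Suc a})"
    have "card (set ?C') = card (set ?C)" using h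
      by (metis List.finite_set card_Suc_Diff1 card_insert_disjoint finite_Diff DiffD1)
    then show ?thesis using h col by (metis distinct_card strict_sorted_iff)
  qed
  then show ?case using ne by (cases c) (auto simp: ins_word_Nil)
qed

section \<open>Recording tableaux\<close>

lemma yboxes_ht: "yboxes P = {(r, c). 1 \<le> r \<and> 1 \<le> c \<and> r \<le> ht P (c - 1)}"
  by (auto simp: yboxes_def ht_def)

lemma tableau_eqI:
  assumes "[] \<notin> set Q" "[] \<notin> set Q'" "yboxes Q = yboxes Q'"
    and ent: "\<And>r c. (r, c) \<in> yboxes Q \<Longrightarrow> yentry Q r c = yentry Q' r c"
  shows "Q = Q'"
proof -
  have len: "c < length R \<longleftrightarrow> (1, Suc c) \<in> yboxes R" if "[] \<notin> set R" for R c
    using that by (auto simp: yboxes_def Suc_le_eq) (metis nth_mem)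
  have l: "length Q = length Q'"
    using len[OF assms(1)] len[OF assms(2)] assms(3) by (metis linorder_neqE_nat less_irrefl)
  have lc: "length (Q ! c) = length (Q' ! c)" if "c < length Q" for c
  proof -
    have "r < length (Q ! c) \<longleftrightarrow> r < length (Q' ! c)" for r
    proof -
      have "(Suc r, Suc c) \<in> yboxes Q \<longleftrightarrow> (Suc r, Suc c) \<in> yboxes Q'" using assms(3) by simp
      then show ?thesis using that l by (simp add: yboxes_def Suc_le_eq)
    qed
    then show ?thesis by (metis linorder_neqE_nat less_irrefl)
  qed
  show ?thesis
  proof (rule nth_equalityI[OF l], rule nth_equalityI)
    fix c assume c: "c < length Q"
    then show "length (Q ! c) = length (Q' ! c)" by (rule lc)
    fix r assume "r < length (Q ! c)"
    then show "Q ! c ! r = Q' ! c ! r" using ent[of "Suc r" "Suc c"] c by (simp add: yboxes_def yentry_def)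
  qed
qed

lemma level_unique:
  assumes "[] \<notin> set Q" "[] \<notin> set Q'" "yboxes Q = yboxes Q'"
    and lev: "\<And>j. j \<le> n \<Longrightarrow> {(r, c) \<in> yboxes Q. yentry Q r c \<le> j} = {(r, c) \<in> yboxes Q'. yentry Q' r c \<le> j}"
    and "{(r, c) \<in> yboxes Q. yentry Q r c \<le> n} = yboxes Q"
  shows "Q = Q'"
proof (rule tableau_eqI[OF assms(1-3)])
  fix r c assume rc: "(r, c) \<in> yboxes Q"
  have iff: "yentry Q r c \<le> j \<longleftrightarrow> yentry Q' r c \<le> j" if "j \<le> n" for j
    using lev[OF that] rc assms(3) by blast
  have "yentry Q r c \<le> n" using assms(5) rc by blast
  then show "yentry Q r c = yentry Q' r c" using iff iff[of n] by (metis le_antisym order_refl)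
qed

section \<open>Standard tableaux from growing sequences of shapes\<close>

locale growth =
  fixes H :: "nat \<Rightarrow> nat \<Rightarrow> nat" and n N :: nat
  assumes start: "H 0 c = 0"
    and grow: "j < n \<Longrightarrow> \<exists>d. \<forall>c. H (Suc j) c = H j c + (if c = d then 1 else 0)"
    and anti: "j \<le> n \<Longrightarrow> H j (Suc c) \<le> H j c"
    and support: "H n c > 0 \<longleftrightarrow> c < N"
begin

lemma mono: "i \<le> j \<Longrightarrow> j \<le> n \<Longrightarrow> H i c \<le> H j c"
proof (induction j)
  case (Suc j)
  have "H j c \<le> H (Suc j) c" using grow[of j] Suc.prems by (metis Suc_le_lessD le_add1)
  then show ?case using Suc by (metis Suc_leD le_SucE le_trans order_refl)
qed simp

lemma anti_le: "j \<le> n \<Longrightarrow> c \<le> d \<Longrightarrow> H j d \<le> H j c"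
  using lift_Suc_antimono_le[of "H j" c d] anti by blast

text \<open>Times start at 1, the shape at time 0 being empty, while \<open>r\<close> and
  \<open>c\<close> are counted from 0.\<close>

definition time :: "nat \<Rightarrow> nat \<Rightarrow> nat" where "time r c = (LEAST j. r < H j c)"

lemma time_le: assumes "r < H n c" "j \<le> n" shows "time r c \<le> j \<longleftrightarrow> r < H j c"
proof
  assume "time r c \<le> j"
  moreover have "r < H (time r c) c" unfolding time_def using assms(1) by (rule LeastI)
  ultimately show "r < H j c" using mono[of "time r c" j c] assms(2) by linarith
next
  assume "r < H j c"
  then show "time r c \<le> j" unfolding time_def by (rule Least_le)
qed

lemma time_bounds: assumes "r < H n c" shows "1 \<le> time r c" "time r c \<le> n"
  using time_le[OF assms, of 0] time_le[OF assms, of n] start assms by auto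

definition rec_tab :: "nat list list" where
  "rec_tab = map (\<lambda>c. map (\<lambda>r. time r c) [0..<H n c]) [0..<N]"

lemma length_rec [simp]: "length rec_tab = N" "c < N \<Longrightarrow> rec_tab ! c = map (\<lambda>r. time r c) [0..<H n c]"
  by (auto simp: rec_tab_def)

lemma nonempty_rec: "[] \<notin> set rec_tab"
proof
  assume "[] \<in> set rec_tab"
  then obtain c where "c < N" "H n c = 0" by (auto simp: rec_tab_def)
  then show False using support[of c] by simp
qed

lemma yboxes_rec: "yboxes rec_tab = {(r, c). 1 \<le> r \<and> 1 \<le> c \<and> r \<le> H n (c - 1)}"
proof -
  have "ht rec_tab c = H n c" for c using support[of c] by (auto simp: ht_def)
  then show ?thesis by (simp add: yboxes_ht)
qed

lemma yentry_rec: assumes "(r, c) \<in> yboxes rec_tab" shows "yentry rec_tab r c = time (r - 1) (c - 1)" "r - 1 < H n (c - 1)"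
proof -
  have rc: "1 \<le> r" "1 \<le> c" "r \<le> H n (c - 1)" using assms by (auto simp: yboxes_rec)
  then show "r - 1 < H n (c - 1)" by linarith
  then have "c - 1 < N" using support[of "c - 1"] by linarith
  then show "yentry rec_tab r c = time (r - 1) (c - 1)" using rc by (auto simp: yentry_def)
qed

lemma level_rec: assumes "j \<le> n"
  shows "{(r, c) \<in> yboxes rec_tab. yentry rec_tab r c \<le> j} = {(r, c). 1 \<le> r \<and> 1 \<le> c \<and> r \<le> H j (c - 1)}"
proof -
  have "(r, c) \<in> yboxes rec_tab \<and> yentry rec_tab r c \<le> j \<longleftrightarrow> 1 \<le> r \<and> 1 \<le> c \<and> r \<le> H j (c - 1)" for r c
  proof (cases "(r, c) \<in> yboxes rec_tab")
    case True
    then show ?thesis using yentry_rec[OF True] time_le[of "r - 1" "c - 1" j] assms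
      by (cases r) (auto simp: yboxes_rec)
  next
    case False
    then show ?thesis using mono[of j n "c - 1"] assms by (auto simp: yboxes_rec)
  qed
  then show ?thesis by auto
qed

text \<open>One step adds a single box, so two boxes of one column cannot appear at the same
  time.\<close>

lemma time_Suc_less: assumes "Suc r < H n c" shows "time r c < time (Suc r) c"
proof -
  let ?m = "time (Suc r) c"
  have b: "1 \<le> ?m" "?m \<le> n" using time_bounds[OF assms] by auto
  then obtain m where m: "?m = Suc m" by (cases ?m) auto
  have "Suc r < H (Suc m) c" using time_le[OF assms, of ?m] b m by simp
  moreover obtain d where "\<forall>c. H (Suc m) c = H m c + (if c = d then 1 else 0)" using grow[of m] b m by auto
  ultimately have "r < H m c" by (auto split: if_splits)
  then have "time r c \<le> m" using time_le[of r c m] assms b m by simp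
  then show ?thesis using m by simp
qed

lemma time_mono_col: assumes "r < H n (Suc c)" shows "time r c \<le> time r (Suc c)"
proof -
  let ?m = "time r (Suc c)"
  have b: "?m \<le> n" using time_bounds[OF assms] by auto
  have "r < H ?m (Suc c)" using time_le[OF assms b] by simp
  then have "r < H ?m c" using anti[OF b, of c] by linarith
  moreover have "r < H n c" using assms anti[of n c] by simp
  ultimately show ?thesis using time_le[of r c ?m] b by simp
qed

lemma SSYT_rec: "rec_tab \<in> SSYT"
proof -
  have "sorted_wrt (\<ge>) (map length rec_tab)"
    unfolding sorted_wrt_iff_nth_less using anti_le[of n] by auto
  moreover have "1 \<le> yentry rec_tab r c" if "(r, c) \<in> yboxes rec_tab" for r c
    using yentry_rec[OF that] time_bounds by simp
  moreover have "yentry rec_tab r c \<le> yentry rec_tab r (c + 1)" if "(r, c) \<in> yboxes rec_tab" "(r, c + 1) \<in> yboxes rec_tab" for r c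
  proof -
    have "Suc (c - 1) = c" using that by (auto simp: yboxes_def)
    then show ?thesis using yentry_rec[OF that(1)] yentry_rec[OF that(2)] time_mono_col[of "r - 1" "c - 1"] by simp
  qed
  moreover have "yentry rec_tab r c < yentry rec_tab (r + 1) c" if "(r, c) \<in> yboxes rec_tab" "(r + 1, c) \<in> yboxes rec_tab" for r c
  proof -
    have "Suc (r - 1) = r" using that by (auto simp: yboxes_def)
    then show ?thesis using yentry_rec[OF that(1)] yentry_rec[OF that(2)] time_Suc_less[of "r - 1" "c - 1"] by simp
  qed
  ultimately show ?thesis unfolding SSYT_def using nonempty_rec by auto
qed

lemma sum_H: "j \<le> n \<Longrightarrow> (\<Sum>c<N. H j c) = j"
proof (induction j)
  case 0
  then show ?case by (simp add: start)
next
  case (Suc j)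
  obtain d where d: "\<forall>c. H (Suc j) c = H j c + (if c = d then 1 else 0)" using grow[of j] Suc.prems by auto
  have "H (Suc j) d > 0" using d by simp
  then have "H n d > 0" using mono[of "Suc j" n d] Suc.prems by linarith
  then have "d < N" using support by blast
  then show ?case using Suc d by (simp add: sum.distrib)
qed

text \<open>The box added by step \<open>j\<close> gets the entry \<open>j\<close>, so all of
  \<open>1, ..., n\<close> occur; since there are only \<open>n\<close> boxes, the entries are
  distinct.\<close>

lemma standard_rec: "standard rec_tab"
proof -
  have len: "length (concat rec_tab) = n"
    using sum_H[of n] by (simp add: rec_tab_def length_concat o_def sum_list_sum_nth lessThan_atLeast0)
  have "set (concat rec_tab) = (\<Union>c\<in>{..<N}. (\<lambda>r. time r c) ` {..<H n c})" by (auto simp: rec_tab_def)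
  also have "\<dots> = {1..n}"
  proof (intro equalityI subsetI)
    fix j assume "j \<in> (\<Union>c\<in>{..<N}. (\<lambda>r. time r c) ` {..<H n c})"
    then show "j \<in> {1..n}" using time_bounds by auto
  next
    fix j assume j: "j \<in> {1..n}"
    then obtain i where i: "j = Suc i" by (cases j) auto
    obtain d where d: "\<forall>c. H (Suc i) c = H i c + (if c = d then 1 else 0)" using grow[of i] j i by auto
    have "H i d < H n d" using mono[of j n d] d i j by simp
    moreover have "time (H i d) d = j"
    proof (rule antisym)
      show "time (H i d) d \<le> j" using time_le[OF \<open>H i d < H n d\<close>, of j] d i j by simp
      show "j \<le> time (H i d) d" using time_le[OF \<open>H i d < H n d\<close>, of i] i j by simp
    qed
    moreover have "d < N" using support[of d] \<open>H i d < H n d\<close> by simp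
    ultimately show "j \<in> (\<Union>c\<in>{..<N}. (\<lambda>r. time r c) ` {..<H n c})" by force
  qed
  finally have "set (concat rec_tab) = {1..n}" .
  then show ?thesis using len SSYT_rec by (simp add: standard_def card_distinct)
qed

end

text \<open>Existence and uniqueness for the definite description in \<open>insertion\<close>. From
  here on the recording tableau is accessed through its level sets alone.\<close>

lemma insertion_recording:
  fixes v :: "nat list"
  defines "Q \<equiv> snd (insertion v)"
  shows "[] \<notin> set Q" "yboxes Q = yboxes (insertion_step v (length v))"
    "\<And>j. j \<le> length v \<Longrightarrow> {(r, c) \<in> yboxes Q. yentry Q r c \<le> j} = yboxes (insertion_step v j)"
proof -
  define H where "H j c = ht (insertion_step v j) c" for j c
  let ?n = "length v" and ?N = "length (insertion_step v (length v))"
  interpret growth H ?n ?N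
  proof
    show "H 0 c = 0" for c by (simp add: H_def insertion_step_eq)
    show "\<exists>d. \<forall>c. H (Suc j) c = H j c + (if c = d then 1 else 0)" if "j < ?n" for j
    proof -
      have "drop (?n - Suc j) v = v ! (?n - Suc j) # drop (?n - j) v"
        using Cons_nth_drop_Suc[of "?n - Suc j" v] that by (simp add: Suc_diff_Suc)
      then show ?thesis unfolding H_def insertion_step_eq by (auto simp: ht_col_insert)
    qed
    show "H j (Suc c) \<le> H j c" for j c
      unfolding H_def insertion_step_eq by (rule semistandard_ht[OF semistandard_ins_word])
    show "H ?n c > 0 \<longleftrightarrow> c < ?N" for c
      using tableau_ins_word[of "[]" v] by (auto simp: H_def ht_def insertion_step_eq tableau_def)
  qed
  let ?P = "\<lambda>Q. standard Q \<and> yboxes Q = yboxes (insertion_step v (length v)) \<and>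
        (\<forall>j\<le>length v. {(r, c) \<in> yboxes Q. yentry Q r c \<le> j} = yboxes (insertion_step v j))"
  have bx: "yboxes (insertion_step v j) = {(r, c). 1 \<le> r \<and> 1 \<le> c \<and> r \<le> H j (c - 1)}" for j
    by (simp add: yboxes_ht H_def)
  have ex: "?P rec_tab"
    unfolding bx by (intro conjI allI impI standard_rec yboxes_rec level_rec)
  have un: "R = R'" if R: "?P R" and R': "?P R'" for R R'
  proof (rule level_unique[where n = ?n])
    show "[] \<notin> set R" "[] \<notin> set R'" using R R' by (auto simp: standard_def SSYT_def)
    note y = R[THEN conjunct2, THEN conjunct1] R'[THEN conjunct2, THEN conjunct1]
    show "yboxes R = yboxes R'" by (simp only: y)
    note l = R[THEN conjunct2, THEN conjunct2, rule_format] R'[THEN conjunct2, THEN conjunct2, rule_format]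
    show "{(r, c) \<in> yboxes R. yentry R r c \<le> j} = {(r, c) \<in> yboxes R'. yentry R' r c \<le> j}" if "j \<le> ?n" for j
      by (simp only: l[OF that])
    show "{(r, c) \<in> yboxes R. yentry R r c \<le> ?n} = yboxes R"
      by (rule trans[OF l(1)[OF order_refl] y(1)[symmetric]])
  qed
  have eq: "Q = (THE Q. ?P Q)" unfolding Q_def insertion_def snd_conv ..
  have "?P (THE Q. ?P Q)" by (rule theI[where P = ?P, OF ex un[OF _ ex]])
  then have P: "?P Q" unfolding eq .
  then show "[] \<notin> set Q" by (auto simp: standard_def SSYT_def)
  show "yboxes Q = yboxes (insertion_step v (length v))" by (rule P[THEN conjunct2, THEN conjunct1])
  show "{(r, c) \<in> yboxes Q. yentry Q r c \<le> j} = yboxes (insertion_step v j)" if "j \<le> length v" for j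
    by (rule P[THEN conjunct2, THEN conjunct2, rule_format, OF that])
qed


section \<open>The key tableau of a weak composition\<close>

definition ncols :: "nat list \<Rightarrow> nat" where "ncols \<alpha> = Max (set (0 # \<alpha>))"

lemma part_le_ncols: "part \<alpha> k \<le> ncols \<alpha>"
proof -
  have "part \<alpha> k \<in> set (0 # \<alpha>)" by (auto simp: Defs.part_def)
  then show ?thesis unfolding ncols_def by (intro Max_ge) auto
qed

lemma ncols_attained: "c < ncols \<alpha> \<Longrightarrow> \<exists>k\<in>{1..length \<alpha>}. c < part \<alpha> k"
proof -
  assume "c < ncols \<alpha>"
  moreover have "ncols \<alpha> \<in> set (0 # \<alpha>)" unfolding ncols_def by (intro Max_in) auto
  ultimately have "ncols \<alpha> \<in> set \<alpha>" by auto
  then obtain i where "i < length \<alpha>" "\<alpha> ! i = ncols \<alpha>" by (auto simp: in_set_conv_nth)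
  then show ?thesis using \<open>c < ncols \<alpha>\<close> by (intro bexI[of _ "Suc i"]) (auto simp: Defs.part_def)
qed

text \<open>Since the columns of a key tableau are nested, the letter \<open>k\<close> has to occupy
  exactly the leftmost \<open>part \<alpha> k\<close> columns.\<close>

definition key_col :: "nat list \<Rightarrow> nat \<Rightarrow> nat list" where
  "key_col \<alpha> c = filter (\<lambda>k. c < part \<alpha> k) [1..<Suc (length \<alpha>)]"

definition key_tab :: "nat list \<Rightarrow> nat list list" where
  "key_tab \<alpha> = map (key_col \<alpha>) [0..<ncols \<alpha>]"

lemma set_key_col: "set (key_col \<alpha> c) = {k. c < part \<alpha> k}"
  by (auto simp: key_col_def Defs.part_def)

lemma column_key_col: "column (key_col \<alpha> c)"
  unfolding key_col_def by (rule sorted_wrt_filter) (simp del: upt_Suc)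

lemma key_col_nonempty: "key_col \<alpha> c \<noteq> [] \<longleftrightarrow> c < ncols \<alpha>"
proof -
  have "key_col \<alpha> c \<noteq> [] \<longleftrightarrow> (\<exists>k. c < part \<alpha> k)" using set_key_col[of \<alpha> c] by (metis empty_Collect_eq set_empty)
  then show ?thesis using part_le_ncols ncols_attained by (meson less_le_trans)
qed

text \<open>A weaker predicate inserts further elements into the sorted list, which can only lower
  the entry at a given position. This yields the weakly increasing rows of
  \<open>key_tab\<close>.\<close>

lemma filter_nth_mono:
  assumes "sorted xs" "\<And>x. P x \<Longrightarrow> R x"
  shows "length (filter P xs) \<le> length (filter R xs)"
    "j < length (filter P xs) \<Longrightarrow> filter R xs ! j \<le> filter P xs ! j"
  using assms(1)
proof (induction xs arbitrary: j)
  case (Cons x xs)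
  { case 1 then show ?case using Cons assms(2) by auto }
  { case 2
    show ?case
    proof (cases "P x")
      case True
      then show ?thesis using Cons 2 assms(2)[OF True] by (cases j) auto
    next
      case False
      show ?thesis
      proof (cases "R x \<and> j > 0")
        case True
        then obtain i where i: "j = Suc i" by (cases j) auto
        have "filter R xs ! i \<le> filter P xs ! i" using Cons 2 False i by auto
        also have "\<dots> \<le> filter P xs ! j"
        proof -
          have "sorted (filter P xs)" using 2 by (simp add: sorted_wrt_filter)
          then show ?thesis using 2 False i by (intro sorted_nth_mono) auto
        qed
        finally show ?thesis using True False i by simp
      next
        case F: False
        show ?thesis
        proof (cases "R x")
          case True
          then have "j = 0" using F by simp
          moreover have "filter P xs ! 0 \<in> set xs" using 2 False \<open>j = 0\<close> by (metis (no_types, lifting) filter.simps(2) filter_is_subset nth_mem subset_code(1))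
          ultimately show ?thesis using True False 2 by auto
        next
          case False
          then show ?thesis using Cons 2 \<open>\<not> P x\<close> by auto
        qed
      qed
    qed }
qed auto

lemma count_list_concat: "count_list (concat xss) k = sum_list (map (\<lambda>xs. count_list xs k) xss)"
  by (induction xss) auto

lemma count_list_column: "column C \<Longrightarrow> count_list C k = (if k \<in> set C then 1 else 0)"
  by (induction C) auto

lemma count_list_columns:
  assumes "\<And>C. C \<in> set T \<Longrightarrow> column C"
  shows "count_list (concat T) k = card {c. c < length T \<and> k \<in> set (T ! c)}"
proof -
  have "count_list (concat T) k = (\<Sum>c<length T. count_list (T ! c) k)"
    by (simp add: count_list_concat sum_list_sum_nth lessThan_atLeast0)
  also have "\<dots> = (\<Sum>c<length T. if k \<in> set (T ! c) then 1 else 0)"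
    using assms by (intro sum.cong) (auto simp: count_list_column)
  also have "\<dots> = card {c. c < length T \<and> k \<in> set (T ! c)}"
    by (simp add: sum.If_cases Int_def lessThan_def)
  finally show ?thesis .
qed

lemma key_tab_SSYT: "key_tab \<alpha> \<in> SSYT"
proof -
  have "sorted_wrt (\<ge>) (map length (key_tab \<alpha>))"
    unfolding sorted_wrt_iff_nth_less
    by (auto simp: key_tab_def key_col_def intro!: filter_nth_mono(1) simp del: upt_Suc)
  moreover have "[] \<notin> set (key_tab \<alpha>)"
  proof
    assume "[] \<in> set (key_tab \<alpha>)"
    then obtain c where "c < ncols \<alpha>" "key_col \<alpha> c = []" by (auto simp: key_tab_def)
    then show False using key_col_nonempty[of \<alpha> c] by simp
  qed
  moreover have "1 \<le> yentry (key_tab \<alpha>) r c" if "(r, c) \<in> yboxes (key_tab \<alpha>)" for r c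
  proof -
    have "yentry (key_tab \<alpha>) r c \<in> set (key_col \<alpha> (c - 1))"
      using that by (auto simp: yboxes_def yentry_def key_tab_def)
    then show ?thesis by (auto simp: set_key_col Defs.part_def split: if_splits)
  qed
  moreover have "yentry (key_tab \<alpha>) r c \<le> yentry (key_tab \<alpha>) r (c + 1)"
    if "(r, c) \<in> yboxes (key_tab \<alpha>)" "(r, c + 1) \<in> yboxes (key_tab \<alpha>)" for r c
    using that filter_nth_mono(2)[of "[1..<Suc (length \<alpha>)]" "\<lambda>k. c < part \<alpha> k" "\<lambda>k. c - 1 < part \<alpha> k" "r - 1"]
    by (auto simp: yboxes_def yentry_def key_tab_def key_col_def simp del: upt_Suc)
  moreover have "yentry (key_tab \<alpha>) r c < yentry (key_tab \<alpha>) (r + 1) c"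
    if "(r, c) \<in> yboxes (key_tab \<alpha>)" "(r + 1, c) \<in> yboxes (key_tab \<alpha>)" for r c
    using that column_nth_less[OF column_key_col[of \<alpha> "c - 1"], of "r - 1" r]
    by (auto simp: yboxes_def yentry_def key_tab_def)
  ultimately show ?thesis unfolding SSYT_def by auto
qed

lemma SSYT_column:
  assumes "T \<in> SSYT" "C \<in> set T"
  shows "column C"
proof -
  obtain c where c: "c < length T" "C = T ! c" using assms(2) by (auto simp: in_set_conv_nth)
  have "C ! r < C ! Suc r" if "Suc r < length C" for r
  proof -
    have "(Suc r, Suc c) \<in> yboxes T" "(Suc r + 1, Suc c) \<in> yboxes T" using that c by (auto simp: yboxes_def)
    then have "yentry T (Suc r) (Suc c) < yentry T (Suc r + 1) (Suc c)" using assms(1) unfolding SSYT_def by blast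
    then show ?thesis using c by (simp add: yentry_def)
  qed
  then show ?thesis by (simp add: sorted_wrt_iff_nth_Suc_transp)
qed

text \<open>Nested columns make the set of columns containing \<open>k\<close> an initial segment,
  and the weight prescribes its length.\<close>

lemma key_eq: "key \<alpha> = key_tab \<alpha>"
proof -
  let ?P = "\<lambda>T. T \<in> SSYT \<and> Poly_Mapping.lookup (wt (concat T)) = part \<alpha> \<and>
                   (\<forall>c. c + 1 < length T \<longrightarrow> set (T ! (c + 1)) \<subseteq> set (T ! c))"
  have "count_list (concat (key_tab \<alpha>)) k = part \<alpha> k" for k
  proof -
    have "count_list (concat (key_tab \<alpha>)) k = card {c. c < ncols \<alpha> \<and> c < part \<alpha> k}"
      by (subst count_list_columns[OF SSYT_column[OF key_tab_SSYT]])
        (auto simp: key_tab_def set_key_col intro!: arg_cong[where f = card])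
    also have "{c. c < ncols \<alpha> \<and> c < part \<alpha> k} = {..<part \<alpha> k}" using part_le_ncols[of \<alpha> k] by auto
    finally show ?thesis by simp
  qed
  then have ex: "?P (key_tab \<alpha>)" using key_tab_SSYT by (auto simp: key_tab_def set_key_col)
  have un: "T = key_tab \<alpha>" if T: "?P T" for T
  proof -
    have colT: "column C" if "C \<in> set T" for C using SSYT_column that T by blast
    have sub: "set (T ! d) \<subseteq> set (T ! c)" if "c \<le> d" "d < length T" for c d
      using that
    proof (induction d)
      case (Suc d)
      then show ?case using T by (cases "c = Suc d") (auto simp: le_Suc_eq)
    qed simp
    have mem: "c < length T \<and> k \<in> set (T ! c) \<longleftrightarrow> c < part \<alpha> k" for c k
    proof -
      let ?A = "{c. c < length T \<and> k \<in> set (T ! c)}"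
      have card: "card ?A = part \<alpha> k" using count_list_columns[of T k, OF colT] T by (simp add: fun_eq_iff)
      have "?A = {..<card ?A}"
      proof -
        have fin: "finite ?A" by simp
        have dc: "c \<in> ?A" if "d \<in> ?A" "c \<le> d" for c d using that sub[of c d] by auto
        have "c < card ?A" if "c \<in> ?A" for c
        proof -
          have "{..c} \<subseteq> ?A" using dc that by blast
          then have "card {..c} \<le> card ?A" using fin card_mono by blast
          then show ?thesis by simp
        qed
        then have "?A \<subseteq> {..<card ?A}" by blast
        then show ?thesis by (metis card_lessThan card_subset_eq finite_lessThan)
      qed
      then have "?A = {..<part \<alpha> k}" by (simp only: card)
      then have "c \<in> ?A \<longleftrightarrow> c \<in> {..<part \<alpha> k}" by (simp only:)
      then show ?thesis by simp
    qed
    have len: "length T = ncols \<alpha>"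
    proof -
      have "c < length T \<longleftrightarrow> c < ncols \<alpha>" for c
      proof
        assume c: "c < length T"
        have "[] \<notin> set T" using T by (auto simp: SSYT_def)
        then have "T ! c \<noteq> []" using c by (metis nth_mem)
        then obtain k where "k \<in> set (T ! c)" by (metis list.set_intros(1) neq_Nil_conv)
        then show "c < ncols \<alpha>" using mem[of c k] c part_le_ncols[of \<alpha> k] by auto
      next
        assume "c < ncols \<alpha>"
        then show "c < length T" using ncols_attained mem by blast
      qed
      then show ?thesis by (metis linorder_neqE_nat less_irrefl)
    qed
    show ?thesis
    proof (rule nth_equalityI)
      show "length T = length (key_tab \<alpha>)" using len by (simp add: key_tab_def)
      fix c assume c: "c < length T"
      have "set (T ! c) = set (key_col \<alpha> c)" using mem c by (auto simp: set_key_col)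
      then show "T ! c = key_tab \<alpha> ! c"
        using column_eqI[OF colT[OF nth_mem[OF c]] column_key_col] c len by (simp add: key_tab_def)
    qed
  qed
  have "(THE T. ?P T) = key_tab \<alpha>" by (rule the_equality[where P = ?P, OF ex un])
  then show ?thesis unfolding key_def .
qed

text \<open>The height of column \<open>c\<close>, counted from 0, of the key tableau restricted to
  the letters at most \<open>k\<close>.\<close>

definition cnt :: "nat list \<Rightarrow> nat \<Rightarrow> nat \<Rightarrow> nat" where
  "cnt \<alpha> k c = length (filter ((<) c) (take k \<alpha>))"

lemma cnt_Suc: "k < length \<alpha> \<Longrightarrow> cnt \<alpha> (Suc k) c = cnt \<alpha> k c + (if c < \<alpha> ! k then 1 else 0)"
  by (simp add: cnt_def take_Suc_conv_app_nth)

lemma cnt_key_col: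
  assumes "k \<le> length \<alpha>"
  shows "length (filter (\<lambda>x. x \<le> k) (key_col \<alpha> c)) = cnt \<alpha> k c"
proof -
  have "filter (\<lambda>x. x \<le> k) [1..<Suc (length \<alpha>)] = [1..<Suc k]"
  proof -
    have "[1..<Suc (length \<alpha>)] = [1..<Suc k] @ [Suc k..<Suc (length \<alpha>)]"
      using upt_add_eq_append[of 1 "Suc k" "length \<alpha> - k"] assms by simp
    moreover have "filter (\<lambda>x. x \<le> k) [1..<Suc k] = [1..<Suc k]" by (rule filter_True) auto
    moreover have "filter (\<lambda>x. x \<le> k) [Suc k..<Suc (length \<alpha>)] = []" by (rule filter_False) auto
    ultimately show ?thesis by (metis append_Nil2 filter_append)
  qed
  moreover have "filter (\<lambda>x. x \<le> k) (key_col \<alpha> c) = filter (\<lambda>j. c < part \<alpha> j) (filter (\<lambda>x. x \<le> k) [1..<Suc (length \<alpha>)])"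
    unfolding key_col_def filter_filter by (rule filter_cong) auto
  ultimately have e: "filter (\<lambda>x. x \<le> k) (key_col \<alpha> c) = filter (\<lambda>j. c < part \<alpha> j) [1..<Suc k]" by simp
  have "take k \<alpha> = map (part \<alpha>) [1..<Suc k]"
    using assms by (intro nth_equalityI) (auto simp: Defs.part_def simp del: upt_Suc)
  then show ?thesis unfolding e cnt_def by (simp add: filter_map o_def del: upt_Suc)
qed

section \<open>The standardization of the key tableau and its level sets\<close>

lemma yboxes_std: "yboxes (std T) = yboxes T" "[] \<notin> set T \<Longrightarrow> [] \<notin> set (std T)"
proof -
  have "length (std T) = length T" "\<And>c. c < length T \<Longrightarrow> length (std T ! c) = length (T ! c)"
    by (simp_all add: std_def nth_append del: upt_Suc)
  then show "yboxes (std T) = yboxes T" "[] \<notin> set T \<Longrightarrow> [] \<notin> set (std T)"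
    by (auto simp: yboxes_def) (metis in_set_conv_nth length_0_conv)
qed

lemma yentry_std:
  assumes "(r, c) \<in> yboxes T"
  shows "yentry (std T) r c = card {(r', c') \<in> yboxes T. yentry T r' c' < yentry T r c \<or>
                                  (yentry T r' c' = yentry T r c \<and> c' \<le> c)}"
proof -
  obtain r' c' where "r = Suc r'" "c = Suc c'" "c' < length T" "r' < length (T ! c')"
    using assms by (cases r; cases c) (auto simp: yboxes_def)
  then have "std T ! (c - 1) ! (r - 1) = card {(r', c') \<in> yboxes T. yentry T r' c' < yentry T r c \<or>
                                  (yentry T r' c' = yentry T r c \<and> c' \<le> c)}"
    by (simp add: std_def del: upt_Suc)
  then show ?thesis by (simp add: yentry_def[of "std T"])
qed

lemma yboxes_key: "(r, c) \<in> yboxes (key_tab \<alpha>) \<longleftrightarrow> 1 \<le> c \<and> 1 \<le> r \<and> r \<le> length (key_col \<alpha> (c - 1))"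
  using key_col_nonempty[of \<alpha> "c - 1"] by (auto simp: yboxes_def key_tab_def)

lemma yentry_key: "(r, c) \<in> yboxes (key_tab \<alpha>) \<Longrightarrow> yentry (key_tab \<alpha>) r c = key_col \<alpha> (c - 1) ! (r - 1)"
  by (auto simp: yboxes_def yentry_def key_tab_def)

lemma yentry_key_part:
  assumes "(r, c) \<in> yboxes (key_tab \<alpha>)"
  shows "c \<le> part \<alpha> (yentry (key_tab \<alpha>) r c)" "1 \<le> yentry (key_tab \<alpha>) r c" "yentry (key_tab \<alpha>) r c \<le> length \<alpha>"
proof -
  have "yentry (key_tab \<alpha>) r c \<in> set (key_col \<alpha> (c - 1))"
    using yentry_key[OF assms] assms by (auto simp: yboxes_key)
  then have "c - 1 < part \<alpha> (yentry (key_tab \<alpha>) r c)" by (simp add: set_key_col)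
  then show "c \<le> part \<alpha> (yentry (key_tab \<alpha>) r c)" "1 \<le> yentry (key_tab \<alpha>) r c" "yentry (key_tab \<alpha>) r c \<le> length \<alpha>"
    by (auto simp: Defs.part_def split: if_splits)
qed

lemma sum_part: "k \<le> length \<alpha> \<Longrightarrow> (\<Sum>i\<in>{1..k}. part \<alpha> i) = sum_list (take k \<alpha>)"
proof (induction k)
  case (Suc k)
  then show ?case by (simp add: take_Suc_conv_app_nth Defs.part_def)
qed simp

text \<open>The letter \<open>k\<close> of the key tableau occupies one box in each of the columns \<open>1, \<dots>, \<alpha>\<^sub>k\<close>,
  so the boxes are in bijection with the pairs (letter, column).\<close>

lemma yentry_std_key:
  assumes rc: "(r, c) \<in> yboxes (key_tab \<alpha>)"
  defines "k \<equiv> yentry (key_tab \<alpha>) r c"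
  shows "yentry (std (key_tab \<alpha>)) r c = sum_list (take (k - 1) \<alpha>) + c"
proof -
  let ?K = "key_tab \<alpha>"
  let ?B = "{(r', c') \<in> yboxes ?K. yentry ?K r' c' < k \<or> (yentry ?K r' c' = k \<and> c' \<le> c)}"
  let ?f = "\<lambda>(r', c'). (yentry ?K r' c', c')"
  have k: "1 \<le> k" "k \<le> length \<alpha>" "c \<le> part \<alpha> k" using yentry_key_part[OF rc] by (simp_all add: k_def)
  have inj: "inj_on ?f ?B"
  proof (rule inj_onI)
    fix z z' assume h: "z \<in> ?B" "z' \<in> ?B" "?f z = ?f z'"
    obtain r1 c1 r2 c2 where z: "z = (r1, c1)" "z' = (r2, c2)" by (metis surj_pair)
    have b: "(r1, c1) \<in> yboxes ?K" "(r2, c1) \<in> yboxes ?K" "yentry ?K r1 c1 = yentry ?K r2 c1" "c2 = c1"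
      using h z by auto
    have "distinct (key_col \<alpha> (c1 - 1))" using column_key_col by (simp add: strict_sorted_iff)
    moreover have "1 \<le> r1" "r1 \<le> length (key_col \<alpha> (c1 - 1))" "1 \<le> r2" "r2 \<le> length (key_col \<alpha> (c1 - 1))"
      using b(1,2) by (simp_all add: yboxes_key)
    moreover from this have "r1 - 1 < length (key_col \<alpha> (c1 - 1))" "r2 - 1 < length (key_col \<alpha> (c1 - 1))" by linarith+
    ultimately have "r1 - 1 = r2 - 1"
      using b(3) yentry_key[OF b(1)] yentry_key[OF b(2)]
        nth_eq_iff_index_eq[of "key_col \<alpha> (c1 - 1)" "r1 - 1" "r2 - 1"] by simp
    then show "z = z'" using z b(4) \<open>1 \<le> r1\<close> \<open>1 \<le> r2\<close> by simp
  qed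
  have img: "?f ` ?B = (SIGMA i:{1..<k}. {1..part \<alpha> i}) \<union> {k} \<times> {1..c}"
  proof (intro equalityI subsetI)
    fix z assume "z \<in> ?f ` ?B"
    then obtain r' c' where z: "z = (yentry ?K r' c', c')" "(r', c') \<in> yboxes ?K"
      "yentry ?K r' c' < k \<or> (yentry ?K r' c' = k \<and> c' \<le> c)" by auto
    then show "z \<in> (SIGMA i:{1..<k}. {1..part \<alpha> i}) \<union> {k} \<times> {1..c}"
      using yentry_key_part[OF z(2)] by (auto simp: yboxes_key)
  next
    fix z assume "z \<in> (SIGMA i:{1..<k}. {1..part \<alpha> i}) \<union> {k} \<times> {1..c}"
    then obtain i c' where z: "z = (i, c')" "1 \<le> c'" "c' \<le> part \<alpha> i" "i < k \<or> i = k \<and> c' \<le> c"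
      using k by auto
    then have "i \<in> set (key_col \<alpha> (c' - 1))" by (simp add: set_key_col)
    then obtain j where j: "j < length (key_col \<alpha> (c' - 1))" "key_col \<alpha> (c' - 1) ! j = i"
      by (auto simp: in_set_conv_nth)
    then have b: "(Suc j, c') \<in> yboxes ?K" using z by (simp add: yboxes_key)
    then have "yentry ?K (Suc j) c' = i" using yentry_key[OF b] j by simp
    then show "z \<in> ?f ` ?B" using b z by (intro image_eqI[of _ _ "(Suc j, c')"]) auto
  qed
  have "yentry (std ?K) r c = card ?B" using yentry_std[OF rc] by (simp add: k_def)
  also have "\<dots> = card (?f ` ?B)" using card_image[OF inj] by simp
  also have "\<dots> = card (SIGMA i:{1..<k}. {1..part \<alpha> i}) + card ({k} \<times> {1..c})"
    unfolding img by (rule card_Un_disjoint) (use k in auto)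
  also have "\<dots> = sum_list (take (k - 1) \<alpha>) + c"
  proof -
    have "{1..<k} = {1..k - 1}" using k by auto
    then show ?thesis using sum_part[of "k - 1" \<alpha>] k by (simp add: card_cartesian_product)
  qed
  finally show ?thesis .
qed

lemma sorted_initial_segment:
  fixes C :: "nat list"
  assumes "sorted C"
  shows "r < length C \<and> C ! r \<le> m \<longleftrightarrow> r < length (filter (\<lambda>x. x \<le> m) C)"
  using assms
proof (induction C arbitrary: r)
  case (Cons x C)
  show ?case
  proof (cases "x \<le> m")
    case True
    then show ?thesis using Cons by (cases r) auto
  next
    case False
    then have "\<forall>y\<in>set (x # C). \<not> y \<le> m" using Cons.prems by auto
    then have "filter (\<lambda>x. x \<le> m) (x # C) = []" by (simp add: filter_False)
    moreover have "\<not> (r < length (x # C) \<and> (x # C) ! r \<le> m)"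
      using \<open>\<forall>y\<in>set (x # C). \<not> y \<le> m\<close> nth_mem by blast
    ultimately show ?thesis by simp
  qed
qed simp

lemma sum_list_take_mono: "k \<le> l \<Longrightarrow> sum_list (take k \<alpha>) \<le> sum_list (take l (\<alpha> :: nat list))"
  by (metis le_add1 sum_list_append take_add le_Suc_ex)

text \<open>The entries up to this bound come from the letters at most \<open>k\<close> and from the
  \<open>i\<close> leftmost copies of \<open>k + 1\<close>, one in each of the columns
  \<open>0, ..., i - 1\<close>.\<close>

lemma std_key_level:
  assumes k: "k \<le> length \<alpha>" and i: "0 < i \<Longrightarrow> k < length \<alpha> \<and> i \<le> \<alpha> ! k"
  shows "{(r, c) \<in> yboxes (std (key_tab \<alpha>)). yentry (std (key_tab \<alpha>)) r c \<le> sum_list (take k \<alpha>) + i} =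
    {(r, c). 1 \<le> r \<and> 1 \<le> c \<and> r \<le> cnt \<alpha> k (c - 1) + (if c - 1 < i then 1 else 0)}"
proof -
  let ?K = "key_tab \<alpha>"
  have "(r, c) \<in> yboxes (std ?K) \<and> yentry (std ?K) r c \<le> sum_list (take k \<alpha>) + i \<longleftrightarrow>
      1 \<le> r \<and> 1 \<le> c \<and> r \<le> cnt \<alpha> k (c - 1) + (if c - 1 < i then 1 else 0)" for r c
  proof (cases "1 \<le> r \<and> 1 \<le> c")
    case rc: True
    \<comment> \<open>In the first \<open>i\<close> columns the letters up to \<open>k + 1\<close>
      are below the bound, in the other columns only those up to \<open>k\<close>.\<close>
    define m where "m = (if c - 1 < i then Suc k else k)"
    have m: "m \<le> length \<alpha>" using k i by (auto simp: m_def)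
    have cm: "cnt \<alpha> m (c - 1) = cnt \<alpha> k (c - 1) + (if c - 1 < i then 1 else 0)"
      using cnt_Suc[of k \<alpha> "c - 1"] i by (auto simp: m_def)
    have le: "yentry (std ?K) r c \<le> sum_list (take k \<alpha>) + i \<longleftrightarrow> yentry ?K r c \<le> m" if b: "(r, c) \<in> yboxes ?K"
    proof -
      let ?l = "yentry ?K r c"
      have l: "1 \<le> ?l" "?l \<le> length \<alpha>" "c \<le> part \<alpha> ?l" using yentry_key_part[OF b] by auto
      have tl: "sum_list (take ?l \<alpha>) = sum_list (take (?l - 1) \<alpha>) + part \<alpha> ?l"
        using l take_Suc_conv_app_nth[of "?l - 1" \<alpha>] by (simp add: Defs.part_def)
      consider "?l \<le> k" | "?l = Suc k" | "Suc k < ?l" by linarith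
      then show ?thesis
      proof cases
        case 1
        then show ?thesis using yentry_std_key[OF b] tl l sum_list_take_mono[of ?l k \<alpha>] by (auto simp: m_def)
      next
        case 2
        then show ?thesis using yentry_std_key[OF b] rc by (auto simp: m_def)
      next
        case 3
        have "k < length \<alpha>" using 3 l by simp
        then have "sum_list (take k \<alpha>) + \<alpha> ! k = sum_list (take (Suc k) \<alpha>)" by (simp add: take_Suc_conv_app_nth)
        also have "\<dots> \<le> sum_list (take (?l - 1) \<alpha>)" using 3 by (intro sum_list_take_mono) simp
        finally have "sum_list (take k \<alpha>) + i < yentry (std ?K) r c"
          using yentry_std_key[OF b] i rc by (cases "i = 0") auto
        then show ?thesis using 3 by (auto simp: m_def)
      qed
    qed
    have "(r, c) \<in> yboxes (std ?K) \<and> yentry (std ?K) r c \<le> sum_list (take k \<alpha>) + i \<longleftrightarrow>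
        r - 1 < length (key_col \<alpha> (c - 1)) \<and> key_col \<alpha> (c - 1) ! (r - 1) \<le> m"
      using le yentry_key[of r c \<alpha>] rc yboxes_key[of r c \<alpha>] by (auto simp: yboxes_std)
    also have "\<dots> \<longleftrightarrow> r - 1 < cnt \<alpha> m (c - 1)"
      using sorted_initial_segment[of "key_col \<alpha> (c - 1)"] column_key_col[of \<alpha> "c - 1"] cnt_key_col[OF m]
      by (simp add: strict_sorted_iff)
    finally show ?thesis using rc cm by auto
  qed (auto simp: yboxes_def)
  then show ?thesis by auto
qed


section \<open>Words in terms of column heights\<close>

text \<open>The recording condition in terms of shapes at the ends of the factors: after
  \<open>k\<close> factors the shape is that of the key tableau restricted to the letters at most
  \<open>k\<close>.\<close>

definition WH :: "nat list \<Rightarrow> (nat \<Rightarrow> nat) \<Rightarrow> nat list list set" where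
  "WH \<alpha> \<phi> = {us. map length us = \<alpha> \<and> (\<forall>r\<in>set us. sorted r \<and> (\<forall>a\<in>set r. 1 \<le> a)) \<and>
     flagged_factorization \<phi> us \<and>
     (\<forall>k\<le>length us. \<forall>c. ht (ins_word (word_of (take k us)) []) c = cnt \<alpha> k c)}"

lemma word_of_split: "word_of us = word_of (drop k us) @ word_of (take k us)"
  unfolding word_of_def by (metis append_take_drop_id concat_append rev_append)

lemma word_of_take_Suc: "k < length us \<Longrightarrow> word_of (take (Suc k) us) = us ! k @ word_of (take k us)"
  by (simp add: word_of_def take_Suc_conv_app_nth)

lemma word_of_drop: "k < length us \<Longrightarrow> word_of (drop k us) = word_of (drop (Suc k) us) @ us ! k"
  by (simp add: word_of_def Cons_nth_drop_Suc[symmetric])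

lemma length_word_of: "length (word_of us) = sum_list (map length us)"
  by (simp add: word_of_def length_concat rev_map[symmetric])

text \<open>After \<open>k\<close> complete factors, the last \<open>i\<close> letters of the next
  one have been inserted. The case \<open>i = 0\<close> is set apart because \<open>k\<close> may
  then be the number of all factors, where \<open>us ! k\<close> has no meaning.\<close>

lemma insertion_step_word:
  assumes "map length us = \<alpha>" "k \<le> length us" "0 < i \<Longrightarrow> k < length us \<and> i \<le> \<alpha> ! k"
  shows "insertion_step (word_of us) (sum_list (take k \<alpha>) + i) =
    ins_word ((if 0 < i then drop (\<alpha> ! k - i) (us ! k) else []) @ word_of (take k us)) []"
proof -
  have lt: "length (word_of (take k us)) = sum_list (take k \<alpha>)"
    using assms(1) by (simp add: length_word_of take_map[symmetric])
  show ?thesis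
  proof (cases "0 < i")
    case False
    have "word_of us = word_of (drop k us) @ word_of (take k us)" by (rule word_of_split)
    then have "drop (length (word_of us) - sum_list (take k \<alpha>)) (word_of us) = word_of (take k us)"
      using lt by (metis append_eq_conv_conj diff_add_inverse2 length_append)
    then show ?thesis using False by (simp add: insertion_step_eq)
  next
    case True
    then have k: "k < length us" "i \<le> \<alpha> ! k" "length (us ! k) = \<alpha> ! k" using assms by auto
    have e: "word_of us = (word_of (drop (Suc k) us) @ take (\<alpha> ! k - i) (us ! k)) @ (drop (\<alpha> ! k - i) (us ! k) @ word_of (take k us))"
      using word_of_split[of us k] word_of_drop[of k us] k by simp
    have "length (drop (\<alpha> ! k - i) (us ! k) @ word_of (take k us)) = sum_list (take k \<alpha>) + i"
      using lt k by simp
    then have "drop (length (word_of us) - (sum_list (take k \<alpha>) + i)) (word_of us) = drop (\<alpha> ! k - i) (us ! k) @ word_of (take k us)"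
      by (metis e append_eq_conv_conj diff_add_inverse2 length_append)
    then show ?thesis using True by (simp add: insertion_step_eq)
  qed
qed

lemma sum_list_decompose:
  "j \<le> sum_list \<alpha> \<Longrightarrow> \<exists>k i. k \<le> length \<alpha> \<and> j = sum_list (take k \<alpha>) + i \<and> (0 < i \<longrightarrow> k < length \<alpha> \<and> i \<le> \<alpha> ! k)"
  for \<alpha> :: "nat list"
proof (induction \<alpha> rule: rev_induct)
  case (snoc x \<alpha>)
  show ?case
  proof (cases "j \<le> sum_list \<alpha>")
    case True
    then obtain k i where "k \<le> length \<alpha>" "j = sum_list (take k \<alpha>) + i" "0 < i \<longrightarrow> k < length \<alpha> \<and> i \<le> \<alpha> ! k"
      using snoc by blast
    then have "k \<le> length (\<alpha> @ [x]) \<and> j = sum_list (take k (\<alpha> @ [x])) + i \<and>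
        (0 < i \<longrightarrow> k < length (\<alpha> @ [x]) \<and> i \<le> (\<alpha> @ [x]) ! k)" by (auto simp: nth_append)
    then show ?thesis by blast
  next
    case False
    then have "length \<alpha> \<le> length (\<alpha> @ [x]) \<and> j = sum_list (take (length \<alpha>) (\<alpha> @ [x])) + (j - sum_list \<alpha>) \<and>
        (0 < j - sum_list \<alpha> \<longrightarrow> length \<alpha> < length (\<alpha> @ [x]) \<and> j - sum_list \<alpha> \<le> (\<alpha> @ [x]) ! length \<alpha>)"
      using snoc.prems by auto
    then show ?thesis by (rule exI[where x = "length \<alpha>", OF exI[where x = "j - sum_list \<alpha>"]])
  qed
qed simp

lemma WH_row:
  assumes "us \<in> WH \<alpha> \<phi>" "k < length us"
  defines "P \<equiv> ins_word (word_of (take k us)) []"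
  shows "sorted (us ! k)" "tableau P"
    "\<And>c. ht (ins_word (us ! k) P) c = ht P c + (if c < length (us ! k) then 1 else 0)"
proof -
  show "sorted (us ! k)" using assms(1,2) by (auto simp: WH_def)
  show "tableau P" unfolding P_def by (rule tableau_ins_word) simp
  have H: "\<And>k c. k \<le> length us \<Longrightarrow> ht (ins_word (word_of (take k us)) []) c = cnt \<alpha> k c"
    using assms(1) by (simp add: WH_def)
  have "ht (ins_word (us ! k) P) c = cnt \<alpha> (Suc k) c" "ht P c = cnt \<alpha> k c" "length (us ! k) = \<alpha> ! k" "k < length \<alpha>" for c
    using H[of "Suc k" c] H[of k c] assms(1,2) word_of_take_Suc[OF assms(2)] unfolding WH_def P_def
    by (auto simp: ins_word_append[symmetric] Suc_le_eq)
  then show "ht (ins_word (us ! k) P) c = ht P c + (if c < length (us ! k) then 1 else 0)" for c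
    using cnt_Suc by simp
qed

text \<open>The last letter of a factor lands in column 0 and therefore exceeds all entries of that
  column, among them the letter inserted immediately before it.\<close>

lemma WH_descent:
  assumes "us \<in> WH \<alpha> \<phi>" "k < length us" "us ! k \<noteq> []" "word_of (take k us) = x # w"
  shows "x < last (us ! k)"
proof -
  let ?P = "ins_word (x # w) []" and ?r = "us ! k"
  note row = WH_row[OF assms(1,2), unfolded assms(4)]
  have "lands ?r ?P = rev [0..<length ?r]" by (rule row_exact[OF row(2,1,3)])
  then have "lands (drop (length ?r - 1) ?r) ?P = drop (length ?r - 1) (rev [0..<length ?r])"
    by (simp add: lands_drop)
  also have "\<dots> = [0]"
  proof -
    obtain m where "length ?r = Suc m" using assms(3) by (cases "length ?r") auto
    then show ?thesis by (simp add: upt_conv_Cons del: upt_Suc)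
  qed
  moreover have "drop (length ?r - 1) ?r = [last ?r]"
    using assms(3) by (metis append_butlast_last_id append_eq_conv_conj length_butlast)
  ultimately have l: "land (last ?r) ?P = 0" by simp
  obtain C Cs where P: "?P = C # Cs" "C = fst (pass (x # w) [])"
    using ins_word_Nil[of "x # w"] by simp
  have "snd (step (last ?r) C) = []" using l P(1) by (auto split: list.splits)
  then have all: "\<forall>z\<in>set C. z < last ?r"
    by (cases rule: step_cases[where C = C and x = "last ?r"]) auto
  have "x \<in> set C" using P(2) set_step[of "fst (pass w [])" x] column_pass[of "[]" w] by simp
  then show ?thesis using all by blast
qed

text \<open>There is a descent wherever two nonempty factors meet in the word, so no factor can be
  prolonged on either side.\<close>

lemma WH_maximal:
  assumes us: "us \<in> WH \<alpha> \<phi>"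
  shows "maximal_factorization us"
  unfolding maximal_factorization_def
proof (intro conjI allI impI ballI)
  fix w assume "w \<in> set us"
  then show "sorted w" using us by (auto simp: WH_def)
next
  fix i p s t q
  assume i: "i < length us" "us ! i \<noteq> []"
    and h: "word_of (drop (Suc i) us) = p @ s \<and> word_of (take i us) = t @ q \<and> sorted (s @ us ! i @ t)"
  show "t = []"
  proof (rule ccontr)
    assume "t \<noteq> []"
    then obtain x t' where t: "t = x # t'" by (cases t) auto
    then have "x < last (us ! i)" using WH_descent[OF us i, of x "t' @ q"] h by simp
    moreover have "last (us ! i) \<le> x" using h t i(2) by (auto simp: sorted_append)
    ultimately show False by simp
  qed
  show "s = []"
  proof (rule ccontr)
    assume s: "s \<noteq> []"
    have "\<exists>k>i. k < length us \<and> us ! k \<noteq> []"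
    proof (rule ccontr)
      assume "\<not> ?thesis"
      then have "\<forall>w\<in>set (drop (Suc i) us). w = []" by (auto simp: in_set_conv_nth)
      then have "word_of (drop (Suc i) us) = []" by (auto simp: word_of_def)
      then show False using h s by simp
    qed
    then obtain k where k: "k > i" "k < length us" "us ! k \<noteq> []"
      and least: "\<And>l. l > i \<Longrightarrow> l < k \<Longrightarrow> us ! l = []"
      using exists_least_iff[of "\<lambda>k. k > i \<and> k < length us \<and> us ! k \<noteq> []"] by (metis (no_types, lifting) less_trans)
    \<comment> \<open>Empty factors contribute no letters, so the next nonempty factor is adjacent
      to \<open>us ! i\<close> in the word.\<close>
    have same: "word_of (take l us) = word_of (take (Suc i) us) \<and> word_of (drop l us) = word_of (drop (Suc i) us)"
      if "Suc i \<le> l" "l \<le> k" for l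
      using that
    proof (induction l)
      case (Suc l)
      show ?case
      proof (cases "Suc i = Suc l")
        case False
        then have "us ! l = []" "l < length us" using least[of l] Suc.prems k by auto
        then show ?thesis using Suc False word_of_take_Suc[of l us] word_of_drop[of l us] by simp
      qed simp
    qed simp
    obtain x w where xw: "us ! i = x # w" using i(2) by (cases "us ! i") auto
    have "word_of (take k us) = x # (w @ word_of (take i us))"
      using same[of k] k word_of_take_Suc[OF i(1)] xw by simp
    then have "x < last (us ! k)" by (rule WH_descent[OF us k(2,3)])
    moreover have "last s = last (us ! k)"
      using same[of k] k h s word_of_drop[OF k(2)] by (metis Suc_leI last_appendR order_refl)
    moreover have "last s \<le> x" using h s xw by (auto simp: sorted_append)
    ultimately show False by simp
  qed
qed

text \<open>A recording tableau is determined by its level sets, and the levels inside a factor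
  follow from those at its ends.\<close>

theorem WFact_eq_WH: "WFact \<alpha> \<phi> = WH \<alpha> \<phi>"
proof -
  let ?K = "std (key_tab \<alpha>)"
  have ne: "[] \<notin> set ?K" using yboxes_std(2) key_tab_SSYT by (auto simp: SSYT_def)
  have iff: "(\<exists>P. insertion (word_of us) = (P, std (key \<alpha>))) \<longleftrightarrow>
      (\<forall>k\<le>length us. \<forall>c. ht (ins_word (word_of (take k us)) []) c = cnt \<alpha> k c)"
    if len: "map length us = \<alpha>" and srt: "\<forall>r\<in>set us. sorted r" for us
  proof -
    let ?v = "word_of us"
    have n: "length ?v = sum_list \<alpha>" "length us = length \<alpha>" using len by (auto simp: length_word_of)
    note rec = insertion_recording[where v = ?v]
    have "(\<exists>P. insertion ?v = (P, std (key \<alpha>))) \<longleftrightarrow> snd (insertion ?v) = ?K"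
      by (metis key_eq prod.collapse snd_conv)
    also have "\<dots> \<longleftrightarrow> (\<forall>k\<le>length us. \<forall>c. ht (ins_word (word_of (take k us)) []) c = cnt \<alpha> k c)" (is "?L \<longleftrightarrow> ?R")
    proof
      assume L: ?L
      show ?R
      proof (intro allI impI)
        fix k c assume k: "k \<le> length us"
        have le: "sum_list (take k \<alpha>) \<le> length ?v"
          using n sum_list_take_mono[of k "length \<alpha>" \<alpha>] k by simp
        have "yboxes (ins_word (word_of (take k us)) []) =
            {(r, c). 1 \<le> r \<and> 1 \<le> c \<and> r \<le> cnt \<alpha> k (c - 1)}"
          using rec(3)[OF le] std_key_level[of k \<alpha> 0] insertion_step_word[OF len k, of 0] k n
          unfolding L by simp
        then have "(r, Suc c) \<in> yboxes (ins_word (word_of (take k us)) []) \<longleftrightarrow> 1 \<le> r \<and> r \<le> cnt \<alpha> k c" for r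
          by simp
        then have eq: "1 \<le> r \<and> r \<le> ht (ins_word (word_of (take k us)) []) c \<longleftrightarrow> 1 \<le> r \<and> r \<le> cnt \<alpha> k c" for r
          by (simp add: yboxes_ht)
        show "ht (ins_word (word_of (take k us)) []) c = cnt \<alpha> k c"
          using eq[of "ht (ins_word (word_of (take k us)) []) c"] eq[of "cnt \<alpha> k c"] by linarith
      qed
    next
      assume R: ?R
      have lev: "{(r, c) \<in> yboxes ?K. yentry ?K r c \<le> j} = yboxes (insertion_step ?v j)" if jle: "j \<le> length ?v" for j
      proof -
        obtain k i where ki': "k \<le> length \<alpha>" "j = sum_list (take k \<alpha>) + i" "0 < i \<longrightarrow> k < length \<alpha> \<and> i \<le> \<alpha> ! k"
          using sum_list_decompose[OF jle[unfolded n(1)]] by (elim exE conjE)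
        note ki = ki'(1,2) ki'(3)[rule_format]
        let ?P = "ins_word (word_of (take k us)) []"
        have h: "ht (insertion_step ?v j) c = cnt \<alpha> k c + (if c < i then 1 else 0)" for c
        proof (cases "0 < i")
          case True
          have k: "k < length us" "i \<le> \<alpha> ! k" using ki(3)[OF True] n(2) by simp_all
          moreover have "length (us ! k) = \<alpha> ! k" using len k(1) by (metis nth_map)
          ultimately have k: "k < length us" "i \<le> \<alpha> ! k" "length (us ! k) = \<alpha> ! k" by simp_all
          have "ht (ins_word (us ! k) ?P) d = ht ?P d + (if d < length (us ! k) then 1 else 0)" for d
            using R[rule_format, of "Suc k" d] R[rule_format, of k d] k n cnt_Suc[of k \<alpha> d] word_of_take_Suc[OF k(1)]
            by (simp add: ins_word_append)
          then have "ht (ins_word (drop (\<alpha> ! k - i) (us ! k)) ?P) c = ht ?P c + (if c < length (us ! k) - (\<alpha> ! k - i) then 1 else 0)"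
            using srt k by (intro row_exact_drop tableau_ins_word) auto
          then show ?thesis
            using insertion_step_word[OF len, of k i] ki n True R[rule_format, of k c] k by (simp add: ins_word_append)
        next
          case False
          then show ?thesis using insertion_step_word[OF len, of k i] ki n R[rule_format, of k c] by simp
        qed
        have "yboxes (insertion_step ?v j) = {(r, c). 1 \<le> r \<and> 1 \<le> c \<and> r \<le> cnt \<alpha> k (c - 1) + (if c - 1 < i then 1 else 0)}"
          by (simp only: yboxes_ht h)
        then show ?thesis using std_key_level[OF ki(1,3)] by (simp only: ki(2))
      qed
      have top: "yboxes ?K = yboxes (insertion_step ?v (length ?v))"
      proof -
        have "yentry ?K r c \<le> length ?v" if b: "(r, c) \<in> yboxes ?K" for r c
        proof -
          have b': "(r, c) \<in> yboxes (key_tab \<alpha>)" using b by (simp add: yboxes_std)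
          let ?l = "yentry (key_tab \<alpha>) r c"
          have l: "1 \<le> ?l" "?l \<le> length \<alpha>" "c \<le> part \<alpha> ?l" using yentry_key_part[OF b'] by auto
          have "sum_list (take ?l \<alpha>) = sum_list (take (?l - 1) \<alpha>) + part \<alpha> ?l"
            using l take_Suc_conv_app_nth[of "?l - 1" \<alpha>] by (simp add: Defs.part_def)
          then show ?thesis using yentry_std_key[OF b'] l n sum_list_take_mono[of ?l "length \<alpha>" \<alpha>] by simp
        qed
        then have "{(r, c) \<in> yboxes ?K. yentry ?K r c \<le> length ?v} = yboxes ?K" by auto
        then show ?thesis using lev[of "length ?v"] by simp
      qed
      show ?L
      proof (rule level_unique[where n = "length ?v"])
        show "[] \<notin> set (snd (insertion ?v))" by (rule rec(1))
        show "[] \<notin> set ?K" by (rule ne)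
        show "yboxes (snd (insertion ?v)) = yboxes ?K" using rec(2) top by simp
        show "{(r, c) \<in> yboxes (snd (insertion ?v)). yentry (snd (insertion ?v)) r c \<le> j} =
            {(r, c) \<in> yboxes ?K. yentry ?K r c \<le> j}" if "j \<le> length ?v" for j
          by (rule trans[OF rec(3)[OF that] lev[OF that, symmetric]])
        show "{(r, c) \<in> yboxes (snd (insertion ?v)). yentry (snd (insertion ?v)) r c \<le> length ?v} =
            yboxes (snd (insertion ?v))" by (rule trans[OF rec(3)[OF order_refl] rec(2)[symmetric]])
      qed
    qed
    finally show ?thesis .
  qed
  have pos: "(\<forall>a\<in>set (word_of us). 1 \<le> a) \<longleftrightarrow> (\<forall>r\<in>set us. \<forall>a\<in>set r. 1 \<le> a)" for us
    by (auto simp: word_of_def)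
  show ?thesis
  proof (intro equalityI subsetI)
    fix us assume us: "us \<in> WFact \<alpha> \<phi>"
    then have "map length us = \<alpha>" "\<forall>r\<in>set us. sorted r" by (auto simp: WFact_def maximal_factorization_def)
    from iff[OF this] show "us \<in> WH \<alpha> \<phi>"
      using us pos[of us] unfolding WFact_def WH_def maximal_factorization_def mem_Collect_eq by blast
  next
    fix us assume us: "us \<in> WH \<alpha> \<phi>"
    then have "map length us = \<alpha>" "\<forall>r\<in>set us. sorted r" by (auto simp: WH_def)
    from iff[OF this] show "us \<in> WFact \<alpha> \<phi>"
      using us pos[of us] WH_maximal[OF us] unfolding WFact_def WH_def mem_Collect_eq by blast
  qed
qed

section \<open>Strings of words\<close>

text \<open>The weight with the multiplicities of \<open>a\<close> and \<open>a + 1\<close> merged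
  into their sum, which is what a raising step leaves invariant. The charge recovers the separate
  multiplicities.\<close>

definition label :: "nat \<Rightarrow> nat list \<Rightarrow> nat \<Rightarrow> nat" where
  "label a w b = (if b = a then count_list w a + count_list w (Suc a) else if b = Suc a then 0 else count_list w b)"

lemma tok_simps [simp]: "tok a (Suc a) = Opn" "tok a a = Cls"
  by (auto simp: tok_def)

lemma count_tok: "count_list (map (tok a) w) Opn = count_list w (Suc a)" "count_list (map (tok a) w) Cls = count_list w a"
  by (induction w) (auto simp: tok_def)

lemma no_cls: "a \<notin> set w \<Longrightarrow> cls (map (tok a) w) = 0"
  by (induction w) (auto simp: tok_def)

lemma no_opn: "Suc a \<notin> set w \<Longrightarrow> opn (map (tok a) w) = 0"
  by (induction w) (auto simp: tok_def)

lemma word_of_inj: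
  "map length us = map length us' \<Longrightarrow> word_of us = word_of us' \<Longrightarrow> us = us'"
proof (induction us arbitrary: us')
  case (Cons r us)
  then obtain r' us'' where "us' = r' # us''" by (cases us') auto
  then show ?case using Cons by (auto simp: word_of_def)
qed auto

lemma word_of_update:
  "k < length us \<Longrightarrow> word_of (us[k := r]) = word_of (drop (Suc k) us) @ r @ word_of (take k us)"
  by (simp add: upd_conv_take_nth_drop word_of_def)

lemma word_of_locate:
  "word_of us = p @ x # q \<Longrightarrow> \<exists>k r s. k < length us \<and> us ! k = r @ x # s \<and>
     p = word_of (drop (Suc k) us) @ r \<and> q = s @ word_of (take k us)"
proof (induction us arbitrary: q)
  case (Cons t us)
  have e: "word_of us @ t = p @ x # q" using Cons.prems by (simp add: word_of_def)
  then consider q' where "word_of us = p @ x # q'" "q = q' @ t"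
    | r where "p = word_of us @ r" "t = r @ x # q"
    by (auto simp: append_eq_append_conv2 append_eq_Cons_conv)
  then show ?case
  proof cases
    case 1
    then obtain k r s where k: "k < length us" "us ! k = r @ x # s" "p = word_of (drop (Suc k) us) @ r"
       "q' = s @ word_of (take k us)" using Cons.IH by blast
    then have "Suc k < length (t # us) \<and> (t # us) ! Suc k = r @ x # s \<and>
        p = word_of (drop (Suc (Suc k)) (t # us)) @ r \<and> q = s @ word_of (take (Suc k) (t # us))"
      using 1(2) by (simp add: word_of_def)
    then show ?thesis by blast
  next
    case 2
    then have "0 < length (t # us) \<and> (t # us) ! 0 = r @ x # q \<and>
        p = word_of (drop (Suc 0) (t # us)) @ r \<and> q = q @ word_of (take 0 (t # us))"
      by (simp add: word_of_def)
    then show ?thesis by blast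
  qed
qed (simp add: word_of_def)

lemma WH_D:
  assumes "us \<in> WH \<alpha> \<phi>" "k < length us"
  shows "sorted (us ! k)" "\<And>x. x \<in> set (us ! k) \<Longrightarrow> 1 \<le> x" "\<And>x. x \<in> set (us ! k) \<Longrightarrow> x \<le> \<phi> (Suc k)"
  using assms nth_mem[OF assms(2)] unfolding WH_def flagged_factorization_def by blast+

text \<open>Inside its factor the flipped letter has no \<open>a + 1\<close> to its left and no
  \<open>a\<close> to its right, since these would be unmatched on the wrong side; so the factor
  stays sorted. No row has the flag \<open>a\<close>, so the flags do not distinguish
  \<open>a\<close> from \<open>a + 1\<close>. The heights are kept by \<open>letter_step_ht\<close>,
  applied to every suffix that consists of whole factors.\<close>

lemma flip_letter:
  assumes us: "us \<in> WH \<alpha> \<phi>" and "1 \<le> a" and flag: "\<And>k. k < length \<alpha> \<Longrightarrow> \<phi> (Suc k) \<noteq> a"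
    and k: "k < length us" "us ! k = r @ x # s" and xy: "x = Suc a \<and> y = a \<or> x = a \<and> y = Suc a"
    and flip: "flip_at (map (tok a) (word_of (drop (Suc k) us) @ r)) (map (tok a) (s @ word_of (take k us)))"
  shows "us[k := r @ y # s] \<in> WH \<alpha> \<phi>"
proof -
  let ?us = "us[k := r @ y # s]"
  have srt: "sorted (r @ x # s)" using WH_D(1)[OF us k(1)] k(2) by simp
  have pos: "\<forall>z\<in>set (r @ x # s). 1 \<le> z" using WH_D(2)[OF us k(1)] k(2) by auto
  have r: "Suc a \<notin> set r"
  proof
    assume "Suc a \<in> set r"
    then obtain r1 r2 where r12: "r = r1 @ Suc a # r2" by (metis split_list)
    then have "\<forall>z\<in>set r2. Suc a \<le> z" using srt by (auto simp: sorted_append)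
    then have "a \<notin> set r2" by auto
    then have "opn (map (tok a) (Suc a # r2)) > 0" by (simp add: no_cls)
    then have "opn (map (tok a) (word_of (drop (Suc k) us) @ r1) @ map (tok a) (Suc a # r2)) > 0"
      unfolding opn_append by linarith
    then show False using flip r12 by (simp add: flip_at_def)
  qed
  have s: "a \<notin> set s"
  proof
    assume "a \<in> set s"
    then obtain s1 s2 where s12: "s = s1 @ a # s2" by (metis split_list)
    then have "\<forall>z\<in>set s1. z \<le> a" using srt by (auto simp: sorted_append)
    then have "Suc a \<notin> set s1" by auto
    then have "opn (map (tok a) s1) = 0" by (rule no_opn)
    then have "cls (map (tok a) s1 @ map (tok a) (a # s2 @ word_of (take k us))) > 0"
      by (simp add: cls_append)
    then show False using flip s12 by (simp add: flip_at_def)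
  qed
  have "sorted (r @ y # s)"
  proof -
    have "\<forall>z\<in>set r. z \<le> y" using srt xy r by (auto simp: sorted_append le_Suc_eq)
    moreover have "\<forall>z\<in>set s. y \<le> z" using srt xy s by (auto simp: sorted_append Suc_le_eq le_less)
    moreover have "\<forall>z\<in>set r. \<forall>t\<in>set s. z \<le> t" using srt by (auto simp: sorted_append)
    ultimately show ?thesis using srt by (auto simp: sorted_append)
  qed
  moreover have "\<forall>z\<in>set (r @ y # s). 1 \<le> z" using pos xy \<open>1 \<le> a\<close> by auto
  moreover have "\<forall>t\<in>set us. sorted t \<and> (\<forall>z\<in>set t. 1 \<le> z)" using us by (simp add: WH_def)
  ultimately have rows: "\<forall>t\<in>set ?us. sorted t \<and> (\<forall>z\<in>set t. 1 \<le> z)"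
    using set_update_subset_insert[of us k "r @ y # s"] by blast
  have len: "map length ?us = \<alpha>"
    using us k by (auto simp: WH_def map_update intro!: list_update_same_conv[THEN iffD2])
  have "y \<le> \<phi> (Suc k)"
  proof -
    have "x \<le> \<phi> (Suc k)" using us k by (auto simp: WH_def flagged_factorization_def)
    then show ?thesis using xy flag[of k] k us by (auto simp: WH_def)
  qed
  then have "flagged_factorization \<phi> ?us"
    using us k by (auto simp: WH_def flagged_factorization_def nth_list_update)
  moreover have "ht (ins_word (word_of (take j ?us)) []) c = cnt \<alpha> j c" if j: "j \<le> length ?us" for j c
  proof -
    have old: "ht (ins_word (word_of (take j us)) []) c = cnt \<alpha> j c" using us j by (simp add: WH_def)
    show ?thesis
    proof (cases "j \<le> k")
      case True
      then show ?thesis using old by simp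
    next
      case False
      let ?p = "word_of (drop (Suc k) (take j us)) @ r" and ?q = "s @ word_of (take k us)"
      have tk: "take j ?us = (take j us)[k := r @ y # s]" by (simp add: take_update_swap)
      have tk2: "take j us = (take j us)[k := r @ x # s]"
        using False k by (metis list_update_id not_le nth_take)
      have kj: "k < length (take j us)" using False k j by simp
      have w: "word_of (take j ?us) = ?p @ y # ?q" "word_of (take j us) = ?p @ x # ?q"
        using word_of_update[OF kj, of "r @ y # s"] word_of_update[OF kj, of "r @ x # s"] False
        by (simp_all add: tk tk2[symmetric] min_def)
      have "word_of (drop (Suc k) us) = word_of (drop j us) @ word_of (drop (Suc k) (take j us))"
        using word_of_split[of "drop (Suc k) us" "j - Suc k"] False by (simp add: drop_take)
      then have "flip_at (map (tok a) ?p) (map (tok a) ?q)"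
        using flip by (simp add: flip_at_def opn_append[of "map (tok a) (word_of (drop j us))"])
      then have "letter_step a (word_of (take j us)) (word_of (take j ?us)) \<or>
          letter_step a (word_of (take j ?us)) (word_of (take j us))"
        unfolding w letter_step_def using xy by blast
      then show ?thesis using letter_step_ht[of a "word_of (take j us)" "word_of (take j ?us)" c]
          letter_step_ht[of a "word_of (take j ?us)" "word_of (take j us)" c] old by auto
    qed
  qed
  ultimately show ?thesis using rows len unfolding WH_def by blast
qed

text \<open>Rows below row \<open>i\<close> cannot contain \<open>a\<close> or \<open>a + 1\<close>,
  and the flags of the rows above it admit both. So only row \<open>i\<close> feels the passage from
  the flag value \<open>a + 1\<close> to \<open>a\<close>.\<close>

locale word_strings =
  fixes \<alpha> :: "nat list" and \<phi> :: "nat \<Rightarrow> nat" and i a :: nat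
  assumes i: "i < length \<alpha>" and a1: "1 \<le> a" and flag_i: "\<phi> (Suc i) = Suc a"
    and flag_below: "\<And>k. k < i \<Longrightarrow> \<phi> (Suc k) < a"
    and flag_above: "\<And>k. i < k \<Longrightarrow> k < length \<alpha> \<Longrightarrow> a < \<phi> (Suc k)"
begin

definition edge :: "nat list list \<Rightarrow> nat list list \<Rightarrow> bool" where
  "edge us us' \<longleftrightarrow> us \<in> WH \<alpha> \<phi> \<and> us' \<in> WH \<alpha> \<phi> \<and>
     (\<exists>k r s. k < length us \<and> us ! k = r @ Suc a # s \<and> us' = us[k := r @ a # s] \<and>
       flip_at (map (tok a) (word_of (drop (Suc k) us) @ r)) (map (tok a) (s @ word_of (take k us))))"

lemma flag_neq: "k < length \<alpha> \<Longrightarrow> \<phi> (Suc k) \<noteq> a"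
  using flag_i flag_below flag_above by (metis lessI less_irrefl linorder_neqE_nat n_not_Suc_n)

lemma edge_words:
  assumes "edge us us'"
  obtains p q where "word_of us = p @ Suc a # q" "word_of us' = p @ a # q" "flip_at (map (tok a) p) (map (tok a) q)"
proof -
  obtain k r s where k: "k < length us" "us ! k = r @ Suc a # s" "us' = us[k := r @ a # s]"
     "flip_at (map (tok a) (word_of (drop (Suc k) us) @ r)) (map (tok a) (s @ word_of (take k us)))"
    using assms by (auto simp: edge_def)
  have "us = us[k := r @ Suc a # s]" using k by (metis list_update_id)
  then have "word_of us = (word_of (drop (Suc k) us) @ r) @ Suc a # (s @ word_of (take k us))"
    using word_of_update[OF k(1), of "r @ Suc a # s"] by simp
  moreover have "word_of us' = (word_of (drop (Suc k) us) @ r) @ a # (s @ word_of (take k us))"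
    using word_of_update[OF k(1), of "r @ a # s"] k by simp
  ultimately show ?thesis using that k(4) by blast
qed

lemma flip_locate:
  assumes us: "us \<in> WH \<alpha> \<phi>" and w: "map (tok a) (word_of us) = P @ tok a x # Q" and flip: "flip_at P Q"
    and x: "x = Suc a \<or> x = a"
  obtains k r s where "k < length us" "us ! k = r @ x # s"
    "flip_at (map (tok a) (word_of (drop (Suc k) us) @ r)) (map (tok a) (s @ word_of (take k us)))"
proof -
  obtain p z q where pq: "word_of us = p @ z # q" "map (tok a) p = P" "tok a z = tok a x" "map (tok a) q = Q"
    using w by (auto simp: map_eq_append_conv map_eq_Cons_conv)
  have "z = x" using pq(3) x by (auto simp: tok_def split: if_splits)
  then obtain k r s where "k < length us" "us ! k = r @ x # s"
     "p = word_of (drop (Suc k) us) @ r" "q = s @ word_of (take k us)"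
    using word_of_locate[of us p x q] pq by blast
  then show ?thesis using that flip pq by blast
qed

lemma edge_labels:
  assumes "edge us us'"
  shows "opn (map (tok a) (word_of us)) = Suc (opn (map (tok a) (word_of us')))"
    "cls (map (tok a) (word_of us')) = Suc (cls (map (tok a) (word_of us)))"
    "label a (word_of us) = label a (word_of us')"
proof -
  obtain p q where "word_of us = p @ Suc a # q" "word_of us' = p @ a # q" "flip_at (map (tok a) p) (map (tok a) q)"
    using edge_words[OF assms] .
  then show "opn (map (tok a) (word_of us)) = Suc (opn (map (tok a) (word_of us')))"
    "cls (map (tok a) (word_of us')) = Suc (cls (map (tok a) (word_of us)))"
    "label a (word_of us) = label a (word_of us')"
    using flip_at_counts by (auto simp: label_def fun_eq_iff)
qed

lemma edge_unique:
  assumes "edge us us'" "edge vs vs'"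
  shows "us = vs \<longleftrightarrow> us' = vs'"
proof -
  obtain p q where 1: "word_of us = p @ Suc a # q" "word_of us' = p @ a # q" "flip_at (map (tok a) p) (map (tok a) q)"
    using edge_words[OF assms(1)] .
  obtain p' q' where 2: "word_of vs = p' @ Suc a # q'" "word_of vs' = p' @ a # q'" "flip_at (map (tok a) p') (map (tok a) q')"
    using edge_words[OF assms(2)] .
  have m: "map length us = \<alpha>" "map length us' = \<alpha>" "map length vs = \<alpha>" "map length vs' = \<alpha>"
    using assms by (auto simp: edge_def WH_def)
  have len: "length p = length p'" if "us = vs \<or> us' = vs'"
  proof -
    from that have "map (tok a) p = map (tok a) p'"
    proof
      assume "us = vs"
      then have "p @ Suc a # q = p' @ Suc a # q'" using 1 2 by simp
      then have "map (tok a) (p @ Suc a # q) = map (tok a) (p' @ Suc a # q')" by simp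
      then show ?thesis using flip_unique_opn[OF _ 1(3) 2(3)] by simp
    next
      assume "us' = vs'"
      then have "p @ a # q = p' @ a # q'" using 1 2 by simp
      then have "map (tok a) (p @ a # q) = map (tok a) (p' @ a # q')" by simp
      then show ?thesis using flip_unique_cls[OF _ 1(3) 2(3)] by simp
    qed
    then show ?thesis by (rule map_eq_imp_length_eq)
  qed
  show ?thesis
  proof
    assume eq: "us = vs"
    then have "p @ Suc a # q = p' @ Suc a # q'" using 1(1) 2(1) by simp
    moreover have "length p = length p'" using len eq by blast
    ultimately have "p = p' \<and> q = q'" by simp
    then have "word_of us' = word_of vs'" using 1(2) 2(2) by simp
    then show "us' = vs'" using word_of_inj[of us' vs'] m by simp
  next
    assume eq: "us' = vs'"
    then have "p @ a # q = p' @ a # q'" using 1(2) 2(2) by simp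
    moreover have "length p = length p'" using len eq by blast
    ultimately have "p = p' \<and> q = q'" by simp
    then have "word_of us = word_of vs" using 1(1) 2(1) by simp
    then show "us = vs" using word_of_inj[of us vs] m by simp
  qed
qed

sublocale strings "WH \<alpha> \<phi>" edge "\<lambda>us. opn (map (tok a) (word_of us))" "\<lambda>us. cls (map (tok a) (word_of us))"
  "\<lambda>us. label a (word_of us)"
proof
  show "finite (WH \<alpha> \<phi>)" using finite_WFact by (simp add: WFact_eq_WH)
  show "us \<in> WH \<alpha> \<phi> \<and> us' \<in> WH \<alpha> \<phi> \<and> opn (map (tok a) (word_of us)) = Suc (opn (map (tok a) (word_of us'))) \<and>
      cls (map (tok a) (word_of us')) = Suc (cls (map (tok a) (word_of us))) \<and>
      label a (word_of us) = label a (word_of us')" if "edge us us'" for us us'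
    using edge_labels[OF that] that by (simp add: edge_def)
  show "us' = us''" if "edge us us'" "edge us us''" for us us' us'' using edge_unique that by blast
  show "us = vs" if "edge us us'" "edge vs us'" for us us' vs using edge_unique that by blast
  show "\<exists>us'. edge us us'" if us: "us \<in> WH \<alpha> \<phi>" "opn (map (tok a) (word_of us)) > 0" for us
  proof -
    obtain P Q where "map (tok a) (word_of us) = P @ tok a (Suc a) # Q" "flip_at P Q"
      using exists_flip_opn[OF us(2)] by auto
    then obtain k r s where k: "k < length us" "us ! k = r @ Suc a # s"
      "flip_at (map (tok a) (word_of (drop (Suc k) us) @ r)) (map (tok a) (s @ word_of (take k us)))"
      using flip_locate[OF us(1)] by metis
    then have "us[k := r @ a # s] \<in> WH \<alpha> \<phi>"
      using flip_letter[OF us(1) a1 flag_neq] by blast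
    then show ?thesis unfolding edge_def using us(1) k by blast
  qed
  show "\<exists>us. edge us us'" if us: "us' \<in> WH \<alpha> \<phi>" "cls (map (tok a) (word_of us')) > 0" for us'
  proof -
    obtain P Q where "map (tok a) (word_of us') = P @ tok a a # Q" "flip_at P Q"
      using exists_flip_cls[OF us(2)] by auto
    then obtain k r s where k: "k < length us'" "us' ! k = r @ a # s"
      "flip_at (map (tok a) (word_of (drop (Suc k) us') @ r)) (map (tok a) (s @ word_of (take k us')))"
      using flip_locate[OF us(1)] by metis
    let ?us = "us'[k := r @ Suc a # s]"
    have "?us \<in> WH \<alpha> \<phi>" using flip_letter[OF us(1) a1 flag_neq] k by blast
    moreover have "k < length ?us" "?us ! k = r @ Suc a # s" "us' = ?us[k := r @ a # s]"
      "drop (Suc k) ?us = drop (Suc k) us'" "take k ?us = take k us'"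
      using k by (auto simp: list_update_id[symmetric] simp flip: k(2))
    ultimately have "edge ?us us'" unfolding edge_def using us(1) k(3) by metis
    then show ?thesis by blast
  qed
qed

lemma WH_sub_iff: "us \<in> WH \<alpha> (\<phi>(Suc i := a)) \<longleftrightarrow> us \<in> WH \<alpha> \<phi> \<and> (\<forall>x\<in>set (us ! i). x \<le> a)"
proof -
  have "flagged_factorization (\<phi>(Suc i := a)) us \<longleftrightarrow> flagged_factorization \<phi> us \<and> (\<forall>x\<in>set (us ! i). x \<le> a)"
    if "i < length us"
  proof
    assume f: "flagged_factorization (\<phi>(Suc i := a)) us"
    have "x \<le> \<phi> (Suc k) \<and> (k = i \<longrightarrow> x \<le> a)" if "k < length us" "x \<in> set (us ! k)" for k x
      using f[unfolded flagged_factorization_def, rule_format, OF that] flag_i by (cases "k = i") auto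
    then show "flagged_factorization \<phi> us \<and> (\<forall>x\<in>set (us ! i). x \<le> a)"
      using that by (simp add: flagged_factorization_def)
  qed (simp add: flagged_factorization_def)
  moreover have "us \<in> WH \<alpha> \<psi> \<Longrightarrow> i < length us" for \<psi> using i by (auto simp: WH_def)
  ultimately show ?thesis unfolding WH_def by blast
qed

lemma below_small: "us \<in> WH \<alpha> \<phi> \<Longrightarrow> x \<in> set (word_of (take i us)) \<Longrightarrow> x < a"
proof -
  assume us: "us \<in> WH \<alpha> \<phi>" "x \<in> set (word_of (take i us))"
  then obtain t where "t \<in> set (take i us)" "x \<in> set t" by (auto simp: word_of_def)
  then obtain k where "k < i" "k < length us" "x \<in> set (us ! k)" by (auto simp: in_set_conv_nth[of t])
  then have "x \<le> \<phi> (Suc k)" using WH_D[OF us(1)] by blast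
  then show "x < a" using flag_below[OF \<open>k < i\<close>] by simp
qed

sublocale filtered_strings "WH \<alpha> \<phi>" edge "\<lambda>us. opn (map (tok a) (word_of us))"
  "\<lambda>us. cls (map (tok a) (word_of us))" "\<lambda>us. label a (word_of us)" "WH \<alpha> (\<phi>(Suc i := a))"
proof
  show "WH \<alpha> (\<phi>(Suc i := a)) \<subseteq> WH \<alpha> \<phi>" using WH_sub_iff by blast
  show "us \<in> WH \<alpha> (\<phi>(Suc i := a))" if us: "us \<in> WH \<alpha> \<phi>" "opn (map (tok a) (word_of us)) = 0" for us
  proof (rule ccontr)
    assume "\<not> ?thesis"
    then obtain x where x: "x \<in> set (us ! i)" "\<not> x \<le> a" using us(1) WH_sub_iff by blast
    have il: "i < length us" using us(1) i by (auto simp: WH_def)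
    have "x \<le> Suc a" using us(1) x(1) il flag_i by (auto simp: WH_def flagged_factorization_def)
    then have "Suc a \<in> set (us ! i)" using x by (simp add: le_Suc_eq)
    then obtain r s where rs: "us ! i = r @ Suc a # s" by (metis split_list)
    have "sorted (us ! i)" using us(1) il by (auto simp: WH_def)
    \<comment> \<open>An \<open>a + 1\<close> in row \<open>i\<close> is followed only by letters
      above \<open>a\<close> of its own factor and by letters below \<open>a\<close> of lower rows,
      so it remains unmatched.\<close>
    then have "a \<notin> set (s @ word_of (take i us))" using rs below_small[OF us(1)] by (auto simp: sorted_append)
    then have "opn (map (tok a) (Suc a # s @ word_of (take i us))) > 0" by (simp add: no_cls flip: map_append)
    moreover have "us[i := r @ Suc a # s] = us" using rs by (metis list_update_id)
    then have w: "word_of us = (word_of (drop (Suc i) us) @ r) @ (Suc a # s @ word_of (take i us))"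
      using word_of_update[OF il, of "r @ Suc a # s"] by simp
    have "opn (map (tok a) (word_of us)) \<ge> opn (map (tok a) (Suc a # s @ word_of (take i us)))"
      unfolding w map_append[of _ "_ @ r"] opn_append by simp
    ultimately show False using us(2) by linarith
  qed
  show "us' \<in> WH \<alpha> (\<phi>(Suc i := a))" if e: "edge us us'" and us: "us \<in> WH \<alpha> (\<phi>(Suc i := a))" for us us'
  proof -
    obtain k r s where k: "k < length us" "us ! k = r @ Suc a # s" "us' = us[k := r @ a # s]"
      using e by (auto simp: edge_def)
    have "\<forall>x\<in>set (us' ! i). x \<le> a"
      using us k WH_sub_iff[of us] by (cases "k = i") auto
    then show ?thesis using WH_sub_iff[of us'] e by (simp add: edge_def)
  qed
  show "us \<in> WH \<alpha> (\<phi>(Suc i := a))"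
    if e: "edge us us'" and us': "us' \<in> WH \<alpha> (\<phi>(Suc i := a))" and pos: "opn (map (tok a) (word_of us')) > 0" for us us'
  proof -
    obtain k r s where k: "k < length us" "us ! k = r @ Suc a # s" "us' = us[k := r @ a # s]"
       "flip_at (map (tok a) (word_of (drop (Suc k) us) @ r)) (map (tok a) (s @ word_of (take k us)))"
      using e by (auto simp: edge_def)
    have us: "us \<in> WH \<alpha> \<phi>" using e by (simp add: edge_def)
    \<comment> \<open>If the step changed row \<open>i\<close>, no opening bracket could stand to
      the right of the new \<open>a\<close>, and \<open>us'\<close> would already be the end of its
      string.\<close>
    have "k \<noteq> i"
    proof
      assume ki: "k = i"
      have "\<forall>x\<in>set s. x \<le> a" using us' WH_sub_iff[of us'] k ki by simp
      moreover have "take k us' = take k us" using k by simp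
      ultimately have "Suc a \<notin> set (s @ word_of (take k us))" using below_small[OF us] ki by force
      then have "opn (map (tok a) (s @ word_of (take k us))) = 0" by (rule no_opn)
      moreover have "map (tok a) (word_of us') =
          map (tok a) (word_of (drop (Suc k) us) @ r) @ Cls # map (tok a) (s @ word_of (take k us))"
        using word_of_update[OF k(1), of "r @ a # s"] k by simp
      ultimately have "opn (map (tok a) (word_of us')) = 0"
        using k(4) by (simp only: opn_append) (simp add: flip_at_def)
      then show False using pos by simp
    qed
    then have "\<forall>x\<in>set (us ! i). x \<le> a" using us' WH_sub_iff[of us'] k by simp
    then show ?thesis using WH_sub_iff[of us] us by simp
  qed
qed

end

section \<open>Exchanging two adjacent rows of a word\<close>

text \<open>The letter \<open>c\<close> moves left past the letters of \<open>Y\<close> one at a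
  time by the second relation; the letter in front of the passed one is the witness.\<close>

lemma knuth_left: "sorted (a # Y) \<Longrightarrow> c < a \<Longrightarrow> knuth (a # Y @ [c]) (a # c # Y)"
proof (induction Y rule: rev_induct)
  case (snoc y Y)
  have le: "a \<le> y" "sorted (a # Y)" "\<forall>z\<in>set Y. a \<le> z \<and> z \<le> y" using snoc.prems by (auto simp: sorted_append)
  obtain L l where L: "a # Y = L @ [l]" by (metis append_butlast_last_id list.distinct(1))
  then have l: "l \<in> set (a # Y)" by simp
  have "knuth (L @ [l, c, y] @ []) (L @ [l, y, c] @ [])"
    using l le snoc.prems(2) by (intro knuth2) auto
  then have "knuth ((a # Y) @ [c, y]) ((a # Y) @ [y, c])" unfolding L by simp
  then have "knuth (a # (Y @ [y]) @ [c]) ((a # Y @ [c]) @ [y])" by (simp add: knuth_sym)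
  moreover have "knuth ([] @ (a # Y @ [c]) @ [y]) ([] @ (a # c # Y) @ [y])"
    using snoc le by (intro knuth_cong) auto
  ultimately show ?case using knuth_trans by fastforce
qed (simp add: knuth_refl)

text \<open>The array with \<open>A\<close> above \<open>C\<close>, read by columns from top to
  bottom.\<close>

fun interleave :: "nat list \<Rightarrow> nat list \<Rightarrow> nat list" where
  "interleave (a # A) (c # C) = a # c # interleave A C"
| "interleave A C = []"

lemma knuth_interleave:
  "list_all2 (<) C A \<Longrightarrow> sorted (A @ Y) \<Longrightarrow> knuth (A @ Y @ C) (interleave A C @ Y)"
proof (induction C A rule: list_all2_induct)
  case Nil
  then show ?case by (simp add: knuth_refl)
next
  case (Cons c C a A)
  have "knuth ([] @ (a # (A @ Y) @ [c]) @ C) ([] @ (a # c # A @ Y) @ C)"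
    using Cons by (intro knuth_cong knuth_left) auto
  moreover have "knuth ([a, c] @ (A @ Y @ C) @ []) ([a, c] @ (interleave A C @ Y) @ [])"
    using Cons by (intro knuth_cong) auto
  ultimately show ?case using knuth_trans by fastforce
qed

lemma knuth_right: "sorted (Z @ [d]) \<Longrightarrow> d < b \<Longrightarrow> knuth (Z @ [b, d]) (b # Z @ [d])"
proof (induction Z arbitrary: d rule: rev_induct)
  case (snoc z Z)
  have "z \<le> d" "sorted (Z @ [z])" using snoc.prems by (auto simp: sorted_append)
  then have "knuth (Z @ [z, b, d] @ []) (Z @ [b, z, d] @ [])"
    using snoc.prems by (intro knuth1) auto
  moreover have "knuth ([] @ (Z @ [b, z]) @ [d]) ([] @ (b # Z @ [z]) @ [d])"
    using snoc.IH[of z] \<open>z \<le> d\<close> \<open>sorted (Z @ [z])\<close> snoc.prems(2) by (intro knuth_cong) auto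
  ultimately show ?case using knuth_trans by fastforce
qed (simp add: knuth_refl)

text \<open>Each \<open>b\<close> is first brought next to its partner \<open>d < b\<close>, in
  whose presence it can pass the whole of \<open>Z\<close> by the first relation.\<close>

lemma knuth_exchange:
  "list_all2 (\<lambda>b d. d < b) B D \<Longrightarrow> sorted B \<Longrightarrow> sorted (Z @ D) \<Longrightarrow> knuth (Z @ B @ D) (B @ Z @ D)"
proof (induction B D arbitrary: Z rule: list_all2_induct)
  case Nil
  then show ?case by (simp add: knuth_refl)
next
  case (Cons b B d D)
  have "knuth (Z @ (b # B @ [d]) @ D) (Z @ (b # d # B) @ D)"
    using Cons by (intro knuth_cong knuth_left) auto
  moreover have "knuth ([] @ (Z @ [b, d]) @ B @ D) ([] @ (b # Z @ [d]) @ B @ D)"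
    using Cons by (intro knuth_cong knuth_right) (auto simp: sorted_append)
  moreover have "knuth ((Z @ [d]) @ B @ D) (B @ (Z @ [d]) @ D)"
    using Cons.prems by (intro Cons.IH) auto
  then have "knuth ([b] @ ((Z @ [d]) @ B @ D) @ []) ([b] @ (B @ (Z @ [d]) @ D) @ [])"
    by (rule knuth_cong)
  ultimately show ?case using knuth_trans by (metis (no_types, lifting) append.assoc append_Cons append_Nil append_Nil2)
qed

text \<open>A jeu de taquin slide of \<open>x\<close> from the upper to the lower row. Reading
  \<open>C\<close> together with its partners \<open>A1\<close> by columns gets it out of the way;
  then \<open>B\<close>, held by its partners \<open>D1\<close>, passes \<open>x\<close>; finally
  \<open>C\<close> is separated from \<open>A1\<close> again.\<close>

lemma knuth_move:
  assumes A: "A = A0 @ A1" "list_all2 (<) C A1" and D: "D = D1 @ D0" "list_all2 (\<lambda>b d. d < b) B D1"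
    and srt: "sorted (A @ x # B)" "sorted (C @ x # D)"
  shows "knuth ((A @ x # B) @ (C @ D)) ((A @ B) @ (C @ x # D))"
proof -
  have s: "sorted (A1 @ (x # B))" "sorted (A1 @ B)" "sorted B" "sorted ([x] @ D1)"
    using srt unfolding A D by (auto simp: sorted_append)
  have 1: "knuth (A0 @ (A1 @ (x # B) @ C) @ D) (A0 @ (interleave A1 C @ (x # B)) @ D)"
    using A(2) s by (intro knuth_cong knuth_interleave) auto
  have 2: "knuth ((A0 @ interleave A1 C) @ ([x] @ B @ D1) @ D0) ((A0 @ interleave A1 C) @ (B @ [x] @ D1) @ D0)"
    using D(2) s by (intro knuth_cong knuth_exchange) auto
  have 3: "knuth (A0 @ (interleave A1 C @ B) @ (x # D)) (A0 @ (A1 @ B @ C) @ (x # D))"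
    using A(2) s by (intro knuth_cong knuth_sym[OF knuth_interleave]) auto
  have e1: "A0 @ (interleave A1 C @ (x # B)) @ D = (A0 @ interleave A1 C) @ ([x] @ B @ D1) @ D0" by (simp add: D)
  have e2: "(A0 @ interleave A1 C) @ (B @ [x] @ D1) @ D0 = A0 @ (interleave A1 C @ B) @ (x # D)" by (simp add: D)
  from knuth_trans[OF knuth_trans[OF 1[unfolded e1] 2, unfolded e2] 3]
  show ?thesis by (simp add: A)
qed

text \<open>A pair of rows is encoded by the decreasing list of the numbers \<open>2 v + 1\<close> for the letters \<open>v\<close> of the
  lower row and \<open>2 v\<close> for those of the upper row, so that at equal letters the lower row comes first.\<close>

definition code :: "nat list \<Rightarrow> nat list \<Rightarrow> nat list" where
  "code r r' = rev (sort (map (\<lambda>v. 2 * v + 1) r @ map (\<lambda>v. 2 * v) r'))"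

definition lower :: "nat list \<Rightarrow> nat list" where "lower L = rev (map (\<lambda>x. x div 2) (filter odd L))"
definition upper :: "nat list \<Rightarrow> nat list" where "upper L = rev (map (\<lambda>x. x div 2) (filter even L))"
definition ptok :: "nat \<Rightarrow> bracket" where "ptok x = (if even x then Opn else Cls)"

lemma ptok_simps: "even x \<Longrightarrow> ptok x = Opn" "odd x \<Longrightarrow> ptok x = Cls"
  by (simp_all add: ptok_def)

lemma code_sorted: "sorted (rev (code r r'))" by (simp add: code_def)

lemma mset_code_aux: "mset (map (\<lambda>v. 2 * v + 1) (lower L) @ map (\<lambda>v. 2 * v) (upper L)) = mset L"
proof -
  have "map (\<lambda>v. 2 * v + 1) (map (\<lambda>x. x div 2) (filter odd L)) = filter odd L" for L :: "nat list"
    by (induction L) auto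
  moreover have "map (\<lambda>v. 2 * v) (map (\<lambda>x. x div 2) (filter even L)) = filter even L" for L :: "nat list"
    by (induction L) auto
  ultimately have "mset (map (\<lambda>v. 2 * v + 1) (lower L)) = mset (filter odd L)" "mset (map (\<lambda>v. 2 * v) (upper L)) = mset (filter even L)"
    unfolding lower_def upper_def rev_map[symmetric] mset_rev by presburger+
  then have "mset (map (\<lambda>v. 2 * v + 1) (lower L) @ map (\<lambda>v. 2 * v) (upper L)) = mset (filter odd L) + mset (filter even L)" by simp
  also have "\<dots> = mset L" by (induction L) auto
  finally show ?thesis .
qed

lemma code_decode: "sorted (rev L) \<Longrightarrow> code (lower L) (upper L) = L"
  unfolding code_def
  by (subst properties_for_sort[of "rev L"]) (use mset_code_aux[of L] in auto)

lemma decode_code: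
  assumes "sorted r" "sorted r'"
  shows "lower (code r r') = r" "upper (code r r') = r'"
proof -
  have "filter odd (map (\<lambda>v. 2 * v + 1) r @ map (\<lambda>v. 2 * v) r') = map (\<lambda>v. 2 * v + 1) r" by (simp add: filter_map o_def)
  moreover have "filter even (map (\<lambda>v. 2 * v + 1) r @ map (\<lambda>v. 2 * v) r') = map (\<lambda>v. 2 * v) r'" by (simp add: filter_map o_def)
  moreover have "sorted (map (\<lambda>v. 2 * v + 1) r)" "sorted (map (\<lambda>v. 2 * v) r')"
    using assms by (auto simp: sorted_map sorted_wrt_mono_rel)
  ultimately have "filter odd (code r r') = rev (map (\<lambda>v. 2 * v + 1) r)" "filter even (code r r') = rev (map (\<lambda>v. 2 * v) r')"
    unfolding code_def rev_filter[symmetric] filter_sort by (simp_all add: sorted_sort_id)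
  then show "lower (code r r') = r" "upper (code r r') = r'"
    by (simp_all add: lower_def upper_def rev_map o_def)
qed

lemma sorted_decode: "sorted (rev L) \<Longrightarrow> sorted (lower L)" "sorted (rev L) \<Longrightarrow> sorted (upper L)"
proof -
  have "sorted (map (\<lambda>x. x div 2) M)" if "sorted M" for M :: "nat list"
    using that by (auto simp: sorted_map intro: sorted_wrt_mono_rel div_le_mono)
  moreover have "lower L = map (\<lambda>x. x div 2) (filter odd (rev L))" "upper L = map (\<lambda>x. x div 2) (filter even (rev L))"
    by (simp_all add: lower_def upper_def rev_map rev_filter)
  ultimately show "sorted (rev L) \<Longrightarrow> sorted (lower L)" "sorted (rev L) \<Longrightarrow> sorted (upper L)"
    by (simp_all add: sorted_wrt_filter)
qed

text \<open>Bracket matching in a decreasing list as a componentwise inequality. \<open>Es\<close>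
  is the queue of open upper letters, and a closing bracket takes the oldest of them; this choice is
  legitimate because every open upper letter exceeds all later lower letters, so only their number
  matters.\<close>

lemma cls_aligned:
  "sorted_wrt (\<ge>) q \<Longrightarrow> cls (map ptok q) \<le> length Es \<Longrightarrow>
   (\<And>e y. e \<in> set Es \<Longrightarrow> y \<in> set q \<Longrightarrow> odd y \<Longrightarrow> y div 2 < e) \<Longrightarrow>
   list_all2 (<) (map (\<lambda>x. x div 2) (filter odd q))
     (take (length (filter odd q)) (Es @ map (\<lambda>x. x div 2) (filter even q)))"
proof (induction q arbitrary: Es)
  case (Cons x q)
  show ?case
  proof (cases "even x")
    case True
    have "y div 2 < x div 2" if "y \<in> set q" "odd y" for y
    proof -
      have "y \<le> x" using Cons.prems(1) that by auto
      then show ?thesis using True that(2) by presburger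
    qed
    then have "list_all2 (<) (map (\<lambda>x. x div 2) (filter odd q))
     (take (length (filter odd q)) ((Es @ [x div 2]) @ map (\<lambda>x. x div 2) (filter even q)))"
      using Cons.prems True by (intro Cons.IH) (auto simp: ptok_def)
    then show ?thesis using True by simp
  next
    case False
    then have "cls (map ptok q) < length Es" using Cons.prems(2) by (simp add: ptok_simps)
    then obtain e Es' where e: "Es = e # Es'" by (cases Es) auto
    have "list_all2 (<) (map (\<lambda>x. x div 2) (filter odd q))
     (take (length (filter odd q)) (Es' @ map (\<lambda>x. x div 2) (filter even q)))"
      using Cons.prems False e by (intro Cons.IH) (auto simp: ptok_def)
    then show ?thesis using Cons.prems(3)[of e x] False e by simp
  qed
qed simp

text \<open>The mirror image of \<open>cls_aligned\<close>, read from the right end: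
  \<open>Fs\<close> holds the lower letters that wait for a larger upper partner.\<close>

lemma opn_aligned:
  "sorted_wrt (\<ge>) p \<Longrightarrow> opn (map ptok p) \<le> length Fs \<Longrightarrow>
   (\<And>f y. f \<in> set Fs \<Longrightarrow> y \<in> set p \<Longrightarrow> even y \<Longrightarrow> f < y div 2) \<Longrightarrow>
   list_all2 (\<lambda>b d. d < b) (upper p) (take (length (upper p)) (Fs @ lower p))"
proof (induction p arbitrary: Fs rule: rev_induct)
  case Nil
  then show ?case by (simp add: upper_def)
next
  case (snoc x p)
  have srt: "sorted_wrt (\<ge>) p" "\<forall>y\<in>set p. x \<le> y" using snoc.prems(1) by (auto simp: sorted_wrt_append)
  show ?case
  proof (cases "even x")
    case True
    then have "opn (map ptok p) < length Fs" using snoc.prems(2) by (simp add: ptok_simps opn_append)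
    then obtain f Fs' where f: "Fs = f # Fs'" by (cases Fs) auto
    have "list_all2 (\<lambda>b d. d < b) (upper p) (take (length (upper p)) (Fs' @ lower p))"
      using snoc.prems True f srt by (intro snoc.IH) (auto simp: ptok_def opn_append)
    then show ?thesis using snoc.prems(3)[of f x] True f by (simp add: upper_def lower_def)
  next
    case False
    have "x div 2 < y div 2" if "y \<in> set p" "even y" for y
    proof -
      have "x \<le> y" using srt that by auto
      then show ?thesis using False that(2) by presburger
    qed
    then have "list_all2 (\<lambda>b d. d < b) (upper p) (take (length (upper p)) ((Fs @ [x div 2]) @ lower p))"
      using snoc.prems False srt by (intro snoc.IH) (auto simp: ptok_def opn_append)
    then show ?thesis using False by (simp add: upper_def lower_def)
  qed
qed

text \<open>The flip condition says that the lower letters of \<open>q\<close> have upper partners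
  within \<open>q\<close> and the upper letters of \<open>p\<close> have lower partners within
  \<open>p\<close>; these are the two matchings that \<open>knuth_move\<close> requires. As the code
  is decreasing, the letters of \<open>q\<close> come first in both rows.\<close>

lemma knuth_flip:
  assumes srt: "sorted (rev (p @ (2 * x) # q))" and flip: "flip_at (map ptok p) (map ptok q)"
  defines "L \<equiv> p @ (2 * x) # q" and "L' \<equiv> p @ (2 * x + 1) # q"
  shows "knuth (upper L @ lower L) (upper L' @ lower L')" and "sorted (rev L')"
proof -
  have pq: "sorted_wrt (\<ge>) p" "sorted_wrt (\<ge>) q" "\<forall>y\<in>set p. 2 * x \<le> y" "\<forall>y\<in>set q. y \<le> 2 * x"
    "\<forall>y\<in>set p. \<forall>z\<in>set q. z \<le> y"
    using srt by (auto simp: sorted_append sorted_wrt_rev)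
  \<comment> \<open>A copy of \<open>2 * x\<close> in \<open>p\<close> would be followed, within
    \<open>p\<close>, by copies of itself only, and so be unmatched there.\<close>
  have no: "2 * x \<notin> set p"
  proof
    assume "2 * x \<in> set p"
    then obtain u v where uv: "p = u @ (2 * x) # v" by (metis split_list)
    have "\<forall>y\<in>set v. y = 2 * x" using pq(1,3) uv by (auto simp: sorted_wrt_append intro!: le_antisym)
    then have "\<forall>t\<in>set (map ptok v). t = Opn" by (auto simp: ptok_def)
    moreover have "\<forall>t\<in>set ts. t = Opn \<Longrightarrow> cls ts = 0" for ts by (induction ts) auto
    ultimately have "cls (map ptok v) = 0" by blast
    then have "opn (map ptok p) > 0" using uv by (simp add: opn_append ptok_def)
    then show False using flip by (simp add: flip_at_def)
  qed
  then have gt: "\<forall>y\<in>set p. 2 * x + 1 \<le> y" using pq(3) by (metis Suc_eq_plus1 Suc_leI le_neq_implies_less)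
  then show s': "sorted (rev L')" unfolding L'_def using pq by (auto simp: sorted_append sorted_wrt_rev)
  let ?k = "length (filter odd q)" and ?ev = "map (\<lambda>x. x div 2) (filter even q)"
  have "list_all2 (<) (map (\<lambda>x. x div 2) (filter odd q)) (take ?k ([] @ ?ev))"
    using flip pq by (intro cls_aligned) (auto simp: flip_at_def)
  then have A: "list_all2 (<) (lower q) (rev (take ?k ?ev))" by (simp add: lower_def)
  have "list_all2 (\<lambda>b d. d < b) (upper p) (take (length (upper p)) ([] @ lower p))"
    using flip pq by (intro opn_aligned) (auto simp: flip_at_def)
  then have B: "list_all2 (\<lambda>b d. d < b) (upper p) (take (length (upper p)) (lower p))" by simp
  have eq: "upper L = upper q @ x # upper p" "lower L = lower q @ lower p"
    "upper L' = upper q @ upper p" "lower L' = lower q @ x # lower p"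
    by (auto simp: L_def L'_def upper_def lower_def)
  have "sorted (upper L)" "sorted (lower L')" using sorted_decode srt s' by (simp_all add: L_def)
  then show "knuth (upper L @ lower L) (upper L' @ lower L')" unfolding eq
    by (intro knuth_move[OF _ A _ B, of _ "rev (drop ?k ?ev)" _ "drop (length (upper p)) (lower p)"])
      (simp_all add: upper_def flip: rev_append)
qed

lemma knuth_mset: "knuth u v \<Longrightarrow> mset u = mset v"
  by (induction rule: knuth.induct) auto

lemma word_of_update2:
  assumes "Suc i < length us"
  shows "word_of (us[i := r, Suc i := s]) = word_of (drop (Suc (Suc i)) us) @ (s @ r) @ word_of (take i us)"
proof -
  have "word_of (us[i := r, Suc i := s]) = word_of (drop (Suc (Suc i)) us) @ s @ word_of (take (Suc i) (us[i := r]))"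
    using word_of_update[of "Suc i" "us[i := r]" s] assms by simp
  also have "word_of (take (Suc i) (us[i := r])) = r @ word_of (take i us)"
    using word_of_take_Suc[of i "us[i := r]"] assms by simp
  finally show ?thesis by simp
qed

section \<open>The string structure on two adjacent factors\<close>

definition swp :: "nat list \<Rightarrow> nat \<Rightarrow> nat list" where
  "swp \<alpha> i = \<alpha>[i := \<alpha> ! Suc i, Suc i := \<alpha> ! i]"

lemma swp_simps [simp]: "length (swp \<alpha> i) = length \<alpha>"
  "Suc i < length \<alpha> \<Longrightarrow> swp \<alpha> i ! i = \<alpha> ! Suc i" "Suc i < length \<alpha> \<Longrightarrow> swp \<alpha> i ! Suc i = \<alpha> ! i"
  "k \<noteq> i \<Longrightarrow> k \<noteq> Suc i \<Longrightarrow> swp \<alpha> i ! k = \<alpha> ! k"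
  by (auto simp: swp_def)

lemma cnt_swp:
  assumes "Suc i < length \<alpha>" "k \<noteq> Suc i" "k \<le> length \<alpha>"
  shows "cnt (swp \<alpha> i) k c = cnt \<alpha> k c"
proof (cases "k \<le> i")
  case True
  then show ?thesis by (simp add: cnt_def swp_def)
next
  case False
  then have "Suc (Suc i) \<le> k" using assms by simp
  then show ?thesis using assms(3)
  proof (induction k rule: dec_induct)
    case base
    have "cnt (swp \<alpha> i) i c = cnt \<alpha> i c" by (simp add: cnt_def swp_def)
    then show ?case using assms(1) cnt_Suc[of i] cnt_Suc[of "Suc i"] by simp
  next
    case (step k)
    then show ?case using cnt_Suc[of k \<alpha> c] cnt_Suc[of k "swp \<alpha> i" c] by simp
  qed
qed

locale row_strings =
  fixes \<alpha> :: "nat list" and \<phi> :: "nat \<Rightarrow> nat" and i :: nat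
  assumes i: "Suc i < length \<alpha>" and flag: "\<phi> (Suc i) = \<phi> (Suc (Suc i))"
begin

text \<open>The lengths of the two factors are free up to their sum, and the shape between them is
  not prescribed. The set is therefore the same for \<open>\<alpha>\<close> and
  \<open>swp \<alpha> i\<close>, and the reflection of strings becomes the exchange of the two
  parts.\<close>

definition Z :: "nat list list set" where
  "Z = {us. length us = length \<alpha> \<and> (\<forall>r\<in>set us. sorted r \<and> (\<forall>a\<in>set r. 1 \<le> a)) \<and> flagged_factorization \<phi> us \<and>
     (\<forall>k<length \<alpha>. k \<noteq> i \<longrightarrow> k \<noteq> Suc i \<longrightarrow> length (us ! k) = \<alpha> ! k) \<and>
     length (us ! i) + length (us ! Suc i) = \<alpha> ! i + \<alpha> ! Suc i \<and>
     (\<forall>k\<le>length \<alpha>. k \<noteq> Suc i \<longrightarrow> (\<forall>c. ht (ins_word (word_of (take k us)) []) c = cnt \<alpha> k c))}"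

definition pair :: "nat list list \<Rightarrow> nat list" where "pair us = code (us ! i) (us ! Suc i)"
definition put :: "nat list list \<Rightarrow> nat list \<Rightarrow> nat list list" where
  "put us L = us[i := lower L, Suc i := upper L]"

definition edge :: "nat list list \<Rightarrow> nat list list \<Rightarrow> bool" where
  "edge us us' \<longleftrightarrow> us \<in> Z \<and> us' \<in> Z \<and> (\<exists>p x q. pair us = p @ (2 * x) # q \<and>
     us' = put us (p @ (2 * x + 1) # q) \<and> flip_at (map ptok p) (map ptok q))"

lemma Z_rows: assumes "us \<in> Z" "k < length us"
  shows "sorted (us ! k)" "\<And>x. x \<in> set (us ! k) \<Longrightarrow> 1 \<le> x" "\<And>x. x \<in> set (us ! k) \<Longrightarrow> x \<le> \<phi> (Suc k)"
  using assms nth_mem[OF assms(2)] unfolding Z_def flagged_factorization_def by blast+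

lemma Z_length: "us \<in> Z \<Longrightarrow> length us = length \<alpha>" by (simp add: Z_def)

lemma Z_ht: "us \<in> Z \<Longrightarrow> k \<le> length \<alpha> \<Longrightarrow> k \<noteq> Suc i \<Longrightarrow> ht (ins_word (word_of (take k us)) []) c = cnt \<alpha> k c"
  by (simp add: Z_def)

lemma decode_pair: assumes "us \<in> Z" shows "lower (pair us) = us ! i" "upper (pair us) = us ! Suc i"
  using decode_code Z_rows(1)[OF assms] Z_length[OF assms] i by (simp_all add: pair_def)

lemma put_pair: "us \<in> Z \<Longrightarrow> put us (pair us) = us"
  by (simp add: put_def decode_pair)

lemma put_put: "put (put us L) L' = put us L'"
  by (simp add: put_def list_update_swap)

lemma pair_put: "length us = length \<alpha> \<Longrightarrow> sorted (rev L) \<Longrightarrow> pair (put us L) = L"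
  using i by (simp add: pair_def put_def code_decode)

lemma sorted_pair: "sorted (rev (pair us))" by (simp add: pair_def code_sorted)

lemma word_put:
  assumes "length us = length \<alpha>"
  shows "word_of (put us L) = word_of (drop (Suc (Suc i)) us) @ (upper L @ lower L) @ word_of (take i us)"
  unfolding put_def by (rule word_of_update2) (use i assms in simp)

text \<open>The pair changes within its Knuth class, so the shapes before and after it are kept; the
  two rows share their flag, so letters may move between them.\<close>

lemma put_Z:
  assumes us: "us \<in> Z" and L: "sorted (rev L)" and kn: "knuth (upper (pair us) @ lower (pair us)) (upper L @ lower L)"
  shows "put us L \<in> Z" "knuth (word_of us) (word_of (put us L))"
proof -
  have len: "length us = length \<alpha>" using Z_length[OF us] .
  have ms: "mset (upper L @ lower L) = mset (us ! Suc i @ us ! i)"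
    using knuth_mset[OF kn] decode_pair[OF us] by simp
  have st: "set (upper L) \<union> set (lower L) = set (us ! i) \<union> set (us ! Suc i)"
    using arg_cong[OF ms, of set_mset] by auto
  have letters: "1 \<le> x \<and> x \<le> \<phi> (Suc i)" if "x \<in> set (upper L) \<union> set (lower L)" for x
    using that Z_rows[OF us, of i] Z_rows[OF us, of "Suc i"] i len flag unfolding st by auto
  have nth: "put us L ! i = lower L" "put us L ! Suc i = upper L" "\<And>k. k \<noteq> i \<Longrightarrow> k \<noteq> Suc i \<Longrightarrow> put us L ! k = us ! k"
    "length (put us L) = length \<alpha>"
    using i len by (auto simp: put_def)
  have rows: "sorted (put us L ! k) \<and> (\<forall>x\<in>set (put us L ! k). 1 \<le> x) \<and> (\<forall>x\<in>set (put us L ! k). x \<le> \<phi> (Suc k))"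
    if "k < length \<alpha>" for k
  proof -
    consider "k = i" | "k = Suc i" | "k \<noteq> i" "k \<noteq> Suc i" by blast
    then show ?thesis
    proof cases
      case 1
      then show ?thesis using nth letters sorted_decode[OF L] by auto
    next
      case 2
      then show ?thesis using nth letters sorted_decode[OF L] flag by auto
    next
      case 3
      then show ?thesis using nth Z_rows[OF us, of k] that len by auto
    qed
  qed
  have lens: "length (lower L) + length (upper L) = \<alpha> ! i + \<alpha> ! Suc i"
    using arg_cong[OF ms, of size] us by (simp add: Z_def)
  have hts: "ht (ins_word (word_of (take k (put us L))) []) c = cnt \<alpha> k c" if "k \<le> length \<alpha>" "k \<noteq> Suc i" for k c
  proof -
    have old: "ht (ins_word (word_of (take k us)) []) c = cnt \<alpha> k c" using us that by (simp add: Z_def)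
    show ?thesis
    proof (cases "k \<le> i")
      case True
      then show ?thesis using old by (simp add: put_def)
    next
      case False
      then have k: "Suc i < length (take k us)" "Suc i < k" using that len i by auto
      let ?t = "take k us"
      have e: "take k (put us L) = ?t[i := lower L, Suc i := upper L]" by (simp add: put_def take_update_swap)
      have "us = us[i := us ! i, Suc i := us ! Suc i]" by simp
      then have e': "?t = ?t[i := us ! i, Suc i := us ! Suc i]" by (metis take_update_swap)
      have "knuth (word_of ?t) (word_of (take k (put us L)))"
        unfolding e by (subst e') (simp only: word_of_update2[OF k(1)] decode_pair[OF us, symmetric] knuth_cong[OF kn])
      then show ?thesis using knuth_ins_word old by simp
    qed
  qed
  have "\<forall>r\<in>set (put us L). sorted r \<and> (\<forall>a\<in>set r. 1 \<le> a)"
    using rows nth(4) by (metis in_set_conv_nth)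
  moreover have "flagged_factorization \<phi> (put us L)" using rows nth(4) by (simp add: flagged_factorization_def)
  moreover have "\<forall>k<length \<alpha>. k \<noteq> i \<longrightarrow> k \<noteq> Suc i \<longrightarrow> length (put us L ! k) = \<alpha> ! k"
    using us nth by (simp add: Z_def)
  ultimately show "put us L \<in> Z" using lens hts nth unfolding Z_def by simp
  have "knuth (word_of (put us (pair us))) (word_of (put us L))"
    unfolding word_put[OF len] by (rule knuth_cong[OF kn])
  then show "knuth (word_of us) (word_of (put us L))" using put_pair[OF us] by simp
qed

lemma edge_step:
  assumes us: "us \<in> Z" and L: "pair us = p @ (2 * x) # q" and flip: "flip_at (map ptok p) (map ptok q)"
  shows "put us (p @ (2 * x + 1) # q) \<in> Z" "pair (put us (p @ (2 * x + 1) # q)) = p @ (2 * x + 1) # q"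
    "knuth (word_of us) (word_of (put us (p @ (2 * x + 1) # q)))"
proof -
  have s: "sorted (rev (p @ (2 * x) # q))" using sorted_pair[of us] L by simp
  note kf = knuth_flip[OF s flip]
  show "put us (p @ (2 * x + 1) # q) \<in> Z" "knuth (word_of us) (word_of (put us (p @ (2 * x + 1) # q)))"
    using put_Z[OF us kf(2)] kf(1) L by simp_all
  show "pair (put us (p @ (2 * x + 1) # q)) = p @ (2 * x + 1) # q"
    by (rule pair_put[OF Z_length[OF us] kf(2)])
qed

lemma edgeE:
  assumes "edge us us'"
  obtains p x q where "us \<in> Z" "us' \<in> Z" "pair us = p @ (2 * x) # q" "pair us' = p @ (2 * x + 1) # q"
    "us' = put us (p @ (2 * x + 1) # q)" "us = put us' (p @ (2 * x) # q)" "flip_at (map ptok p) (map ptok q)"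
    "knuth (word_of us) (word_of us')"
proof -
  obtain p x q where e: "us \<in> Z" "us' \<in> Z" "pair us = p @ (2 * x) # q"
     "us' = put us (p @ (2 * x + 1) # q)" "flip_at (map ptok p) (map ptok q)"
    using assms by (auto simp: edge_def)
  moreover have "us = put us' (p @ (2 * x) # q)" using e put_pair[OF e(1)] by (simp add: put_put)
  ultimately show ?thesis using that edge_step[OF e(1,3,5)] by blast
qed

text \<open>Two of the lengths vary, so finite sets are collected over all admissible lists of
  lengths; twice the sum of \<open>\<alpha>\<close> is a crude bound for the length of one
  factor.\<close>

lemma finite_Z: "finite Z"
proof -
  let ?B = "{\<beta> :: nat list. set \<beta> \<subseteq> {..sum_list \<alpha> + sum_list \<alpha>} \<and> length \<beta> = length \<alpha>}"
  have el: "\<alpha> ! k \<le> sum_list \<alpha>" if "k < length \<alpha>" for k using that elem_le_sum_list by blast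
  have "Z \<subseteq> (\<Union>\<beta>\<in>?B. {us. map length us = \<beta> \<and> (\<forall>i < length us. \<forall>a \<in> set (us ! i). a \<le> \<phi> (Suc i))})"
  proof
    fix us assume us: "us \<in> Z"
    have "length (us ! k) \<le> sum_list \<alpha> + sum_list \<alpha>" if k: "k < length us" for k
    proof -
      have "length (us ! i) + length (us ! Suc i) \<le> sum_list \<alpha> + sum_list \<alpha>"
        using us el[of i] el[of "Suc i"] i by (simp add: Z_def)
      then show ?thesis using us el[of k] k by (cases "k = i \<or> k = Suc i") (auto simp: Z_def)
    qed
    then have "map length us \<in> ?B" using Z_length[OF us] by (auto simp: in_set_conv_nth)
    then show "us \<in> (\<Union>\<beta>\<in>?B. {us. map length us = \<beta> \<and> (\<forall>i < length us. \<forall>a \<in> set (us ! i). a \<le> \<phi> (Suc i))})"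
      using us by (auto simp: Z_def flagged_factorization_def)
  qed
  moreover have "finite ?B" by (rule finite_lists_length_eq) simp
  ultimately show ?thesis using finite_bounded_lists by (meson finite_UN finite_subset)
qed

sublocale strings Z edge "\<lambda>us. opn (map ptok (pair us))" "\<lambda>us. cls (map ptok (pair us))" "\<lambda>us. count_list (word_of us)"
proof
  show "finite Z" by (rule finite_Z)
  show "us \<in> Z \<and> us' \<in> Z \<and> opn (map ptok (pair us)) = Suc (opn (map ptok (pair us'))) \<and>
      cls (map ptok (pair us')) = Suc (cls (map ptok (pair us))) \<and> count_list (word_of us) = count_list (word_of us')"
    if "edge us us'" for us us'
    using that
  proof (rule edgeE)
    fix p x q
    assume h: "us \<in> Z" "us' \<in> Z" "pair us = p @ (2 * x) # q" "pair us' = p @ (2 * x + 1) # q"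
      "flip_at (map ptok p) (map ptok q)" "knuth (word_of us) (word_of us')"
    have "count_list (word_of us) = count_list (word_of us')"
      using knuth_mset[OF h(6)] by (metis count_mset ext)
    then show ?thesis using flip_at_counts[OF h(5)] h by (simp add: ptok_def)
  qed
  show "us' = us''" if "edge us us'" "edge us us''" for us us' us''
    using that(1)
  proof (rule edgeE)
    fix p x q
    assume h: "pair us = p @ (2 * x) # q" "us' = put us (p @ (2 * x + 1) # q)" "flip_at (map ptok p) (map ptok q)"
    show ?thesis using that(2)
    proof (rule edgeE)
      fix p' x' q'
      assume h': "pair us = p' @ (2 * x') # q'" "us'' = put us (p' @ (2 * x' + 1) # q')" "flip_at (map ptok p') (map ptok q')"
      have e: "p @ (2 * x) # q = p' @ (2 * x') # q'" using h(1) h'(1) by simp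
      then have "map ptok (p @ (2 * x) # q) = map ptok (p' @ (2 * x') # q')" by simp
      then have "map ptok p = map ptok p'" using flip_unique_opn[OF _ h(3) h'(3)] by (simp add: ptok_def)
      then have "length p = length p'" by (rule map_eq_imp_length_eq)
      then show ?thesis using e h h' by simp
    qed
  qed
  show "us = vs" if "edge us us'" "edge vs us'" for us us' vs
    using that(1)
  proof (rule edgeE)
    fix p x q
    assume h: "pair us' = p @ (2 * x + 1) # q" "us = put us' (p @ (2 * x) # q)" "flip_at (map ptok p) (map ptok q)"
    show ?thesis using that(2)
    proof (rule edgeE)
      fix p' x' q'
      assume h': "pair us' = p' @ (2 * x' + 1) # q'" "vs = put us' (p' @ (2 * x') # q')" "flip_at (map ptok p') (map ptok q')"
      have e: "p @ (2 * x + 1) # q = p' @ (2 * x' + 1) # q'" using h(1) h'(1) by simp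
      then have "map ptok (p @ (2 * x + 1) # q) = map ptok (p' @ (2 * x' + 1) # q')" by simp
      then have "map ptok p = map ptok p'" using flip_unique_cls[OF _ h(3) h'(3)] by (simp add: ptok_def)
      then have "length p = length p'" by (rule map_eq_imp_length_eq)
      then show ?thesis using e h h' by simp
    qed
  qed
  show "\<exists>us'. edge us us'" if us: "us \<in> Z" "opn (map ptok (pair us)) > 0" for us
  proof -
    obtain P Q where "map ptok (pair us) = P @ Opn # Q" "flip_at P Q" using exists_flip_opn[OF us(2)] by blast
    then obtain p y q where pq: "pair us = p @ y # q" "ptok y = Opn" "flip_at (map ptok p) (map ptok q)"
      by (auto simp: map_eq_append_conv map_eq_Cons_conv)
    then obtain x where "y = 2 * x" by (auto simp: ptok_def elim: evenE split: if_splits)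
    then have "edge us (put us (p @ (2 * x + 1) # q))"
      unfolding edge_def using us(1) pq edge_step(1)[OF us(1), of p x q] by blast
    then show ?thesis by blast
  qed
  show "\<exists>us. edge us us'" if us: "us' \<in> Z" "cls (map ptok (pair us')) > 0" for us'
  proof -
    obtain P Q where "map ptok (pair us') = P @ Cls # Q" "flip_at P Q" using exists_flip_cls[OF us(2)] by blast
    then obtain p y q where pq: "pair us' = p @ y # q" "ptok y = Cls" "flip_at (map ptok p) (map ptok q)"
      by (auto simp: map_eq_append_conv map_eq_Cons_conv)
    then obtain x where y: "y = 2 * x + 1" by (auto simp: ptok_def elim: oddE split: if_splits)
    let ?L = "p @ (2 * x) # q"
    have srt: "sorted_wrt (\<ge>) (p @ (2 * x + 1) # q)" using sorted_pair[of us'] unfolding pq(1) y by (simp only: sorted_wrt_rev)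
    \<comment> \<open>The mirror of the argument in \<open>knuth_flip\<close>: it ensures that the
      code remains decreasing when \<open>2 * x + 1\<close> is lowered to
      \<open>2 * x\<close>.\<close>
    have no: "2 * x + 1 \<notin> set q"
    proof
      assume "2 * x + 1 \<in> set q"
      then obtain u v where uv: "q = u @ (2 * x + 1) # v" by (metis split_list)
      have "\<forall>z\<in>set u. z = 2 * x + 1"
      proof
        fix z assume "z \<in> set u"
        then have "2 * x + 1 \<le> z" "z \<le> 2 * x + 1" using srt uv by (auto simp: sorted_wrt_append)
        then show "z = 2 * x + 1" by simp
      qed
      then have "\<forall>t\<in>set (map ptok u). t = Cls" by (auto simp: ptok_def)
      moreover have "\<forall>t\<in>set ts. t = Cls \<Longrightarrow> opn ts = 0" for ts by (induction ts) auto
      ultimately have "opn (map ptok u) = 0" by blast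
      then have "cls (map ptok q) > 0" using uv by (simp add: cls_append ptok_def)
      then show False using pq(3) by (simp add: flip_at_def)
    qed
    have "\<forall>z\<in>set q. z \<le> 2 * x"
    proof
      fix z assume "z \<in> set q"
      then have "z \<le> 2 * x + 1" "z \<noteq> 2 * x + 1" using srt no by (auto simp: sorted_wrt_append)
      then show "z \<le> 2 * x" by simp
    qed
    then have sL: "sorted (rev ?L)" using srt by (auto simp: sorted_wrt_rev sorted_wrt_append)
    have "knuth (upper (pair us') @ lower (pair us')) (upper ?L @ lower ?L)"
      using knuth_sym[OF knuth_flip(1)[OF sL pq(3)]] pq(1) y by simp
    then have Z: "put us' ?L \<in> Z" using put_Z[OF us(1) sL] by simp
    have p: "pair (put us' ?L) = ?L" by (rule pair_put[OF Z_length[OF us(1)] sL])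
    have "us' = put (put us' ?L) (p @ (2 * x + 1) # q)" using put_pair[OF us(1)] pq(1) y by (simp add: put_put)
    then have "edge (put us' ?L) us'" unfolding edge_def using us(1) Z p pq(3) by blast
    then show ?thesis by blast
  qed
qed

text \<open>Closing brackets are the letters of the lower row, opening ones those of the upper row;
  reversing the charge exchanges the two lengths.\<close>

lemma charge:
  assumes "us \<in> Z"
  shows "int (cls (map ptok (pair us))) - int (opn (map ptok (pair us))) = int (length (us ! i)) - int (length (us ! Suc i))"
proof -
  have "count_list (map ptok L) Cls = length (lower L)" "count_list (map ptok L) Opn = length (upper L)" for L
    unfolding lower_def upper_def by (induction L) (auto simp: ptok_def)
  then show ?thesis using unmatched_balance[of "map ptok (pair us)"] decode_pair[OF assms] by simp
qed

text \<open>\<open>I\<close> and \<open>I'\<close> are the columns that grow under the first and the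
  second factor. Their combined effect is fixed by the shapes before and after the pair, its
  division between the two is not.\<close>

lemma Z_increments:
  assumes us: "us \<in> Z"
  obtains I I' where "card I = length (us ! i)" "card I' = length (us ! Suc i)" "finite I" "finite I'"
    "\<And>c. ht (ins_word (word_of (take (Suc i) us)) []) c = cnt \<alpha> i c + (if c \<in> I then 1 else 0)"
    "\<And>c. (if c \<in> I then 1 else 0) + (if c \<in> I' then 1 else 0 :: nat) =
       (if c < \<alpha> ! i then 1 else 0) + (if c < \<alpha> ! Suc i then 1 else 0)"
proof -
  let ?P = "ins_word (word_of (take i us)) []" and ?P' = "ins_word (word_of (take (Suc i) us)) []"
  have len: "length us = length \<alpha>" by (rule Z_length[OF us])
  have t: "tableau ?P" "tableau ?P'" by (simp_all add: tableau_ins_word)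
  have s: "sorted (us ! i)" "sorted (us ! Suc i)" using Z_rows(1)[OF us] i len by simp_all
  have P': "?P' = ins_word (us ! i) ?P" using word_of_take_Suc[of i us] i len by (simp add: ins_word_append)
  have P'': "ins_word (word_of (take (Suc (Suc i)) us)) [] = ins_word (us ! Suc i) ?P'"
    using word_of_take_Suc[of "Suc i" us] i len by (simp add: ins_word_append)
  have h: "ht ?P c = cnt \<alpha> i c" "ht (ins_word (us ! Suc i) ?P') c = cnt \<alpha> (Suc (Suc i)) c" for c
    using Z_ht[OF us, of i c] Z_ht[OF us, of "Suc (Suc i)" c] i P'' by simp_all
  have 1: "ht ?P' c = cnt \<alpha> i c + (if c \<in> set (lands (us ! i) ?P) then 1 else 0)" for c
    using row_strip(1)[OF t(1) s(1), of c] h(1)[of c] P' by simp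
  have 2: "cnt \<alpha> (Suc (Suc i)) c = ht ?P' c + (if c \<in> set (lands (us ! Suc i) ?P') then 1 else 0)" for c
    using row_strip(1)[OF t(2) s(2), of c] h(2)[of c] by simp
  show ?thesis
  proof (rule that[of "set (lands (us ! i) ?P)" "set (lands (us ! Suc i) ?P')"])
    show "card (set (lands (us ! i) ?P)) = length (us ! i)" "card (set (lands (us ! Suc i) ?P')) = length (us ! Suc i)"
      using row_strip(2)[OF t(1) s(1)] row_strip(2)[OF t(2) s(2)] by (simp_all add: distinct_card)
    show "ht ?P' c = cnt \<alpha> i c + (if c \<in> set (lands (us ! i) ?P) then 1 else 0)" for c by (rule 1)
    show "(if c \<in> set (lands (us ! i) ?P) then 1 else 0) + (if c \<in> set (lands (us ! Suc i) ?P') then 1 else 0 :: nat) =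
       (if c < \<alpha> ! i then 1 else 0) + (if c < \<alpha> ! Suc i then 1 else 0)" for c
      using 1[of c] 2[of c] cnt_Suc[of "Suc i" \<alpha> c] cnt_Suc[of i \<alpha> c] i by simp
  qed auto
qed

lemma Z_length_bound: assumes "us \<in> Z" shows "length (us ! i) \<le> max (\<alpha> ! i) (\<alpha> ! Suc i)"
proof -
  obtain I I' where I: "card I = length (us ! i)" "\<And>c. (if c \<in> I then 1 else 0) + (if c \<in> I' then 1 else 0 :: nat) =
       (if c < \<alpha> ! i then 1 else 0) + (if c < \<alpha> ! Suc i then 1 else 0)"
    using Z_increments[OF assms] by metis
  have "I \<subseteq> {..<max (\<alpha> ! i) (\<alpha> ! Suc i)}"
  proof
    fix c assume "c \<in> I"
    then show "c \<in> {..<max (\<alpha> ! i) (\<alpha> ! Suc i)}" using I(2)[of c] by (auto split: if_splits)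
  qed
  then have "card I \<le> card {..<max (\<alpha> ! i) (\<alpha> ! Suc i)}" by (intro card_mono) auto
  then show ?thesis using I(1) by simp
qed

text \<open>Columns below the smaller part grow twice and hence belong to both \<open>I\<close> and
  \<open>I'\<close>. If the lengths are as prescribed, the shorter factor has no further columns and
  the longer one takes all the rest.\<close>

lemma Z_middle:
  assumes us: "us \<in> Z" and len: "length (us ! i) = \<alpha> ! i" "length (us ! Suc i) = \<alpha> ! Suc i"
  shows "ht (ins_word (word_of (take (Suc i) us)) []) c = cnt \<alpha> (Suc i) c"
proof -
  obtain I I' where I: "card I = length (us ! i)" "card I' = length (us ! Suc i)" "finite I" "finite I'"
    "\<And>c. ht (ins_word (word_of (take (Suc i) us)) []) c = cnt \<alpha> i c + (if c \<in> I then 1 else 0)"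
    "\<And>c. (if c \<in> I then 1 else 0) + (if c \<in> I' then 1 else 0 :: nat) =
       (if c < \<alpha> ! i then 1 else 0) + (if c < \<alpha> ! Suc i then 1 else 0)"
    using Z_increments[OF us] by metis
  have "c \<in> I \<longleftrightarrow> c < \<alpha> ! i"
  proof (cases "\<alpha> ! i \<le> \<alpha> ! Suc i")
    case True
    have "{..<\<alpha> ! i} \<subseteq> I"
    proof
      fix c assume "c \<in> {..<\<alpha> ! i}"
      then show "c \<in> I" using I(6)[of c] True by (auto split: if_splits)
    qed
    then have "{..<\<alpha> ! i} = I" using I(1,3) len by (intro card_subset_eq) auto
    then show ?thesis by blast
  next
    case False
    have "{..<\<alpha> ! Suc i} \<subseteq> I'"
    proof
      fix c assume "c \<in> {..<\<alpha> ! Suc i}"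
      then show "c \<in> I'" using I(6)[of c] False by (auto split: if_splits)
    qed
    then have "{..<\<alpha> ! Suc i} = I'" using I(2,4) len by (intro card_subset_eq) auto
    then have "c \<in> I' \<longleftrightarrow> c < \<alpha> ! Suc i" by blast
    then show ?thesis using I(6)[of c] by (auto split: if_splits)
  qed
  then show ?thesis using I(5)[of c] cnt_Suc[of i \<alpha> c] i by simp
qed

lemma WH_eq: "WH \<alpha> \<phi> = {us \<in> Z. length (us ! i) = \<alpha> ! i \<and> length (us ! Suc i) = \<alpha> ! Suc i}"
proof (intro equalityI subsetI)
  fix us assume us: "us \<in> WH \<alpha> \<phi>"
  then have l: "length us = length \<alpha>" "\<And>k. k < length \<alpha> \<Longrightarrow> length (us ! k) = \<alpha> ! k" by (auto simp: WH_def)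
  show "us \<in> {us \<in> Z. length (us ! i) = \<alpha> ! i \<and> length (us ! Suc i) = \<alpha> ! Suc i}"
    using us l i unfolding WH_def Z_def by simp
next
  fix us assume us: "us \<in> {us \<in> Z. length (us ! i) = \<alpha> ! i \<and> length (us ! Suc i) = \<alpha> ! Suc i}"
  have "map length us = \<alpha>"
    using us by (intro nth_equalityI) (auto simp: Z_def)
  moreover have "ht (ins_word (word_of (take k us)) []) c = cnt \<alpha> k c" if "k \<le> length us" for k c
    using us that Z_middle[of us c] by (cases "k = Suc i") (auto simp: Z_def)
  moreover have "\<forall>r\<in>set us. sorted r \<and> (\<forall>a\<in>set r. 1 \<le> a)" "flagged_factorization \<phi> us" using us by (simp_all add: Z_def)
  ultimately show "us \<in> WH \<alpha> \<phi>" by (simp add: WH_def)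
qed

lemma card_WH: "card {us \<in> WH \<alpha> \<phi>. count_list (word_of us) = w} = card (slice Z w (int (\<alpha> ! i) - int (\<alpha> ! Suc i)))"
proof -
  have "us \<in> WH \<alpha> \<phi> \<longleftrightarrow> int (length (us ! i)) - int (length (us ! Suc i)) = int (\<alpha> ! i) - int (\<alpha> ! Suc i)" if "us \<in> Z" for us
  proof -
    have "length (us ! i) + length (us ! Suc i) = \<alpha> ! i + \<alpha> ! Suc i" using that by (simp add: Z_def)
    then show ?thesis unfolding WH_eq using that by auto
  qed
  note iff = this
  have "us \<in> {us \<in> WH \<alpha> \<phi>. count_list (word_of us) = w} \<longleftrightarrow> us \<in> slice Z w (int (\<alpha> ! i) - int (\<alpha> ! Suc i))" for us
  proof (cases "us \<in> Z")
    case True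
    then show ?thesis using iff[OF True] charge[OF True] by (auto simp: slice_def)
  next
    case False
    then have "us \<notin> WH \<alpha> \<phi>" using WH_eq by blast
    then show ?thesis using False by (simp add: slice_def)
  qed
  then have "{us \<in> WH \<alpha> \<phi>. count_list (word_of us) = w} = slice Z w (int (\<alpha> ! i) - int (\<alpha> ! Suc i))" by blast
  then show ?thesis by simp
qed

text \<open>Some element \<open>z\<close> at the end of a string of the same length has a lower row
  longer than its upper row by \<open>?o + ?c\<close>. The lower row is bounded by the larger part,
  so \<open>?o + ?c\<close> is at most \<open>\<alpha> ! Suc i - \<alpha> ! i\<close>; by the charge
  of \<open>us\<close> this is \<open>?o - ?c\<close>.\<close>

lemma WH_matched:
  assumes less: "\<alpha> ! i < \<alpha> ! Suc i" and us: "us \<in> WH \<alpha> \<phi>"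
  shows "cls (map ptok (pair us)) = 0"
proof -
  let ?o = "opn (map ptok (pair us))" and ?c = "cls (map ptok (pair us))" and ?w = "count_list (word_of us)"
  have usZ: "us \<in> Z" "length (us ! i) = \<alpha> ! i" "length (us ! Suc i) = \<alpha> ! Suc i" using us WH_eq by auto
  have "us \<in> level Z ?w ?o ?c" using usZ by (simp add: level_def)
  moreover have "finite (level Z ?w ?o ?c)" using finite_Z by (simp add: level_def)
  ultimately have "card (level Z ?w ?o ?c) > 0" by (auto simp: card_gt_0_iff)
  then have "level Z ?w 0 (?o + ?c) \<noteq> {}" using card_level[of ?w ?o ?c] by (metis card.empty less_irrefl)
  then obtain z where z: "z \<in> Z" "opn (map ptok (pair z)) = 0" "cls (map ptok (pair z)) = ?o + ?c"
    by (auto simp: level_def)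
  have "length (z ! i) + length (z ! Suc i) = \<alpha> ! i + \<alpha> ! Suc i" using z(1) by (simp add: Z_def)
  then show ?thesis using charge[OF z(1)] charge[OF usZ(1)] z usZ Z_length_bound[OF z(1)] less by simp
qed

text \<open>A letter of the lower row equal to the common flag value would come first in the code,
  as a closing bracket with nothing in front of it.\<close>

lemma WH_lower_less:
  assumes less: "\<alpha> ! i < \<alpha> ! Suc i" and us: "us \<in> WH \<alpha> \<phi>" and x: "x \<in> set (us ! i)"
  shows "x < \<phi> (Suc i)"
proof (rule ccontr)
  assume "\<not> x < \<phi> (Suc i)"
  have usZ: "us \<in> Z" using us WH_eq by auto
  have len: "length us = length \<alpha>" by (rule Z_length[OF usZ])
  let ?M = "\<phi> (Suc i)"
  have le: "y \<le> ?M" if "y \<in> set (us ! i) \<union> set (us ! Suc i)" for y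
    using that Z_rows(3)[OF usZ, of i] Z_rows(3)[OF usZ, of "Suc i"] i len flag by auto
  then have xM: "x = ?M" using x \<open>\<not> x < ?M\<close> by (simp add: le_antisym)
  have st: "set (pair us) = (\<lambda>v. 2 * v + 1) ` set (us ! i) \<union> (\<lambda>v. 2 * v) ` set (us ! Suc i)"
    by (simp add: pair_def code_def)
  then obtain y L where L: "pair us = y # L" using x by (cases "pair us") auto
  have mem: "2 * ?M + 1 \<in> set (pair us)" using st x xM by auto
  have "y \<le> 2 * ?M + 1"
  proof -
    have "y \<in> set (pair us)" using L by simp
    then show ?thesis unfolding st using le by fastforce
  qed
  moreover have "2 * ?M + 1 \<le> y"
    using mem sorted_pair[of us] unfolding L by (auto simp: sorted_append)
  ultimately have "y = 2 * ?M + 1" by simp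
  then have "cls (map ptok (pair us)) > 0" using L by (simp add: ptok_def)
  then show False using WH_matched[OF less us] by simp
qed

end

text \<open>The two sets are opposite slices of the same set \<open>Z\<close>.\<close>

theorem card_WH_swp:
  assumes "Suc i < length \<alpha>" "\<phi> (Suc i) = \<phi> (Suc (Suc i))"
  shows "card {us \<in> WH \<alpha> \<phi>. count_list (word_of us) = w} = card {us \<in> WH (swp \<alpha> i) \<phi>. count_list (word_of us) = w}"
proof -
  interpret A: row_strings \<alpha> \<phi> i by unfold_locales (use assms in auto)
  interpret B: row_strings "swp \<alpha> i" \<phi> i by unfold_locales (use assms in auto)
  have Z: "B.Z = A.Z"
    unfolding A.Z_def B.Z_def using assms(1) cnt_swp[OF assms(1)] by (auto simp: add.commute)
  have "card {us \<in> WH (swp \<alpha> i) \<phi>. count_list (word_of us) = w} = card (A.slice A.Z w (- (int (\<alpha> ! i) - int (\<alpha> ! Suc i))))"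
    unfolding B.card_WH Z using assms(1) by (simp add: A.slice_def B.slice_def A.pair_def B.pair_def)
  also have "\<dots> = card (A.slice A.Z w (int (\<alpha> ! i) - int (\<alpha> ! Suc i)))"
    using A.card_slice_opposite by metis
  finally show ?thesis using A.card_WH by simp
qed

section \<open>Key tableaux as greedy fillings\<close>

text \<open>The default 0 lets a single inequality express that the box to the right exists and has
  the larger entry: at the end of a row nothing is smaller than \<open>carry\<close>.\<close>

definition carry :: "nat list \<Rightarrow> nat \<Rightarrow> nat" where
  "carry r j = (if Suc j < length r then r ! Suc j else 0)"

definition ok_row :: "nat list \<Rightarrow> bool" where
  "ok_row r \<longleftrightarrow> (\<forall>x\<in>set r. 1 \<le> x) \<and> (\<forall>j<length r. carry r j \<le> r ! j)"

definition ok_pair :: "nat list \<Rightarrow> nat list \<Rightarrow> bool" where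
  "ok_pair r s \<longleftrightarrow> (\<forall>j. j < length r \<longrightarrow> j < length s \<longrightarrow> r ! j \<noteq> s ! j \<and> (s ! j < r ! j \<longrightarrow> s ! j < carry r j))"

lemma boxes_Suc: "(Suc i, Suc j) \<in> boxes T \<longleftrightarrow> i < length T \<and> j < length (T ! i)"
  by (auto simp: boxes_def)

lemma boxes_0: "(0, j) \<notin> boxes T" "(i, 0) \<notin> boxes T"
  by (auto simp: boxes_def)

lemma entry_Suc: "entry T (Suc i) (Suc j) = T ! i ! j"
  by (simp add: entry_def)

lemma all_pos: "(\<forall>i. P i) \<longleftrightarrow> P 0 \<and> (\<forall>i. P (Suc i))" for P :: "nat \<Rightarrow> bool"
  by (metis not0_implies_Suc)

lemma key_tableau_iff: "key_tableau T \<longleftrightarrow> (\<forall>r\<in>set T. ok_row r) \<and> sorted_wrt ok_pair T"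
proof
  assume K: "key_tableau T"
  have pos: "1 \<le> T ! i ! j" if "i < length T" "j < length (T ! i)" for i j
    using K that unfolding key_tableau_def by (metis (mono_tags, lifting) boxes_Suc case_prodD entry_Suc)
  have dec: "T ! i ! Suc j \<le> T ! i ! j" if "i < length T" "Suc j < length (T ! i)" for i j
  proof -
    have "(Suc i, Suc j) \<in> boxes T" "(Suc i, Suc j + 1) \<in> boxes T" using that by (auto simp: boxes_def)
    then have "entry T (Suc i) (Suc j + 1) \<le> entry T (Suc i) (Suc j)" using K unfolding key_tableau_def by blast
    then show ?thesis by (simp add: entry_def)
  qed
  have ne: "T ! i ! j \<noteq> T ! k ! j" if "i < k" "k < length T" "j < length (T ! i)" "j < length (T ! k)" for i k j
  proof -
    have "(Suc i, Suc j) \<in> boxes T" "(Suc k, Suc j) \<in> boxes T" "Suc i \<noteq> Suc k" using that by (auto simp: boxes_def)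
    then have "entry T (Suc i) (Suc j) \<noteq> entry T (Suc k) (Suc j)" using K unfolding key_tableau_def by blast
    then show ?thesis by (simp add: entry_def)
  qed
  have tr: "Suc j < length (T ! i) \<and> T ! k ! j < T ! i ! Suc j"
    if "i < k" "k < length T" "j < length (T ! i)" "j < length (T ! k)" "T ! k ! j < T ! i ! j" for i k j
  proof -
    have "(Suc i, Suc j) \<in> boxes T" "(Suc k, Suc j) \<in> boxes T" "Suc i < Suc k" "entry T (Suc i) (Suc j) > entry T (Suc k) (Suc j)"
      using that by (auto simp: boxes_def entry_def)
    then have "(Suc i, Suc j + 1) \<in> boxes T \<and> entry T (Suc i) (Suc j + 1) > entry T (Suc k) (Suc j)"
      using K unfolding key_tableau_def by blast
    then show ?thesis by (auto simp: boxes_def entry_def)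
  qed
  have "ok_row (T ! i)" if "i < length T" for i
    using pos[OF that] dec[OF that] by (auto simp: ok_row_def carry_def in_set_conv_nth)
  then show "(\<forall>r\<in>set T. ok_row r) \<and> sorted_wrt ok_pair T"
    using ne tr by (auto simp: in_set_conv_nth sorted_wrt_iff_nth_less ok_pair_def carry_def)
next
  assume h: "(\<forall>r\<in>set T. ok_row r) \<and> sorted_wrt ok_pair T"
  have row: "ok_row (T ! i)" if "i < length T" for i using h that by simp
  have pair: "ok_pair (T ! i) (T ! k)" if "i < k" "k < length T" for i k
    using h that by (simp add: sorted_wrt_iff_nth_less)
  have box: "\<exists>i' j'. i = Suc i' \<and> j = Suc j' \<and> i' < length T \<and> j' < length (T ! i') \<and> entry T i j = T ! i' ! j'"
    if "(i, j) \<in> boxes T" for i j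
    using that by (cases i; cases j) (auto simp: boxes_0 boxes_Suc entry_Suc)
  have 1: "1 \<le> entry T i j" if "(i, j) \<in> boxes T" for i j
    using box[OF that] row by (auto simp: ok_row_def)
  have 2: "entry T i (j + 1) \<le> entry T i j" if b: "(i, j) \<in> boxes T" "(i, j + 1) \<in> boxes T" for i j
  proof -
    obtain i' j' where ij: "i = Suc i'" "j = Suc j'" "i' < length T" "j' < length (T ! i')" using box[OF b(1)] by blast
    then have "Suc j' < length (T ! i')" using b(2) by (simp add: boxes_Suc)
    then show ?thesis
      using row[OF ij(3), unfolded ok_row_def, THEN conjunct2, rule_format, of j'] ij by (simp add: carry_def entry_Suc)
  qed
  have 3: "entry T i j \<noteq> entry T k j" if b: "(i, j) \<in> boxes T" "(k, j) \<in> boxes T" "i < k" for i j k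
  proof -
    obtain i' j' where ij: "i = Suc i'" "j = Suc j'" "i' < length T" "j' < length (T ! i')" using box[OF b(1)] by blast
    obtain k' where kj: "k = Suc k'" "k' < length T" "j' < length (T ! k')" using box[OF b(2)] ij by auto
    then show ?thesis using pair[of i' k'] ij b(3) by (auto simp: ok_pair_def entry_Suc)
  qed
  have 4: "(i, j + 1) \<in> boxes T \<and> entry T i (j + 1) > entry T k j"
    if b: "(i, j) \<in> boxes T" "(k, j) \<in> boxes T" "i < k" "entry T i j > entry T k j" for i j k
  proof -
    obtain i' j' where ij: "i = Suc i'" "j = Suc j'" "i' < length T" "j' < length (T ! i')" using box[OF b(1)] by blast
    obtain k' where kj: "k = Suc k'" "k' < length T" "j' < length (T ! k')" using box[OF b(2)] ij by auto
    have "T ! k' ! j' < carry (T ! i') j'"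
      using pair[of i' k'] ij kj b(3,4) by (auto simp: ok_pair_def entry_Suc)
    then show ?thesis using ij kj by (auto simp: carry_def boxes_Suc entry_Suc split: if_splits)
  qed
  show "key_tableau T"
    unfolding key_tableau_def using 1 2 3 4
    by (intro conjI allI impI ballI) (auto, metis linorder_neqE_nat)
qed

section \<open>Greedy fillings of prescribed column sets\<close>

fun greedy :: "nat \<Rightarrow> nat set list \<Rightarrow> nat list \<Rightarrow> bool" where
  "greedy t [] [] = True"
| "greedy t (C # Cs) (x # xs) = (x \<in> C \<and> t \<le> x \<and> (\<forall>s\<in>C. t \<le> s \<longrightarrow> x \<le> s) \<and> greedy x Cs xs)"
| "greedy t _ _ = False"

fun rm :: "nat set list \<Rightarrow> nat list \<Rightarrow> nat set list" where
  "rm (C # Cs) (x # xs) = (C - {x}) # rm Cs xs"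
| "rm Cs xs = Cs"

text \<open>The columns are listed from right to left, so that a row, read backwards, is filled greedily.\<close>

definition row_fits :: "nat set list \<Rightarrow> nat list \<Rightarrow> bool" where
  "row_fits Cs r \<longleftrightarrow> length r \<le> length Cs \<and> greedy 0 (drop (length Cs - length r) Cs) (rev r)"

definition rm_row :: "nat set list \<Rightarrow> nat list \<Rightarrow> nat set list" where
  "rm_row Cs r = take (length Cs - length r) Cs @ rm (drop (length Cs - length r) Cs) (rev r)"

fun fills :: "nat set list \<Rightarrow> nat list list \<Rightarrow> bool" where
  "fills Cs [] = (\<forall>C\<in>set Cs. C = {})"
| "fills Cs (r # T) = (row_fits Cs r \<and> fills (rm_row Cs r) T)"

lemma greedy_length: "greedy t Cs xs \<Longrightarrow> length Cs = length xs"
  by (induction t Cs xs rule: greedy.induct) auto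

lemma length_rm [simp]: "length (rm Cs xs) = length Cs"
  by (induction Cs xs rule: rm.induct) auto

lemma length_rm_row [simp]: "length (rm_row Cs r) = length Cs"
  by (simp add: rm_row_def)

lemma nth_rm: "length Cs = length xs \<Longrightarrow> j < length xs \<Longrightarrow> rm Cs xs ! j = Cs ! j - {xs ! j}"
proof (induction Cs xs arbitrary: j rule: rm.induct)
  case (1 C Cs x xs)
  then show ?case by (cases j) auto
qed auto

lemma greedy_nth:
  "greedy t Cs xs \<longleftrightarrow> length Cs = length xs \<and> (\<forall>j<length xs. let p = (if j = 0 then t else xs ! (j - 1)) in
     xs ! j \<in> Cs ! j \<and> p \<le> xs ! j \<and> (\<forall>s\<in>Cs ! j. p \<le> s \<longrightarrow> xs ! j \<le> s))"
proof (induction t Cs xs rule: greedy.induct)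
  case (2 t C Cs x xs)
  show ?case
    unfolding greedy.simps 2 length_Cons all_pos[of "\<lambda>j. j < Suc _ \<longrightarrow> _ j"] by (auto simp: Let_def nth_Cons')
qed auto

lemma greedy_unique: "greedy t Cs xs \<Longrightarrow> greedy t Cs ys \<Longrightarrow> xs = ys"
proof (induction t Cs xs arbitrary: ys rule: greedy.induct)
  case (2 t C Cs x xs)
  then obtain y ys' where ys: "ys = y # ys'" by (cases ys) auto
  then have "x = y" using 2 by (auto intro: le_antisym)
  then show ?case using 2 ys by auto
qed (auto elim: greedy.elims)

lemma row_fits_unique: "row_fits Cs r \<Longrightarrow> row_fits Cs s \<Longrightarrow> length r = length s \<Longrightarrow> r = s"
  unfolding row_fits_def using greedy_unique by (metis rev_rev_ident)

lemma fills_unique: "fills Cs T \<Longrightarrow> fills Cs T' \<Longrightarrow> map length T = map length T' \<Longrightarrow> T = T'"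
proof (induction T arbitrary: Cs T')
  case (Cons r T)
  then obtain s S where T': "T' = s # S" by (cases T') auto
  then have "r = s" using Cons.prems row_fits_unique by auto
  then show ?case using Cons T' by auto
qed simp

definition cols :: "nat \<Rightarrow> (nat \<Rightarrow> nat set) \<Rightarrow> nat set list" where
  "cols L S = map S (rev [0..<L])"

lemma length_cols [simp]: "length (cols L S) = L" by (simp add: cols_def)

lemma nth_cols: "j < L \<Longrightarrow> cols L S ! j = S (L - Suc j)"
  by (simp add: cols_def rev_nth)

lemma cols_eq_iff: "cols L S = cols L S' \<longleftrightarrow> (\<forall>c<L. S c = S' c)"
  by (auto simp: cols_def)

lemma cols_exists: "\<exists>S. Cs = cols (length Cs) S"
proof
  show "Cs = cols (length Cs) (\<lambda>c. Cs ! (length Cs - Suc c))"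
    by (rule nth_equalityI) (auto simp: nth_cols)
qed

lemma row_fits_cols:
  assumes "length r \<le> L"
  shows "row_fits (cols L S) r \<longleftrightarrow>
    (\<forall>c<length r. r ! c \<in> S c \<and> carry r c \<le> r ! c \<and> (\<forall>s\<in>S c. carry r c \<le> s \<longrightarrow> r ! c \<le> s))" (is "_ \<longleftrightarrow> (\<forall>c<_. ?Q c)")
proof -
  let ?n = "length r"
  have "(let p = (if j = 0 then 0 else rev r ! (j - 1)) in
     rev r ! j \<in> drop (L - ?n) (cols L S) ! j \<and> p \<le> rev r ! j \<and> (\<forall>s\<in>drop (L - ?n) (cols L S) ! j. p \<le> s \<longrightarrow> rev r ! j \<le> s)) \<longleftrightarrow> ?Q (?n - Suc j)"
    if j: "j < ?n" for j
  proof -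
    have 1: "rev r ! j = r ! (?n - Suc j)" using j by (simp add: rev_nth)
    have 2: "(if j = 0 then 0 else rev r ! (j - 1)) = carry r (?n - Suc j)"
    proof (cases j)
      case (Suc k)
      then show ?thesis using j by (auto simp: carry_def rev_nth Suc_diff_Suc)
    qed (use j in \<open>auto simp: carry_def\<close>)
    have 3: "drop (L - ?n) (cols L S) ! j = S (?n - Suc j)" using j assms by (simp add: nth_cols)
    show ?thesis unfolding Let_def 1 2 3 ..
  qed
  then have "row_fits (cols L S) r \<longleftrightarrow> (\<forall>j<?n. ?Q (?n - Suc j))"
    using assms unfolding row_fits_def greedy_nth by auto
  also have "\<dots> \<longleftrightarrow> (\<forall>c<?n. ?Q c)"
  proof (intro iffI allI impI)
    fix c assume "\<forall>j<?n. ?Q (?n - Suc j)" "c < ?n"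
    moreover have "?n - Suc (?n - Suc c) = c" "?n - Suc c < ?n" using \<open>c < ?n\<close> by auto
    ultimately show "?Q c" by metis
  qed auto
  finally show ?thesis .
qed

lemma rm_row_cols:
  assumes "length r \<le> L"
  shows "rm_row (cols L S) r = cols L (\<lambda>c. if c < length r then S c - {r ! c} else S c)"
proof (rule nth_equalityI)
  fix j assume "j < length (rm_row (cols L S) r)"
  then have j: "j < L" by simp
  show "rm_row (cols L S) r ! j = cols L (\<lambda>c. if c < length r then S c - {r ! c} else S c) ! j"
  proof (cases "j < L - length r")
    case True
    then show ?thesis using j assms by (auto simp: rm_row_def nth_append nth_cols)
  next
    case False
    let ?k = "j - (L - length r)"
    have k: "?k < length (rev r)" "length (drop (L - length r) (cols L S)) = length (rev r)" using False j assms by auto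
    have "rm_row (cols L S) r ! j = drop (L - length r) (cols L S) ! ?k - {rev r ! ?k}"
      using False j assms nth_rm[OF k(2,1)] by (simp add: rm_row_def nth_append)
    also have "drop (L - length r) (cols L S) ! ?k = S (L - Suc j)" using False j by (simp add: nth_cols)
    also have "rev r ! ?k = r ! (L - Suc j)" using k False j assms by (simp add: rev_nth)
    finally show ?thesis using j False assms by (simp add: nth_cols)
  qed
qed simp

definition colset :: "nat list list \<Rightarrow> nat \<Rightarrow> nat set" where
  "colset T c = {r ! c | r. r \<in> set T \<and> c < length r}"

lemma colset_simps: "colset [] c = {}" "colset (r # T) c = (if c < length r then insert (r ! c) (colset T c) else colset T c)"
  by (auto simp: colset_def)

text \<open>A filling exhausts the columns, so these can only be the column sets of
  \<open>T\<close>.\<close>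

lemma fills_cols: "fills Cs T \<Longrightarrow> Cs = cols (length Cs) (colset T)"
proof (induction T arbitrary: Cs)
  case Nil
  then show ?case by (intro nth_equalityI) (auto simp: nth_cols colset_simps)
next
  case (Cons r T)
  obtain S where S: "Cs = cols (length Cs) S" using cols_exists by blast
  let ?L = "length Cs"
  have len: "length r \<le> ?L" using Cons.prems by (simp add: row_fits_def)
  have "fills (rm_row Cs r) T" using Cons.prems by simp
  then have "rm_row Cs r = cols ?L (colset T)" using Cons.IH[of "rm_row Cs r"] by (simp only: length_rm_row)
  then have "cols ?L (\<lambda>c. if c < length r then S c - {r ! c} else S c) = cols ?L (colset T)"
    using rm_row_cols[OF len, of S] S by simp
  then have e: "\<And>c. c < ?L \<Longrightarrow> (if c < length r then S c - {r ! c} else S c) = colset T c"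
    by (simp add: cols_eq_iff)
  have "row_fits (cols ?L S) r" using Cons.prems S by simp
  then have m: "r ! c \<in> S c" if "c < length r" for c using row_fits_cols[OF len, of S] that by blast
  have "S c = colset (r # T) c" if "c < ?L" for c
    using e[OF that] m[of c] by (cases "c < length r") (auto simp: colset_simps)
  then have "cols ?L S = cols ?L (colset (r # T))" by (simp add: cols_eq_iff)
  then show ?case using S by simp
qed

text \<open>\<open>ok_pair\<close> says that no entry of a higher row in the same column lies
  between \<open>carry r j\<close> and \<open>r ! j\<close>. Among the entries left over by the rows
  below, \<open>r ! j\<close> is therefore the least one that is at least its right neighbour, and
  this is the greedy choice.\<close>

lemma fills_iff:
  assumes "\<forall>r\<in>set T. length r \<le> L \<and> (\<forall>x\<in>set r. 1 \<le> x)"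
  shows "fills (cols L (colset T)) T \<longleftrightarrow> (\<forall>r\<in>set T. ok_row r) \<and> sorted_wrt ok_pair T"
  using assms
proof (induction T)
  case Nil
  then show ?case by (auto simp: cols_def colset_simps)
next
  case (Cons r T)
  have len: "length r \<le> L" using Cons.prems by simp
  let ?S = "colset (r # T)"
  have disj: "cols L (\<lambda>c. if c < length r then ?S c - {r ! c} else ?S c) = cols L (colset T) \<longleftrightarrow> (\<forall>c<length r. r ! c \<notin> colset T c)"
    using len by (auto simp: cols_eq_iff colset_simps)
  have "fills (cols L ?S) (r # T) \<longleftrightarrow> row_fits (cols L ?S) r \<and> fills (rm_row (cols L ?S) r) T" by simp
  also have "\<dots> \<longleftrightarrow> row_fits (cols L ?S) r \<and> (\<forall>c<length r. r ! c \<notin> colset T c) \<and> fills (cols L (colset T)) T"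
  proof -
    have "fills (rm_row (cols L ?S) r) T \<longleftrightarrow> (\<forall>c<length r. r ! c \<notin> colset T c) \<and> fills (cols L (colset T)) T"
    proof
      assume f: "fills (rm_row (cols L ?S) r) T"
      then have e: "rm_row (cols L ?S) r = cols L (colset T)"
        using fills_cols[of "rm_row (cols L ?S) r" T] by simp
      have "\<forall>c<length r. r ! c \<notin> colset T c" using e disj unfolding rm_row_cols[OF len] by blast
      moreover have "fills (cols L (colset T)) T" using f unfolding e .
      ultimately show "(\<forall>c<length r. r ! c \<notin> colset T c) \<and> fills (cols L (colset T)) T" by blast
    next
      assume h: "(\<forall>c<length r. r ! c \<notin> colset T c) \<and> fills (cols L (colset T)) T"
      then have e: "rm_row (cols L ?S) r = cols L (colset T)" using disj unfolding rm_row_cols[OF len] by blast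
      show "fills (rm_row (cols L ?S) r) T" using h unfolding e by blast
    qed
    then show ?thesis by simp
  qed
  also have "\<dots> \<longleftrightarrow> (ok_row r \<and> (\<forall>s\<in>set T. ok_pair r s)) \<and> fills (cols L (colset T)) T"
  proof -
    have pos: "\<forall>x\<in>set r. 1 \<le> x" "\<And>s c. s \<in> colset T c \<Longrightarrow> 1 \<le> s" using Cons.prems by (auto simp: colset_def)
    have "row_fits (cols L ?S) r \<and> (\<forall>c<length r. r ! c \<notin> colset T c) \<longleftrightarrow>
       (\<forall>c<length r. carry r c \<le> r ! c \<and> (\<forall>s\<in>colset T c. r ! c \<noteq> s \<and> (s < r ! c \<longrightarrow> s < carry r c)))"
      unfolding row_fits_cols[OF len] by (auto simp: colset_simps) (meson not_le)+
    also have "\<dots> \<longleftrightarrow> ok_row r \<and> (\<forall>s\<in>set T. ok_pair r s)"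
      using pos(1) unfolding ok_row_def ok_pair_def colset_def by blast
    finally show ?thesis by blast
  qed
  finally show ?case using Cons by auto
qed

definition rows_flagged :: "(nat \<Rightarrow> nat) \<Rightarrow> nat list list \<Rightarrow> bool" where
  "rows_flagged \<phi> T \<longleftrightarrow> (\<forall>k<length T. \<forall>x\<in>set (T ! k). 1 \<le> x \<and> x \<le> \<phi> (Suc k))"

theorem SSKT_iff:
  "T \<in> SSKT \<alpha> \<phi> \<longleftrightarrow> map length T = \<alpha> \<and> rows_flagged \<phi> T \<and> fills (cols (ncols \<alpha>) (colset T)) T"
proof (cases "map length T = \<alpha>")
  case True
  have len: "length r \<le> ncols \<alpha>" if "r \<in> set T" for r
  proof -
    have "length r \<in> set (0 # \<alpha>)" using that True by auto
    then show ?thesis unfolding ncols_def by (intro Max_ge) auto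
  qed
  have fl: "flagged_tableau \<phi> T \<longleftrightarrow> (\<forall>k<length T. \<forall>x\<in>set (T ! k). x \<le> \<phi> (Suc k))"
  proof -
    have "flagged_tableau \<phi> T \<longleftrightarrow> (\<forall>i j. (i, j) \<in> boxes T \<longrightarrow> entry T i j \<le> \<phi> i)" by (auto simp: flagged_tableau_def)
    also have "\<dots> \<longleftrightarrow> (\<forall>i j. (Suc i, Suc j) \<in> boxes T \<longrightarrow> T ! i ! j \<le> \<phi> (Suc i))" (is "?A \<longleftrightarrow> ?B")
    proof
      assume ?A
      then show ?B by (metis entry_Suc)
    next
      assume B: ?B
      have "entry T i j \<le> \<phi> i" if b: "(i, j) \<in> boxes T" for i j
      proof -
        obtain i' j' where "i = Suc i'" "j = Suc j'" using b by (cases i; cases j) (auto simp: boxes_0)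
        then show ?thesis using B b entry_Suc by metis
      qed
      then show ?A by blast
    qed
    also have "\<dots> \<longleftrightarrow> (\<forall>k<length T. \<forall>x\<in>set (T ! k). x \<le> \<phi> (Suc k))"
      unfolding boxes_Suc by (metis in_set_conv_nth)
    finally show ?thesis .
  qed
  have pos: "(\<forall>k<length T. \<forall>x\<in>set (T ! k). 1 \<le> x) \<longleftrightarrow> (\<forall>r\<in>set T. \<forall>x\<in>set r. 1 \<le> x)"
    by (metis in_set_conv_nth)
  have "key_tableau T \<longleftrightarrow> (\<forall>r\<in>set T. \<forall>x\<in>set r. 1 \<le> x) \<and> fills (cols (ncols \<alpha>) (colset T)) T"
  proof (cases "\<forall>r\<in>set T. \<forall>x\<in>set r. 1 \<le> x")
    case True
    then show ?thesis using fills_iff[of T "ncols \<alpha>"] len key_tableau_iff by simp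
  next
    case False
    then show ?thesis unfolding key_tableau_iff ok_row_def by blast
  qed
  then show ?thesis using True fl pos unfolding SSKT_def shape_def rows_flagged_def by auto
qed (auto simp: SSKT_def shape_def)

lemma greedy_count:
  "greedy t Cs xs \<Longrightarrow> length (filter (\<lambda>C. b \<in> C) Cs) = count_list xs b + length (filter (\<lambda>C. b \<in> C) (rm Cs xs))"
  by (induction t Cs xs rule: greedy.induct) auto

text \<open>Each use of \<open>b\<close> removes it from one column, and in the end all columns are
  empty. So the weight depends on the column sets alone.\<close>

lemma fills_count: "fills Cs T \<Longrightarrow> count_list (concat T) b = length (filter (\<lambda>C. b \<in> C) Cs)"
proof (induction T arbitrary: Cs)
  case Nil
  then show ?case by (auto simp: filter_empty_conv)
next
  case (Cons r T)
  let ?k = "length Cs - length r"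
  have "length (filter (\<lambda>C. b \<in> C) (drop ?k Cs)) = count_list (rev r) b + length (filter (\<lambda>C. b \<in> C) (rm (drop ?k Cs) (rev r)))"
    using Cons.prems by (intro greedy_count[where t = 0]) (simp add: row_fits_def)
  moreover have "length (filter (\<lambda>C. b \<in> C) Cs) = length (filter (\<lambda>C. b \<in> C) (take ?k Cs)) + length (filter (\<lambda>C. b \<in> C) (drop ?k Cs))"
    by (metis append_take_drop_id filter_append length_append)
  moreover have "count_list (concat T) b = length (filter (\<lambda>C. b \<in> C) (rm_row Cs r))" using Cons by simp
  moreover have "count_list (rev r) b = count_list r b" by (metis count_mset mset_rev)
  ultimately show ?case by (simp add: rm_row_def)
qed


subsection \<open>Exchanging two adjacent rows\<close>

text \<open>Two rows choose from the same column, first with threshold \<open>p\<close>, then with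
  \<open>q\<close>. If the thresholds act in the other order, the same two entries are taken. Either
  each threshold keeps its entry, or the entries change owners, and then they are chosen in the
  original order.\<close>

lemma two_chains_step:
  fixes C :: "nat set"
  assumes x: "x \<in> C" "p \<le> x" "\<forall>s\<in>C. p \<le> s \<longrightarrow> x \<le> s"
    and y: "y \<in> C - {x}" "q \<le> y" "\<forall>s\<in>C - {x}. q \<le> s \<longrightarrow> y \<le> s"
  shows "(q \<le> y \<and> (\<forall>s\<in>C. q \<le> s \<longrightarrow> y \<le> s) \<and> (\<forall>s\<in>C - {y}. p \<le> s \<longrightarrow> x \<le> s)) \<or>
    (q \<le> x \<and> (\<forall>s\<in>C. q \<le> s \<longrightarrow> x \<le> s) \<and> p \<le> y \<and> (\<forall>s\<in>C - {x}. p \<le> s \<longrightarrow> y \<le> s))"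
proof (cases "p \<le> q")
  case True
  show ?thesis
  proof (cases "x < q")
    case True
    then show ?thesis using x y by auto
  next
    case False
    have "\<forall>s\<in>C - {x}. p \<le> s \<longrightarrow> y \<le> s" using x y False by (meson DiffD1 not_le order_trans)
    then show ?thesis using x y False True by (meson DiffD1 not_le order_trans)
  qed
next
  case False
  show ?thesis
  proof (cases "y < p")
    case True
    then show ?thesis using x y by (metis DiffD1 DiffI empty_iff insert_iff le_trans less_imp_le)
  next
    case yp: False
    have xy: "x \<le> y" using x y yp by auto
    have "\<forall>s\<in>C. q \<le> s \<longrightarrow> x \<le> s" using y xy by (metis DiffI empty_iff insert_iff order_refl order_trans)
    then show ?thesis using x y yp False by (meson not_le order_trans less_imp_le)
  qed
qed

text \<open>Until the entries change owners, the exchanged thresholds are handed on to the next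
  column; afterwards both rows can be copied.\<close>

lemma two_chains:
  "greedy p Cs xs \<Longrightarrow> greedy q (rm Cs xs) ys \<Longrightarrow> \<exists>xs' ys'. greedy q Cs xs' \<and> greedy p (rm Cs xs') ys' \<and>
     rm (rm Cs xs') ys' = rm (rm Cs xs) ys \<and> set xs' \<union> set ys' \<subseteq> set xs \<union> set ys"
proof (induction p Cs xs arbitrary: q ys rule: greedy.induct)
  case (1 p)
  then have "ys = []" by (cases ys) auto
  then show ?case by (intro exI[of _ "[]"]) auto
next
  case (2 p C Cs x xs)
  then obtain y ys' where ys: "ys = y # ys'" by (cases ys) auto
  have x: "x \<in> C" "p \<le> x" "\<forall>s\<in>C. p \<le> s \<longrightarrow> x \<le> s" "greedy x Cs xs" using "2.prems" by auto
  have y: "y \<in> C - {x}" "q \<le> y" "\<forall>s\<in>C - {x}. q \<le> s \<longrightarrow> y \<le> s" "greedy y (rm Cs xs) ys'" using "2.prems" ys by auto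
  from two_chains_step[OF x(1-3) y(1-3)] show ?case
  proof (elim disjE conjE)
    assume h: "\<forall>s\<in>C. q \<le> s \<longrightarrow> y \<le> s" "\<forall>s\<in>C - {y}. p \<le> s \<longrightarrow> x \<le> s"
    obtain us vs where uv: "greedy y Cs us" "greedy x (rm Cs us) vs" "rm (rm Cs us) vs = rm (rm Cs xs) ys'"
      "set us \<union> set vs \<subseteq> set xs \<union> set ys'" using "2.IH"[OF x(4) y(4)] by blast
    have "greedy q (C # Cs) (y # us) \<and> greedy p (rm (C # Cs) (y # us)) (x # vs) \<and>
       rm (rm (C # Cs) (y # us)) (x # vs) = rm (rm (C # Cs) (x # xs)) ys \<and> set (y # us) \<union> set (x # vs) \<subseteq> set (x # xs) \<union> set ys"
      using uv h x y ys by auto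
    then show ?thesis by blast
  next
    assume h: "q \<le> x" "\<forall>s\<in>C. q \<le> s \<longrightarrow> x \<le> s" "p \<le> y" "\<forall>s\<in>C - {x}. p \<le> s \<longrightarrow> y \<le> s"
    have "greedy q (C # Cs) (x # xs) \<and> greedy p (rm (C # Cs) (x # xs)) ys" using h x y ys by auto
    then show ?thesis by blast
  qed
qed auto

lemma greedy_append:
  "length A = length u \<Longrightarrow> greedy t (A @ B) (u @ v) \<longleftrightarrow> greedy t A u \<and> greedy (last (t # u)) B v"
proof (induction A u arbitrary: t rule: list_induct2)
  case (Cons x xs y ys)
  then show ?case by auto
qed simp

lemma rm_append: "length A = length u \<Longrightarrow> rm (A @ B) (u @ v) = rm A u @ rm B v"
  by (induction A u rule: list_induct2) auto

lemma greedy_split: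
  assumes "greedy t (A @ B) w" obtains u v where "w = u @ v" "length A = length u" "greedy t A u" "greedy (last (t # u)) B v"
proof -
  have "length w = length A + length B" using greedy_length[OF assms] by simp
  then have "w = take (length A) w @ drop (length A) w" "length A = length (take (length A) w)" by auto
  then show ?thesis using that assms greedy_append by metis
qed

text \<open>Seen from right to left, the longer row starts earlier and arrives at the first common
  column with the threshold \<open>last (0 # u)\<close>, where the shorter row starts with 0.
  Exchanging the lengths means exchanging these thresholds on the common columns
  \<open>suf\<close>.\<close>

lemma rows_exchange:
  assumes "row_fits Cs r" "row_fits (rm_row Cs r) s"
  shows "\<exists>r' s'. length r' = length s \<and> length s' = length r \<and> row_fits Cs r' \<and> row_fits (rm_row Cs r') s' \<and>
    rm_row (rm_row Cs r') s' = rm_row (rm_row Cs r) s \<and> set r' \<union> set s' \<subseteq> set r \<union> set s"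
proof -
  let ?L = "length Cs"
  consider "length r = length s" | "length r < length s" | "length s < length r" by linarith
  then show ?thesis
  proof cases
    case 1
    then have "length r = length s \<and> length s = length r \<and> row_fits Cs r \<and> row_fits (rm_row Cs r) s \<and>
      rm_row (rm_row Cs r) s = rm_row (rm_row Cs r) s \<and> set r \<union> set s \<subseteq> set r \<union> set s" using assms by simp
    then show ?thesis by (rule exI[of _ r, OF exI[of _ s]])
  next
    case 2
    have ls: "length s \<le> ?L" using assms by (simp add: row_fits_def)
    define pre where "pre = take (?L - length s) Cs"
    define mid where "mid = take (length s - length r) (drop (?L - length s) Cs)"
    define suf where "suf = drop (?L - length r) Cs"
    have e: "?L - length r = (?L - length s) + (length s - length r)" using 2 ls by simp
    have suf: "suf = drop (length s - length r) (drop (?L - length s) Cs)" by (simp add: suf_def e add.commute)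
    have len: "length pre = ?L - length s" "length mid = length s - length r" "length suf = length r"
      using 2 ls by (auto simp: pre_def mid_def suf_def)
    have d: "drop (?L - length r) Cs = suf" "take (?L - length r) Cs = pre @ mid"
      "drop (?L - length s) Cs = mid @ suf" "take (?L - length s) Cs = pre"
    proof -
      show "drop (?L - length r) Cs = suf" "take (?L - length s) Cs = pre" by (simp_all add: suf_def pre_def)
      show "take (?L - length r) Cs = pre @ mid" unfolding e take_add pre_def mid_def ..
      show "drop (?L - length s) Cs = mid @ suf" unfolding mid_def suf append_take_drop_id ..
    qed
    have r: "greedy 0 suf (rev r)" using assms(1) by (simp add: row_fits_def d)
    have R: "rm_row Cs r = pre @ mid @ rm suf (rev r)" by (simp add: rm_row_def d)
    have dR: "drop (?L - length s) (rm_row Cs r) = mid @ rm suf (rev r)" "take (?L - length s) (rm_row Cs r) = pre"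
      unfolding R using len by simp_all
    then have "greedy 0 (mid @ rm suf (rev r)) (rev s)" using assms(2) by (simp add: row_fits_def)
    from greedy_split[OF this] obtain u v where uv: "rev s = u @ v" "length mid = length u" "greedy 0 mid u"
      "greedy (last (0 # u)) (rm suf (rev r)) v" .
    obtain xs ys where xy: "greedy (last (0 # u)) suf xs" "greedy 0 (rm suf xs) ys"
       "rm (rm suf xs) ys = rm (rm suf (rev r)) v" "set xs \<union> set ys \<subseteq> set r \<union> set v"
      using two_chains[OF r uv(4)] by auto
    have lxy: "length xs = length r" "length ys = length r"
      using greedy_length[OF xy(1)] greedy_length[OF xy(2)] len by auto
    have lu: "length u = length s - length r" using uv(2) len by simp
    define r' where "r' = rev (u @ xs)"
    define s' where "s' = rev ys"
    have l': "length r' = length s" "length s' = length r" using lxy lu 2 by (auto simp: r'_def s'_def)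
    have rr: "rev r' = u @ xs" "rev s' = ys" by (simp_all add: r'_def s'_def)
    have f: "row_fits Cs r'" unfolding row_fits_def l' d rr greedy_append[OF uv(2)]
      using uv(3) xy(1) ls by blast
    have R': "rm_row Cs r' = pre @ rm mid u @ rm suf xs"
      unfolding rm_row_def l' d rr rm_append[OF uv(2)] ..
    have "drop (?L - length r) (rm_row Cs r') = rm suf xs" "take (?L - length r) (rm_row Cs r') = pre @ rm mid u"
      unfolding R' using len 2 ls by auto
    then have g: "row_fits (rm_row Cs r') s'" "rm_row (rm_row Cs r') s' = pre @ rm mid u @ rm (rm suf xs) ys"
      using xy(2) 2 ls by (simp_all add: row_fits_def rm_row_def[of "rm_row Cs r'"] l' rr)
    have "rm_row (rm_row Cs r) s = pre @ rm mid u @ rm (rm suf (rev r)) v"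
      unfolding rm_row_def[of "rm_row Cs r"] length_rm_row dR uv(1) rm_append[OF uv(2)] ..
    moreover have "set r' \<union> set s' \<subseteq> set r \<union> set s"
      using xy(4) arg_cong[OF uv(1), of set] by (auto simp: r'_def s'_def)
    ultimately show ?thesis using l' f g xy(3) by metis
  next
    case 3
    have lr: "length r \<le> ?L" using assms by (simp add: row_fits_def)
    define pre where "pre = take (?L - length r) Cs"
    define mid where "mid = take (length r - length s) (drop (?L - length r) Cs)"
    define suf where "suf = drop (?L - length s) Cs"
    have e: "?L - length s = (?L - length r) + (length r - length s)" using 3 lr by simp
    have suf: "suf = drop (length r - length s) (drop (?L - length r) Cs)" by (simp add: suf_def e add.commute)
    have len: "length pre = ?L - length r" "length mid = length r - length s" "length suf = length s"
      using 3 lr by (auto simp: pre_def mid_def suf_def)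
    have d: "drop (?L - length s) Cs = suf" "take (?L - length s) Cs = pre @ mid"
      "drop (?L - length r) Cs = mid @ suf" "take (?L - length r) Cs = pre"
    proof -
      show "drop (?L - length s) Cs = suf" "take (?L - length r) Cs = pre" by (simp_all add: suf_def pre_def)
      show "take (?L - length s) Cs = pre @ mid" unfolding e take_add pre_def mid_def ..
      show "drop (?L - length r) Cs = mid @ suf" unfolding mid_def suf append_take_drop_id ..
    qed
    have "greedy 0 (mid @ suf) (rev r)" using assms(1) by (simp add: row_fits_def d)
    from greedy_split[OF this] obtain u v where uv: "rev r = u @ v" "length mid = length u" "greedy 0 mid u"
      "greedy (last (0 # u)) suf v" .
    have R: "rm_row Cs r = pre @ rm mid u @ rm suf v" by (simp add: rm_row_def d uv(1) rm_append[OF uv(2)])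
    have dR: "drop (?L - length s) (rm_row Cs r) = rm suf v" "take (?L - length s) (rm_row Cs r) = pre @ rm mid u"
      unfolding R using len 3 lr by auto
    then have s: "greedy 0 (rm suf v) (rev s)" using assms(2) by (simp add: row_fits_def)
    obtain xs ys where xy: "greedy 0 suf xs" "greedy (last (0 # u)) (rm suf xs) ys"
       "rm (rm suf xs) ys = rm (rm suf v) (rev s)" "set xs \<union> set ys \<subseteq> set v \<union> set s"
      using two_chains[OF uv(4) s] by auto
    have lxy: "length xs = length s" "length ys = length s"
      using greedy_length[OF xy(1)] greedy_length[OF xy(2)] len by auto
    have lu: "length u = length r - length s" using uv(2) len by simp
    define r' where "r' = rev xs"
    define s' where "s' = rev (u @ ys)"
    have l': "length r' = length s" "length s' = length r" using lxy lu 3 by (auto simp: r'_def s'_def)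
    have rr: "rev r' = xs" "rev s' = u @ ys" by (simp_all add: r'_def s'_def)
    have f: "row_fits Cs r'" unfolding row_fits_def l' d rr using xy(1) 3 lr by simp
    have R': "rm_row Cs r' = pre @ mid @ rm suf xs" unfolding rm_row_def l' d rr by simp
    have "drop (?L - length r) (rm_row Cs r') = mid @ rm suf xs" "take (?L - length r) (rm_row Cs r') = pre"
      unfolding R' using len by auto
    then have g: "row_fits (rm_row Cs r') s'" "rm_row (rm_row Cs r') s' = pre @ rm mid u @ rm (rm suf xs) ys"
      using xy(2) uv(3) lr
      by (simp_all only: row_fits_def rm_row_def[of "rm_row Cs r'"] l' rr greedy_append[OF uv(2)] rm_append[OF uv(2)]
        length_rm_row simp_thms append_assoc)
    have "rm_row (rm_row Cs r) s = pre @ rm mid u @ rm (rm suf v) (rev s)"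
      unfolding rm_row_def[of "rm_row Cs r"] using dR by simp
    moreover have "set r' \<union> set s' \<subseteq> set r \<union> set s"
      using xy(4) arg_cong[OF uv(1), of set] by (auto simp: r'_def s'_def)
    ultimately show ?thesis using l' f g xy(3) by metis
  qed
qed

lemma fills_exchange:
  "fills Cs T \<Longrightarrow> Suc i < length T \<Longrightarrow> \<exists>T'. fills Cs T' \<and> map length T' = swp (map length T) i \<and>
     (\<forall>k<length T. k \<noteq> i \<longrightarrow> k \<noteq> Suc i \<longrightarrow> T' ! k = T ! k) \<and>
     set (T' ! i) \<union> set (T' ! Suc i) \<subseteq> set (T ! i) \<union> set (T ! Suc i)"
proof (induction i arbitrary: Cs T)
  case 0
  then obtain r s S where T: "T = r # s # S" by (cases T; cases "tl T") auto
  then have h: "row_fits Cs r" "row_fits (rm_row Cs r) s" "fills (rm_row (rm_row Cs r) s) S" using 0 by auto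
  obtain r' s' where rs: "length r' = length s" "length s' = length r" "row_fits Cs r'" "row_fits (rm_row Cs r') s'"
    "rm_row (rm_row Cs r') s' = rm_row (rm_row Cs r) s" "set r' \<union> set s' \<subseteq> set r \<union> set s"
    using rows_exchange[OF h(1,2)] by blast
  have "fills Cs (r' # s' # S)" using rs h by simp
  moreover have "map length (r' # s' # S) = swp (map length T) 0" using rs T by (simp add: swp_def)
  moreover have "(r' # s' # S) ! k = T ! k" if "k \<noteq> 0" "k \<noteq> Suc 0" for k
    using that T by (cases k) (auto simp: nth_Cons split: nat.splits)
  ultimately show ?case using rs(6) T by (intro exI[of _ "r' # s' # S"]) auto
next
  case (Suc i)
  then obtain r S where T: "T = r # S" by (cases T) auto
  then obtain S' where S': "fills (rm_row Cs r) S'" "map length S' = swp (map length S) i"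
     "\<forall>k<length S. k \<noteq> i \<longrightarrow> k \<noteq> Suc i \<longrightarrow> S' ! k = S ! k"
     "set (S' ! i) \<union> set (S' ! Suc i) \<subseteq> set (S ! i) \<union> set (S ! Suc i)"
    using Suc.IH[of "rm_row Cs r" S] Suc.prems by auto
  have "map length (r # S') = swp (map length T) (Suc i)" using S'(2) T by (simp add: swp_def)
  moreover have "(r # S') ! k = T ! k" if "k < length T" "k \<noteq> Suc i" "k \<noteq> Suc (Suc i)" for k
    using that T S'(3) by (cases k) auto
  ultimately show ?case using S' T Suc.prems by (intro exI[of _ "r # S'"]) auto
qed

lemma ncols_swp: "Suc i < length \<alpha> \<Longrightarrow> ncols (swp \<alpha> i) = ncols \<alpha>"
proof -
  assume i: "Suc i < length \<alpha>"
  have "mset (swp \<alpha> i) = mset \<alpha>" unfolding swp_def by (rule mset_swap) (use i in auto)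
  then have "set (swp \<alpha> i) = set \<alpha>" by (metis set_mset_mset)
  then show ?thesis by (simp add: ncols_def)
qed

text \<open>The exchange keeps the column sets, which together with the shape determine the tableau;
  hence it is injective.\<close>

lemma card_SSKT_swp_le:
  assumes i: "Suc i < length \<alpha>" and flag: "\<phi> (Suc i) = \<phi> (Suc (Suc i))"
  shows "card {T \<in> SSKT \<alpha> \<phi>. count_list (concat T) = w} \<le> card {T \<in> SSKT (swp \<alpha> i) \<phi>. count_list (concat T) = w}"
proof -
  let ?L = "ncols \<alpha>"
  have ex: "\<exists>T'. T' \<in> SSKT (swp \<alpha> i) \<phi> \<and> count_list (concat T') = count_list (concat T) \<and> cols ?L (colset T') = cols ?L (colset T)"
    if T: "T \<in> SSKT \<alpha> \<phi>" for T
  proof -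
    have h: "map length T = \<alpha>" "rows_flagged \<phi> T" "fills (cols ?L (colset T)) T" using T SSKT_iff by blast+
    have il: "Suc i < length T" using i h(1) by auto
    obtain T' where T': "fills (cols ?L (colset T)) T'" "map length T' = swp \<alpha> i"
       "\<forall>k<length T. k \<noteq> i \<longrightarrow> k \<noteq> Suc i \<longrightarrow> T' ! k = T ! k"
       "set (T' ! i) \<union> set (T' ! Suc i) \<subseteq> set (T ! i) \<union> set (T ! Suc i)"
      using fills_exchange[OF h(3) il] h(1) by auto
    have len: "length T' = length T" using T'(2) h(1) by (metis length_map swp_simps(1))
    have c: "cols ?L (colset T') = cols ?L (colset T)" using fills_cols[OF T'(1)] by simp
    have "rows_flagged \<phi> T'"
      unfolding rows_flagged_def
    proof (intro allI impI ballI)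
      fix k x assume k: "k < length T'" "x \<in> set (T' ! k)"
      show "1 \<le> x \<and> x \<le> \<phi> (Suc k)"
      proof (cases "k = i \<or> k = Suc i")
        case True
        then have "x \<in> set (T ! i) \<union> set (T ! Suc i)" using T'(4) k by auto
        then have "1 \<le> x \<and> x \<le> \<phi> (Suc i)"
          using h(2)[unfolded rows_flagged_def, rule_format, of i x]
            h(2)[unfolded rows_flagged_def, rule_format, of "Suc i" x] flag il by auto
        then show ?thesis using True flag by auto
      next
        case False
        then show ?thesis using T'(3) k h(2) len by (auto simp: rows_flagged_def)
      qed
    qed
    then have "T' \<in> SSKT (swp \<alpha> i) \<phi>" using T'(1,2) c ncols_swp[OF i] by (simp add: SSKT_iff)
    moreover have "count_list (concat T') = count_list (concat T)"
      using fills_count[OF T'(1)] fills_count[OF h(3)] by auto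
    ultimately show ?thesis using c by blast
  qed
  then obtain f where f: "\<And>T. T \<in> SSKT \<alpha> \<phi> \<Longrightarrow> f T \<in> SSKT (swp \<alpha> i) \<phi> \<and> count_list (concat (f T)) = count_list (concat T) \<and> cols ?L (colset (f T)) = cols ?L (colset T)"
    by metis
  show ?thesis
  proof (rule card_inj_on_le[of f])
    show "inj_on f {T \<in> SSKT \<alpha> \<phi>. count_list (concat T) = w}"
    proof (rule inj_onI)
      fix T U assume TU: "T \<in> {T \<in> SSKT \<alpha> \<phi>. count_list (concat T) = w}" "U \<in> {T \<in> SSKT \<alpha> \<phi>. count_list (concat T) = w}" "f T = f U"
      then have "cols ?L (colset T) = cols ?L (colset U)" using f by (metis (mono_tags, lifting) mem_Collect_eq)
      then show "T = U" using TU fills_unique[of "cols ?L (colset T)" T U] SSKT_iff by auto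
    qed
    show "f ` {T \<in> SSKT \<alpha> \<phi>. count_list (concat T) = w} \<subseteq> {T \<in> SSKT (swp \<alpha> i) \<phi>. count_list (concat T) = w}"
      using f by auto
    show "finite {T \<in> SSKT (swp \<alpha> i) \<phi>. count_list (concat T) = w}" using finite_SSKT by simp
  qed
qed

theorem card_SSKT_swp:
  assumes i: "Suc i < length \<alpha>" and flag: "\<phi> (Suc i) = \<phi> (Suc (Suc i))"
  shows "card {T \<in> SSKT \<alpha> \<phi>. count_list (concat T) = w} = card {T \<in> SSKT (swp \<alpha> i) \<phi>. count_list (concat T) = w}"
proof -
  have "swp (swp \<alpha> i) i = \<alpha>"
    using i by (intro nth_equalityI) (auto simp: swp_def nth_list_update)
  then show ?thesis
    using card_SSKT_swp_le[OF assms, of w] card_SSKT_swp_le[of i "swp \<alpha> i" \<phi> w] assms by simp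
qed

section \<open>Strings of key tableaux\<close>

definition ct :: "nat \<Rightarrow> nat set \<Rightarrow> bracket" where
  "ct a C = (if Suc a \<in> C \<and> a \<notin> C then Opn else if a \<in> C \<and> Suc a \<notin> C then Cls else Neu)"

text \<open>\<open>rel a x y Cs Ds\<close>: the columns differ only by replacements of \<open>a\<close> and \<open>a + 1\<close> at unmatched brackets,
  where matching is interrupted by the columns that contain neither of the two letters (a row that
  reaches such a column leaves the letters \<open>a\<close>, \<open>a + 1\<close> for good);
  \<open>x\<close> and \<open>y\<close> count the opening brackets that are pending on the two sides.\<close>

inductive rel :: "nat \<Rightarrow> nat \<Rightarrow> nat \<Rightarrow> nat set list \<Rightarrow> nat set list \<Rightarrow> bool" for a where
  rel_nil: "rel a x y [] []"
| rel_none: "a \<notin> C \<Longrightarrow> Suc a \<notin> C \<Longrightarrow> rel a 0 0 Cs Ds \<Longrightarrow> rel a x y (C # Cs) (C # Ds)"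
| rel_both: "a \<in> C \<Longrightarrow> Suc a \<in> C \<Longrightarrow> rel a x y Cs Ds \<Longrightarrow> rel a x y (C # Cs) (C # Ds)"
| rel_opn: "a \<notin> C \<Longrightarrow> Suc a \<in> C \<Longrightarrow> rel a (Suc x) (Suc y) Cs Ds \<Longrightarrow> rel a x y (C # Cs) (C # Ds)"
| rel_cls: "a \<in> C \<Longrightarrow> Suc a \<notin> C \<Longrightarrow> x > 0 \<longleftrightarrow> y > 0 \<Longrightarrow> rel a (x - 1) (y - 1) Cs Ds \<Longrightarrow> rel a x y (C # Cs) (C # Ds)"
| rel_co: "a \<in> C \<Longrightarrow> Suc a \<notin> C \<Longrightarrow> D = insert (Suc a) (C - {a}) \<Longrightarrow> rel a 0 (Suc y) Cs Ds \<Longrightarrow> rel a 0 y (C # Cs) (D # Ds)"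
| rel_oc: "a \<notin> C \<Longrightarrow> Suc a \<in> C \<Longrightarrow> D = insert a (C - {Suc a}) \<Longrightarrow> rel a (Suc x) 0 Cs Ds \<Longrightarrow> rel a x 0 (C # Cs) (D # Ds)"

lemma rel_sym: "rel a x y Cs Ds \<Longrightarrow> rel a y x Ds Cs"
proof (induction rule: rel.induct)
  case (rel_co C D y Cs Ds)
  then show ?case by (intro rel.rel_oc) auto
next
  case (rel_oc C D x Cs Ds)
  then show ?case by (intro rel.rel_co) auto
qed (auto intro: rel.intros)

lemma rel_refl: "rel a x x Cs Cs"
proof (induction Cs arbitrary: x)
  case (Cons C Cs)
  then show ?case
    by (cases "a \<in> C"; cases "Suc a \<in> C") (auto intro: rel.intros)
qed (rule rel_nil)

section \<open>Greedy rows through related columns\<close>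

definition agree :: "nat \<Rightarrow> nat \<Rightarrow> nat \<Rightarrow> bool" where
  "agree a u v \<longleftrightarrow> u = v \<or> u \<in> {a, Suc a} \<and> v \<in> {a, Suc a}"

lemma agree_refl [simp]: "agree a u u" by (simp add: agree_def)

lemma list_agree_refl [simp]: "list_all2 (agree a) xs xs" by (simp add: list_all2_refl)

text \<open>The lowering of the counters under which \<open>rel\<close> persists. If the new
  counters differ, the smaller one must be unchanged; otherwise a closing bracket might become
  unmatched on one side only.\<close>

definition weaker :: "nat \<Rightarrow> nat \<Rightarrow> nat \<Rightarrow> nat \<Rightarrow> bool" where
  "weaker x y p q \<longleftrightarrow> p \<le> x \<and> q \<le> y \<and> (p < q \<longrightarrow> x = p) \<and> (q < p \<longrightarrow> y = q)"

lemma greedy_ConsE: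
  assumes "greedy t (C # Cs) xs"
  obtains x xs' where "xs = x # xs'" "x \<in> C" "t \<le> x" "\<forall>s\<in>C. t \<le> s \<longrightarrow> x \<le> s" "greedy x Cs xs'"
  using assms by (cases xs) auto

lemma greedy_ConsI:
  "x \<in> C \<Longrightarrow> t \<le> x \<Longrightarrow> (\<And>s. s \<in> C \<Longrightarrow> t \<le> s \<Longrightarrow> x \<le> s) \<Longrightarrow> greedy x Cs xs \<Longrightarrow> greedy t (C # Cs) (x # xs)"
  by simp

lemma greedy_Nil: "greedy t [] xs \<longleftrightarrow> xs = []" by (cases xs) auto

text \<open>Above \<open>a + 1\<close> the two lists have the same entries, so both sides choose the
  same row. Lowered counters are allowed for because the row may have taken an \<open>a + 1\<close>
  away in an earlier column.\<close>

lemma chain_above: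
  "rel a x y Cs Ds \<Longrightarrow> weaker x y p q \<Longrightarrow> Suc a < t \<Longrightarrow> greedy t Cs xs \<Longrightarrow>
     greedy t Ds xs \<and> rel a p q (rm Cs xs) (rm Ds xs)"
proof (induction arbitrary: p q t xs rule: rel.induct)
  case (rel_nil x y)
  then show ?case by (auto simp: greedy_Nil intro: rel.rel_nil)
next
  case (rel_none C Cs Ds x y)
  from greedy_ConsE[OF rel_none.prems(3)] obtain z zs where z: "xs = z # zs" "z \<in> C" "t \<le> z" "\<forall>s\<in>C. t \<le> s \<longrightarrow> z \<le> s" "greedy z Cs zs" .
  have "greedy z Ds zs \<and> rel a 0 0 (rm Cs zs) (rm Ds zs)"
    using rel_none.IH[of 0 0 z zs] rel_none.prems z by (simp add: weaker_def)
  then show ?case using z rel_none by (auto intro!: rel.rel_none)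
next
  case (rel_both C x y Cs Ds)
  from greedy_ConsE[OF rel_both.prems(3)] obtain z zs where z: "xs = z # zs" "z \<in> C" "t \<le> z" "\<forall>s\<in>C. t \<le> s \<longrightarrow> z \<le> s" "greedy z Cs zs" .
  have "greedy z Ds zs \<and> rel a p q (rm Cs zs) (rm Ds zs)"
    using rel_both.IH[of p q z zs] rel_both.prems z by simp
  then show ?case using z rel_both by (auto intro!: rel.rel_both)
next
  case (rel_opn C x y Cs Ds)
  from greedy_ConsE[OF rel_opn.prems(3)] obtain z zs where z: "xs = z # zs" "z \<in> C" "t \<le> z" "\<forall>s\<in>C. t \<le> s \<longrightarrow> z \<le> s" "greedy z Cs zs" .
  have "greedy z Ds zs \<and> rel a (Suc p) (Suc q) (rm Cs zs) (rm Ds zs)"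
    using rel_opn.IH[of "Suc p" "Suc q" z zs] rel_opn.prems z by (simp add: weaker_def)
  then show ?case using z rel_opn by (auto intro!: rel.rel_opn)
next
  case (rel_cls C x y Cs Ds)
  from greedy_ConsE[OF rel_cls.prems(3)] obtain z zs where z: "xs = z # zs" "z \<in> C" "t \<le> z" "\<forall>s\<in>C. t \<le> s \<longrightarrow> z \<le> s" "greedy z Cs zs" .
  have w: "weaker (x - 1) (y - 1) (p - 1) (q - 1)" "p > 0 \<longleftrightarrow> q > 0"
    using rel_cls.prems(1) rel_cls.hyps(3) by (auto simp: weaker_def)
  have "greedy z Ds zs \<and> rel a (p - 1) (q - 1) (rm Cs zs) (rm Ds zs)"
    using rel_cls.IH[OF w(1), of z zs] rel_cls.prems z by simp
  then show ?case using z rel_cls w(2) by (auto intro!: rel.rel_cls)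
next
  case (rel_co C D y Cs Ds)
  from greedy_ConsE[OF rel_co.prems(3)] obtain z zs where z: "xs = z # zs" "z \<in> C" "t \<le> z" "\<forall>s\<in>C. t \<le> s \<longrightarrow> z \<le> s" "greedy z Cs zs" .
  have w: "weaker 0 (Suc y) 0 (Suc q)" "p = 0" using rel_co.prems(1) by (auto simp: weaker_def)
  have "greedy z Ds zs \<and> rel a 0 (Suc q) (rm Cs zs) (rm Ds zs)"
    using rel_co.IH[OF w(1), of z zs] rel_co.prems z by simp
  then show ?case using z rel_co w(2) by (auto intro!: rel.rel_co)
next
  case (rel_oc C D x Cs Ds)
  from greedy_ConsE[OF rel_oc.prems(3)] obtain z zs where z: "xs = z # zs" "z \<in> C" "t \<le> z" "\<forall>s\<in>C. t \<le> s \<longrightarrow> z \<le> s" "greedy z Cs zs" .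
  have w: "weaker (Suc x) 0 (Suc p) 0" "q = 0" using rel_oc.prems(1) by (auto simp: weaker_def)
  have "greedy z Ds zs \<and> rel a (Suc p) 0 (rm Cs zs) (rm Ds zs)"
    using rel_oc.IH[OF w(1), of z zs] rel_oc.prems z by simp
  then show ?case using z rel_oc w(2) by (auto intro!: rel.rel_oc)
qed

definition sim :: "nat \<Rightarrow> nat \<Rightarrow> nat \<Rightarrow> nat set list \<Rightarrow> nat set list \<Rightarrow> nat list \<Rightarrow> nat list \<Rightarrow> bool" where
  "sim a p q Cs Ds xs ys \<longleftrightarrow> list_all2 (agree a) xs ys \<and> rel a p q (rm Cs xs) (rm Ds ys)"

lemma simI: "list_all2 (agree a) xs ys \<Longrightarrow> rel a p q (rm Cs xs) (rm Ds ys) \<Longrightarrow> sim a p q Cs Ds xs ys"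
  by (simp add: sim_def)

text \<open>From a column without \<open>a\<close> and \<open>a + 1\<close>, both thresholds lead to
  the same entry above \<open>a + 1\<close>. Such a column resets the counters, hence
  \<open>p\<close> and \<open>q\<close> are arbitrary.\<close>

lemma chain_jump:
  assumes C: "a \<notin> C" "Suc a \<notin> C" and rel: "rel a 0 0 Cs Ds" and t: "t \<in> {a, Suc a}" "t' \<in> {a, Suc a}"
    and g: "greedy t (C # Cs) xs"
  shows "greedy t' (C # Ds) xs \<and> sim a p q (C # Cs) (C # Ds) xs xs"
proof -
  from greedy_ConsE[OF g] obtain z zs where z: "xs = z # zs" "z \<in> C" "t \<le> z" "\<forall>s\<in>C. t \<le> s \<longrightarrow> z \<le> s" "greedy z Cs zs" .
  have az: "Suc a < z" using z(2,3) t C by (metis Suc_leI empty_iff insert_iff le_neq_implies_less)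
  have ge: "z \<le> s" if "s \<in> C" "t' \<le> s" for s
  proof -
    have "s \<noteq> a" "s \<noteq> Suc a" using that C by auto
    then have "t \<le> s" using that(2) t by auto
    then show ?thesis using z(4) that by blast
  qed
  have "weaker 0 0 0 0" by (simp add: weaker_def)
  from chain_above[OF rel this az z(5)] have h: "greedy z Ds zs" "rel a 0 0 (rm Cs zs) (rm Ds zs)" by auto
  have "greedy t' (C # Ds) xs" unfolding z(1) using z(2) ge h(1) az t by (intro greedy_ConsI) auto
  moreover have "rel a p q (rm (C # Cs) xs) (rm (C # Ds) xs)" unfolding z(1) using C h by (auto intro!: rel.rel_none)
  ultimately show ?thesis by (auto intro: simI)
qed

lemma min_Suc: "Suc a \<in> C \<Longrightarrow> greedy (Suc a) (C # Cs) xs \<longleftrightarrow> (\<exists>zs. xs = Suc a # zs \<and> greedy (Suc a) Cs zs)"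
  by (cases xs) (auto intro: le_antisym)

lemma min_a: "a \<in> C \<Longrightarrow> greedy a (C # Cs) xs \<longleftrightarrow> (\<exists>zs. xs = a # zs \<and> greedy a Cs zs)"
  by (cases xs) (auto intro: le_antisym)

lemma min_a_Suc: "a \<notin> C \<Longrightarrow> Suc a \<in> C \<Longrightarrow> greedy a (C # Cs) xs \<longleftrightarrow> (\<exists>zs. xs = Suc a # zs \<and> greedy (Suc a) Cs zs)"
proof (cases xs)
  case (Cons z zs)
  assume C: "a \<notin> C" "Suc a \<in> C"
  have "(z \<in> C \<and> a \<le> z \<and> (\<forall>s\<in>C. a \<le> s \<longrightarrow> z \<le> s)) \<longleftrightarrow> z = Suc a"
  proof
    assume h: "z \<in> C \<and> a \<le> z \<and> (\<forall>s\<in>C. a \<le> s \<longrightarrow> z \<le> s)"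
    then have "z \<le> Suc a" "z \<noteq> a" using C by auto
    then show "z = Suc a" using h by simp
  next
    assume z: "z = Suc a"
    have "Suc a \<le> s" if "s \<in> C" "a \<le> s" for s using that C by (metis Suc_leI le_neq_implies_less)
    then show "z \<in> C \<and> a \<le> z \<and> (\<forall>s\<in>C. a \<le> s \<longrightarrow> z \<le> s)" using z C by simp
  qed
  then show ?thesis using Cons by auto
qed simp

text \<open>In this and the next two names, 0 and 1 stand for the thresholds \<open>a\<close> and
  \<open>a + 1\<close> on the two sides. A row reaches the threshold \<open>a + 1\<close> by taking
  that letter from a column without \<open>a\<close>; this column is left with neither letter and
  interrupts the matching, which explains the counters 0 in the conclusion.\<close>

lemma chain_11:
  "rel a x y Cs Ds \<Longrightarrow> x > 0 \<Longrightarrow> y > 0 \<Longrightarrow> greedy (Suc a) Cs xs \<Longrightarrow>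
     \<exists>ys. greedy (Suc a) Ds ys \<and> sim a 0 0 Cs Ds xs ys"
proof (induction arbitrary: xs rule: rel.induct)
  case (rel_nil x y)
  then show ?case by (auto simp: greedy_Nil sim_def intro: rel.rel_nil)
next
  case (rel_none C Cs Ds x y)
  then show ?case using chain_jump[of a C Cs Ds "Suc a" "Suc a" xs 0 0] by auto
next
  case (rel_both C x y Cs Ds)
  then obtain zs where z: "xs = Suc a # zs" "greedy (Suc a) Cs zs" using min_Suc by blast
  then obtain ws where w: "greedy (Suc a) Ds ws" "sim a 0 0 Cs Ds zs ws" using rel_both.IH rel_both.prems by blast
  have "greedy (Suc a) (C # Ds) (Suc a # ws)" using min_Suc rel_both.hyps w by blast
  moreover have "rel a 0 0 ((C - {Suc a}) # rm Cs zs) ((C - {Suc a}) # rm Ds ws)"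
    using rel_both.hyps w(2) by (intro rel.rel_cls) (auto simp: sim_def)
  ultimately show ?case using w(2) z by (intro exI[of _ "Suc a # ws"]) (auto simp: sim_def)
next
  case (rel_opn C x y Cs Ds)
  then obtain zs where z: "xs = Suc a # zs" "greedy (Suc a) Cs zs" using min_Suc by blast
  then obtain ws where w: "greedy (Suc a) Ds ws" "sim a 0 0 Cs Ds zs ws" using rel_opn.IH by blast
  have "greedy (Suc a) (C # Ds) (Suc a # ws)" using min_Suc rel_opn.hyps w by blast
  moreover have "rel a 0 0 ((C - {Suc a}) # rm Cs zs) ((C - {Suc a}) # rm Ds ws)"
    using rel_opn.hyps w(2) by (intro rel.rel_none) (auto simp: sim_def)
  ultimately show ?case using w(2) z by (intro exI[of _ "Suc a # ws"]) (auto simp: sim_def)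
next
  case (rel_cls C x y Cs Ds)
  from greedy_ConsE[OF rel_cls.prems(3)] obtain z zs where z: "xs = z # zs" "z \<in> C" "Suc a \<le> z" "\<forall>s\<in>C. Suc a \<le> s \<longrightarrow> z \<le> s" "greedy z Cs zs" .
  have "Suc a < z" using z(2,3) rel_cls.hyps(2) by (metis le_neq_implies_less)
  moreover have "weaker (x - 1) (y - 1) 0 0" by (simp add: weaker_def)
  ultimately have h: "greedy z Ds zs" "rel a 0 0 (rm Cs zs) (rm Ds zs)" using chain_above[OF rel_cls.hyps(4)] z(5) by auto
  have "greedy (Suc a) (C # Ds) xs" unfolding z(1) using z h by (intro greedy_ConsI) auto
  moreover have "rel a 0 0 ((C - {z}) # rm Cs zs) ((C - {z}) # rm Ds zs)"
    using rel_cls.hyps h \<open>Suc a < z\<close> by (intro rel.rel_cls) auto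
  ultimately show ?case using z by (intro exI[of _ xs]) (auto simp: sim_def)
qed auto

text \<open>The row holds \<open>a\<close> on one side and \<open>a + 1\<close> on the other, as it
  does after a column in which the sides differ. In a column with both letters it removes different
  ones and so creates a new difference: a single change can spread. The two directions serve the
  cases \<open>rel_co\<close> and \<open>rel_oc\<close> of the following lemmas.\<close>

lemma chain_01:
  "rel a x y Cs Ds \<Longrightarrow> x = 0 \<Longrightarrow> y > 0 \<Longrightarrow>
     (\<forall>xs. greedy a Cs xs \<longrightarrow> (\<exists>ys. greedy (Suc a) Ds ys \<and> (\<forall>p. sim a p 0 Cs Ds xs ys))) \<and>
     (\<forall>ys. greedy (Suc a) Ds ys \<longrightarrow> (\<exists>xs. greedy a Cs xs \<and> (\<forall>p. sim a p 0 Cs Ds xs ys)))"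
proof (induction rule: rel.induct)
  case (rel_nil x y)
  then show ?case by (auto simp: greedy_Nil sim_def intro: rel.rel_nil)
next
  case (rel_none C Cs Ds x y)
  have "greedy (Suc a) (C # Ds) xs \<and> (\<forall>p. sim a p 0 (C # Cs) (C # Ds) xs xs)" if "greedy a (C # Cs) xs" for xs
    using chain_jump[OF rel_none.hyps, of a "Suc a" xs] that by auto
  moreover have "greedy a (C # Cs) ys \<and> (\<forall>p. sim a p 0 (C # Cs) (C # Ds) ys ys)" if "greedy (Suc a) (C # Ds) ys" for ys
  proof -
    have "greedy a (C # Cs) ys"
      using chain_jump[OF rel_none.hyps(1,2) rel_sym[OF rel_none.hyps(3)], of "Suc a" a ys] that by auto
    then show ?thesis using chain_jump[OF rel_none.hyps, of a "Suc a" ys] by auto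
  qed
  ultimately show ?case by blast
next
  case (rel_both C x y Cs Ds)
  have st: "sim a p 0 (C # Cs) (C # Ds) (a # zs) (Suc a # ws)" if "\<And>p. sim a p 0 Cs Ds zs ws" for zs ws p
  proof -
    have "rel a p 0 ((C - {a}) # rm Cs zs) ((C - {Suc a}) # rm Ds ws)"
      using rel_both.hyps that[of "Suc p"] by (intro rel.rel_oc) (auto simp: sim_def)
    then show ?thesis using that[of p] by (auto simp: sim_def agree_def)
  qed
  note IH = rel_both.IH[OF rel_both.prems]
  show ?case
  proof (intro conjI allI impI)
    fix xs assume "greedy a (C # Cs) xs"
    then obtain zs where z: "xs = a # zs" "greedy a Cs zs" using min_a rel_both.hyps by blast
    then obtain ws where w: "greedy (Suc a) Ds ws" "\<And>p. sim a p 0 Cs Ds zs ws" using IH by blast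
    then show "\<exists>ys. greedy (Suc a) (C # Ds) ys \<and> (\<forall>p. sim a p 0 (C # Cs) (C # Ds) xs ys)"
      using min_Suc[OF rel_both.hyps(2)] st z by blast
  next
    fix ys assume "greedy (Suc a) (C # Ds) ys"
    then obtain ws where z: "ys = Suc a # ws" "greedy (Suc a) Ds ws" using min_Suc rel_both.hyps by blast
    then obtain zs where w: "greedy a Cs zs" "\<And>p. sim a p 0 Cs Ds zs ws" using IH by blast
    then show "\<exists>xs. greedy a (C # Cs) xs \<and> (\<forall>p. sim a p 0 (C # Cs) (C # Ds) xs ys)"
      using min_a[OF rel_both.hyps(1)] st z by blast
  qed
next
  case (rel_opn C x y Cs Ds)
  have st: "sim a p 0 (C # Cs) (C # Ds) (Suc a # zs) (Suc a # ws)" if "sim a 0 0 Cs Ds zs ws" for zs ws p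
  proof -
    have "rel a p 0 ((C - {Suc a}) # rm Cs zs) ((C - {Suc a}) # rm Ds ws)"
      using rel_opn.hyps that by (intro rel.rel_none) (auto simp: sim_def)
    then show ?thesis using that by (auto simp: sim_def)
  qed
  show ?case
  proof (intro conjI allI impI)
    fix xs assume "greedy a (C # Cs) xs"
    then obtain zs where z: "xs = Suc a # zs" "greedy (Suc a) Cs zs" using min_a_Suc rel_opn.hyps by blast
    then obtain ws where w: "greedy (Suc a) Ds ws" "sim a 0 0 Cs Ds zs ws" using chain_11[OF rel_opn.hyps(3)] by blast
    then show "\<exists>ys. greedy (Suc a) (C # Ds) ys \<and> (\<forall>p. sim a p 0 (C # Cs) (C # Ds) xs ys)"
      using min_Suc[OF rel_opn.hyps(2)] st z by blast
  next
    fix ys assume "greedy (Suc a) (C # Ds) ys"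
    then obtain ws where z: "ys = Suc a # ws" "greedy (Suc a) Ds ws" using min_Suc rel_opn.hyps by blast
    then obtain zs where w0: "greedy (Suc a) Cs zs" using chain_11[OF rel_sym[OF rel_opn.hyps(3)]] by blast
    then obtain ws' where w: "greedy (Suc a) Ds ws'" "sim a 0 0 Cs Ds zs ws'" using chain_11[OF rel_opn.hyps(3)] by blast
    then have "ws' = ws" using z greedy_unique by blast
    then show "\<exists>xs. greedy a (C # Cs) xs \<and> (\<forall>p. sim a p 0 (C # Cs) (C # Ds) xs ys)"
      using min_a_Suc[OF rel_opn.hyps(1,2)] st z w w0 by blast
  qed
next
  case (rel_co C D y Cs Ds)
  have st: "sim a p 0 (C # Cs) (D # Ds) (a # zs) (Suc a # ws)" if "\<And>p. sim a p 0 Cs Ds zs ws" for zs ws p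
  proof -
    have "D - {Suc a} = C - {a}" using rel_co.hyps by auto
    then have "rel a p 0 ((C - {a}) # rm Cs zs) ((D - {Suc a}) # rm Ds ws)"
      using rel_co.hyps that[of 0] by (auto simp: sim_def intro!: rel.rel_none)
    then show ?thesis using that[of p] by (auto simp: sim_def agree_def)
  qed
  note IH = rel_co.IH[OF refl zero_less_Suc]
  have D: "Suc a \<in> D" using rel_co.hyps by simp
  show ?case
  proof (intro conjI allI impI)
    fix xs assume "greedy a (C # Cs) xs"
    then obtain zs where z: "xs = a # zs" "greedy a Cs zs" using min_a rel_co.hyps by blast
    then obtain ws where w: "greedy (Suc a) Ds ws" "\<And>p. sim a p 0 Cs Ds zs ws" using IH by blast
    then show "\<exists>ys. greedy (Suc a) (D # Ds) ys \<and> (\<forall>p. sim a p 0 (C # Cs) (D # Ds) xs ys)"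
      using min_Suc[OF D] st z by blast
  next
    fix ys assume "greedy (Suc a) (D # Ds) ys"
    then obtain ws where z: "ys = Suc a # ws" "greedy (Suc a) Ds ws" using min_Suc[OF D] by blast
    then obtain zs where w: "greedy a Cs zs" "\<And>p. sim a p 0 Cs Ds zs ws" using IH by blast
    then show "\<exists>xs. greedy a (C # Cs) xs \<and> (\<forall>p. sim a p 0 (C # Cs) (D # Ds) xs ys)"
      using min_a[OF rel_co.hyps(1)] st z by blast
  qed
qed auto

lemma sim_sym: "sim a p q Cs Ds xs ys \<Longrightarrow> sim a q p Ds Cs ys xs"
  unfolding sim_def using rel_sym by (auto simp: list_all2_conv_all_nth agree_def)

text \<open>Behind a row at the threshold \<open>a\<close>, a column with both letters becomes an
  opening bracket and the next column of any other kind is left with neither letter. The counters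
  are thus reset before a closing bracket can use them, which makes \<open>p\<close> and
  \<open>q\<close> arbitrary.\<close>

lemma chain_00:
  "rel a x y Cs Ds \<Longrightarrow> greedy a Cs xs \<Longrightarrow> \<exists>ys. greedy a Ds ys \<and> (\<forall>p q. sim a p q Cs Ds xs ys)"
proof (induction arbitrary: xs rule: rel.induct)
  case (rel_nil x y)
  then show ?case by (auto simp: greedy_Nil sim_def intro: rel.rel_nil)
next
  case (rel_none C Cs Ds x y)
  have "greedy a (C # Ds) xs \<and> (\<forall>p q. sim a p q (C # Cs) (C # Ds) xs xs)"
    using chain_jump[OF rel_none.hyps, of a a xs] rel_none.prems by auto
  then show ?case by blast
next
  case (rel_both C x y Cs Ds)
  then obtain zs where z: "xs = a # zs" "greedy a Cs zs" using min_a by blast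
  then obtain ws where w: "greedy a Ds ws" "\<And>p q. sim a p q Cs Ds zs ws" using rel_both.IH by blast
  have "greedy a (C # Ds) (a # ws)" using min_a rel_both.hyps w by blast
  moreover have "sim a p q (C # Cs) (C # Ds) (a # zs) (a # ws)" for p q
  proof -
    have "rel a p q ((C - {a}) # rm Cs zs) ((C - {a}) # rm Ds ws)"
      using rel_both.hyps w(2)[of "Suc p" "Suc q"] by (intro rel.rel_opn) (auto simp: sim_def)
    then show ?thesis using w(2)[of p q] by (auto simp: sim_def)
  qed
  ultimately show ?case using z by blast
next
  case (rel_opn C x y Cs Ds)
  then obtain zs where z: "xs = Suc a # zs" "greedy (Suc a) Cs zs" using min_a_Suc by blast
  then obtain ws where w: "greedy (Suc a) Ds ws" "sim a 0 0 Cs Ds zs ws" using chain_11[OF rel_opn.hyps(3)] by blast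
  have "greedy a (C # Ds) (Suc a # ws)" using min_a_Suc rel_opn.hyps w by blast
  moreover have "sim a p q (C # Cs) (C # Ds) (Suc a # zs) (Suc a # ws)" for p q
  proof -
    have "rel a p q ((C - {Suc a}) # rm Cs zs) ((C - {Suc a}) # rm Ds ws)"
      using rel_opn.hyps w(2) by (intro rel.rel_none) (auto simp: sim_def)
    then show ?thesis using w(2) by (auto simp: sim_def)
  qed
  ultimately show ?case using z by blast
next
  case (rel_cls C x y Cs Ds)
  then obtain zs where z: "xs = a # zs" "greedy a Cs zs" using min_a by blast
  then obtain ws where w: "greedy a Ds ws" "\<And>p q. sim a p q Cs Ds zs ws" using rel_cls.IH by blast
  have "greedy a (C # Ds) (a # ws)" using min_a rel_cls.hyps w by blast
  moreover have "sim a p q (C # Cs) (C # Ds) (a # zs) (a # ws)" for p q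
  proof -
    have "rel a p q ((C - {a}) # rm Cs zs) ((C - {a}) # rm Ds ws)"
      using rel_cls.hyps w(2)[of 0 0] by (intro rel.rel_none) (auto simp: sim_def)
    then show ?thesis using w(2)[of p q] by (auto simp: sim_def)
  qed
  ultimately show ?case using z by blast
next
  case (rel_co C D y Cs Ds)
  then obtain zs where z: "xs = a # zs" "greedy a Cs zs" using min_a by blast
  then obtain ws where w: "greedy (Suc a) Ds ws" "\<And>p. sim a p 0 Cs Ds zs ws"
    using chain_01[OF rel_co.hyps(4)] by blast
  have "a \<notin> D" "Suc a \<in> D" "D - {Suc a} = C - {a}" using rel_co.hyps by auto
  then have "greedy a (D # Ds) (Suc a # ws)" using min_a_Suc w by blast
  moreover have "sim a p q (C # Cs) (D # Ds) (a # zs) (Suc a # ws)" for p q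
  proof -
    have "rel a p q ((C - {a}) # rm Cs zs) ((D - {Suc a}) # rm Ds ws)"
      unfolding \<open>D - {Suc a} = C - {a}\<close> using rel_co.hyps w(2)[of 0] by (intro rel.rel_none) (auto simp: sim_def)
    then show ?thesis using w(2)[of p] by (auto simp: sim_def agree_def)
  qed
  ultimately show ?case using z by blast
next
  case (rel_oc C D x Cs Ds)
  then obtain zs where z: "xs = Suc a # zs" "greedy (Suc a) Cs zs" using min_a_Suc by blast
  then obtain ws where w: "greedy a Ds ws" "\<And>p. sim a p 0 Ds Cs ws zs"
    using chain_01[OF rel_sym[OF rel_oc.hyps(4)]] by blast
  have "a \<in> D" "D - {a} = C - {Suc a}" using rel_oc.hyps by auto
  then have "greedy a (D # Ds) (a # ws)" using min_a w by blast
  moreover have "sim a p q (C # Cs) (D # Ds) (Suc a # zs) (a # ws)" for p q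
  proof -
    have s: "sim a 0 0 Cs Ds zs ws" by (rule sim_sym[OF w(2)])
    have "rel a p q ((C - {Suc a}) # rm Cs zs) ((D - {a}) # rm Ds ws)"
      unfolding \<open>D - {a} = C - {Suc a}\<close> using rel_oc.hyps s by (intro rel.rel_none) (auto simp: sim_def)
    then show ?thesis using s by (auto simp: sim_def agree_def)
  qed
  ultimately show ?case using z by blast
qed


text \<open>As long as it stays below \<open>a\<close>, the row does not affect the brackets; where
  it takes \<open>a\<close> or \<open>a + 1\<close> or jumps beyond, the lemma for the respective
  thresholds takes over.\<close>

lemma chain_below:
  "rel a x y Cs Ds \<Longrightarrow> t < a \<Longrightarrow> greedy t Cs xs \<Longrightarrow> \<exists>ys. greedy t Ds ys \<and> sim a x y Cs Ds xs ys"
proof (induction arbitrary: t xs rule: rel.induct)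
  case (rel_nil x y)
  then show ?case by (auto simp: greedy_Nil sim_def intro: rel.rel_nil)
next
  case (rel_none C Cs Ds x y)
  from greedy_ConsE[OF rel_none.prems(2)] obtain z zs where z: "xs = z # zs" "z \<in> C" "t \<le> z" "\<forall>s\<in>C. t \<le> s \<longrightarrow> z \<le> s" "greedy z Cs zs" .
  have "\<exists>ws. greedy z Ds ws \<and> sim a 0 0 Cs Ds zs ws"
  proof (cases "z < a")
    case True
    then show ?thesis using rel_none.IH z(5) by blast
  next
    case False
    then have "Suc a < z" using z(2) rel_none.hyps by (metis Suc_lessI linorder_neqE_nat)
    moreover have "weaker 0 0 0 0" by (simp add: weaker_def)
    ultimately have "greedy z Ds zs \<and> rel a 0 0 (rm Cs zs) (rm Ds zs)" using chain_above[OF rel_none.hyps(3)] z(5) by blast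
    then have "greedy z Ds zs \<and> sim a 0 0 Cs Ds zs zs" by (simp add: sim_def)
    then show ?thesis ..
  qed
  then obtain ws where w: "greedy z Ds ws" "sim a 0 0 Cs Ds zs ws" by blast
  have "rel a x y ((C - {z}) # rm Cs zs) ((C - {z}) # rm Ds ws)"
    using rel_none.hyps w(2) by (intro rel.rel_none) (auto simp: sim_def)
  moreover have "greedy t (C # Ds) (z # ws)" using z w by simp
  ultimately show ?case using z(1) w(2) by (intro exI[of _ "z # ws"]) (auto simp: sim_def)
next
  case (rel_both C x y Cs Ds)
  from greedy_ConsE[OF rel_both.prems(2)] obtain z zs where z: "xs = z # zs" "z \<in> C" "t \<le> z" "\<forall>s\<in>C. t \<le> s \<longrightarrow> z \<le> s" "greedy z Cs zs" .
  have za: "z \<le> a" using z(4) rel_both.hyps rel_both.prems by simp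
  have "\<exists>ws. greedy z Ds ws \<and> sim a x y (C # Cs) (C # Ds) (z # zs) (z # ws)"
  proof (cases "z < a")
    case True
    then obtain ws where w: "greedy z Ds ws" "sim a x y Cs Ds zs ws" using rel_both.IH z(5) by blast
    have "rel a x y ((C - {z}) # rm Cs zs) ((C - {z}) # rm Ds ws)"
      using rel_both.hyps w(2) True by (intro rel.rel_both) (auto simp: sim_def)
    then show ?thesis using w by (auto simp: sim_def)
  next
    case False
    then have [simp]: "z = a" using za by simp
    obtain ws where w: "greedy a Ds ws" "\<And>p q. sim a p q Cs Ds zs ws" using chain_00[OF rel_both.hyps(3), of zs] z(5) by auto
    have "rel a x y ((C - {a}) # rm Cs zs) ((C - {a}) # rm Ds ws)"
      using rel_both.hyps w(2)[of "Suc x" "Suc y"] by (intro rel.rel_opn) (auto simp: sim_def)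
    then show ?thesis using w(1) w(2)[of x y] by (auto simp: sim_def)
  qed
  then obtain ws where w: "greedy z Ds ws" "sim a x y (C # Cs) (C # Ds) (z # zs) (z # ws)" by blast
  moreover have "greedy t (C # Ds) (z # ws)" using z w by simp
  ultimately show ?case using z(1) by blast
next
  case (rel_opn C x y Cs Ds)
  from greedy_ConsE[OF rel_opn.prems(2)] obtain z zs where z: "xs = z # zs" "z \<in> C" "t \<le> z" "\<forall>s\<in>C. t \<le> s \<longrightarrow> z \<le> s" "greedy z Cs zs" .
  have za: "z \<le> Suc a" "z \<noteq> a" using z(2,4) rel_opn.hyps rel_opn.prems by auto
  have "\<exists>ws. greedy z Ds ws \<and> sim a x y (C # Cs) (C # Ds) (z # zs) (z # ws)"
  proof (cases "z < a")
    case True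
    then obtain ws where w: "greedy z Ds ws" "sim a (Suc x) (Suc y) Cs Ds zs ws" using rel_opn.IH z(5) by blast
    have "rel a x y ((C - {z}) # rm Cs zs) ((C - {z}) # rm Ds ws)"
      using rel_opn.hyps w(2) True by (intro rel.rel_opn) (auto simp: sim_def)
    then show ?thesis using w by (auto simp: sim_def)
  next
    case False
    then have [simp]: "z = Suc a" using za by simp
    obtain ws where w: "greedy (Suc a) Ds ws" "sim a 0 0 Cs Ds zs ws" using chain_11[OF rel_opn.hyps(3)] z(5) by auto
    have "rel a x y ((C - {Suc a}) # rm Cs zs) ((C - {Suc a}) # rm Ds ws)"
      using rel_opn.hyps w(2) by (intro rel.rel_none) (auto simp: sim_def)
    then show ?thesis using w by (auto simp: sim_def)
  qed
  then obtain ws where w: "greedy z Ds ws" "sim a x y (C # Cs) (C # Ds) (z # zs) (z # ws)" by blast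
  moreover have "greedy t (C # Ds) (z # ws)" using z w by simp
  ultimately show ?case using z(1) by blast
next
  case (rel_cls C x y Cs Ds)
  from greedy_ConsE[OF rel_cls.prems(2)] obtain z zs where z: "xs = z # zs" "z \<in> C" "t \<le> z" "\<forall>s\<in>C. t \<le> s \<longrightarrow> z \<le> s" "greedy z Cs zs" .
  have za: "z \<le> a" using z(4) rel_cls.hyps rel_cls.prems by simp
  have "\<exists>ws. greedy z Ds ws \<and> sim a x y (C # Cs) (C # Ds) (z # zs) (z # ws)"
  proof (cases "z < a")
    case True
    then obtain ws where w: "greedy z Ds ws" "sim a (x - 1) (y - 1) Cs Ds zs ws" using rel_cls.IH z(5) by blast
    have "rel a x y ((C - {z}) # rm Cs zs) ((C - {z}) # rm Ds ws)"
      using rel_cls.hyps w(2) True by (intro rel.rel_cls) (auto simp: sim_def)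
    then show ?thesis using w by (auto simp: sim_def)
  next
    case False
    then have [simp]: "z = a" using za by simp
    obtain ws where w: "greedy a Ds ws" "\<And>p q. sim a p q Cs Ds zs ws" using chain_00[OF rel_cls.hyps(4), of zs] z(5) by auto
    have "rel a x y ((C - {a}) # rm Cs zs) ((C - {a}) # rm Ds ws)"
      using rel_cls.hyps w(2)[of 0 0] by (intro rel.rel_none) (auto simp: sim_def)
    then show ?thesis using w(1) w(2)[of x y] by (auto simp: sim_def)
  qed
  then obtain ws where w: "greedy z Ds ws" "sim a x y (C # Cs) (C # Ds) (z # zs) (z # ws)" by blast
  moreover have "greedy t (C # Ds) (z # ws)" using z w by simp
  ultimately show ?case using z(1) by blast
next
  case (rel_co C D y Cs Ds)
  from greedy_ConsE[OF rel_co.prems(2)] obtain z zs where z: "xs = z # zs" "z \<in> C" "t \<le> z" "\<forall>s\<in>C. t \<le> s \<longrightarrow> z \<le> s" "greedy z Cs zs" .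
  have za: "z \<le> a" using z(4) rel_co.hyps rel_co.prems by simp
  show ?case
  proof (cases "z < a")
    case True
    then obtain ws where w: "greedy z Ds ws" "sim a 0 (Suc y) Cs Ds zs ws" using rel_co.IH z(5) by blast
    have "rel a 0 y ((C - {z}) # rm Cs zs) ((D - {z}) # rm Ds ws)"
      using rel_co.hyps w(2) True by (intro rel.rel_co) (auto simp: sim_def)
    moreover have "greedy t (D # Ds) (z # ws)" using z w True rel_co.hyps by auto
    ultimately show ?thesis using z(1) w by (intro exI[of _ "z # ws"]) (auto simp: sim_def)
  next
    case False
    then have [simp]: "z = a" using za by simp
    obtain ws where w: "greedy (Suc a) Ds ws" "sim a 0 0 Cs Ds zs ws"
      using chain_01[OF rel_co.hyps(4)] z(5) by auto
    have D: "D - {Suc a} = C - {a}" "Suc a \<in> D" "a \<notin> D" using rel_co.hyps by auto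
    have "rel a 0 y ((C - {a}) # rm Cs zs) ((D - {Suc a}) # rm Ds ws)"
      unfolding D(1) using rel_co.hyps w(2) by (intro rel.rel_none) (auto simp: sim_def)
    moreover have "Suc a \<le> s" if "s \<in> D" "t \<le> s" for s
    proof (cases "s = Suc a")
      case False
      then have "a \<le> s" "s \<noteq> a" using that z(4) D rel_co.hyps by auto
      then show ?thesis by simp
    qed simp
    then have "greedy t (D # Ds) (Suc a # ws)" using w D rel_co.prems by (intro greedy_ConsI) auto
    ultimately show ?thesis using z(1) w by (intro exI[of _ "Suc a # ws"]) (auto simp: sim_def agree_def)
  qed
next
  case (rel_oc C D x Cs Ds)
  from greedy_ConsE[OF rel_oc.prems(2)] obtain z zs where z: "xs = z # zs" "z \<in> C" "t \<le> z" "\<forall>s\<in>C. t \<le> s \<longrightarrow> z \<le> s" "greedy z Cs zs" .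
  have za: "z \<le> Suc a" "z \<noteq> a" using z(2,4) rel_oc.hyps rel_oc.prems by auto
  show ?case
  proof (cases "z < a")
    case True
    then obtain ws where w: "greedy z Ds ws" "sim a (Suc x) 0 Cs Ds zs ws" using rel_oc.IH z(5) by blast
    have "rel a x 0 ((C - {z}) # rm Cs zs) ((D - {z}) # rm Ds ws)"
      using rel_oc.hyps w(2) True by (intro rel.rel_oc) (auto simp: sim_def)
    moreover have "greedy t (D # Ds) (z # ws)" using z w True rel_oc.hyps by auto
    ultimately show ?thesis using z(1) w by (intro exI[of _ "z # ws"]) (auto simp: sim_def)
  next
    case False
    then have [simp]: "z = Suc a" using za by simp
    obtain ws where w: "greedy a Ds ws" "sim a 0 0 Ds Cs ws zs"
      using chain_01[OF rel_sym[OF rel_oc.hyps(4)]] z(5) by auto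
    have s: "sim a 0 0 Cs Ds zs ws" by (rule sim_sym[OF w(2)])
    have D: "D - {a} = C - {Suc a}" "a \<in> D" using rel_oc.hyps by auto
    have "rel a x 0 ((C - {Suc a}) # rm Cs zs) ((D - {a}) # rm Ds ws)"
      unfolding D(1) using rel_oc.hyps s by (intro rel.rel_none) (auto simp: sim_def)
    moreover have "a \<le> s" if "s \<in> D" "t \<le> s" for s
      using that z(4) rel_oc.hyps by (auto dest: Suc_leD)
    then have "greedy t (D # Ds) (a # ws)" using w D rel_oc.prems by (intro greedy_ConsI) auto
    ultimately show ?thesis using z(1) s by (intro exI[of _ "a # ws"]) (auto simp: sim_def agree_def)
  qed
qed

lemma rel_length: "rel a x y Cs Ds \<Longrightarrow> length Ds = length Cs"
  by (induction rule: rel.induct) auto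

lemma rel_empty: "rel a x y Cs Ds \<Longrightarrow> \<forall>C\<in>set Cs. C = {} \<Longrightarrow> \<forall>C\<in>set Ds. C = {}"
  by (induction rule: rel.induct) auto

lemma rel_Cons:
  assumes "rel a x y (C # Cs) Fs"
  shows "\<exists>D Ds x' y'. Fs = D # Ds \<and> rel a x' y' Cs Ds \<and> (\<forall>E E'. rel a x' y' E E' \<longrightarrow> rel a x y (C # E) (D # E'))"
  using assms by (cases rule: rel.cases) (blast intro: rel.intros)+

text \<open>A short row leaves the first columns untouched; the relation on them can be continued
  with any related tails.\<close>

lemma rel_split:
  "rel a x y (A @ B) Fs \<Longrightarrow> \<exists>A' B' x' y'. Fs = A' @ B' \<and> length A' = length A \<and> rel a x' y' B B' \<and>
     (\<forall>E E'. rel a x' y' E E' \<longrightarrow> rel a x y (A @ E) (A' @ E'))"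
proof (induction A arbitrary: x y Fs)
  case Nil
  then have "Fs = [] @ Fs \<and> length [] = length [] \<and> rel a x y B Fs \<and> (\<forall>E E'. rel a x y E E' \<longrightarrow> rel a x y ([] @ E) ([] @ E'))" by simp
  then show ?case by blast
next
  case (Cons C A)
  then obtain D Ds x1 y1 where D: "Fs = D # Ds" "rel a x1 y1 (A @ B) Ds" "\<And>E E'. rel a x1 y1 E E' \<Longrightarrow> rel a x y (C # E) (D # E')"
    using rel_Cons[of a x y C "A @ B" Fs] by auto
  then obtain A' B' x' y' where h: "Ds = A' @ B'" "length A' = length A" "rel a x' y' B B'" "\<And>E E'. rel a x' y' E E' \<Longrightarrow> rel a x1 y1 (A @ E) (A' @ E')"
    using Cons.IH[OF D(2)] by blast
  have "Fs = (D # A') @ B' \<and> length (D # A') = length (C # A) \<and> rel a x' y' B B' \<and>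
     (\<forall>E E'. rel a x' y' E E' \<longrightarrow> rel a x y ((C # A) @ E) ((D # A') @ E'))" using D h by simp
  then show ?case by blast
qed

text \<open>Each row has a counterpart that agrees with it up to exchanging \<open>a\<close> and
  \<open>a + 1\<close>, and the remaining columns are related again. The assumption puts the initial
  threshold 0 below \<open>a\<close>.\<close>

theorem fills_rel:
  assumes "1 \<le> a"
  shows "fills Cs T \<Longrightarrow> rel a 0 0 Cs Ds \<Longrightarrow> \<exists>T'. fills Ds T' \<and> list_all2 (list_all2 (agree a)) T T'"
proof (induction T arbitrary: Cs Ds)
  case Nil
  then have "fills Ds []" using rel_empty by simp
  then show ?case by blast
next
  case (Cons r T)
  let ?k = "length Cs - length r"
  have len: "length r \<le> length Cs" and g: "greedy 0 (drop ?k Cs) (rev r)" using Cons.prems by (auto simp: row_fits_def)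
  have "rel a 0 0 (take ?k Cs @ drop ?k Cs) Ds" using Cons.prems by simp
  then obtain A B x y where h: "Ds = A @ B" "length A = length (take ?k Cs)" "rel a x y (drop ?k Cs) B"
    "\<And>E E'. rel a x y E E' \<Longrightarrow> rel a 0 0 (take ?k Cs @ E) (A @ E')" using rel_split[of a 0 0 "take ?k Cs" "drop ?k Cs" Ds] by blast
  obtain ys where ys: "greedy 0 B ys" "sim a x y (drop ?k Cs) B (rev r) ys" using chain_below[OF h(3) _ g] assms by auto
  have lA: "length A = ?k" using h(2) by simp
  have ly: "length ys = length r" using ys(2) list_all2_lengthD[of "agree a" "rev r" ys] by (simp add: sim_def)
  have lB: "length B = length r" using greedy_length[OF ys(1)] ly by simp
  have d: "length Ds - length (rev ys) = length A" using h(1) ly lB by simp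
  have "row_fits Ds (rev ys)" using ys(1) h(1) ly lB unfolding row_fits_def d by simp
  moreover have e: "rm_row Ds (rev ys) = A @ rm B ys" unfolding rm_row_def d using h(1) by simp
  have "rel a 0 0 (rm_row Cs r) (rm_row Ds (rev ys))"
    unfolding e unfolding rm_row_def using h(4) ys(2) by (simp add: sim_def)
  then obtain T' where "fills (rm_row Ds (rev ys)) T'" "list_all2 (list_all2 (agree a)) T T'"
    using Cons.IH[of "rm_row Cs r"] Cons.prems by auto
  moreover have "list_all2 (agree a) r (rev ys)"
    using ys(2) list_all2_rev[of "agree a" "rev r" ys] by (simp add: sim_def)
  ultimately have "fills Ds (rev ys # T') \<and> list_all2 (list_all2 (agree a)) (r # T) (rev ys # T')" by simp
  then show ?case by blast
qed

section \<open>Bracket flips as instances of the relation\<close>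

lemma rel_flip_suffix: "cls (map (ct a) q) \<le> m \<Longrightarrow> rel a (Suc m) m q q"
proof (induction q arbitrary: m)
  case (Cons C q)
  consider "a \<notin> C" "Suc a \<notin> C" | "a \<in> C" "Suc a \<in> C" | "a \<notin> C" "Suc a \<in> C" | "a \<in> C" "Suc a \<notin> C" by blast
  then show ?case
  proof cases
    case 1
    then show ?thesis by (intro rel.rel_none rel_refl)
  next
    case 2
    then show ?thesis using Cons by (intro rel.rel_both) (auto simp: ct_def)
  next
    case 3
    then show ?thesis using Cons.IH[of "Suc m"] Cons.prems by (intro rel.rel_opn) (auto simp: ct_def)
  next
    case 4
    then obtain m' where "m = Suc m'" using Cons.prems by (cases m) (auto simp: ct_def)
    then show ?thesis using 4 Cons.IH[of m'] Cons.prems by (intro rel.rel_cls) (auto simp: ct_def)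
  qed
qed (rule rel_nil)

lemma rel_flip_prefix:
  "rel a 0 0 E E' \<Longrightarrow> opn (map (ct a) p) + (x - cls (map (ct a) p)) = 0 \<Longrightarrow> rel a x x (p @ E) (p @ E')"
proof (induction p arbitrary: x)
  case (Cons C p)
  consider "a \<notin> C" "Suc a \<notin> C" | "a \<in> C" "Suc a \<in> C" | "a \<notin> C" "Suc a \<in> C" | "a \<in> C" "Suc a \<notin> C" by blast
  then show ?case
  proof cases
    case 1
    then show ?thesis using Cons.IH[of 0] Cons.prems unfolding append_Cons by (intro rel.rel_none) (auto simp: ct_def)
  next
    case 2
    then show ?thesis using Cons.IH[of x] Cons.prems unfolding append_Cons by (intro rel.rel_both) (auto simp: ct_def)
  next
    case 3
    then show ?thesis using Cons.IH[of "Suc x"] Cons.prems unfolding append_Cons by (intro rel.rel_opn) (auto simp: ct_def)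
  next
    case 4
    then show ?thesis using Cons.IH[of "x - 1"] Cons.prems unfolding append_Cons by (intro rel.rel_cls) (auto simp: ct_def)
  qed
qed simp

text \<open>A bracket that is unmatched in the whole list remains so when matching is interrupted.
  Beyond the flipped column the two counters differ by one, which is never noticed because
  \<open>q\<close> has no unmatched closing bracket.\<close>

lemma rel_flip:
  assumes "flip_at (map (ct a) p) (map (ct a) q)" "Suc a \<in> C" "a \<notin> C"
  shows "rel a 0 0 (p @ C # q) (p @ insert a (C - {Suc a}) # q)"
proof (rule rel_flip_prefix)
  have "rel a (Suc 0) 0 q q" using assms(1) by (intro rel_flip_suffix) (simp add: flip_at_def)
  then show "rel a 0 0 (C # q) (insert a (C - {Suc a}) # q)" using assms by (intro rel.rel_oc) auto
  show "opn (map (ct a) p) + (0 - cls (map (ct a) p)) = 0" using assms(1) by (simp add: flip_at_def)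
qed

section \<open>The row whose flag is lowered, before and after a flip\<close>

lemma greedy_sorted: "greedy t Cs xs \<Longrightarrow> sorted (t # xs)"
proof (induction t Cs xs rule: greedy.induct)
  case (2 t C Cs x xs)
  then have "sorted (x # xs)" "t \<le> x" by auto
  then show ?case by auto
qed auto

lemma greedy_mem: "greedy t Cs xs \<Longrightarrow> list_all2 (\<lambda>C x. x \<in> C) Cs xs"
  by (induction t Cs xs rule: greedy.induct) auto

text \<open>Where the row first takes \<open>a + 1\<close>, its threshold was at most
  \<open>a\<close>, so \<open>a\<close> is missing; from there on it remains at
  \<open>a + 1\<close>. Since all later columns contain \<open>a + 1\<close>, this column is an
  unmatched opening bracket.\<close>

lemma greedy_last:
  "greedy t Cs xs \<Longrightarrow> t \<le> a \<Longrightarrow> xs \<noteq> [] \<Longrightarrow> last xs = Suc a \<Longrightarrow>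
     \<exists>p C q. Cs = p @ C # q \<and> Suc a \<in> C \<and> a \<notin> C \<and> (\<forall>D\<in>set q. Suc a \<in> D)"
proof (induction t Cs xs rule: greedy.induct)
  case (2 t C Cs x xs)
  show ?case
  proof (cases "x \<le> a")
    case True
    then have ne: "xs \<noteq> []" using "2.prems" by auto
    then obtain p D q where "Cs = p @ D # q" "Suc a \<in> D" "a \<notin> D" "\<forall>D\<in>set q. Suc a \<in> D"
      using 2 True by auto
    then have "C # Cs = (C # p) @ D # q \<and> Suc a \<in> D \<and> a \<notin> D \<and> (\<forall>D\<in>set q. Suc a \<in> D)" by simp
    then show ?thesis by blast
  next
    case False
    have g: "greedy x Cs xs" using "2.prems" by simp
    have all: "z = Suc a" if z: "z \<in> set (x # xs)" for z
    proof -
      have "sorted (x # xs)" using greedy_sorted[OF g] .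
      then have "x \<le> z" using z by auto
      moreover obtain u v where uv: "x # xs = u @ z # v" using z by (meson split_list)
      then have "z \<le> last (x # xs)" using \<open>sorted (x # xs)\<close> unfolding uv by (auto simp: sorted_append)
      ultimately show ?thesis using False "2.prems"(4) by simp
    qed
    have "x = Suc a" using all by simp
    then have "Suc a \<in> C" "a \<notin> C" using "2.prems" by auto
    moreover have "Suc a \<in> D" if D: "D \<in> set Cs" for D
    proof -
      obtain k where k: "k < length Cs" "D = Cs ! k" using D by (metis in_set_conv_nth)
      have "length xs = length Cs" "xs ! k \<in> Cs ! k" using greedy_mem[OF g] k by (auto simp: list_all2_conv_all_nth)
      moreover have "xs ! k = Suc a" using all k \<open>length xs = length Cs\<close> by simp
      ultimately show ?thesis using k by simp
    qed
    ultimately have "C # Cs = [] @ C # Cs \<and> Suc a \<in> C \<and> a \<notin> C \<and> (\<forall>D\<in>set Cs. Suc a \<in> D)" by simp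
    then show ?thesis by blast
  qed
qed auto

lemma ct_eq: "ct a C = Opn \<longleftrightarrow> Suc a \<in> C \<and> a \<notin> C" "ct a C = Cls \<longleftrightarrow> a \<in> C \<and> Suc a \<notin> C"
  by (auto simp: ct_def)

lemma ct_no_cls: "\<forall>D\<in>set q. Suc a \<in> D \<Longrightarrow> cls (map (ct a) q) = 0"
  by (induction q) (auto simp: ct_def)

lemma ct_no_opn: "\<forall>D\<in>set q. a \<in> D \<Longrightarrow> opn (map (ct a) q) = 0"
  by (induction q) (auto simp: ct_def)

lemma count_ct:
  "int (count_list (map (ct a) Cs) Cls) - int (count_list (map (ct a) Cs) Opn) =
     int (length (filter (\<lambda>C. a \<in> C) Cs)) - int (length (filter (\<lambda>C. Suc a \<in> C) Cs))"
  by (induction Cs) (auto simp: ct_def)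

definition flipped :: "nat \<Rightarrow> nat set \<Rightarrow> nat set \<Rightarrow> bool" where
  "flipped a C D \<longleftrightarrow> C = D \<or> Suc a \<in> C \<and> a \<notin> C \<and> D = insert a (C - {Suc a})"

text \<open>The only entry lost by a flip is \<open>a + 1\<close>; where the old row used it, the
  new entry is at most \<open>a + 1\<close> anyway, so the thresholds stay ordered.\<close>

lemma greedy_flipped_le:
  "greedy t' Cs xs \<Longrightarrow> greedy t Ds ys \<Longrightarrow> t \<le> t' \<Longrightarrow> \<forall>y\<in>set ys. y \<le> Suc a \<Longrightarrow> list_all2 (flipped a) Cs Ds \<Longrightarrow>
     list_all2 (\<le>) ys xs"
proof (induction t' Cs xs arbitrary: t Ds ys rule: greedy.induct)
  case (1 t')
  then show ?case by (auto simp: greedy_Nil)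
next
  case (2 t' C Cs x xs)
  then obtain D Ds' where D: "Ds = D # Ds'" "flipped a C D" "list_all2 (flipped a) Cs Ds'" by (auto simp: list_all2_Cons1)
  from greedy_ConsE[OF "2.prems"(2)[unfolded D]] obtain y ys' where y: "ys = y # ys'" "y \<in> D" "t \<le> y"
    "\<forall>s\<in>D. t \<le> s \<longrightarrow> y \<le> s" "greedy y Ds' ys'" .
  have x: "x \<in> C" "t' \<le> x" "greedy x Cs xs" using "2.prems" by auto
  have "y \<le> x"
  proof (cases "x \<in> D")
    case True
    then show ?thesis using x y "2.prems" by auto
  next
    case False
    then have "x = Suc a" using D(2) x(1) by (auto simp: flipped_def)
    then show ?thesis using "2.prems" y by auto
  qed
  then show ?case using "2.IH"[OF x(3) y(5) _ _ D(3)] "2.prems" y by auto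
qed auto

text \<open>If the row takes an entry below \<open>a\<close> from \<open>D\<close>, undoing the flip
  does not affect it. If it takes \<open>a\<close>, it stays at \<open>a\<close>, so all later
  columns contain \<open>a\<close> and none of them is an opening bracket.\<close>

lemma greedy_unflip:
  assumes "greedy t (P @ D # Q) ys" "\<forall>y\<in>set ys. y \<le> a" "a \<in> D"
  shows "greedy t (P @ insert (Suc a) (D - {a}) # Q) ys \<or> (\<forall>E\<in>set Q. a \<in> E)"
proof -
  from greedy_split[OF assms(1)] obtain u v where uv: "ys = u @ v" "length P = length u" "greedy t P u"
    "greedy (last (t # u)) (D # Q) v" .
  from greedy_ConsE[OF uv(4)] obtain y vs where y: "v = y # vs" "y \<in> D" "last (t # u) \<le> y"
    "\<forall>s\<in>D. last (t # u) \<le> s \<longrightarrow> y \<le> s" "greedy y Q vs" .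
  show ?thesis
  proof (cases "y = a")
    case True
    have "z = a" if "z \<in> set vs" for z
      using that greedy_sorted[OF y(5)] True assms(2) uv(1) y(1) by (auto intro: le_antisym)
    then have "a \<in> E" if "E \<in> set Q" for E
      using that greedy_mem[OF y(5)] by (metis in_set_conv_nth list_all2_conv_all_nth)
    then show ?thesis by blast
  next
    case False
    then have "y < a" using assms(2) uv y by (simp add: le_neq_implies_less)
    then have "greedy (last (t # u)) (insert (Suc a) (D - {a}) # Q) v" using y by auto
    then show ?thesis using uv greedy_append[OF uv(2)] by blast
  qed
qed

lemma fills_drop:
  "fills (cols L S) T \<Longrightarrow> fills (cols L (\<lambda>c. S c - colset (take i T) c)) (drop i T)"
proof (induction i arbitrary: S T)
  case 0
  then show ?case by (simp add: colset_simps)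
next
  case (Suc i)
  show ?case
  proof (cases T)
    case Nil
    then show ?thesis using Suc.prems by (simp add: colset_simps)
  next
    case (Cons r U)
    let ?S = "\<lambda>c. if c < length r then S c - {r ! c} else S c"
    have "length r \<le> L" using Suc.prems Cons by (simp add: row_fits_def)
    then have "fills (cols L ?S) U" using Suc.prems Cons rm_row_cols by simp
    then have "fills (cols L (\<lambda>c. ?S c - colset (take i U) c)) (drop i U)" by (rule Suc.IH)
    moreover have "?S c - colset (take i U) c = S c - colset (take (Suc i) T) c" for c
      using Cons by (auto simp: colset_simps)
    ultimately show ?thesis using Cons by simp
  qed
qed

lemma fills_row:
  assumes "fills (cols L S) T" "i < length T"
  shows "length (T ! i) \<le> L"
    "greedy 0 (drop (L - length (T ! i)) (cols L (\<lambda>c. S c - colset (take i T) c))) (rev (T ! i))"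
  using fills_drop[OF assms(1), of i] assms(2) by (auto simp: Cons_nth_drop_Suc[symmetric] row_fits_def)

locale tableau_strings =
  fixes \<alpha> :: "nat list" and \<phi> :: "nat \<Rightarrow> nat" and i a :: nat
  assumes i: "i < length \<alpha>" and a1: "1 \<le> a" and flag_i: "\<phi> (Suc i) = Suc a"
    and flag_below: "\<And>k. k < i \<Longrightarrow> \<phi> (Suc k) < a"
    and flag_above: "\<And>k. i < k \<Longrightarrow> k < length \<alpha> \<Longrightarrow> a < \<phi> (Suc k)"
begin

definition clist :: "nat list list \<Rightarrow> nat set list" where
  "clist T = cols (ncols \<alpha>) (colset T)"

definition edge :: "nat list list \<Rightarrow> nat list list \<Rightarrow> bool" where
  "edge T T' \<longleftrightarrow> T \<in> SSKT \<alpha> \<phi> \<and> T' \<in> SSKT \<alpha> \<phi> \<and>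
     (\<exists>p C q. clist T = p @ C # q \<and> clist T' = p @ insert a (C - {Suc a}) # q \<and> Suc a \<in> C \<and> a \<notin> C \<and>
       flip_at (map (ct a) p) (map (ct a) q))"

lemma SSKT_D:
  assumes "T \<in> SSKT \<alpha> \<phi>"
  shows "map length T = \<alpha>" "length T = length \<alpha>" "fills (clist T) T"
    "k < length \<alpha> \<Longrightarrow> x \<in> set (T ! k) \<Longrightarrow> 1 \<le> x \<and> x \<le> \<phi> (Suc k)"
proof -
  show "map length T = \<alpha>" "fills (clist T) T" using assms by (auto simp: SSKT_iff clist_def)
  then show "length T = length \<alpha>" by auto
  then show "k < length \<alpha> \<Longrightarrow> x \<in> set (T ! k) \<Longrightarrow> 1 \<le> x \<and> x \<le> \<phi> (Suc k)"
    using assms unfolding SSKT_iff rows_flagged_def by auto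
qed

lemma flag_neq: "k < length \<alpha> \<Longrightarrow> \<phi> (Suc k) \<noteq> a"
  using flag_i flag_below flag_above by (metis lessI less_irrefl linorder_neqE_nat n_not_Suc_n)

lemma SSKT_eqI: "T \<in> SSKT \<alpha> \<phi> \<Longrightarrow> T' \<in> SSKT \<alpha> \<phi> \<Longrightarrow> clist T = clist T' \<Longrightarrow> T = T'"
  using fills_unique SSKT_D by metis

text \<open>Entries change only between \<open>a\<close> and \<open>a + 1\<close>, and no row has
  the flag \<open>a\<close>; so the flags are respected.\<close>

lemma SSKT_rel:
  assumes T: "T \<in> SSKT \<alpha> \<phi>" and r: "rel a 0 0 (clist T) Ds"
  obtains T' where "T' \<in> SSKT \<alpha> \<phi>" "clist T' = Ds" "list_all2 (list_all2 (agree a)) T T'"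
proof -
  obtain T' where T': "fills Ds T'" "list_all2 (list_all2 (agree a)) T T'" using fills_rel[OF a1 SSKT_D(3)[OF T] r] by blast
  have len: "length Ds = ncols \<alpha>" using rel_length[OF r] by (simp add: clist_def)
  have Ds: "clist T' = Ds" using fills_cols[OF T'(1)] len by (simp add: clist_def)
  have lT: "length T' = length T" using list_all2_lengthD[OF T'(2)] by simp
  have m: "map length T' = \<alpha>"
  proof -
    have "length (T' ! k) = length (T ! k)" if "k < length T" for k
      using T'(2) that list_all2_lengthD[of "agree a" "T ! k"] by (auto simp: list_all2_conv_all_nth)
    then have "map length T' = map length T" using lT by (intro nth_equalityI) auto
    then show ?thesis using SSKT_D[OF T] by simp
  qed
  have "rows_flagged \<phi> T'"
    unfolding rows_flagged_def
  proof (intro allI impI ballI)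
    fix k x assume k: "k < length T'" "x \<in> set (T' ! k)"
    then obtain j where j: "j < length (T' ! k)" "x = T' ! k ! j" by (metis in_set_conv_nth)
    have "list_all2 (agree a) (T ! k) (T' ! k)" using T'(2) k by (simp add: list_all2_conv_all_nth)
    then have "agree a (T ! k ! j) x" "j < length (T ! k)" using j by (simp_all add: list_all2_conv_all_nth)
    moreover have kl: "k < length \<alpha>" using k lT SSKT_D[OF T] by simp
    then have "1 \<le> T ! k ! j \<and> T ! k ! j \<le> \<phi> (Suc k)" using SSKT_D(4)[OF T kl] \<open>j < length (T ! k)\<close> by simp
    ultimately show "1 \<le> x \<and> x \<le> \<phi> (Suc k)" using flag_neq[OF kl] a1 by (auto simp: agree_def)
  qed
  then have "T' \<in> SSKT \<alpha> \<phi>" using T'(1) m Ds by (simp add: SSKT_iff clist_def)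
  then show ?thesis using that Ds T'(2) by blast
qed

lemma edge_agree:
  assumes "edge T T'" shows "list_all2 (list_all2 (agree a)) T T'"
proof -
  obtain p C q where e: "T \<in> SSKT \<alpha> \<phi>" "T' \<in> SSKT \<alpha> \<phi>" "clist T = p @ C # q" "clist T' = p @ insert a (C - {Suc a}) # q"
    "Suc a \<in> C" "a \<notin> C" "flip_at (map (ct a) p) (map (ct a) q)" using assms by (auto simp: edge_def)
  have "rel a 0 0 (clist T) (clist T')" unfolding e(3,4) by (rule rel_flip[OF e(7,5,6)])
  from SSKT_rel[OF e(1) this] obtain T'' where "T'' \<in> SSKT \<alpha> \<phi>" "clist T'' = clist T'" "list_all2 (list_all2 (agree a)) T T''" .
  then show ?thesis using SSKT_eqI e(2) by blast
qed

lemma edge_labels: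
  assumes "edge T T'"
  shows "opn (map (ct a) (clist T)) = Suc (opn (map (ct a) (clist T')))"
    "cls (map (ct a) (clist T')) = Suc (cls (map (ct a) (clist T)))"
    "label a (concat T) = label a (concat T')"
proof -
  obtain p C q where e: "T \<in> SSKT \<alpha> \<phi>" "T' \<in> SSKT \<alpha> \<phi>" "clist T = p @ C # q" "clist T' = p @ insert a (C - {Suc a}) # q"
    "Suc a \<in> C" "a \<notin> C" "flip_at (map (ct a) p) (map (ct a) q)" using assms by (auto simp: edge_def)
  have "ct a C = Opn" "ct a (insert a (C - {Suc a})) = Cls" using e by (auto simp: ct_def)
  then show "opn (map (ct a) (clist T)) = Suc (opn (map (ct a) (clist T')))"
    "cls (map (ct a) (clist T')) = Suc (cls (map (ct a) (clist T)))"
    using flip_at_counts[OF e(7)] e(3,4) by simp_all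
  show "label a (concat T) = label a (concat T')"
    unfolding label_def fun_eq_iff fills_count[OF SSKT_D(3)[OF e(1)]] fills_count[OF SSKT_D(3)[OF e(2)]] e(3,4)
    using e(5,6) by auto
qed

lemma edge_unique:
  assumes "edge T T'" "edge U U'"
  shows "T = U \<longleftrightarrow> T' = U'"
proof -
  obtain p C q where e: "T \<in> SSKT \<alpha> \<phi>" "T' \<in> SSKT \<alpha> \<phi>" "clist T = p @ C # q" "clist T' = p @ insert a (C - {Suc a}) # q"
    "Suc a \<in> C" "a \<notin> C" "flip_at (map (ct a) p) (map (ct a) q)" using assms by (auto simp: edge_def)
  obtain p' C' q' where f: "U \<in> SSKT \<alpha> \<phi>" "U' \<in> SSKT \<alpha> \<phi>" "clist U = p' @ C' # q'" "clist U' = p' @ insert a (C' - {Suc a}) # q'"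
    "Suc a \<in> C'" "a \<notin> C'" "flip_at (map (ct a) p') (map (ct a) q')" using assms by (auto simp: edge_def)
  have c: "ct a C = Opn" "ct a (insert a (C - {Suc a})) = Cls" "ct a C' = Opn" "ct a (insert a (C' - {Suc a})) = Cls"
    using e f by (auto simp: ct_def)
  show ?thesis
  proof
    assume "T = U"
    then have eq: "p @ C # q = p' @ C' # q'" using e f by simp
    then have "map (ct a) (p @ C # q) = map (ct a) (p' @ C' # q')" by simp
    then have "map (ct a) p = map (ct a) p'" using flip_unique_opn[OF _ e(7) f(7)] c by simp
    then have "length p = length p'" by (rule map_eq_imp_length_eq)
    then have "p = p' \<and> C = C' \<and> q = q'" using eq by simp
    then have "clist T' = clist U'" using e f by simp
    then show "T' = U'" using SSKT_eqI e f by blast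
  next
    assume "T' = U'"
    then have eq: "p @ insert a (C - {Suc a}) # q = p' @ insert a (C' - {Suc a}) # q'" using e f by simp
    then have "map (ct a) (p @ insert a (C - {Suc a}) # q) = map (ct a) (p' @ insert a (C' - {Suc a}) # q')" by simp
    then have "map (ct a) p = map (ct a) p'" using flip_unique_cls[OF _ e(7) f(7)] c by simp
    then have "length p = length p'" by (rule map_eq_imp_length_eq)
    then have "p = p' \<and> insert a (C - {Suc a}) = insert a (C' - {Suc a}) \<and> q = q'" using eq by simp
    moreover have "C = insert (Suc a) (insert a (C - {Suc a}) - {a})" "C' = insert (Suc a) (insert a (C' - {Suc a}) - {a})"
      using e(5,6) f(5,6) by auto
    then have "C = C'" using calculation by metis
    ultimately have "clist T = clist U" using e f by simp
    then show "T = U" using SSKT_eqI e f by blast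
  qed
qed

sublocale strings "SSKT \<alpha> \<phi>" edge "\<lambda>T. opn (map (ct a) (clist T))" "\<lambda>T. cls (map (ct a) (clist T))"
  "\<lambda>T. label a (concat T)"
proof
  show "finite (SSKT \<alpha> \<phi>)" by (rule finite_SSKT)
  show "T \<in> SSKT \<alpha> \<phi> \<and> T' \<in> SSKT \<alpha> \<phi> \<and> opn (map (ct a) (clist T)) = Suc (opn (map (ct a) (clist T'))) \<and>
      cls (map (ct a) (clist T')) = Suc (cls (map (ct a) (clist T))) \<and>
      label a (concat T) = label a (concat T')" if "edge T T'" for T T'
    using edge_labels[OF that] that by (simp add: edge_def)
  show "T' = T''" if "edge T T'" "edge T T''" for T T' T'' using edge_unique that by blast
  show "T = U" if "edge T T'" "edge U T'" for T T' U using edge_unique that by blast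
  show "\<exists>T'. edge T T'" if T: "T \<in> SSKT \<alpha> \<phi>" "opn (map (ct a) (clist T)) > 0" for T
  proof -
    obtain P Q where "map (ct a) (clist T) = P @ Opn # Q" "flip_at P Q"
      using exists_flip_opn[OF T(2)] by auto
    then obtain p C q where pq: "clist T = p @ C # q" "ct a C = Opn" "flip_at (map (ct a) p) (map (ct a) q)"
      by (auto simp: map_eq_append_conv map_eq_Cons_conv)
    then have "rel a 0 0 (clist T) (p @ insert a (C - {Suc a}) # q)" using rel_flip by (simp add: ct_eq)
    from SSKT_rel[OF T(1) this] obtain T' where "T' \<in> SSKT \<alpha> \<phi>" "clist T' = p @ insert a (C - {Suc a}) # q" .
    then show ?thesis unfolding edge_def using T(1) pq by (auto simp: ct_eq)
  qed
  show "\<exists>T. edge T T'" if T: "T' \<in> SSKT \<alpha> \<phi>" "cls (map (ct a) (clist T')) > 0" for T'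
  proof -
    obtain P Q where "map (ct a) (clist T') = P @ Cls # Q" "flip_at P Q"
      using exists_flip_cls[OF T(2)] by auto
    then obtain p D q where pq: "clist T' = p @ D # q" "ct a D = Cls" "flip_at (map (ct a) p) (map (ct a) q)"
      by (auto simp: map_eq_append_conv map_eq_Cons_conv)
    let ?C = "insert (Suc a) (D - {a})"
    have C: "Suc a \<in> ?C" "a \<notin> ?C" "insert a (?C - {Suc a}) = D" using pq(2) by (auto simp: ct_eq)
    have "rel a 0 0 (p @ ?C # q) (clist T')" using rel_flip[OF pq(3) C(1,2)] C(3) pq(1) by simp
    from SSKT_rel[OF T(1) rel_sym[OF this]] obtain T where "T \<in> SSKT \<alpha> \<phi>" "clist T = p @ ?C # q" .
    then show ?thesis unfolding edge_def using T(1) pq C by metis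
  qed
qed

lemma SSKT_sub_iff: "T \<in> SSKT \<alpha> (\<phi>(Suc i := a)) \<longleftrightarrow> T \<in> SSKT \<alpha> \<phi> \<and> (\<forall>x\<in>set (T ! i). x \<le> a)"
proof -
  have "rows_flagged (\<phi>(Suc i := a)) T \<longleftrightarrow> rows_flagged \<phi> T \<and> (\<forall>x\<in>set (T ! i). x \<le> a)"
    if "i < length T"
  proof
    assume f: "rows_flagged (\<phi>(Suc i := a)) T"
    have "1 \<le> x \<and> x \<le> \<phi> (Suc k) \<and> (k = i \<longrightarrow> x \<le> a)" if "k < length T" "x \<in> set (T ! k)" for k x
      using f[unfolded rows_flagged_def, rule_format, OF that] flag_i by (cases "k = i") auto
    then show "rows_flagged \<phi> T \<and> (\<forall>x\<in>set (T ! i). x \<le> a)"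
      using that by (simp add: rows_flagged_def)
  qed (simp add: rows_flagged_def)
  moreover have "map length T = \<alpha> \<Longrightarrow> i < length T" using i by auto
  ultimately show ?thesis unfolding SSKT_iff by blast
qed

text \<open>The columns as row \<open>i\<close> finds them, after the rows below it have taken their
  entries.\<close>

definition rest :: "nat list list \<Rightarrow> nat set list" where
  "rest T = cols (ncols \<alpha>) (\<lambda>c. colset T c - colset (take i T) c)"

lemma below_small: "T \<in> SSKT \<alpha> \<phi> \<Longrightarrow> x \<in> colset (take i T) c \<Longrightarrow> x < a"
proof -
  assume T: "T \<in> SSKT \<alpha> \<phi>" and "x \<in> colset (take i T) c"
  then obtain r where "r \<in> set (take i T)" "x \<in> set r" by (auto simp: colset_def)
  then obtain k where "k < i" "x \<in> set (T ! k)" by (auto simp: in_set_conv_nth[of r])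
  then show "x < a" using SSKT_D(4)[OF T, of k x] flag_below[of k] i by simp
qed

lemma ct_rest:
  assumes "T \<in> SSKT \<alpha> \<phi>" shows "map (ct a) (rest T) = map (ct a) (clist T)"
proof -
  have "ct a (colset T c - colset (take i T) c) = ct a (colset T c)" for c
    using below_small[OF assms, of a c] below_small[OF assms, of "Suc a" c] by (auto simp: ct_def)
  then show ?thesis by (simp add: rest_def clist_def cols_def)
qed

lemma row_i:
  assumes "T \<in> SSKT \<alpha> \<phi>"
  shows "length (T ! i) = \<alpha> ! i" "\<alpha> ! i \<le> ncols \<alpha>" "greedy 0 (drop (ncols \<alpha> - \<alpha> ! i) (rest T)) (rev (T ! i))"
proof -
  show l: "length (T ! i) = \<alpha> ! i" using SSKT_D[OF assms] i by (metis nth_map)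
  have il: "i < length T" using SSKT_D[OF assms] i by simp
  show "\<alpha> ! i \<le> ncols \<alpha>" "greedy 0 (drop (ncols \<alpha> - \<alpha> ! i) (rest T)) (rev (T ! i))"
    using fills_row[OF SSKT_D(3)[OF assms, unfolded clist_def] il] unfolding l rest_def by auto
qed

text \<open>The rows below row \<open>i\<close> have only entries smaller than \<open>a\<close>, on
  which agreement is equality. So these rows coincide, and removing them leaves the flip
  intact.\<close>

lemma edge_rest:
  assumes "edge T T'"
  obtains p C q where "rest T = p @ C # q" "rest T' = p @ insert a (C - {Suc a}) # q" "Suc a \<in> C" "a \<notin> C"
    "flip_at (map (ct a) p) (map (ct a) q)"
proof -
  obtain p C q where e: "T \<in> SSKT \<alpha> \<phi>" "T' \<in> SSKT \<alpha> \<phi>" "clist T = p @ C # q" "clist T' = p @ insert a (C - {Suc a}) # q"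
    "Suc a \<in> C" "a \<notin> C" "flip_at (map (ct a) p) (map (ct a) q)" using assms by (auto simp: edge_def)
  have "T ! k = T' ! k" if k: "k < i" for k
  proof (rule nth_equalityI)
    have "list_all2 (agree a) (T ! k) (T' ! k)"
      using edge_agree[OF assms] SSKT_D(2)[OF e(1)] k i by (simp add: list_all2_conv_all_nth)
    then have l: "length (T ! k) = length (T' ! k)" and g: "\<And>j. j < length (T ! k) \<Longrightarrow> agree a (T ! k ! j) (T' ! k ! j)"
      by (auto simp: list_all2_conv_all_nth)
    show "length (T ! k) = length (T' ! k)" by (rule l)
    fix j assume j: "j < length (T ! k)"
    have "T ! k ! j < a" using SSKT_D(4)[OF e(1), of k "T ! k ! j"] flag_below[OF k] j k i by simp
    then show "T ! k ! j = T' ! k ! j" using g[OF j] by (auto simp: agree_def)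
  qed
  then have tk: "take i T' = take i T"
    using SSKT_D(2)[OF e(1)] SSKT_D(2)[OF e(2)] i by (intro nth_equalityI) auto
  let ?L = "ncols \<alpha>" and ?j = "length p"
  let ?B = "cols ?L (colset (take i T))"
  have rest: "rest T = map2 (-) (clist T) ?B" "rest T' = map2 (-) (clist T') ?B"
    unfolding rest_def clist_def tk by (auto intro!: nth_equalityI simp: nth_cols)
  have L: "length p + Suc (length q) = ?L" using arg_cong[OF e(3), of length] by (simp add: clist_def)
  then have B: "?B = take ?j ?B @ ?B ! ?j # drop (Suc ?j) ?B" by (intro id_take_nth_drop) simp
  define B1 b B2 where "B1 = take ?j ?B" and "b = ?B ! ?j" and "B2 = drop (Suc ?j) ?B"
  have B': "?B = B1 @ b # B2" "length B1 = length p" using B L by (auto simp: B1_def b_def B2_def)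
  have b: "a \<notin> b" "Suc a \<notin> b"
    using below_small[OF e(1), of a] below_small[OF e(1), of "Suc a"] L by (auto simp: b_def nth_cols)
  have r: "rest T = map2 (-) p B1 @ (C - b) # map2 (-) q B2"
    "rest T' = map2 (-) p B1 @ insert a ((C - b) - {Suc a}) # map2 (-) q B2"
    using b e(3-6) B'(2) unfolding rest B'(1) by auto
  have "map (ct a) (map2 (-) p B1) @ ct a (C - b) # map (ct a) (map2 (-) q B2) = map (ct a) p @ ct a C # map (ct a) q"
    using ct_rest[OF e(1)] unfolding r(1) e(3) by simp
  then have "map (ct a) (map2 (-) p B1) = map (ct a) p" "map (ct a) (map2 (-) q B2) = map (ct a) q"
    using B'(2) by (auto simp: append_eq_append_conv)
  then show ?thesis using that[OF r] e(5-7) b by auto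
qed

sublocale filtered_strings "SSKT \<alpha> \<phi>" edge "\<lambda>T. opn (map (ct a) (clist T))" "\<lambda>T. cls (map (ct a) (clist T))"
  "\<lambda>T. label a (concat T)" "SSKT \<alpha> (\<phi>(Suc i := a))"
proof
  let ?n = "ncols \<alpha> - \<alpha> ! i"
  show "SSKT \<alpha> (\<phi>(Suc i := a)) \<subseteq> SSKT \<alpha> \<phi>" using SSKT_sub_iff by blast
  show "T \<in> SSKT \<alpha> (\<phi>(Suc i := a))" if T: "T \<in> SSKT \<alpha> \<phi>" "opn (map (ct a) (clist T)) = 0" for T
  proof (rule ccontr)
    assume "\<not> ?thesis"
    then obtain x where x: "x \<in> set (T ! i)" "\<not> x \<le> a" using T(1) SSKT_sub_iff by blast
    have le: "y \<le> Suc a" if "y \<in> set (T ! i)" for y using SSKT_D(4)[OF T(1) i that] flag_i by simp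
    then have xa: "x = Suc a" using x by (meson le_SucE)
    have ne: "rev (T ! i) \<noteq> []" using x by auto
    have g: "greedy 0 (drop ?n (rest T)) (rev (T ! i))" using row_i[OF T(1)] by simp
    \<comment> \<open>Read from right to left the row increases, so its maximum comes last.\<close>
    have "last (rev (T ! i)) = Suc a"
    proof (rule le_antisym)
      show "last (rev (T ! i)) \<le> Suc a" using le last_in_set[OF ne] by simp
      have s: "sorted (rev (T ! i))" using greedy_sorted[OF g] by simp
      obtain u v where uv: "rev (T ! i) = u @ x # v" using x by (metis set_rev split_list)
      then show "Suc a \<le> last (rev (T ! i))" using s xa by (auto simp: sorted_append)
    qed
    then obtain p C q where pq: "drop ?n (rest T) = p @ C # q" "Suc a \<in> C" "a \<notin> C" "\<forall>D\<in>set q. Suc a \<in> D"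
      using greedy_last[OF g _ ne] by blast
    then have c: "ct a C = Opn" "cls (map (ct a) q) = 0" using ct_no_cls by (auto simp: ct_def)
    have "rest T = (take ?n (rest T) @ p) @ C # q" using pq(1) by (metis append_assoc append_take_drop_id)
    then have "map (ct a) (clist T) = map (ct a) (take ?n (rest T) @ p) @ Opn # map (ct a) q"
      using ct_rest[OF T(1)] c by (metis list.simps(9) map_append)
    then have "opn (map (ct a) (clist T)) > 0" using c by (simp only: opn_append) simp
    then show False using T(2) by simp
  qed
  show "T' \<in> SSKT \<alpha> (\<phi>(Suc i := a))" if e: "edge T T'" and T: "T \<in> SSKT \<alpha> (\<phi>(Suc i := a))" for T T'
  proof -
    have TT: "T \<in> SSKT \<alpha> \<phi>" "T' \<in> SSKT \<alpha> \<phi>" using e by (auto simp: edge_def)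
    from edge_rest[OF e] obtain p C q where pq: "rest T = p @ C # q" "rest T' = p @ insert a (C - {Suc a}) # q"
      "Suc a \<in> C" "a \<notin> C" .
    have "list_all2 (flipped a) xs xs" for xs by (rule list_all2_refl) (simp add: flipped_def)
    then have "list_all2 (flipped a) (rest T) (rest T')" unfolding pq(1,2)
      by (intro list_all2_appendI list_all2_Cons[THEN iffD2] conjI) (use pq(3,4) in \<open>auto simp: flipped_def\<close>)
    then have fl: "list_all2 (flipped a) (drop ?n (rest T)) (drop ?n (rest T'))" by (rule list_all2_dropI)
    have le: "\<forall>y\<in>set (rev (T' ! i)). y \<le> Suc a" using SSKT_D(4)[OF TT(2) i] flag_i by simp
    have m: "list_all2 (\<le>) (rev (T' ! i)) (rev (T ! i))"
      using greedy_flipped_le[OF row_i(3)[OF TT(1)] row_i(3)[OF TT(2)] _ le fl] by simp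
    have "y \<le> a" if y: "y \<in> set (T' ! i)" for y
    proof -
      have "y \<in> set (rev (T' ! i))" using y by simp
      then obtain k where k: "k < length (rev (T' ! i))" "y = rev (T' ! i) ! k" by (metis in_set_conv_nth)
      then have "y \<le> rev (T ! i) ! k" "k < length (rev (T ! i))" using m by (auto simp: list_all2_conv_all_nth)
      moreover have "rev (T ! i) ! k \<in> set (T ! i)" using nth_mem[OF \<open>k < length (rev (T ! i))\<close>] by simp
      ultimately show ?thesis using T SSKT_sub_iff by (meson order_trans)
    qed
    then show ?thesis using SSKT_sub_iff TT by blast
  qed
  show "T \<in> SSKT \<alpha> (\<phi>(Suc i := a))"
    if e: "edge T T'" and T': "T' \<in> SSKT \<alpha> (\<phi>(Suc i := a))" and pos: "opn (map (ct a) (clist T')) > 0" for T T'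
  proof -
    have TT: "T \<in> SSKT \<alpha> \<phi>" "T' \<in> SSKT \<alpha> \<phi>" using e by (auto simp: edge_def)
    from edge_rest[OF e] obtain p C q where pq: "rest T = p @ C # q" "rest T' = p @ insert a (C - {Suc a}) # q"
      "Suc a \<in> C" "a \<notin> C" "flip_at (map (ct a) p) (map (ct a) q)" .
    let ?D = "insert a (C - {Suc a})"
    have D: "a \<in> ?D" "insert (Suc a) (?D - {a}) = C" "ct a ?D = Cls" using pq by (auto simp: ct_def)
    have le: "\<forall>y\<in>set (rev (T' ! i)). y \<le> a" using T' SSKT_sub_iff by simp
    \<comment> \<open>\<open>T'\<close> still has an unmatched opening bracket, which excludes the
      second alternative of \<open>greedy_unflip\<close>.\<close>
    have nq: "\<not> (\<forall>E\<in>set q. a \<in> E)"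
    proof
      assume "\<forall>E\<in>set q. a \<in> E"
      then have "opn (map (ct a) q) = 0" by (rule ct_no_opn)
      moreover have "map (ct a) (clist T') = map (ct a) p @ Cls # map (ct a) q"
        using ct_rest[OF TT(2)] pq(2) D(3) by simp
      ultimately have "opn (map (ct a) (clist T')) = 0" using pq(5) by (simp add: opn_append flip_at_def)
      then show False using pos by simp
    qed
    have "greedy 0 (drop ?n (rest T)) (rev (T' ! i))"
    proof (cases "?n \<le> length p")
      case True
      then have "greedy 0 (drop ?n p @ ?D # q) (rev (T' ! i))" using row_i(3)[OF TT(2)] pq(2) by simp
      then have "greedy 0 (drop ?n p @ C # q) (rev (T' ! i))"
        using greedy_unflip[OF _ le D(1)] D(2) nq by metis
      then show ?thesis using True pq(1) by simp
    next
      case False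
      \<comment> \<open>Row \<open>i\<close> is too short to reach the flipped column.\<close>
      then have "drop ?n (rest T) = drop ?n (rest T')" unfolding pq(1,2)
        by (cases "?n - length p") auto
      then show ?thesis using row_i(3)[OF TT(2)] by simp
    qed
    then have "rev (T' ! i) = rev (T ! i)" using greedy_unique row_i(3)[OF TT(1)] by blast
    then have "T ! i = T' ! i" by simp
    then show ?thesis using SSKT_sub_iff[of T] SSKT_sub_iff[of T'] TT T' by simp
  qed
qed

end

section \<open>The recursion\<close>

lemma SSKT_key:
  "T \<in> SSKT \<alpha> \<phi> \<longleftrightarrow> map length T = \<alpha> \<and> rows_flagged \<phi> T \<and> (\<forall>r\<in>set T. ok_row r) \<and> sorted_wrt ok_pair T"
proof (cases "map length T = \<alpha> \<and> rows_flagged \<phi> T")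
  case True
  have "length r \<le> ncols \<alpha> \<and> (\<forall>x\<in>set r. 1 \<le> x)" if r: "r \<in> set T" for r
  proof
    have "length r \<in> set (0 # \<alpha>)" using r True by auto
    then show "length r \<le> ncols \<alpha>" unfolding ncols_def by (intro Max_ge) auto
    obtain k where "k < length T" "r = T ! k" using r by (metis in_set_conv_nth)
    then show "\<forall>x\<in>set r. 1 \<le> x" using True by (simp add: rows_flagged_def)
  qed
  then show ?thesis using SSKT_iff[of T] fills_iff[of T "ncols \<alpha>"] True by blast
qed (auto simp: SSKT_iff)

text \<open>At the right end of the shorter row \<open>carry\<close> is 0, so the entry above must
  be larger; as the longer row decreases weakly, this spreads to the left. Every entry of row
  \<open>i\<close> lies below one of row \<open>i + 1\<close>, which obeys the common flag.\<close>

lemma SSKT_lower_less: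
  assumes T: "T \<in> SSKT \<alpha> \<phi>" and i: "Suc i < length \<alpha>" and less: "\<alpha> ! i < \<alpha> ! Suc i"
    and flag: "\<phi> (Suc i) = \<phi> (Suc (Suc i))" and x: "x \<in> set (T ! i)"
  shows "x < \<phi> (Suc i)"
proof -
  let ?r = "T ! i" and ?s = "T ! Suc i"
  have m: "map length T = \<alpha>" and fl: "rows_flagged \<phi> T" and ok: "\<forall>r\<in>set T. ok_row r" "sorted_wrt ok_pair T"
    using T SSKT_key by blast+
  have il: "Suc i < length T" using m i by auto
  have len: "length ?r < length ?s" using less m il by (metis Suc_lessD nth_map)
  have pr: "ok_pair ?r ?s" using ok(2) il by (simp add: sorted_wrt_iff_nth_less)
  have rs: "ok_row ?s" using ok(1) il by simp
  have below: "?r ! c < ?s ! c" if "c + Suc d = length ?r" for c d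
    using that
  proof (induction d arbitrary: c)
    case 0
    then have "carry ?r c = 0" by (simp add: carry_def)
    moreover have "?r ! c \<noteq> ?s ! c \<and> (?s ! c < ?r ! c \<longrightarrow> ?s ! c < carry ?r c)"
      using pr[unfolded ok_pair_def, rule_format, of c] 0 len by simp
    ultimately show ?case by linarith
  next
    case (Suc d)
    have c: "c < length ?r" "c < length ?s" "Suc c < length ?r" "Suc c < length ?s" using Suc.prems len by auto
    have "?r ! Suc c < ?s ! Suc c" using Suc by simp
    also have "\<dots> \<le> ?s ! c" using rs[unfolded ok_row_def, THEN conjunct2, rule_format, OF c(2)] c(4) by (simp add: carry_def)
    finally have "\<not> ?s ! c < carry ?r c" using c by (simp add: carry_def)
    moreover have "?r ! c \<noteq> ?s ! c \<and> (?s ! c < ?r ! c \<longrightarrow> ?s ! c < carry ?r c)"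
      using pr c(1,2) unfolding ok_pair_def by blast
    ultimately show ?case by linarith
  qed
  obtain c where c: "c < length ?r" "x = ?r ! c" using x by (metis in_set_conv_nth)
  have "x < ?s ! c" using below[of c "length ?r - Suc c"] c by simp
  also have "?s ! c \<in> set ?s" using c len by simp
  then have "?s ! c \<le> \<phi> (Suc i)" using fl il flag by (auto simp: rows_flagged_def)
  finally show ?thesis .
qed

section \<open>Weakly decreasing shapes with the identity flag\<close>

lemma pass_top:
  assumes "\<forall>z\<in>set C. z < x"
  shows "pass (replicate (Suc m) x) C = (C @ [x], replicate m x)"
proof (induction m)
  case 0
  then show ?case using assms by (simp add: step_def)
next
  case (Suc m)
  have "{z \<in> set (C @ [x]). x \<le> z} = {x}" using assms by auto
  then have "Min {z \<in> set (C @ [x]). x \<le> z} = x" by simp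
  then have "step x (C @ [x]) = (C @ [x], [x])"
    using assms unfolding step_def by (auto simp: Let_def)
  then show ?case using Suc pass.simps(2)[of x "replicate (Suc m) x" C] by simp
qed

lemma ht_ins_top:
  "\<forall>C\<in>set P. \<forall>z\<in>set C. z < x \<Longrightarrow> ht (ins_word (replicate m x) P) c = ht P c + (if c < m then 1 else 0)"
proof (induction m arbitrary: P c)
  case (Suc m)
  show ?case
  proof (cases P)
    case Nil
    have "ins_word (replicate (Suc m) x) [] = [x] # ins_word (replicate m x) []"
      using ins_word_Nil[of "replicate (Suc m) x"] pass_top[of "[]" x m] by simp
    then show ?thesis using Suc.IH[of "[]"] Nil by (cases c) auto
  next
    case (Cons C Q)
    have "ins_word (replicate (Suc m) x) P = (C @ [x]) # ins_word (replicate m x) Q"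
      using ins_word_Cons[of "replicate (Suc m) x" C Q] pass_top[of C x m] Suc.prems Cons by simp
    then show ?thesis using Suc.IH[of Q] Suc.prems Cons by (cases c) auto
  qed
qed simp

definition superstandard :: "nat list \<Rightarrow> nat list list" where
  "superstandard \<alpha> = map (\<lambda>k. replicate (\<alpha> ! k) (Suc k)) [0..<length \<alpha>]"

lemma superstandard_nth: "length (superstandard \<alpha>) = length \<alpha>"
  "k < length \<alpha> \<Longrightarrow> superstandard \<alpha> ! k = replicate (\<alpha> ! k) (Suc k)"
  by (auto simp: superstandard_def)

lemma map_length_superstandard: "map length (superstandard \<alpha>) = \<alpha>"
  by (rule nth_equalityI) (auto simp: superstandard_nth)

lemma superstandardI:
  assumes "map length T = \<alpha>" and "\<And>k x. k < length \<alpha> \<Longrightarrow> x \<in> set (T ! k) \<Longrightarrow> x = Suc k"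
  shows "T = superstandard \<alpha>"
proof (rule nth_equalityI)
  show l: "length T = length (superstandard \<alpha>)" using assms(1) by (auto simp: superstandard_nth)
  fix k assume k: "k < length T"
  then have "length (T ! k) = \<alpha> ! k" "k < length \<alpha>" using assms(1) by auto
  then show "T ! k = superstandard \<alpha> ! k"
    using assms(2) by (auto simp: superstandard_nth intro: replicate_eqI)
qed

text \<open>In a column, row \<open>k + 1\<close> has an entry at most \<open>k + 1\<close>, and the
  smaller values are used up by the rows below, all of which reach that column.\<close>

lemma SSKT_dominant:
  assumes dec: "\<And>j k. j \<le> k \<Longrightarrow> k < length \<alpha> \<Longrightarrow> \<alpha> ! k \<le> \<alpha> ! j" and id: "\<And>k. k < length \<alpha> \<Longrightarrow> \<phi> (Suc k) = Suc k"
  shows "SSKT \<alpha> \<phi> = {superstandard \<alpha>}"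
proof -
  have "superstandard \<alpha> \<in> SSKT \<alpha> \<phi>"
    unfolding SSKT_key
  proof (intro conjI)
    show "map length (superstandard \<alpha>) = \<alpha>" by (rule map_length_superstandard)
    show "rows_flagged \<phi> (superstandard \<alpha>)" using id by (auto simp: rows_flagged_def superstandard_nth)
    show "\<forall>r\<in>set (superstandard \<alpha>). ok_row r" by (auto simp: superstandard_def ok_row_def carry_def)
    show "sorted_wrt ok_pair (superstandard \<alpha>)"
      by (auto simp: sorted_wrt_iff_nth_less superstandard_nth ok_pair_def)
  qed
  moreover have "T = superstandard \<alpha>" if T: "T \<in> SSKT \<alpha> \<phi>" for T
  proof (rule superstandardI)
    show m: "map length T = \<alpha>" using T SSKT_key by blast
    have len: "length T = length \<alpha>" "\<And>k. k < length \<alpha> \<Longrightarrow> length (T ! k) = \<alpha> ! k" using m by auto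
    have fl: "rows_flagged \<phi> T" and ok: "sorted_wrt ok_pair T" using T SSKT_key by blast+
    have col: "\<forall>k<length \<alpha>. c < \<alpha> ! k \<longrightarrow> T ! k ! c = Suc k" for c
    proof (intro allI impI)
      fix k assume "k < length \<alpha>" "c < \<alpha> ! k"
      then show "T ! k ! c = Suc k"
      proof (induction k rule: less_induct)
        case (less k)
        let ?x = "T ! k ! c"
        have "?x \<in> set (T ! k)" using less.prems len by simp
        then have x: "1 \<le> ?x" "?x \<le> Suc k" using fl less.prems len id by (auto simp: rows_flagged_def)
        show ?case
        proof (rule ccontr)
          assume "?x \<noteq> Suc k"
          then obtain j where j: "?x = Suc j" "j < k" using x by (cases ?x) auto
          have cj: "c < \<alpha> ! j" using dec[of j k] j less.prems by simp
          then have "T ! j ! c = Suc j" using less.IH[of j] j less.prems by simp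
          moreover have "ok_pair (T ! j) (T ! k)" using ok j less.prems len by (simp add: sorted_wrt_iff_nth_less)
          from this[unfolded ok_pair_def, rule_format, of c] have "T ! j ! c \<noteq> ?x" using cj less.prems len j by simp
          ultimately show False using j by simp
        qed
      qed
    qed
    show "x = Suc k" if k: "k < length \<alpha>" "x \<in> set (T ! k)" for k x
      using k col len(2)[OF k(1)] by (auto simp: in_set_conv_nth)
  qed
  ultimately show ?thesis by blast
qed

lemma set_concat_ins_word: "set (concat (ins_word w [])) = set w"
  by (metis mset_ins_word set_mset_mset)

lemma count_list_ins_word: "count_list (concat (ins_word w [])) = count_list w"
  using mset_ins_word[of w] by (metis count_mset ext)

lemma count_list_eq_length: "count_list r x = length r \<Longrightarrow> y \<in> set r \<Longrightarrow> y = x"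
proof (induction r)
  case (Cons z r)
  have "count_list r x \<le> length r" by (rule count_le_length)
  then show ?case using Cons by (auto split: if_splits)
qed simp

text \<open>After \<open>k + 1\<close> factors each of the first \<open>\<alpha> ! k\<close> columns
  has \<open>k + 1\<close> distinct entries from \<open>{1..Suc k}\<close> and hence contains
  \<open>k + 1\<close>. The earlier factors have only smaller letters, so the last of these factors
  consists of copies of \<open>k + 1\<close>.\<close>

lemma WH_dominant:
  assumes dec: "\<And>j k. j \<le> k \<Longrightarrow> k < length \<alpha> \<Longrightarrow> \<alpha> ! k \<le> \<alpha> ! j" and id: "\<And>k. k < length \<alpha> \<Longrightarrow> \<phi> (Suc k) = Suc k"
  shows "WH \<alpha> \<phi> = {superstandard \<alpha>}"
proof -
  let ?S = "superstandard \<alpha>"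
  have small: "x \<le> k" if us: "flagged_factorization \<phi> us" "length us = length \<alpha>" and k: "k \<le> length \<alpha>"
    and x: "x \<in> set (word_of (take k us))" for us k x
  proof -
    obtain t where "t \<in> set (take k us)" "x \<in> set t" using x by (auto simp: word_of_def)
    then obtain j where j: "j < k" "j < length us" "x \<in> set (us ! j)" by (auto simp: in_set_conv_nth[of t])
    then have "x \<le> \<phi> (Suc j)" using us by (auto simp: flagged_factorization_def)
    then show ?thesis using id[of j] j us by simp
  qed
  have fl: "flagged_factorization \<phi> ?S" using id by (auto simp: flagged_factorization_def superstandard_nth)
  have "?S \<in> WH \<alpha> \<phi>"
    unfolding WH_def
  proof (intro CollectI conjI allI impI)
    show "map length ?S = \<alpha>" by (rule map_length_superstandard)
    show "\<forall>r\<in>set ?S. sorted r \<and> (\<forall>a\<in>set r. 1 \<le> a)" by (auto simp: superstandard_def)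
    show "flagged_factorization \<phi> ?S" by (rule fl)
    show "ht (ins_word (word_of (take k ?S)) []) c = cnt \<alpha> k c" if "k \<le> length ?S" for k c
      using that
    proof (induction k arbitrary: c)
      case 0
      then show ?case by (simp add: word_of_def cnt_def)
    next
      case (Suc k)
      have k: "k < length \<alpha>" using Suc.prems by (simp add: superstandard_nth)
      let ?P = "ins_word (word_of (take k ?S)) []"
      have "z < Suc k" if "C \<in> set ?P" "z \<in> set C" for C z
      proof -
        have "z \<in> set (concat ?P)" using that by auto
        then have "z \<in> set (word_of (take k ?S))" by (simp only: set_concat_ins_word)
        then show ?thesis using small[OF fl, of k z] k by (simp add: superstandard_nth)
      qed
      then have "ht (ins_word (replicate (\<alpha> ! k) (Suc k)) ?P) c = ht ?P c + (if c < \<alpha> ! k then 1 else 0)"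
        by (intro ht_ins_top) blast
      then show ?case
        using Suc k by (simp add: word_of_take_Suc superstandard_nth ins_word_append cnt_Suc)
    qed
  qed
  moreover have "us = ?S" if us: "us \<in> WH \<alpha> \<phi>" for us
  proof (rule superstandardI)
    show m: "map length us = \<alpha>" using us by (simp add: WH_def)
    have len: "length us = length \<alpha>" "\<And>k. k < length \<alpha> \<Longrightarrow> length (us ! k) = \<alpha> ! k" using m by auto
    have fu: "flagged_factorization \<phi> us" using us by (simp add: WH_def)
    show "x = Suc k" if k: "k < length \<alpha>" and x: "x \<in> set (us ! k)" for k x
    proof -
      let ?w = "word_of (take (Suc k) us)" and ?m = "\<alpha> ! k"
      let ?P = "ins_word ?w []"
      \<comment> \<open>The parts decrease weakly, so all of the first \<open>k + 1\<close> parts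
        exceed \<open>c\<close>.\<close>
      have ht: "ht ?P c = Suc k" if c: "c < ?m" for c
      proof -
        have "c < z" if "z \<in> set (take (Suc k) \<alpha>)" for z
          using that c dec[OF _ k] k by (auto simp: in_set_conv_nth less_Suc_eq_le) (meson less_le_trans)
        then have "filter ((<) c) (take (Suc k) \<alpha>) = take (Suc k) \<alpha>" by (intro filter_True) blast
        then have "cnt \<alpha> (Suc k) c = Suc k" using k by (simp add: cnt_def)
        then show ?thesis using us k len unfolding WH_def by auto
      qed
      have colP: "column C" if "C \<in> set ?P" for C using ins_word_columns[of "[]" ?w] that by simp
      have in_col: "c < length ?P \<and> Suc k \<in> set (?P ! c)" if c: "c < ?m" for c
      proof -
        have cl: "c < length ?P" "length (?P ! c) = Suc k" using ht[OF c] by (auto simp: ht_def split: if_splits)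
        have "distinct (?P ! c)" using colP cl by (simp add: strict_sorted_iff)
        then have card: "card (set (?P ! c)) = Suc k" using cl by (simp add: distinct_card)
        have "set (?P ! c) \<subseteq> {1..Suc k}"
        proof
          fix z assume "z \<in> set (?P ! c)"
          then have "z \<in> set (concat ?P)" using cl by auto
          then have z: "z \<in> set ?w" by (simp only: set_concat_ins_word)
          then have "z \<le> Suc k" using small[OF fu len(1)] k by simp
          moreover have "1 \<le> z" using z us by (auto simp: word_of_def WH_def dest: in_set_takeD)
          ultimately show "z \<in> {1..Suc k}" by simp
        qed
        then have "set (?P ! c) = {1..Suc k}" using card by (intro card_subset_eq) auto
        then show ?thesis using cl by simp
      qed
      have "{..<?m} \<subseteq> {c. c < length ?P \<and> Suc k \<in> set (?P ! c)}" using in_col by auto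
      then have "?m \<le> card {c. c < length ?P \<and> Suc k \<in> set (?P ! c)}"
        using card_mono[of "{c. c < length ?P \<and> Suc k \<in> set (?P ! c)}" "{..<?m}"] by simp
      also have "\<dots> = count_list (concat ?P) (Suc k)" using count_list_columns[of ?P] colP by simp
      also have "\<dots> = count_list ?w (Suc k)" by (simp only: count_list_ins_word)
      also have "\<dots> = count_list (us ! k) (Suc k)"
      proof -
        have "Suc k \<notin> set (word_of (take k us))" using small[OF fu len(1), of k "Suc k"] k by auto
        then show ?thesis using k len by (simp add: word_of_take_Suc count_list_0_iff)
      qed
      finally have "count_list (us ! k) (Suc k) = length (us ! k)"
        using count_le_length[of "us ! k" "Suc k"] len(2)[OF k] by simp
      then show ?thesis using count_list_eq_length x by metis
    qed
  qed
  ultimately show ?thesis by blast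
qed

section \<open>The induction over shapes and flags\<close>

definition merge :: "nat \<Rightarrow> (nat \<Rightarrow> nat) \<Rightarrow> nat \<Rightarrow> nat" where
  "merge a v b = (if b = a then v a + v (Suc a) else if b = Suc a then 0 else v b)"

text \<open>Sum and difference determine the two multiplicities; so label and charge together amount
  to the weight.\<close>

lemma merge_eqD:
  assumes "merge a v = merge a w" "int (v a) - int (v (Suc a)) = int (w a) - int (w (Suc a))"
  shows "v = w"
proof
  fix b
  have *: "merge a v b = merge a w b" for b using assms(1) by simp
  have "v a + v (Suc a) = w a + w (Suc a)" using *[of a] by (simp add: merge_def)
  then show "v b = w b" using *[of b] assms(2) by (cases "b = a \<or> b = Suc a") (auto simp: merge_def)
qed

lemma label_merge: "label a u = merge a (count_list u)"
  by (auto simp: label_def merge_def)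

lemma card_by_weight:
  assumes "\<And>w. card {x \<in> X. g x = w} = card {y \<in> Y. h y = w}"
  shows "card {x \<in> X. merge a (g x) = k \<and> int (g x a) - int (g x (Suc a)) = d} =
    card {y \<in> Y. merge a (h y) = k \<and> int (h y a) - int (h y (Suc a)) = d}"
proof (cases "\<exists>w. merge a w = k \<and> int (w a) - int (w (Suc a)) = d")
  case True
  then obtain w where w: "merge a w = k" "int (w a) - int (w (Suc a)) = d" by blast
  then have "merge a v = k \<and> int (v a) - int (v (Suc a)) = d \<longleftrightarrow> v = w" for v
    using merge_eqD[of a v w] by auto
  then show ?thesis using assms by simp
next
  case False
  then have "{x \<in> X. merge a (g x) = k \<and> int (g x a) - int (g x (Suc a)) = d} = {}"
    "{y \<in> Y. merge a (h y) = k \<and> int (h y a) - int (h y (Suc a)) = d} = {}" by blast+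
  then show ?thesis by (simp only: card.empty)
qed

text \<open>On both sides a slice is a weight space, so the comparison of filtered strings carries
  the equality of counts from the lowered flag to the given one.\<close>

lemma card_eq_lower:
  assumes i: "i < length \<alpha>" "1 \<le> a" "\<phi> (Suc i) = Suc a" "\<And>k. k < i \<Longrightarrow> \<phi> (Suc k) < a"
    "\<And>k. i < k \<Longrightarrow> k < length \<alpha> \<Longrightarrow> a < \<phi> (Suc k)"
    and eq: "\<And>w. card {T \<in> SSKT \<alpha> (\<phi>(Suc i := a)). count_list (concat T) = w} =
      card {us \<in> WH \<alpha> (\<phi>(Suc i := a)). count_list (word_of us) = w}"
  shows "card {T \<in> SSKT \<alpha> \<phi>. count_list (concat T) = w} = card {us \<in> WH \<alpha> \<phi>. count_list (word_of us) = w}"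
proof -
  interpret W: word_strings \<alpha> \<phi> i a by unfold_locales (use i in auto)
  interpret T: tableau_strings \<alpha> \<phi> i a by unfold_locales (use i in auto)
  have W: "W.slice Y k d = {us \<in> Y. merge a (count_list (word_of us)) = k \<and>
      int (count_list (word_of us) a) - int (count_list (word_of us) (Suc a)) = d}" for Y k d
    unfolding W.slice_def unfolding label_merge unmatched_balance count_tok ..
  have TX: "T.slice Y k d = {T \<in> Y. merge a (count_list (concat T)) = k \<and>
      int (count_list (concat T) a) - int (count_list (concat T) (Suc a)) = d}" if "Y \<subseteq> SSKT \<alpha> \<phi>" for Y k d
  proof -
    have "int (cls (map (ct a) (T.clist T))) - int (opn (map (ct a) (T.clist T))) =
       int (count_list (concat T) a) - int (count_list (concat T) (Suc a))" if "T \<in> SSKT \<alpha> \<phi>" for T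
      unfolding unmatched_balance count_ct fills_count[OF T.SSKT_D(3)[OF that]] ..
    then show ?thesis unfolding T.slice_def unfolding label_merge using that by auto
  qed
  have "card (T.slice (SSKT \<alpha> \<phi>) k d) = card (W.slice (WH \<alpha> \<phi>) k d)" for k d
  proof (rule filtered_strings_card_slice[OF T.filtered_strings_axioms W.filtered_strings_axioms])
    show "card (T.slice (SSKT \<alpha> (\<phi>(Suc i := a))) k d) = card (W.slice (WH \<alpha> (\<phi>(Suc i := a))) k d)" for d
      unfolding W TX[OF T.subset] by (rule card_by_weight[OF eq])
  qed
  from this[of "merge a w" "int (w a) - int (w (Suc a))"]
  have "card {T \<in> SSKT \<alpha> \<phi>. merge a (count_list (concat T)) = merge a w \<and>
      int (count_list (concat T) a) - int (count_list (concat T) (Suc a)) = int (w a) - int (w (Suc a))} =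
    card {us \<in> WH \<alpha> \<phi>. merge a (count_list (word_of us)) = merge a w \<and>
      int (count_list (word_of us) a) - int (count_list (word_of us) (Suc a)) = int (w a) - int (w (Suc a))}"
    unfolding W TX[OF order_refl] .
  moreover have "merge a v = merge a w \<and> int (v a) - int (v (Suc a)) = int (w a) - int (w (Suc a)) \<longleftrightarrow> v = w" for v
    using merge_eqD by auto
  ultimately show ?thesis by simp
qed

lemma SSKT_raise:
  assumes i: "Suc i < length \<alpha>" and less: "\<alpha> ! i < \<alpha> ! Suc i" and id: "\<phi> (Suc i) = Suc i" "\<phi> (Suc (Suc i)) = Suc (Suc i)"
  shows "SSKT \<alpha> (\<phi>(Suc i := Suc (Suc i))) = SSKT \<alpha> \<phi>"
proof -
  let ?\<psi> = "\<phi>(Suc i := Suc (Suc i))"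
  have "rows_flagged ?\<psi> T \<longleftrightarrow> rows_flagged \<phi> T" if "T \<in> SSKT \<alpha> ?\<psi> \<or> T \<in> SSKT \<alpha> \<phi>" for T
  proof
    assume r: "rows_flagged \<phi> T"
    have "x \<le> ?\<psi> (Suc k)" if "x \<le> \<phi> (Suc k)" for x k using that id by (cases "k = i") auto
    then show "rows_flagged ?\<psi> T" using r unfolding rows_flagged_def by blast
  next
    assume r: "rows_flagged ?\<psi> T"
    then have T: "T \<in> SSKT \<alpha> ?\<psi>" using that SSKT_iff by blast
    have "1 \<le> x \<and> x \<le> \<phi> (Suc k)" if k: "k < length T" "x \<in> set (T ! k)" for k x
    proof (cases "k = i")
      case True
      then have "x < ?\<psi> (Suc i)" using SSKT_lower_less[OF T i less _ ] k id by simp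
      then show ?thesis using r k True id by (auto simp: rows_flagged_def)
    next
      case False
      then show ?thesis using r[unfolded rows_flagged_def, rule_format, OF k] by simp
    qed
    then show "rows_flagged \<phi> T" by (simp add: rows_flagged_def)
  qed
  then show ?thesis using SSKT_iff by blast
qed

lemma WH_raise:
  assumes i: "Suc i < length \<alpha>" and less: "\<alpha> ! i < \<alpha> ! Suc i" and id: "\<phi> (Suc i) = Suc i" "\<phi> (Suc (Suc i)) = Suc (Suc i)"
  shows "WH \<alpha> (\<phi>(Suc i := Suc (Suc i))) = WH \<alpha> \<phi>"
proof -
  let ?\<psi> = "\<phi>(Suc i := Suc (Suc i))"
  \<comment> \<open>The raised flag is the one under which the two rows have a common bound.\<close>
  interpret R: row_strings \<alpha> ?\<psi> i by unfold_locales (use i id in auto)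
  have "flagged_factorization ?\<psi> us \<longleftrightarrow> flagged_factorization \<phi> us" if "us \<in> WH \<alpha> ?\<psi> \<or> us \<in> WH \<alpha> \<phi>" for us
  proof
    assume r: "flagged_factorization \<phi> us"
    have "x \<le> ?\<psi> (Suc k)" if "x \<le> \<phi> (Suc k)" for x k using that id by (cases "k = i") auto
    then show "flagged_factorization ?\<psi> us" using r unfolding flagged_factorization_def by blast
  next
    assume r: "flagged_factorization ?\<psi> us"
    then have us: "us \<in> WH \<alpha> ?\<psi>" using that by (auto simp: WH_def)
    have "x \<le> \<phi> (Suc k)" if k: "k < length us" "x \<in> set (us ! k)" for k x
    proof (cases "k = i")
      case True
      then have "x < ?\<psi> (Suc i)" using R.WH_lower_less[OF less us] k by simp
      then show ?thesis using True id by simp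
    next
      case False
      then show ?thesis using r[unfolded flagged_factorization_def, rule_format, OF k] by simp
    qed
    then show "flagged_factorization \<phi> us" by (simp add: flagged_factorization_def)
  qed
  then show ?thesis unfolding WH_def by blast
qed

text \<open>The sum of \<open>j * \<alpha> ! j\<close>, which decreases when the larger of two
  adjacent parts is moved forward.\<close>

fun moment :: "nat list \<Rightarrow> nat" where
  "moment [] = 0"
| "moment (x # xs) = sum_list xs + moment xs"

lemma sum_list_swp: "Suc i < length \<alpha> \<Longrightarrow> sum_list (swp \<alpha> i) = sum_list \<alpha>"
proof -
  assume i: "Suc i < length \<alpha>"
  have "mset (swp \<alpha> i) = mset \<alpha>" unfolding swp_def by (rule mset_swap) (use i in auto)
  then show ?thesis by (metis sum_mset_sum_list)
qed

lemma moment_swp: "Suc i < length \<alpha> \<Longrightarrow> \<alpha> ! i < \<alpha> ! Suc i \<Longrightarrow> moment (swp \<alpha> i) < moment \<alpha>"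
proof (induction \<alpha> arbitrary: i)
  case (Cons x \<alpha>)
  show ?case
  proof (cases i)
    case 0
    then obtain y ys where "\<alpha> = y # ys" using Cons.prems by (cases \<alpha>) auto
    then show ?thesis using 0 Cons.prems by (simp add: swp_def)
  next
    case (Suc j)
    have "swp (x # \<alpha>) i = x # swp \<alpha> j" using Suc by (simp add: swp_def)
    then show ?thesis using Cons Suc sum_list_swp[of j \<alpha>] by simp
  qed
qed simp

definition row_flag :: "nat \<Rightarrow> (nat \<Rightarrow> nat) \<Rightarrow> bool" where
  "row_flag n \<phi> \<longleftrightarrow> (\<forall>k<n. Suc k \<le> \<phi> (Suc k)) \<and> (\<forall>j k. j \<le> k \<longrightarrow> k < n \<longrightarrow> \<phi> (Suc j) \<le> \<phi> (Suc k))"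

text \<open>The induction is lexicographic: lowering a flag keeps the shape and reduces the excess
  of the flag over the identity, while an exchange of rows raises a flag but lowers
  \<open>moment\<close>.\<close>

theorem card_SSKT_WH:
  "row_flag (length \<alpha>) \<phi> \<Longrightarrow>
     card {T \<in> SSKT \<alpha> \<phi>. count_list (concat T) = w} = card {us \<in> WH \<alpha> \<phi>. count_list (word_of us) = w}"
proof (induction "moment \<alpha>" arbitrary: \<alpha> \<phi> w rule: less_induct)
  case less
  note outer = less.hyps
  from less.prems show ?case
  proof (induction "\<Sum>k<length \<alpha>. \<phi> (Suc k) - Suc k" arbitrary: \<phi> w rule: less_induct)
    case less
    have ge: "\<And>k. k < length \<alpha> \<Longrightarrow> Suc k \<le> \<phi> (Suc k)" and mono: "\<And>j k. j \<le> k \<Longrightarrow> k < length \<alpha> \<Longrightarrow> \<phi> (Suc j) \<le> \<phi> (Suc k)"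
      using less.prems by (auto simp: row_flag_def)
    show ?case
    proof (cases "\<exists>i<length \<alpha>. \<phi> (Suc i) > Suc i")
      case True
      \<comment> \<open>Minimality forces the identity flag on the rows below, so their bounds are
        smaller than \<open>a\<close>; this is the separation of flags that the string structures
        require.\<close>
      define i where "i = (LEAST i. i < length \<alpha> \<and> \<phi> (Suc i) > Suc i)"
      have i: "i < length \<alpha>" "\<phi> (Suc i) > Suc i" using LeastI_ex[OF True[simplified]] by (auto simp: i_def)
      have below: "\<phi> (Suc k) = Suc k" if "k < i" for k
        using not_less_Least[of k "\<lambda>i. i < length \<alpha> \<and> \<phi> (Suc i) > Suc i"] that i(1) ge[of k] by (auto simp: i_def[symmetric])
      define a where "a = \<phi> (Suc i) - 1"
      have a: "\<phi> (Suc i) = Suc a" "Suc i \<le> a" using i(2) by (auto simp: a_def)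
      let ?\<psi> = "\<phi>(Suc i := a)"
      have "row_flag (length \<alpha>) ?\<psi>"
        unfolding row_flag_def
      proof (intro conjI allI impI)
        show "Suc k \<le> ?\<psi> (Suc k)" if "k < length \<alpha>" for k using ge[OF that] a by simp
        fix j k assume jk: "j \<le> k" "k < length \<alpha>"
        show "?\<psi> (Suc j) \<le> ?\<psi> (Suc k)"
        proof (cases "k = i \<and> j \<noteq> i")
          case True
          then show ?thesis using below[of j] jk a by simp
        next
          case False
          then show ?thesis using mono[OF jk] a by auto
        qed
      qed
      moreover have "(\<Sum>k<length \<alpha>. ?\<psi> (Suc k) - Suc k) < (\<Sum>k<length \<alpha>. \<phi> (Suc k) - Suc k)"
      proof (rule sum_strict_mono_ex1)
        show "\<forall>k\<in>{..<length \<alpha>}. ?\<psi> (Suc k) - Suc k \<le> \<phi> (Suc k) - Suc k" using a by auto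
        show "\<exists>k\<in>{..<length \<alpha>}. ?\<psi> (Suc k) - Suc k < \<phi> (Suc k) - Suc k"
          using a i by (intro bexI[of _ i]) auto
      qed simp
      ultimately have eq: "card {T \<in> SSKT \<alpha> ?\<psi>. count_list (concat T) = w} = card {us \<in> WH \<alpha> ?\<psi>. count_list (word_of us) = w}" for w
        using less.hyps by blast
      show ?thesis
      proof (rule card_eq_lower[OF i(1) _ a(1) _ _ eq])
        show "1 \<le> a" using a by simp
        show "\<phi> (Suc k) < a" if "k < i" for k using below[OF that] that a by simp
        show "a < \<phi> (Suc k)" if "i < k" "k < length \<alpha>" for k using mono[of i k] that a by simp
      qed
    next
      case False
      then have id: "\<phi> (Suc k) = Suc k" if "k < length \<alpha>" for k using ge[OF that] that by (metis le_neq_implies_less)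
      show ?thesis
      proof (cases "\<exists>i. Suc i < length \<alpha> \<and> \<alpha> ! i < \<alpha> ! Suc i")
        case True
        then obtain i where i: "Suc i < length \<alpha>" "\<alpha> ! i < \<alpha> ! Suc i" by blast
        let ?\<psi> = "\<phi>(Suc i := Suc (Suc i))"
        have ii: "\<phi> (Suc i) = Suc i" "\<phi> (Suc (Suc i)) = Suc (Suc i)" using id i by auto
        have \<psi>: "?\<psi> (Suc i) = ?\<psi> (Suc (Suc i))" using ii by simp
        \<comment> \<open>The outer induction hypothesis covers all flags, hence the raised one
          too.\<close>
        have "row_flag (length (swp \<alpha> i)) ?\<psi>" using id by (auto simp: row_flag_def)
        then have "card {T \<in> SSKT (swp \<alpha> i) ?\<psi>. count_list (concat T) = w} = card {us \<in> WH (swp \<alpha> i) ?\<psi>. count_list (word_of us) = w}"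
          by (rule outer[OF moment_swp[OF i]])
        then show ?thesis
          unfolding card_SSKT_swp[where \<phi> = ?\<psi>, OF i(1) \<psi>, symmetric] card_WH_swp[where \<phi> = ?\<psi>, OF i(1) \<psi>, symmetric]
            SSKT_raise[OF i ii] WH_raise[OF i ii] .
      next
        case False
        have dec: "\<alpha> ! k \<le> \<alpha> ! j" if "j \<le> k" "k < length \<alpha>" for j k
          using that
        proof (induction rule: dec_induct)
          case (step n)
          then have "\<alpha> ! Suc n \<le> \<alpha> ! n" using False by (meson not_less)
          then show ?case using step by simp
        qed simp
        have "mset (concat (superstandard \<alpha>)) = mset (word_of (superstandard \<alpha>))"
          by (simp add: word_of_def mset_concat flip: rev_map)
        then have "count_list (concat (superstandard \<alpha>)) = count_list (word_of (superstandard \<alpha>))"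
          by (metis count_mset ext)
        then have "{T \<in> {superstandard \<alpha>}. count_list (concat T) = w} = {us \<in> {superstandard \<alpha>}. count_list (word_of us) = w}"
          by (intro Collect_cong conj_cong refl) auto
        then show ?thesis by (simp only: SSKT_dominant[OF dec id] WH_dominant[OF dec id])
      qed
    qed
  qed
qed

text \<open>Both sums are grouped over the union of the two sets of weights; a weight that is absent
  on one side contributes an empty fibre there.\<close>

lemma sum_by_weight:
  fixes F :: "'w \<Rightarrow> 'c::comm_semiring_1"
  assumes "finite X" "finite Y" "\<And>w. card {x \<in> X. g x = w} = card {y \<in> Y. h y = w}"
  shows "(\<Sum>x\<in>X. F (g x)) = (\<Sum>y\<in>Y. F (h y))"
proof -
  let ?W = "g ` X \<union> h ` Y"
  have "(\<Sum>x\<in>X. F (g x)) = (\<Sum>w\<in>?W. \<Sum>x\<in>{x \<in> X. g x = w}. F (g x))"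
    using assms by (intro sum.group[symmetric]) auto
  also have "\<dots> = (\<Sum>w\<in>?W. of_nat (card {x \<in> X. g x = w}) * F w)"
    by (intro sum.cong) auto
  also have "\<dots> = (\<Sum>w\<in>?W. of_nat (card {y \<in> Y. h y = w}) * F w)" using assms(3) by simp
  also have "\<dots> = (\<Sum>w\<in>?W. \<Sum>y\<in>{y \<in> Y. h y = w}. F (h y))"
    by (intro sum.cong) auto
  also have "\<dots> = (\<Sum>y\<in>Y. F (h y))"
    using assms by (intro sum.group) auto
  finally show ?thesis .
qed

theorem theorem4p17:
  fixes \<alpha> :: "nat list" and \<phi> :: "nat \<Rightarrow> nat"
  assumes "is_flag \<phi>"
  shows "(\<Sum>T\<in>SSKT \<alpha> \<phi>. xpow (wt (concat T))) =
         (\<Sum>us\<in>WFact \<alpha> \<phi>. xpow (wt (word_of us)))"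
proof -
  have "row_flag (length \<alpha>) \<phi>" using assms by (auto simp: row_flag_def is_flag_def)
  then have "card {T \<in> SSKT \<alpha> \<phi>. count_list (concat T) = w} = card {us \<in> WFact \<alpha> \<phi>. count_list (word_of us) = w}" for w
    unfolding WFact_eq_WH by (rule card_SSKT_WH)
  then show ?thesis
    unfolding wt_def by (rule sum_by_weight[OF finite_SSKT finite_WFact, where F = "\<lambda>v. xpow (Abs_poly_mapping v)"])
qed

end
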